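(* Let $U\subset\mathbb{R}^2$ be a domain with a smooth Riemannian metric $g$. Suppose that $u\in C^1(U;\mathbb{R}^3)$ is an isometric embedding of $(U,g)$ and that $u(U)$ is parametrised as a graph of $f:U'\to\mathbb{R}$, where $u=(\Psi,v)$ with $\Psi:U\to U'\subset\mathbb{R}^2$ a ($C^1$) diffeomorphism with inverse $\Phi$, and $f:=v\circ\Phi$. (i) If $u\in c^{1,1/2}_{loc}\cap BV^2_{loc}(U;\mathbb{R}^3)$, then $f\in c^{1,1/2}_{loc}\cap BV^2_{loc}(U')$ and $f$ satisfies the Gauss equation in the sense of distributions: $$\operatorname{Det}D^2f=K_g(\Phi)\,(1+|Df|^2)^2\quad\text{in }\mathcal{D}'(U').$$ (ii) Likewise, if $u\in C^1\cap W^{1+\frac23,3}_{loc}(U;\mathbb{R}^3)$, then $f\in C^1\cap W^{1+\frac23,3}_{loc}(U')$ and the same equation holds in $\mathcal{D}'(U')$.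
   Context: $K_g$ is the Gaussian curvature of $g$. $u$ isometric means $\partial_iu\cdot\partial_ju=g_{ij}$. Spaces. For a bounded Lipschitz domain $V$, $k\in\mathbb{N}$ and $\alpha\in(0,1)$, the little Hölder space $c^{k,\alpha}(V)$ is the closure of $C^\infty(\overline V)$ in the $C^{k,\alpha}(V)$-norm. $BV^2(V)$ is the space of $h\in W^{1,1}(V)$ whose second-order distributional derivatives are all signed Radon measures of finite mass on $V$. For $s\in(0,1)$, $W^{1+s,p}$ consists of $h\in W^{1,p}$ with $Dh\in W^{s,p}$ (finite Gagliardo seminorm). The subscript $loc$ means on every (Lipschitz) $V\subset\subset U$. Distributional Hessian determinant: for $f\in H^{3/2}_{loc}(U')$ (which holds in both cases), $\operatorname{Det}D^2f$ is the distribution $$\operatorname{Det}D^2f=(f_{x_1}f_{x_2})_{x_1x_2}-\tfrac12(f_{x_1}^2)_{x_2x_2}-\tfrac12(f_{x_2}^2)_{x_1x_1};$$ equivalently it is the distributional Jacobian of $Df$, i.e. the limit of $\det D^2f_k$ in $\mathcal{D}'$ for smooth $f_k$ with $Df_k\to Df$ in $H^{1/2}_{loc}$. *)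

theory Defs
  imports "HOL-Analysis.Analysis"
begin

section \<open>Classical partial derivatives and smoothness on open sets\<close>

definition pd :: "'n::finite \<Rightarrow> (real^'n \<Rightarrow> 'b::real_normed_vector) \<Rightarrow> real^'n \<Rightarrow> 'b" where
  "pd i f x = frechet_derivative f (at x) (axis i 1)"

definition pds :: "'n::finite list \<Rightarrow> (real^'n \<Rightarrow> 'b::real_normed_vector) \<Rightarrow> real^'n \<Rightarrow> 'b" where
  "pds is f = foldr pd is f"

text \<open>The class \<open>C\<^sup>k(S)\<close>, meant for open \<open>S\<close> only: the derivatives are taken at interior points.\<close>

primrec Ck_on :: "nat \<Rightarrow> (real^'n) set \<Rightarrow> (real^'n::finite \<Rightarrow> 'b::real_normed_vector) \<Rightarrow> bool" where
  "Ck_on 0 S f \<longleftrightarrow> continuous_on S f"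
| "Ck_on (Suc k) S f \<longleftrightarrow> (\<forall>x\<in>S. f differentiable (at x)) \<and> (\<forall>i. Ck_on k S (pd i f))"

definition smooth_on :: "(real^'n) set \<Rightarrow> (real^'n::finite \<Rightarrow> 'b::real_normed_vector) \<Rightarrow> bool" where
  "smooth_on S f \<longleftrightarrow> (\<forall>k. Ck_on k S f)"

section \<open>Distributions\<close>

definition test_fun :: "(real^'n) set \<Rightarrow> (real^'n::finite \<Rightarrow> real) \<Rightarrow> bool" where
  "test_fun V \<phi> \<longleftrightarrow>
     smooth_on UNIV \<phi> \<and> (\<exists>K. compact K \<and> K \<subseteq> V \<and> (\<forall>x. x \<notin> K \<longrightarrow> \<phi> x = 0))"

text \<open>Distributions are represented by functionals on all functions; only their values on test
  functions matter, so equality in \<open>\<D>'(V)\<close> is agreement on the test functions of \<open>V\<close>.\<close>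

type_synonym 'n distr = "(real^'n \<Rightarrow> real) \<Rightarrow> real"

definition eq_distr :: "(real^'n::finite) set \<Rightarrow> 'n distr \<Rightarrow> 'n distr \<Rightarrow> bool" where
  "eq_distr V S T \<longleftrightarrow> (\<forall>\<phi>. test_fun V \<phi> \<longrightarrow> S \<phi> = T \<phi>)"

definition distr_of_fun :: "(real^'n::finite) set \<Rightarrow> (real^'n \<Rightarrow> real) \<Rightarrow> 'n distr" where
  "distr_of_fun V h \<phi> = set_lebesgue_integral lebesgue V (\<lambda>x. h x * \<phi> x)"

definition distr_pd :: "'n::finite \<Rightarrow> 'n distr \<Rightarrow> 'n distr" where
  "distr_pd i T \<phi> = - T (pd i \<phi>)"

definition locally_integrable_on :: "(real^'n::finite) set \<Rightarrow> (real^'n \<Rightarrow> real) \<Rightarrow> bool" where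
  "locally_integrable_on V h \<longleftrightarrow> (\<forall>K. compact K \<and> K \<subseteq> V \<longrightarrow> set_integrable lebesgue K h)"

definition has_weak_pd ::
  "(real^'n::finite) set \<Rightarrow> 'n \<Rightarrow> (real^'n \<Rightarrow> real) \<Rightarrow> (real^'n \<Rightarrow> real) \<Rightarrow> bool" where
  "has_weak_pd V i h w \<longleftrightarrow> locally_integrable_on V h \<and> locally_integrable_on V w \<and>
     eq_distr V (distr_pd i (distr_of_fun V h)) (distr_of_fun V w)"

text \<open>The weak derivative is unique up to null sets, so the choice below is harmless under integrals.\<close>

definition weak_pd :: "(real^'n::finite) set \<Rightarrow> 'n \<Rightarrow> (real^'n \<Rightarrow> real) \<Rightarrow> real^'n \<Rightarrow> real" where
  "weak_pd V i h = (SOME w. has_weak_pd V i h w)"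

section \<open>Lipschitz domains and local spaces\<close>

text \<open>Near each boundary point, \<open>V\<close> is the strict epigraph, in some direction \<open>\<nu>\<close>, of a Lipschitz
  function on the hyperplane orthogonal to \<open>\<nu>\<close>; such a function extends to a Lipschitz function
  \<open>\<gamma>\<close> on the whole space.\<close>

definition bounded_lipschitz_domain :: "(real^'n::finite) set \<Rightarrow> bool" where
  "bounded_lipschitz_domain V \<longleftrightarrow> open V \<and> connected V \<and> bounded V \<and>
     (\<forall>p\<in>frontier V. \<exists>\<nu> L r. \<exists>\<gamma> :: real^'n \<Rightarrow> real.
        norm \<nu> = 1 \<and> r > 0 \<and> L-lipschitz_on UNIV \<gamma> \<and>
        V \<inter> ball p r = {x \<in> ball p r. \<gamma> (x - (x \<bullet> \<nu>) *\<^sub>R \<nu>) < x \<bullet> \<nu>})"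

definition loc ::
  "((real^'n::finite) set \<Rightarrow> (real^'n \<Rightarrow> real) \<Rightarrow> bool) \<Rightarrow> (real^'n) set \<Rightarrow> (real^'n \<Rightarrow> real) \<Rightarrow> bool" where
  "loc X U h \<longleftrightarrow> (\<forall>V. bounded_lipschitz_domain V \<and> closure V \<subseteq> U \<longrightarrow> X V h)"

section \<open>Function spaces\<close>

definition holder_norm ::
  "nat \<Rightarrow> real \<Rightarrow> (real^'n::finite) set \<Rightarrow> (real^'n \<Rightarrow> real) \<Rightarrow> ennreal" where
  "holder_norm k \<alpha> V h =
     (SUP is\<in>{is. length is \<le> k}. SUP x\<in>V. ennreal \<bar>pds is h x\<bar>) +
     (SUP is\<in>{is. length is = k}. SUP (x, y)\<in>{(x, y). x \<in> V \<and> y \<in> V \<and> x \<noteq> y}.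
        ennreal (\<bar>pds is h x - pds is h y\<bar> / dist x y powr \<alpha>))"

definition holder_space ::
  "nat \<Rightarrow> real \<Rightarrow> (real^'n::finite) set \<Rightarrow> (real^'n \<Rightarrow> real) \<Rightarrow> bool" where
  "holder_space k \<alpha> V h \<longleftrightarrow> Ck_on k V h \<and> holder_norm k \<alpha> V h < \<infinity>"

text \<open>\<open>C\<^sup>\<infinity>\<close> up to the boundary is taken to mean: restriction of a smooth function on the whole space.\<close>

definition little_holder ::
  "nat \<Rightarrow> real \<Rightarrow> (real^'n::finite) set \<Rightarrow> (real^'n \<Rightarrow> real) \<Rightarrow> bool" where
  "little_holder k \<alpha> V h \<longleftrightarrow> holder_space k \<alpha> V h \<and>
     (\<forall>e>0. \<exists>\<psi>. smooth_on UNIV \<psi> \<and> holder_norm k \<alpha> V (\<lambda>x. h x - \<psi> x) < ennreal e)"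

definition Lp :: "real \<Rightarrow> (real^'n::finite) set \<Rightarrow> (real^'n \<Rightarrow> real) \<Rightarrow> bool" where
  "Lp p V h \<longleftrightarrow> set_borel_measurable lebesgue V h \<and> set_integrable lebesgue V (\<lambda>x. \<bar>h x\<bar> powr p)"

definition W1p :: "real \<Rightarrow> (real^'n::finite) set \<Rightarrow> (real^'n \<Rightarrow> real) \<Rightarrow> bool" where
  "W1p p V h \<longleftrightarrow> Lp p V h \<and> (\<forall>i. \<exists>w. has_weak_pd V i h w \<and> Lp p V w)"

text \<open>A signed Radon measure of finite mass on the open set \<open>V\<close> is a difference of two finite
  Borel measures on \<open>V\<close> (these are automatically Radon).\<close>

definition is_finite_signed_measure :: "(real^'n::finite) set \<Rightarrow> 'n distr \<Rightarrow> bool" where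
  "is_finite_signed_measure V T \<longleftrightarrow> (\<exists>M N. finite_measure M \<and> finite_measure N \<and>
     sets M = sets (restrict_space borel V) \<and> sets N = sets (restrict_space borel V) \<and>
     eq_distr V T (\<lambda>\<phi>. (\<integral>x. \<phi> x \<partial>M) - (\<integral>x. \<phi> x \<partial>N)))"

definition BV2 :: "(real^'n::finite) set \<Rightarrow> (real^'n \<Rightarrow> real) \<Rightarrow> bool" where
  "BV2 V h \<longleftrightarrow> W1p 1 V h \<and>
     (\<forall>i j. is_finite_signed_measure V (distr_pd i (distr_pd j (distr_of_fun V h))))"

text \<open>The \<open>p\<close>-th power of the Gagliardo seminorm of \<open>W\<^sup>s\<^sup>,\<^sup>p(V)\<close>; the integrand is \<open>0\<close> on the diagonal.\<close>

definition gagliardo ::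
  "real \<Rightarrow> real \<Rightarrow> (real^'n::finite) set \<Rightarrow> (real^'n \<Rightarrow> real) \<Rightarrow> ennreal" where
  "gagliardo s p V w =
     (\<integral>\<^sup>+x\<in>V. (\<integral>\<^sup>+y\<in>V. ennreal (\<bar>w x - w y\<bar> powr p / dist x y powr (real CARD('n) + s * p))
        \<partial>lebesgue) \<partial>lebesgue)"

definition Wsp :: "real \<Rightarrow> real \<Rightarrow> (real^'n::finite) set \<Rightarrow> (real^'n \<Rightarrow> real) \<Rightarrow> bool" where
  "Wsp s p V w \<longleftrightarrow> Lp p V w \<and> gagliardo s p V w < \<infinity>"

text \<open>The space \<open>W\<^sup>1\<^sup>+\<^sup>s\<^sup>,\<^sup>p(V)\<close>, for \<open>0 < s < 1\<close>.\<close>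

definition W1sp :: "real \<Rightarrow> real \<Rightarrow> (real^'n::finite) set \<Rightarrow> (real^'n \<Rightarrow> real) \<Rightarrow> bool" where
  "W1sp s p V h \<longleftrightarrow> W1p p V h \<and> (\<forall>i. \<exists>w. has_weak_pd V i h w \<and> Wsp s p V w)"

section \<open>Riemannian metrics on planar domains\<close>

definition smooth_metric_on :: "(real^2) set \<Rightarrow> (real^2 \<Rightarrow> real^2^2) \<Rightarrow> bool" where
  "smooth_metric_on U g \<longleftrightarrow> smooth_on U g \<and>
     (\<forall>x\<in>U. transpose (g x) = g x \<and> (\<forall>\<xi>. \<xi> \<noteq> 0 \<longrightarrow> \<xi> \<bullet> (g x *v \<xi>) > 0))"

text \<open>\<open>christoffel g k i j\<close> is \<open>\<Gamma>\<^sup>k\<^sub>i\<^sub>j\<close>.\<close>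

definition christoffel :: "(real^2 \<Rightarrow> real^2^2) \<Rightarrow> 2 \<Rightarrow> 2 \<Rightarrow> 2 \<Rightarrow> real^2 \<Rightarrow> real" where
  "christoffel g k i j x = (1/2) * (\<Sum>l\<in>UNIV. matrix_inv (g x) $ k $ l *
     (pd i (\<lambda>y. g y $ j $ l) x + pd j (\<lambda>y. g y $ i $ l) x - pd l (\<lambda>y. g y $ i $ j) x))"

text \<open>\<open>riemann g l k i j\<close> is the coefficient of \<open>\<partial>\<^sub>l\<close> in
  \<open>R(\<partial>\<^sub>i,\<partial>\<^sub>j)\<partial>\<^sub>k = \<nabla>\<^sub>i\<nabla>\<^sub>j\<partial>\<^sub>k - \<nabla>\<^sub>j\<nabla>\<^sub>i\<partial>\<^sub>k\<close>.\<close>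

definition riemann :: "(real^2 \<Rightarrow> real^2^2) \<Rightarrow> 2 \<Rightarrow> 2 \<Rightarrow> 2 \<Rightarrow> 2 \<Rightarrow> real^2 \<Rightarrow> real" where
  "riemann g l k i j x =
     pd i (christoffel g l j k) x - pd j (christoffel g l i k) x +
     (\<Sum>m\<in>UNIV. christoffel g l i m x * christoffel g m j k x
             - christoffel g l j m x * christoffel g m i k x)"

text \<open>\<open>K = \<langle>R(\<partial>\<^sub>1,\<partial>\<^sub>2)\<partial>\<^sub>2, \<partial>\<^sub>1\<rangle> / det g\<close>, which is \<open>+1\<close> for the unit sphere.\<close>

definition gauss_curvature :: "(real^2 \<Rightarrow> real^2^2) \<Rightarrow> real^2 \<Rightarrow> real" where
  "gauss_curvature g x = (\<Sum>l\<in>UNIV. g x $ 1 $ l * riemann g l 2 1 2 x) / det (g x)"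

definition C1_isometric_embedding ::
  "(real^2) set \<Rightarrow> (real^2 \<Rightarrow> real^2^2) \<Rightarrow> (real^2 \<Rightarrow> real^3) \<Rightarrow> bool" where
  "C1_isometric_embedding U g u \<longleftrightarrow> Ck_on 1 U u \<and> (\<exists>w. homeomorphism U (u ` U) u w) \<and>
     (\<forall>x\<in>U. \<forall>i j. pd i u x \<bullet> pd j u x = g x $ i $ j)"

definition C1_diffeomorphism ::
  "(real^2) set \<Rightarrow> (real^2) set \<Rightarrow> (real^2 \<Rightarrow> real^2) \<Rightarrow> (real^2 \<Rightarrow> real^2) \<Rightarrow> bool" where
  "C1_diffeomorphism U U' \<Psi> \<Phi> \<longleftrightarrow>
     homeomorphism U U' \<Psi> \<Phi> \<and> Ck_on 1 U \<Psi> \<and> Ck_on 1 U' \<Phi>"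

section \<open>The distributional Hessian determinant\<close>

definition Det_D2 :: "(real^2) set \<Rightarrow> (real^2 \<Rightarrow> real) \<Rightarrow> 2 distr" where
  "Det_D2 V f \<phi> =
     distr_pd 2 (distr_pd 1 (distr_of_fun V (\<lambda>x. weak_pd V 1 f x * weak_pd V 2 f x))) \<phi>
     - (1/2) * distr_pd 2 (distr_pd 2 (distr_of_fun V (\<lambda>x. (weak_pd V 1 f x)\<^sup>2))) \<phi>
     - (1/2) * distr_pd 1 (distr_pd 1 (distr_of_fun V (\<lambda>x. (weak_pd V 2 f x)\<^sup>2))) \<phi>"

end

theory Submission
  imports Defs "HOL-Analysis.Analysis"
begin

text \<open>The induced metric of a mollified map is close to the mollified metric: by the commutator estimate of
  Constantin, E and Titi the difference is quadratic in the oscillation of the gradient. Hence the weak form of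
  the Gauss equation, which is an identity for smooth maps, survives the limit: in the error terms the second
  derivatives of the mollified map are either bounded in \<open>L\<^sup>1\<close> and multiplied by a uniformly small factor
  (little Hoelder and \<open>BV\<^sup>2\<close>), or controlled by the part of the Gagliardo seminorm near the diagonal.
  The slopes of the graph are rational functions of the gradient of the map, which gives the regularity of the graph; its
  second derivatives are push-forwards of those of the map, with continuous densities.\<close>

text \<open>Origin of the exponents: let I_m be the integral over a ball of radius e of the m-th
  power of the oscillation of the gradient. The mollified map has second derivatives of order
  I_1/e^3, and the first derivatives of its metric are off by I_2/e^3 + e. The weak equation pairs
  the two, because second derivatives of the metric are moved by parts onto a coefficient built from
  the gradient. The product is at most a multiple of I_3/e^4 plus small terms, and 4 = 2 + (2/3) * 3
  is the exponent of the Gagliardo kernel in the plane. If the oscillation is o(sqrt e), the metric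
  error tends to zero uniformly and an L^1 bound on second derivatives suffices; a plain Hoelder
  bound O(sqrt e) would only keep that error bounded. The mollified surface is never written as a
  graph over the plane. Integrals are pulled back to the domain, with the test function composed
  with the mollified projection, so a nonvanishing Jacobian is enough and no inverse of that
  projection is needed.\<close>

abbreviation eventually_0 :: "(real \<Rightarrow> bool) \<Rightarrow> bool" (binder "EV " 10) where
  "eventually_0 P \<equiv> eventually P (at_right 0)"

abbreviation sum_UNIV :: "('a::finite \<Rightarrow> 'b::comm_monoid_add) \<Rightarrow> 'b" (binder "SU " 10) where
  "sum_UNIV h \<equiv> sum h UNIV"

lemmas set_integral_def = set_lebesgue_integral_def
lemmas bochner_cong = Bochner_Integration.integral_cong
lemmas bochner_diff = Bochner_Integration.integral_diff
lemmas bochner_sum = Bochner_Integration.integral_sum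
lemmas bochner_integrable_sum = Bochner_Integration.integrable_sum

type_synonym fun2 = "real^2 \<Rightarrow> real"

notation scaleR (infixr "*R" 75)

section \<open>Calculus of partial derivatives\<close>

lemma pd_eqI: "(f has_derivative F) (at x) ==> pd i f x = F (axis i 1)"
unfolding pd_def using frechet_derivative_at by metis

lemma axis_sum_vec: "(SU i. (h$i) *R axis i 1) = (h::real^'n::finite)"
by (simp add: vec_eq_iff axis_def if_distrib cong: if_cong)

lemma has_derivative_pd:
fixes f :: "real^'n::finite => 'b::real_normed_vector"
assumes "f differentiable (at x)"
shows "(f has_derivative (%h. SU i. (h$i) *R pd i f x)) (at x)"
proof -
let ?F = "frechet_derivative f (at x)"
have F: "(f has_derivative ?F) (at x)" using assms frechet_derivative_works by blast
interpret F: bounded_linear ?F using F by (rule has_derivative_bounded_linear)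
have "?F = (%h. SU i. (h$i) *R pd i f x)"
proof
 fix h
 have "?F h = ?F (SU i. (h$i) *R axis i 1)" by (simp only: axis_sum_vec)
 also have "... = (SU i. (h$i) *R pd i f x)"
 by (simp add: F.sum F.scaleR pd_def)
 finally show "?F h = (SU i. (h$i) *R pd i f x)" .
qed
with F show ?thesis by simp
qed

lemma pd_cong_open:
assumes "open S" "x : S" "!!y. y : S ==> f y = g y"
shows "pd i f x = pd i g x"
proof -
have "(f has_derivative F) (at x) \<longleftrightarrow> (g has_derivative F) (at x)" for F
 using has_derivative_transform_within_open[OF _ assms(1,2), of f F UNIV g]
 has_derivative_transform_within_open[OF _ assms(1,2), of g F UNIV f] assms(3) by auto
then show ?thesis unfolding pd_def frechet_derivative_def by simp
qed

lemma differentiable_cong_open: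
assumes "open S" "x : S" "!!y. y : S ==> f y = g y" "f differentiable (at x)"
shows "g differentiable (at x)"
using assms has_derivative_transform_within_open[OF _ assms(1,2)] unfolding differentiable_def by blast

lemma pd_const [simp]: "pd i (%x. c) x = 0"
using pd_eqI[OF has_derivative_const, of i c x] by simp

lemma pd_const_fun [simp]: "pd i (%x. c) = (%x. 0)"
by auto

lemma pd_add:
assumes "f differentiable (at x)" "g differentiable (at x)"
shows "pd i (%x. f x + g x) x = pd i f x + pd i g x"
using pd_eqI[OF has_derivative_add[OF assms[unfolded frechet_derivative_works]]] by (simp add: pd_def)

lemma pd_diff:
assumes "f differentiable (at x)" "g differentiable (at x)"
shows "pd i (%x. f x - g x) x = pd i f x - pd i g x"
using pd_eqI[OF has_derivative_diff[OF assms[unfolded frechet_derivative_works]]] by (simp add: pd_def)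

lemma pd_mult:
fixes f g :: "real^'n::finite => real"
assumes "f differentiable (at x)" "g differentiable (at x)"
shows "pd i (%x. f x * g x) x = pd i f x * g x + f x * pd i g x"
using pd_eqI[OF has_derivative_mult[OF assms[unfolded frechet_derivative_works]]]
by (simp add: pd_def algebra_simps)

lemma pd_cmult:
fixes f :: "real^'n::finite => real"
assumes "f differentiable (at x)"
shows "pd i (%x. c * f x) x = c * pd i f x"
using pd_mult[OF differentiable_const assms] by simp

lemma pd_inverse:
fixes f :: "real^'n::finite => real"
assumes "f differentiable (at x)" "f x ~= 0"
shows "pd i (%x. inverse (f x)) x = - pd i f x * inverse (f x) * inverse (f x)"
using pd_eqI[OF Deriv.has_derivative_inverse[OF assms(2) assms(1)[unfolded frechet_derivative_works]]]
by (simp add: pd_def)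

lemma pd_sum:
assumes "!!a. a : A ==> f a differentiable (at x)"
shows "pd i (%x. \<Sum>a\<in>A. f a x) x = (\<Sum>a\<in>A. pd i (f a) x)"
proof -
have "((%x. \<Sum>a\<in>A. f a x) has_derivative (%h. \<Sum>a\<in>A. frechet_derivative (f a) (at x) h)) (at x)"
 by (intro has_derivative_sum) (use assms frechet_derivative_works in blast)
from pd_eqI[OF this] show ?thesis by (simp add: pd_def)
qed

lemma pd_bounded_linear:
assumes "bounded_linear L" "f differentiable (at x)"
shows "pd i (%x. L (f x)) x = L (pd i f x)"
using pd_eqI[OF bounded_linear.has_derivative[OF assms(1) assms(2)[unfolded frechet_derivative_works]]]
by (simp add: pd_def)

lemma pd_vec_nth:
fixes f :: "real^'n::finite => 'b::euclidean_space^'m::finite"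
assumes "f differentiable (at x)"
shows "pd i (%x. f x $ k) x = pd i f x $ k"
using pd_bounded_linear[OF bounded_linear_vec_nth assms] .

lemma differentiable_vec_nth:
fixes f :: "real^'n::finite => 'b::euclidean_space^'m::finite"
assumes "f differentiable F"
shows "(%x. f x $ k) differentiable F"
using assms bounded_linear.has_derivative[OF bounded_linear_vec_nth] unfolding differentiable_def by blast

lemma pd_compose:
fixes f :: "real^'m::finite => real" and G :: "real^'n::finite => real^'m"
assumes "f differentiable (at (G x))" "G differentiable (at x)"
shows "pd i (%x. f (G x)) x = (SU a. pd a f (G x) * pd i (%x. G x $ a) x)"
proof -
have "((%x. f (G x)) has_derivative (%h. SU a. (frechet_derivative G (at x) h $ a) *R pd a f (G x))) (at x)"
 using has_derivative_compose[OF assms(2)[unfolded frechet_derivative_works] has_derivative_pd[OF assms(1)]]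
 by simp
from pd_eqI[OF this, of i] show ?thesis
 by (simp add: pd_vec_nth[OF assms(2)]) (simp add: pd_def mult.commute)
qed

lemma differentiable_vecI:
fixes G :: "real^'n::finite => real^'m::finite"
assumes "!!a. (%x. G x $ a) differentiable (at x)"
shows "G differentiable (at x)"
proof -
have "(G has_derivative (%h. \<chi> a. frechet_derivative (%x. G x $ a) (at x) h)) (at x)"
proof (subst has_derivative_componentwise_within, rule ballI)
 fix b :: "real^'m" assume "b : Basis"
 then obtain a where b: "b = axis a 1" by (auto simp: Basis_vec_def)
 show "((%x. G x \<bullet> b) has_derivative (%h. (\<chi> a. frechet_derivative (%x. G x $ a) (at x) h) \<bullet> b)) (at x)"
 using assms[of a] unfolding b inner_axis frechet_derivative_works by simp
qed
then show ?thesis unfolding differentiable_def by blast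
qed

lemma pd_uminus:
assumes "f differentiable (at x)"
shows "pd i (%x. - f x) x = - pd i f x"
using pd_eqI[OF has_derivative_minus[OF assms[unfolded frechet_derivative_works]]] by (simp add: pd_def)

section \<open>The classes \<open>C\<^sup>k\<close>\<close>

lemma Ck_on_cong:
assumes "open S" "!!x. x : S ==> f x = g x" "Ck_on k S f"
shows "Ck_on k S g"
using assms(2,3)
proof (induction k arbitrary: f g)
case 0 then show ?case using continuous_on_cong by (metis Ck_on.simps(1))
next
case (Suc k)
have "Ck_on k S (pd i g)" for i
 by (rule Suc.IH[of "pd i f"]) (use Suc.prems in \<open>auto intro: pd_cong_open[OF assms(1)]\<close>)
then show ?case using Suc.prems differentiable_cong_open[OF assms(1)] by (metis Ck_on.simps(2))
qed

lemma Ck_on_subset: "Ck_on k S f ==> T <= S ==> Ck_on k T f"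
by (induction k arbitrary: f) (auto intro: continuous_on_subset)

lemma Ck_on_Suc_D: "Ck_on (Suc k) S f ==> Ck_on k S f"
by (induction k arbitrary: f)
 (auto simp: continuous_at_imp_continuous_on differentiable_imp_continuous_within)

lemma Ck_on_le: "Ck_on m S f ==> k <= m ==> Ck_on k S f"
by (induction m) (auto simp: le_Suc_eq dest: Ck_on_Suc_D simp del: Ck_on.simps)

lemma Ck_on_imp_continuous_on: "Ck_on k S f ==> continuous_on S f"
using Ck_on_le[of k S f 0] by simp

lemma Ck_on_const [simp]: "Ck_on k S (%x. c)"
proof (induction k arbitrary: c)
case (Suc k)
then show ?case by simp
qed simp

lemma Ck_on_add:
assumes "open S"
shows "Ck_on k S f ==> Ck_on k S g ==> Ck_on k S (%x. f x + g x)"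
proof (induction k arbitrary: f g)
case (Suc k)
have "Ck_on k S (pd i (%x. f x + g x))" for i
 by (rule Ck_on_cong[OF assms, of "%x. pd i f x + pd i g x"]) (use Suc in \<open>auto simp: pd_add\<close>)
then show ?case using Suc.prems by auto
qed (auto intro: continuous_intros)

lemma Ck_on_mult:
fixes f g :: "real^'n::finite => real"
assumes "open S"
shows "Ck_on k S f ==> Ck_on k S g ==> Ck_on k S (%x. f x * g x)"
proof (induction k arbitrary: f g)
case (Suc k)
have "Ck_on k S (pd i (%x. f x * g x))" for i
proof (rule Ck_on_cong[OF assms, of "%x. pd i f x * g x + f x * pd i g x"])
 show "Ck_on k S (%x. pd i f x * g x + f x * pd i g x)"
 using Suc.prems Ck_on_Suc_D[OF Suc.prems(1)] Ck_on_Suc_D[OF Suc.prems(2)]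
 by (intro Ck_on_add[OF assms] Suc.IH) auto
qed (use Suc.prems in \<open>auto simp: pd_mult\<close>)
then show ?case using Suc.prems by auto
qed (auto intro: continuous_intros)

lemma Ck_on_sum:
assumes "open S" "!!a. a : A ==> Ck_on k S (f a)"
shows "Ck_on k S (%x. \<Sum>a\<in>A. f a x)"
using assms(2)
proof (induction A rule: infinite_finite_induct)
case (insert a A)
then show ?case by (simp add: Ck_on_add[OF assms(1)])
qed auto

lemma Ck_on_inverse:
fixes f :: "real^'n::finite => real"
assumes "open S" "!!x. x : S ==> f x ~= 0"
shows "Ck_on k S f ==> Ck_on k S (%x. inverse (f x))"
proof (induction k)
case 0 then show ?case using assms(2) by (auto intro!: continuous_intros)
next
case (Suc k)
have "Ck_on k S (pd i (%x. inverse (f x)))" for i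
proof (rule Ck_on_cong[OF assms(1), of "%x. (-1) * pd i f x * inverse (f x) * inverse (f x)"])
 show "Ck_on k S (%x. (-1) * pd i f x * inverse (f x) * inverse (f x))"
 using Suc.prems Suc.IH Ck_on_Suc_D[OF Suc.prems(1)]
 by (intro Ck_on_mult[OF assms(1)] Ck_on_const) auto
qed (use Suc.prems assms(2) in \<open>auto simp: pd_inverse\<close>)
moreover have "(%x. inverse (f x)) differentiable (at x)" if "x : S" for x
 using Suc.prems assms(2) that by (intro differentiable_inverse) auto
ultimately show ?case by simp
qed

lemma Ck_on_compose:
fixes f :: "real^'m::finite => real" and G :: "real^'n::finite => real^'m"
assumes "open S" "G ` S <= T"
shows "Ck_on k T f ==> (!!a. Ck_on k S (%x. G x $ a)) ==> Ck_on k S (%x. f (G x))"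
proof (induction k arbitrary: f)
case 0
have "continuous_on S G" using 0(2) continuous_on_componentwise[of S G]
 by (auto simp: Basis_vec_def inner_axis)
then show ?case using 0(1) assms(2) by (auto intro: continuous_on_compose2)
next
case (Suc k)
have dG: "G differentiable (at x)" if "x : S" for x
 using Suc.prems(2)[unfolded Ck_on.simps] that by (intro differentiable_vecI) blast
have df: "f differentiable (at (G x))" if "x : S" for x
proof -
 have "ALL x:T. f differentiable (at x)" using Suc.prems(1) by simp
 moreover have "G x : T" using assms(2) that by blast
 ultimately show ?thesis by (rule bspec)
qed
have "Ck_on k S (pd i (%x. f (G x)))" for i
proof (rule Ck_on_cong[OF assms(1), of "%x. SU a. pd a f (G x) * pd i (%x. G x $ a) x"])
 show "Ck_on k S (%x. SU a. pd a f (G x) * pd i (%x. G x $ a) x)"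
 proof (intro Ck_on_sum[OF assms(1)] Ck_on_mult[OF assms(1)])
 show "Ck_on k S (%x. pd a f (G x))" for a
  by (rule Suc.IH[OF _ Ck_on_Suc_D[OF Suc.prems(2)]]) (use Suc.prems(1) in simp)
 show "Ck_on k S (pd i (%x. G x $ a))" for a using Suc.prems(2)[of a] by simp
 qed
 show "(SU a. pd a f (G x) * pd i (%x. G x $ a) x) = pd i (%x. f (G x)) x" if "x : S" for x
 using pd_compose[OF df[OF that] dG[OF that]] by simp
qed
moreover have "(%x. f (G x)) differentiable (at x)" if "x : S" for x
 using differentiable_compose[OF df[OF that] dG[OF that]] .
ultimately show ?case by simp
qed

lemma Ck_on_Un:
assumes "open S" "open T"
shows "Ck_on k S f ==> Ck_on k T f ==> Ck_on k (S \<union> T) f"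
by (induction k arbitrary: f) (auto simp: continuous_on_open_Un[OF assms])

lemma Ck_on_vec_nth:
fixes f :: "real^'n::finite => 'b::euclidean_space^'m::finite"
assumes "open S"
shows "Ck_on k S f ==> Ck_on k S (%x. f x $ a)"
proof (induction k arbitrary: f)
case (Suc k)
have "Ck_on k S (pd i (%x. f x $ a))" for i
 by (rule Ck_on_cong[OF assms, of "%x. pd i f x $ a"]) (use Suc in \<open>auto simp: pd_vec_nth\<close>)
then show ?case using Suc.prems by (auto intro: differentiable_vec_nth)
qed (auto intro: continuous_intros)

lemma pd_coord: "pd i (%x::real^'n::finite. x $ a) x = (if i = a then 1 else 0)"
using pd_eqI[OF bounded_linear_imp_has_derivative[OF bounded_linear_vec_nth[where i=a]], of i x]
by (simp add: axis_def)

lemma Ck_on_coord: "Ck_on k S (%x::real^'n::finite. x $ a)"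
proof (cases k)
case (Suc m)
have "pd i (%x::real^'n. x $ a) = (%x. if i = a then 1 else 0)" for i by (auto simp: pd_coord)
then show ?thesis using Suc
 by (auto intro!: bounded_linear_imp_differentiable bounded_linear_vec_nth)
qed (auto intro: continuous_intros)

lemma smooth_onI: "(!!k. Ck_on k S f) ==> smooth_on S f" by (simp add: smooth_on_def)
lemma smooth_onD: "smooth_on S f ==> Ck_on k S f" by (simp add: smooth_on_def)

lemma smooth_on_const [simp]: "smooth_on S (%x. c)" by (simp add: smooth_on_def)
lemma smooth_on_coord: "smooth_on S (%x. x $ a)" by (simp add: smooth_on_def Ck_on_coord)

lemma smooth_on_add: "open S ==> smooth_on S f ==> smooth_on S g ==> smooth_on S (%x. f x + g x)"
by (simp add: smooth_on_def Ck_on_add)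

lemma smooth_on_sum: "open S ==> (!!a. a : A ==> smooth_on S (f a)) ==> smooth_on S (%x. \<Sum>a\<in>A. f a x)"
by (simp add: smooth_on_def Ck_on_sum)

lemma smooth_on_mult:
fixes f g :: "real^'n::finite => real"
shows "open S ==> smooth_on S f ==> smooth_on S g ==> smooth_on S (%x. f x * g x)"
by (simp add: smooth_on_def Ck_on_mult)

lemma smooth_on_uminus:
fixes f :: "real^'n::finite => real"
shows "open S ==> smooth_on S f ==> smooth_on S (%x. - f x)"
using smooth_on_mult[of S "%_. -1" f] by simp

lemma smooth_on_diff:
fixes f g :: "real^'n::finite => real"
shows "open S ==> smooth_on S f ==> smooth_on S g ==> smooth_on S (%x. f x - g x)"
using smooth_on_add[of S f "%x. - g x"] smooth_on_uminus[of S g] by simp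

lemma smooth_on_inverse:
fixes f :: "real^'n::finite => real"
shows "open S ==> (!!x. x : S ==> f x ~= 0) ==> smooth_on S f ==> smooth_on S (%x. inverse (f x))"
by (simp add: smooth_on_def Ck_on_inverse)

lemma smooth_on_divide:
fixes f g :: "real^'n::finite => real"
shows "open S ==> smooth_on S f ==> smooth_on S g ==> (!!x. x : S ==> g x ~= 0) ==> smooth_on S (%x. f x / g x)"
unfolding divide_inverse by (intro smooth_on_mult smooth_on_inverse)

lemma smooth_on_power:
fixes f :: "real^'n::finite => real"
shows "open S ==> smooth_on S f ==> smooth_on S (%x. f x ^ n)"
by (induction n) (auto intro: smooth_on_mult)

lemma smooth_on_compose:
fixes f :: "real^'m::finite => real" and G :: "real^'n::finite => real^'m"
assumes "open S" "G ` S <= T" "smooth_on T f" "!!a. smooth_on S (%x. G x $ a)"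
shows "smooth_on S (%x. f (G x))"
using assms Ck_on_compose by (metis smooth_on_def)

lemma smooth_on_pd: "smooth_on S f ==> smooth_on S (pd i f)"
unfolding smooth_on_def using Ck_on.simps(2) by blast

lemma smooth_on_subset: "smooth_on S f ==> T <= S ==> smooth_on T f"
using Ck_on_subset by (metis smooth_on_def)

lemma smooth_on_cong: "open S ==> (!!x. x : S ==> f x = g x) ==> smooth_on S f ==> smooth_on S g"
using Ck_on_cong by (metis smooth_on_def)

lemma smooth_on_Un: "open S ==> open T ==> smooth_on S f ==> smooth_on T f ==> smooth_on (S \<union> T) f"
by (simp add: smooth_on_def Ck_on_Un)

lemma smooth_on_vec_nth:
fixes f :: "real^'n::finite => 'b::euclidean_space^'m::finite"
shows "open S ==> smooth_on S f ==> smooth_on S (%x. f x $ a)"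
by (simp add: smooth_on_def Ck_on_vec_nth)

lemma smooth_on_diffble: "smooth_on S f ==> x : S ==> f differentiable (at x)"
using smooth_onD[of S f 1] by simp

lemma smooth_on_cont: "smooth_on S f ==> continuous_on S f"
using smooth_onD[of S f 0] by simp

text \<open>Smoothness is local, and the open sets \<open>S\<close> and \<open>- K\<close> cover the
  space.\<close>

lemma smooth_on_extend_zero:
fixes f :: "real^'n::finite => real"
assumes "open S" "smooth_on S f" "closed K" "K <= S" "!!x. x ~: K ==> f x = 0"
shows "smooth_on UNIV f"
proof -
have "smooth_on (- K) f"
 by (rule smooth_on_cong[of _ "%_. 0"]) (use assms in auto)
then have "smooth_on (S \<union> - K) f" using assms by (intro smooth_on_Un) auto
moreover have "S \<union> - K = UNIV" using assms by auto
ultimately show ?thesis by simp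
qed

text \<open>Clairaut's theorem, by the mean value theorem applied twice to the second difference.\<close>

lemma pd_line:
fixes f :: "real^'n::finite => real"
assumes "f differentiable (at (x + s *R axis i 1))"
shows "((%s. f (x + s *R axis i 1)) has_real_derivative pd i f (x + s *R axis i 1)) (at s)"
proof -
have "((%s. f (x + s *R axis i 1)) has_derivative
 (%h. frechet_derivative f (at (x + s *R axis i 1)) (h *R axis i 1))) (at s)"
 by (rule has_derivative_compose[of "%s. x + s *R axis i 1" "%h. h *R axis i 1", OF _ assms[unfolded frechet_derivative_works]])
 (auto intro!: derivative_eq_intros)
moreover have "frechet_derivative f (at (x + s *R axis i 1)) (h *R axis i 1) =
 h * pd i f (x + s *R axis i 1)" for h
 using linear_frechet_derivative[OF assms] by (simp add: pd_def linear_cmul)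
ultimately show ?thesis by (simp add: has_field_derivative_def mult_commute_abs)
qed

lemma pd_MVT:
fixes f :: "real^'n::finite => real"
assumes "t > 0" "!!s. 0 <= s ==> s <= t ==> f differentiable (at (x + s *R axis i 1))"
shows "EX s. 0 < s & s < t & f (x + t *R axis i 1) - f x = t * pd i f (x + s *R axis i 1)"
proof -
have "EX z. 0 < z & z < t & f (x + t *R axis i 1) - f (x + 0 *R axis i 1) = (t - 0) * pd i f (x + z *R axis i 1)"
 by (rule MVT2[OF assms(1)]) (rule pd_line, rule assms(2))
then show ?thesis by simp
qed

lemma pd_commute:
fixes f :: "real^'n::finite => real"
assumes S: "open S" "x : S" and f: "Ck_on 2 S f"
shows "pd i (pd j f) x = pd j (pd i f) x"
proof -
have f1: "!!y. y : S ==> f differentiable (at y)" "!!y k. y : S ==> pd k f differentiable (at y)"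
 "!!k l. continuous_on S (pd k (pd l f))"
 using f by (auto simp: numeral_2_eq_2)
\<comment> \<open>The second difference of step \<open>t\<close> in the two directions is symmetric
  in \<open>i\<close> and \<open>j\<close>; divided by \<open>t * t\<close> it is a value of either
  mixed derivative at a point within \<open>2 * t\<close> of \<open>x\<close>.\<close>
have key: "EX y z. dist y x <= 2 * t & dist z x <= 2 * t & pd i (pd j f) y = pd j (pd i f) z"
 if t: "t > 0" "cball x (2 * t) <= S" for t
proof -
 have *: "EX y. dist y x <= 2 * t & f (x + t *R axis i 1 + t *R axis j 1) - f (x + t *R axis i 1)
  - f (x + t *R axis j 1) + f x = t * t * pd j (pd i f) y" for i j
 proof -
 have d: "dist (x + s *R axis i 1 + s' *R axis j 1) x <= 2 * t"
  if "0 <= s" "s <= t" "0 <= s'" "s' <= t" for s s'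
  using norm_triangle_ineq[of "s *R axis i (1::real)" "s' *R axis j 1"] that by (auto simp: dist_norm)
 have inS: "x + s *R axis i 1 + s' *R axis j 1 : S"
  if "0 <= s" "s <= t" "0 <= s'" "s' <= t" for s s'
  using d[OF that] t(2) by (auto simp: dist_commute)
 let ?g = "%y. f (y + t *R axis j 1) - f y"
 have df1: "f differentiable (at (x + s *R axis i 1))" if "0 <= s" "s <= t" for s
  using f1(1)[of "x + s *R axis i 1"] inS[OF that, of 0] t(1) by simp
 have df2: "(%y. f (y + t *R axis j 1)) differentiable (at (x + s *R axis i 1))"
  if "0 <= s" "s <= t" for s
  by (rule differentiable_compose[where f=f and g="%y. y + t *R axis j 1"])
  (use f1(1)[of "x + s *R axis i 1 + t *R axis j 1"] inS[OF that, of t] t(1) in simp_all)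
 have "EX s. 0 < s & s < t & ?g (x + t *R axis i 1) - ?g x = t * pd i ?g (x + s *R axis i 1)"
  by (rule pd_MVT[OF t(1)]) (intro differentiable_diff df1 df2)
 then obtain s where s: "0 < s" "s < t" "?g (x + t *R axis i 1) - ?g x = t * pd i ?g (x + s *R axis i 1)"
  by blast
 have "pd i (%y. f (y + t *R axis j 1)) (x + s *R axis i 1) = pd i f (x + s *R axis i 1 + t *R axis j 1)"
 proof -
  have "f differentiable (at (x + s *R axis i 1 + t *R axis j 1))"
  using f1(1)[OF inS[of s t]] s t(1) by simp
  then have "((%y. f (y + t *R axis j 1)) has_derivative frechet_derivative f (at (x + s *R axis i 1 + t *R axis j 1))) (at (x + s *R axis i 1))"
  unfolding frechet_derivative_works
  by (intro has_derivative_compose[of "%y. y + t *R axis j 1" "%h. h" _ UNIV f])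
   (auto intro!: derivative_eq_intros)
  from pd_eqI[OF this] show ?thesis by (simp add: pd_def)
 qed
 then have s': "?g (x + t *R axis i 1) - ?g x
  = t * (pd i f (x + s *R axis i 1 + t *R axis j 1) - pd i f (x + s *R axis i 1))"
  using s df1[of s] df2[of s] by (simp add: pd_diff)
 have "EX s1. 0 < s1 & s1 < t & pd i f (x + s *R axis i 1 + t *R axis j 1) - pd i f (x + s *R axis i 1)
  = t * pd j (pd i f) (x + s *R axis i 1 + s1 *R axis j 1)"
  by (rule pd_MVT[OF t(1)]) (use f1(2) inS s in auto)
 then obtain s1 where s1: "0 < s1" "s1 < t" "pd i f (x + s *R axis i 1 + t *R axis j 1) - pd i f (x + s *R axis i 1)
  = t * pd j (pd i f) (x + s *R axis i 1 + s1 *R axis j 1)"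
  by blast
 show ?thesis
  using s' s1 d[of s s1] s by (intro exI[of _ "x + s *R axis i 1 + s1 *R axis j 1"]) (simp add: algebra_simps)
 qed
 obtain y where y: "dist y x <= 2 * t" "f (x + t *R axis i 1 + t *R axis j 1) - f (x + t *R axis i 1)
  - f (x + t *R axis j 1) + f x = t * t * pd j (pd i f) y" using * by blast
 obtain z where z: "dist z x <= 2 * t" "f (x + t *R axis j 1 + t *R axis i 1) - f (x + t *R axis j 1)
  - f (x + t *R axis i 1) + f x = t * t * pd i (pd j f) z" using * by blast
 have zz: "x + t *R axis j 1 + t *R axis i 1 = x + t *R axis i 1 + t *R axis j 1"
 by (simp add: add_ac)
 have "t * t * pd j (pd i f) y = t * t * pd i (pd j f) z"
 using y(2) z(2)[unfolded zz] by linarith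
 then have "pd i (pd j f) z = pd j (pd i f) y" using t(1) by simp
 then show ?thesis using y(1) z(1) by blast
qed
show ?thesis
proof (rule ccontr)
 assume ne: "pd i (pd j f) x ~= pd j (pd i f) x"
 define e where "e = dist (pd i (pd j f) x) (pd j (pd i f) x) / 2"
 have e: "e > 0" using ne by (simp add: e_def)
 have "isCont (pd k (pd l f)) x" for k l
 using f1(3) S continuous_on_eq_continuous_at by blast
 then have cont: "EX d>0. ALL y. dist y x < d --> dist (pd k (pd l f) y) (pd k (pd l f) x) < e" for k l
 unfolding continuous_at_eps_delta using e by (simp only:)
 obtain d1 d2 where d: "d1 > 0" "!!y. dist y x < d1 ==> dist (pd i (pd j f) y) (pd i (pd j f) x) < e"
  "d2 > 0" "!!y. dist y x < d2 ==> dist (pd j (pd i f) y) (pd j (pd i f) x) < e"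
 using cont[of i j] cont[of j i] by (elim exE conjE) simp
 obtain d3 where d3: "d3 > 0" "cball x d3 <= S" using S open_contains_cball by blast
 define t where "t = min (min d1 d2) d3 / 4"
 have t: "t > 0" "2 * t < d1" "2 * t < d2" "2 * t <= d3"
 using d(1,3) d3(1) unfolding t_def by linarith+
 obtain y z where "dist y x <= 2 * t" "dist z x <= 2 * t" "pd i (pd j f) y = pd j (pd i f) z"
 using key[OF t(1) order_trans[OF subset_cball[OF t(4)] d3(2)]] by (elim exE conjE) (rule that)
 then have "dist (pd i (pd j f) y) (pd i (pd j f) x) < e" "dist (pd i (pd j f) y) (pd j (pd i f) x) < e"
 using d(2)[of y] d(4)[of z] t by simp_all
 then show False
 using dist_triangle3[of "pd i (pd j f) x" "pd j (pd i f) x" "pd i (pd j f) y"] unfolding e_def by linarith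
qed
qed

section \<open>Test functions\<close>

lemma continuous_zero_outside_compact_bounded:
fixes f :: "'a::metric_space => real"
assumes "continuous_on UNIV f" "compact K" "!!x. x ~: K ==> f x = 0"
shows "EX C>=0. ALL x. abs (f x) <= C"
proof -
have "bounded (f ` K)"
 by (intro compact_imp_bounded compact_continuous_image continuous_on_subset[OF assms(1)] assms(2)) simp
then obtain C where C: "!!x. x : K ==> abs (f x) <= C" unfolding bounded_iff by auto
have "abs (f x) <= max C 0" for x using C[of x] assms(3)[of x] by (cases "x : K") auto
then show ?thesis by (intro exI[of _ "max C 0"]) auto
qed

lemma pd_zero_outside:
fixes f :: "real^'n::finite => real"
assumes "closed K" "!!x. x ~: K ==> f x = 0" "x ~: K"
shows "pd i f x = 0"
using pd_cong_open[of "- K" x f "%_. 0" i] assms by auto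

lemma test_fun_obtain:
assumes "test_fun V phi"
obtains K where "compact K" "K <= V" "!!x. x ~: K ==> phi x = 0" "!!i x. x ~: K ==> pd i phi x = 0"
using assms unfolding test_fun_def using pd_zero_outside compact_imp_closed by metis

lemma test_fun_pd: "test_fun V phi ==> test_fun V (pd i phi)"
by (rule test_fun_obtain, assumption) (auto simp: test_fun_def intro: smooth_on_pd)

lemma test_fun_mono: "test_fun V phi ==> V <= W ==> test_fun W phi"
unfolding test_fun_def by blast

lemma test_fun_smooth: "test_fun V phi ==> smooth_on UNIV phi"
by (simp add: test_fun_def)

lemma test_fun_diffble: "test_fun V phi ==> phi differentiable (at x)"
using test_fun_smooth smooth_on_diffble by blast

lemma test_fun_continuous: "test_fun V phi ==> continuous_on S phi"
using smooth_on_cont[OF test_fun_smooth] continuous_on_subset by blast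

lemma test_fun_measurable: "test_fun V phi ==> phi : borel_measurable borel"
using test_fun_continuous borel_measurable_continuous_onI by blast

lemma test_fun_bounded: "test_fun V phi ==> EX C>=0. ALL x. abs (phi x) <= C"
using test_fun_obtain[of V phi] continuous_zero_outside_compact_bounded[OF test_fun_continuous] by metis

lemma test_fun_pd_commute: "test_fun V phi ==> pd i (pd j phi) = pd j (pd i phi)"
using pd_commute[OF open_UNIV UNIV_I smooth_onD[OF test_fun_smooth]] by blast

lemma test_fun_integrable:
assumes "test_fun V phi" shows "integrable lborel phi"
proof -
obtain K where K: "compact K" "!!x. x ~: K ==> phi x = 0" using assms test_fun_obtain by metis
have "integrable lborel (%x. indicator K x *R phi x)"
 using borel_integrable_compact[OF K(1) test_fun_continuous[OF assms]] .
moreover have "(%x. indicator K x *R phi x) = phi" using K(2) by (force simp: indicator_def)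
ultimately show ?thesis by simp
qed

lemma test_fun_Lipschitz:
assumes "test_fun V phi"
shows "EX L>=0. ALL x y. abs (phi x - phi y) <= L * norm (x - y)"
proof -
obtain C where C: "!!i. C i >= 0" "!!i x. abs (pd i phi x) <= C i"
 using test_fun_bounded[OF test_fun_pd[OF assms]] by metis
let ?L = "SU i. C i"
have "norm (phi x - phi y) <= ?L * norm (x - y)" for x y
proof (rule differentiable_bound[OF convex_UNIV, where f'="%x h. SU i. (h$i) *R pd i phi x"])
 fix x show "(phi has_derivative (%h. SU i. (h$i) *R pd i phi x)) (at x)"
 by (rule has_derivative_pd[OF test_fun_diffble[OF assms]])
 show "onorm (%h. SU i. (h$i) *R pd i phi x) <= ?L"
 proof (rule onorm_le)
 fix h :: "real^'a"
 have "abs (SU i. h$i * pd i phi x) <= (SU i. abs (h$i) * abs (pd i phi x))"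
  using sum_abs[of "%i. h$i * pd i phi x"] by (simp add: abs_mult)
 also have "... <= (SU i. norm h * C i)"
  by (intro sum_mono mult_mono C component_le_norm_cart) auto
 finally show "norm (SU i. (h$i) *R pd i phi x) <= ?L * norm h"
  by (simp add: sum_distrib_left mult.commute)
 qed
qed auto
then show ?thesis using C(1) by (intro exI[of _ ?L]) (auto simp: sum_nonneg)
qed

text \<open>A remainder bound uniform in the base point: integrated against an integrable function
  it yields differentiability of a convolution directly. It holds because the first derivatives are
  again test functions, hence globally Lipschitz.\<close>

lemma test_fun_Taylor:
assumes "test_fun V phi"
shows "EX C>=0. ALL z v. abs (phi (z + v) - phi z - (SU i. v$i * pd i phi z)) <= C * (norm v)^2"
proof -
obtain L where L: "!!i. L i >= 0" "!!i x y. abs (pd i phi x - pd i phi y) <= L i * norm (x - y)"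
 using test_fun_Lipschitz[OF test_fun_pd[OF assms]] by metis
let ?L = "SU i. L i"
have "norm (phi (z + v) - phi z - (SU i. (((z + v) - z)$i) *R pd i phi z)) <= norm ((z + v) - z) * (?L * norm v)" for z v
proof (rule differentiable_bound_linearization[where S="cball z (norm v)" and f'="%x h. SU i. (h$i) *R pd i phi x"])
 show "z + t *R (z + v - z) : cball z (norm v)" if "t : {0..1}" for t
 using that by (auto simp: dist_norm mult_left_le_one_le)
 show "z : cball z (norm v)" by simp
 fix x assume x: "x : cball z (norm v)"
 show "(phi has_derivative (%h. SU i. (h$i) *R pd i phi x)) (at x within cball z (norm v))"
 by (rule has_derivative_at_withinI[OF has_derivative_pd[OF test_fun_diffble[OF assms]]])
 show "onorm ((%h. SU j. h $ j *R pd j phi x) - (%h. SU j. h $ j *R pd j phi z)) <= ?L * norm v"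
 proof (rule onorm_le)
 fix h :: "real^'a"
 have "abs (SU i. h$i * (pd i phi x - pd i phi z)) <= (SU i. abs (h$i) * abs (pd i phi x - pd i phi z))"
  using sum_abs[of "%i. h$i * (pd i phi x - pd i phi z)"] by (simp add: abs_mult)
 also have "... <= (SU i. norm h * (L i * norm v))"
 proof (intro sum_mono mult_mono component_le_norm_cart)
  fix i
  have "abs (pd i phi x - pd i phi z) <= L i * norm (x - z)" by (rule L)
  also have "... <= L i * norm v" using x L(1) by (intro mult_left_mono) (auto simp: dist_norm norm_minus_commute)
  finally show "abs (pd i phi x - pd i phi z) <= L i * norm v" .
 qed auto
 finally show "norm (((%h. SU j. h $ j *R pd j phi x) - (%h. SU j. h $ j *R pd j phi z)) h) <= ?L * norm v * norm h"
  by (simp add: sum_subtractf[symmetric] right_diff_distrib sum_distrib_left sum_distrib_right mult_ac)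
 qed
qed
then show ?thesis using L(1)
 by (intro exI[of _ ?L]) (auto simp: sum_nonneg power2_eq_square mult_ac)
qed

section \<open>Integration by parts\<close>

lemma integral_translation:
fixes f :: "'a::euclidean_space => real"
assumes "f : borel_measurable borel"
shows "(LINT x|lborel. f (x + c)) = (LINT x|lborel. f x)"
proof -
have "(LINT x|lborel. f x) = (LINT x|(distr lborel borel ((+) c)). f x)" by (simp add: lborel_distr_plus)
also have "... = (LINT x|lborel. f (c + x))" by (rule integral_distr) (use assms in auto)
finally show ?thesis by (simp add: add.commute)
qed

lemma integrable_translation:
fixes f :: "'a::euclidean_space => real"
assumes "integrable lborel f"
shows "integrable lborel (%x. f (x + c))"
proof -
have "integrable (distr lborel borel ((+) c)) f" using assms by (simp add: lborel_distr_plus)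
then show ?thesis using assms by (subst (asm) integrable_distr_eq) (auto simp: add.commute)
qed

lemma continuous_compact_support_integrable:
fixes f :: "'a::euclidean_space => real"
assumes "continuous_on K f" "compact K" "!!x. x ~: K ==> f x = 0"
shows "integrable lborel f"
proof -
have "integrable lborel (%x. indicator K x *R f x)"
 by (rule borel_integrable_compact[OF assms(2,1)])
moreover have "(%x. indicator K x *R f x) = f" using assms(3) by (force simp: indicator_def)
ultimately show ?thesis by simp
qed

text \<open>Difference quotients in direction \<open>i\<close> integrate to zero by translation
  invariance. The mean value theorem bounds them by the supremum of the derivative on a fixed ball
  (steps of at most 1 enlarge the radius \<open>R\<close> to \<open>R + 1\<close>), so dominated
  convergence applies.\<close>

lemma integral_pd_zero:
fixes h :: "real^'n::finite => real"
assumes h: "Ck_on 1 UNIV h" and K: "compact K" "!!x. x ~: K ==> h x = 0"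
shows "(LINT x|lborel. pd i h x) = 0"
proof -
have hd: "h differentiable (at x)" for x using h by simp
have hc: "continuous_on UNIV h" using Ck_on_imp_continuous_on[OF h] .
have pc: "continuous_on UNIV (pd i h)" using h by simp
have [measurable]: "h : borel_measurable borel" "pd i h : borel_measurable borel"
 using hc pc borel_measurable_continuous_onI by blast+
have p0: "pd i h x = 0" if "x ~: K" for x
 using pd_zero_outside[OF compact_imp_closed[OF K(1)] K(2) that] .
obtain C where C: "C >= 0" "!!x. abs (pd i h x) <= C"
 using continuous_zero_outside_compact_bounded[OF pc K(1) p0] by blast
obtain R where R: "K <= cball 0 R" "R > 0"
 using bounded_pos[of K] compact_imp_bounded[OF K(1)] by (auto simp: subset_iff)
define t where "t n = 1 / real (Suc n)" for n
have t: "t n > 0" "t n <= 1" for n by (auto simp: t_def)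
have t0: "t \<longlonglongrightarrow> 0" unfolding t_def using LIMSEQ_inverse_real_of_nat by (simp add: inverse_eq_divide)
let ?s = "%n x. (h (x + t n *R axis i 1) - h x) / t n"
have hint: "integrable lborel h" by (rule continuous_compact_support_integrable[OF _ K]) (use hc continuous_on_subset in blast)
have s0: "(LINT x|lborel. ?s n x) = 0" for n
 using integral_translation[of h "t n *R axis i 1"] integrable_translation[OF hint] hint by simp
have bd: "abs (?s n x) <= C * indicator (cball 0 (R + 1)) x" for n x
proof (cases "x : cball 0 (R + 1)")
 case True
 obtain s where "h (x + t n *R axis i 1) - h x = t n * pd i h (x + s *R axis i 1)"
 using pd_MVT[where f=h and x=x and i=i, OF t(1)] hd by blast
 then show ?thesis using C(2)[of "x + s *R axis i 1"] t(1)[of n] True by simp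
next
 case False
 then have "norm x > R + 1" by simp
 moreover have "norm x <= norm (x + t n *R axis i 1) + t n"
 using norm_triangle_ineq4[of "x + t n *R axis i 1" "t n *R axis i (1::real)"] t(1)[of n] by simp
 ultimately have "norm (x + t n *R axis i 1) > R" "norm x > R" using t(2)[of n] by auto
 then have "x + t n *R axis i 1 ~: K" "x ~: K" using R(1) by auto
 then show ?thesis using K(2) False by simp
qed
have lim: "(%n. ?s n x) \<longlonglongrightarrow> pd i h x" for x
proof -
 have "((%s. h (x + s *R axis i 1)) has_real_derivative pd i h (x + 0 *R axis i 1)) (at 0)"
 by (rule pd_line) (use hd in simp)
 then have "((%s. (h (x + s *R axis i 1) - h x) / s) \<longlongrightarrow> pd i h x) (at 0)"
 unfolding DERIV_def by simp
 moreover have "filterlim t (at 0) sequentially"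
 using t0 t(1) unfolding filterlim_at by (auto simp: less_imp_neq[symmetric] eventually_sequentially)
 ultimately show ?thesis by (rule filterlim_compose)
qed
have "(%n. \<integral>x. ?s n x \<partial>lborel) \<longlonglongrightarrow> (LINT x|lborel. pd i h x)"
proof (rule integral_dominated_convergence[where w="%x. C * indicator (cball 0 (R + 1)) x"])
 show "integrable lborel (%x::real^'n. C * indicator (cball 0 (R + 1)) x :: real)"
 by (intro integrable_mult_right integrable_real_indicator)
  (use emeasure_lborel_cball_finite[of "0::real^'n" "R + 1"] in auto)
qed (use lim bd in auto)
then show ?thesis unfolding s0 by (simp add: LIMSEQ_const_iff)
qed

text \<open>The version for functions that are only defined on an open set.\<close>

lemma set_integral_pd_zero:
fixes h :: "real^'n::finite => real"
assumes W: "open W" and h: "Ck_on 1 W h" and K: "compact K" "K <= W" "!!x. x : W ==> x ~: K ==> h x = 0"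
shows "(LINT x:W|lborel. pd i h x) = 0"
proof -
define h' where "h' x = (if x : W then h x else 0)" for x
have h'0: "h' x = 0" if "x ~: K" for x using K(3) that by (auto simp: h'_def)
have W': "Ck_on 1 W h'" by (rule Ck_on_cong[OF W _ h]) (simp add: h'_def)
have c: "Ck_on 1 (- K) h'"
 by (rule Ck_on_cong[of _ "%_. 0"]) (use h'0 K(1) compact_imp_closed in \<open>auto simp del: Ck_on.simps\<close>)
have "Ck_on 1 (W \<union> - K) h'"
 by (rule Ck_on_Un[OF W _ W' c]) (use K(1) compact_imp_closed in auto)
moreover have "W \<union> - K = UNIV" using K(2) by auto
ultimately have "(LINT x|lborel. pd i h' x) = 0"
 using integral_pd_zero[where i=i, OF _ K(1) h'0] by simp
moreover have "pd i h' x = indicator W x *R pd i h x" for x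
proof (cases "x : W")
 case True
 then show ?thesis using pd_cong_open[OF W True, of h' h i] by (simp add: h'_def)
next
 case False
 then have "pd i h' x = 0"
 using K(2) by (intro pd_zero_outside[OF compact_imp_closed[OF K(1)] h'0]) auto
 then show ?thesis using False by simp
qed
ultimately show ?thesis by (simp add: set_integral_def)
qed

section \<open>Bump functions\<close>

text \<open>Indexing by the power of \<open>t\<close> makes the family closed under differentiation:
  the derivative of member \<open>n\<close> combines members \<open>n + 1\<close> and
  \<open>n + 2\<close>. Smoothness then follows by induction on the order, for all \<open>n\<close>
  at once.\<close>

definition flat_exp :: "nat => real => real" where
"flat_exp n t = (if t <= 0 then 0 else exp (- inverse t) / t ^ n)"

lemma power_le_fact_exp:
fixes x :: real assumes "x >= 0" shows "x ^ n <= fact n * exp x"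
proof -
have "(\<Sum>k\<in>{n}. inverse (fact k) * x ^ k) <= exp x"
 unfolding exp_def using assms summable_exp_generic[of x]
 by (subst sum.cong[OF refl, of _ _ "%k. x ^ k /\<^sub>R fact k"]) (auto intro!: sum_le_suminf simp del: sum.insert)
then show ?thesis by (simp add: field_simps)
qed

lemma flat_exp_le: "abs (flat_exp n t) <= fact (Suc n) * abs t"
proof (cases "t <= 0")
case True
then have "flat_exp n t = 0" by (simp add: flat_exp_def)
then show ?thesis by (simp del: fact_Suc)
next
case False
then have "inverse t ^ Suc n <= fact (Suc n) * exp (inverse t)" by (intro power_le_fact_exp) simp
then have "exp (- inverse t) / t ^ n <= fact (Suc n) * t"
 using False by (simp add: exp_minus field_simps)
then show ?thesis using False by (simp add: flat_exp_def)
qed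

lemma flat_exp_DERIV: "(flat_exp n has_real_derivative flat_exp (n + 2) t - real n * flat_exp (n + 1) t) (at t)"
proof -
consider "t < 0" | "t = 0" | "t > 0" by linarith
then show ?thesis
proof cases
 case 1
 have "(flat_exp n has_real_derivative 0) (at t)"
 by (rule has_field_derivative_transform_within_open[of "%_. 0" _ _ "{..<0}"]) (use 1 in \<open>auto simp: flat_exp_def\<close>)
 then show ?thesis using 1 by (simp add: flat_exp_def)
next
 case 2
 \<comment> \<open>At the origin the difference quotient of member \<open>n\<close> is member
   \<open>n + 1\<close>, which is at most linear in \<open>h\<close> because the exponential beats
   every power.\<close>
 have "((%h. flat_exp n h / h) \<longlongrightarrow> 0) (at 0)"
 proof (rule Lim_null_comparison)
 have "abs (flat_exp n h / h) <= fact (n + 2) * abs h" if "h ~= 0" for h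
 proof -
  have "abs (flat_exp n h / h) = abs (flat_exp (Suc n) h)" using that by (simp add: flat_exp_def abs_mult)
  then show ?thesis using flat_exp_le[of "Suc n" h] by simp
 qed
 then show "\<forall>\<^sub>F h in at 0. norm (flat_exp n h / h) <= fact (n + 2) * abs h"
  by (auto simp: eventually_at_filter)
 show "((%h::real. fact (n + 2) * abs h) \<longlongrightarrow> 0) (at 0)" by (auto intro!: tendsto_eq_intros)
 qed
 then show ?thesis using 2 by (simp add: DERIV_def flat_exp_def)
next
 case 3
 have "((%t. exp (- inverse t) / t ^ n) has_real_derivative flat_exp (n + 2) t - real n * flat_exp (n + 1) t) (at t)"
 proof (cases n)
 case 0
 then show ?thesis using 3
  by (auto intro!: derivative_eq_intros simp: flat_exp_def field_simps power2_eq_square)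
 next
 case (Suc m)
 have "((%t. exp (- inverse t) / t ^ n) has_real_derivative
  (exp (- inverse t) * (inverse t * inverse t) * t ^ n - exp (- inverse t) * (real n * t ^ (n - 1))) / (t ^ n * t ^ n)) (at t)"
  using 3 by (auto intro!: derivative_eq_intros)
 moreover have "(exp (- inverse t) * (inverse t * inverse t) * t ^ n - exp (- inverse t) * (real n * t ^ (n - 1))) / (t ^ n * t ^ n)
  = flat_exp (n + 2) t - real n * flat_exp (n + 1) t"
  using 3 by (simp add: flat_exp_def Suc field_simps)
 ultimately show ?thesis by simp
 qed
 then show ?thesis
 by (rule has_field_derivative_transform_within_open[of _ _ _ "{0<..}"]) (use 3 in \<open>auto simp: flat_exp_def\<close>)
qed
qed

lemma Ck_on_flat_exp:
fixes q :: "real^'n::finite => real"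
assumes "smooth_on UNIV q"
shows "Ck_on k UNIV (%x. flat_exp n (q x))"
proof (induction k arbitrary: n)
case 0
have "continuous_on UNIV (flat_exp n)"
 using flat_exp_DERIV DERIV_isCont continuous_at_imp_continuous_on by blast
then show ?case using smooth_on_cont[OF assms]
 by (auto intro: continuous_on_compose2[where t=UNIV and f=q])
next
case (Suc k)
have D: "((%x. flat_exp n (q x)) has_derivative
 (%h. (flat_exp (n + 2) (q x) - real n * flat_exp (n + 1) (q x)) * frechet_derivative q (at x) h)) (at x)" for x
 using has_derivative_compose[OF smooth_on_diffble[OF assms UNIV_I, unfolded frechet_derivative_works]
 flat_exp_DERIV[unfolded has_field_derivative_def]] by simp
have "pd i (%x. flat_exp n (q x)) = (%x. (flat_exp (n + 2) (q x) + (- real n) * flat_exp (n + 1) (q x)) * pd i q x)" for i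
 using pd_eqI[OF D, of i] by (auto simp: pd_def)
moreover have "Ck_on k UNIV (%x. (flat_exp (n + 2) (q x) + (- real n) * flat_exp (n + 1) (q x)) * pd i q x)" for i
 using Suc smooth_onD[OF smooth_on_pd[OF assms]]
 by (intro Ck_on_mult Ck_on_add Ck_on_const open_UNIV)
moreover have "(%x. flat_exp n (q x)) differentiable (at x)" for x using D unfolding differentiable_def by blast
ultimately show ?case by simp
qed

text \<open>The squared norm keeps the inner function polynomial, hence smooth at the centre
  too.\<close>

definition bump :: "real^'n::finite => real => real^'n => real" where
"bump c r x = flat_exp 0 (r^2 - (norm (x - c))^2)"

lemma smooth_on_norm_sq: "smooth_on UNIV (%x::real^'n::finite. (norm (x - c))^2)"
proof -
have "(%x::real^'n. (norm (x - c))^2) = (%x. SU i. (x$i - c$i) * (x$i - c$i))"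
 by (auto simp: power2_norm_eq_inner inner_vec_def)
then show ?thesis
 by (simp only:) (intro smooth_on_sum smooth_on_mult smooth_on_diff smooth_on_coord smooth_on_const open_UNIV)
qed

lemma smooth_on_bump: "smooth_on UNIV (bump c r)"
unfolding bump_def[abs_def]
by (rule smooth_onI[OF Ck_on_flat_exp]) (intro smooth_on_diff smooth_on_const smooth_on_norm_sq open_UNIV)

lemma bump_nonneg: "bump c r x >= 0" by (simp add: bump_def flat_exp_def)

lemma bump_pos_iff: "r > 0 ==> bump c r x > 0 \<longleftrightarrow> x : ball c r"
using abs_le_square_iff[of r "norm (x - c)"]
by (auto simp: bump_def flat_exp_def dist_norm norm_minus_commute)

lemma bump_zero: "r > 0 ==> x ~: ball c r ==> bump c r x = 0"
using bump_pos_iff[of r c x] bump_nonneg[of c r x] by linarith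

lemma test_fun_bump: "r > 0 ==> test_fun UNIV (bump c r)"
unfolding test_fun_def using smooth_on_bump bump_zero
by (metis compact_cball ball_subset_cball subsetD subset_UNIV)

section \<open>Convolution\<close>

definition mconv :: "(real^'n::finite => real) => (real^'n => real) => real^'n => real" where
"mconv k h x = (LINT y|lborel. k (x - y) * h y)"

lemma mconv_integrable:
fixes k h :: "real^'n::finite => real"
assumes k: "test_fun V k" and h: "integrable lborel h"
shows "integrable lborel (%y. k (x - y) * h y)"
proof -
obtain C where C: "!!x. abs (k x) <= C" using test_fun_bounded[OF k] by blast
have [measurable]: "k : borel_measurable borel" using test_fun_measurable[OF k] .
have [measurable]: "h : borel_measurable borel" using borel_measurable_integrable[OF h] by simp
show ?thesis
proof (rule Bochner_Integration.integrable_bound)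
 show "integrable lborel (%y. C * h y)" using h by simp
 show "AE y in lborel. norm (k (x - y) * h y) <= norm (C * h y)"
 by (intro AE_I2) (use C in \<open>auto simp: abs_mult intro!: mult_right_mono order_trans[OF C abs_ge_self]\<close>)
qed measurable
qed

text \<open>The uniform quadratic Taylor remainder of the kernel, integrated against
  \<open>abs h\<close>, bounds the error of the linearisation by a multiple of the squared step;
  integrability of \<open>h\<close> is enough.\<close>

lemma mconv_has_derivative:
fixes k h :: "real^'n::finite => real"
assumes k: "test_fun V k" and h: "integrable lborel h"
shows "(mconv k h has_derivative (%v. SU i. v$i * mconv (pd i k) h x)) (at x)"
proof -
obtain C where C: "C >= 0" "!!z v. abs (k (z + v) - k z - (SU i. v$i * pd i k z)) <= C * (norm v)^2"
 using test_fun_Taylor[OF k] by blast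
let ?N = "\<integral>y. abs (h y) \<partial>lborel"
have bound: "abs (mconv k h y - mconv k h x - (SU i. (y - x)$i * mconv (pd i k) h x)) <= C * ?N * (norm (y - x))^2" for y
proof -
 have i1: "integrable lborel (%z. k (y - z) * h z)" "integrable lborel (%z. k (x - z) * h z)"
 "!!i. integrable lborel (%z. pd i k (x - z) * h z)"
 using mconv_integrable[OF _ h] k test_fun_pd[OF k] by blast+
 have "mconv k h y - mconv k h x - (SU i. (y - x)$i * mconv (pd i k) h x)
  = (LINT z|lborel. k (y - z) * h z - k (x - z) * h z - (SU i. (y - x)$i * (pd i k (x - z) * h z)))"
 unfolding mconv_def using i1 by (simp add: bochner_diff bochner_sum)
 also have "\<bar>...\<bar> <= (LINT z|lborel. (C * (norm (y - x))^2) * \<bar>h z\<bar>)"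
 proof (rule integral_abs_bound_integral)
 fix z
 have "k (y - z) * h z - k (x - z) * h z - (SU i. (y - x)$i * (pd i k (x - z) * h z))
  = (k ((x - z) + (y - x)) - k (x - z) - (SU i. (y - x)$i * pd i k (x - z))) * h z"
  by (simp add: algebra_simps sum_distrib_left sum_distrib_right)
 then show "abs (k (y - z) * h z - k (x - z) * h z - (SU i. (y - x)$i * (pd i k (x - z) * h z))) <= C * (norm (y - x))^2 * abs (h z)"
  using C(2)[of "x - z" "y - x"] by (simp only: abs_mult) (intro mult_right_mono, auto)
 qed (use i1 h in auto)
 finally show ?thesis using h by (simp add: mult_ac)
qed
show ?thesis unfolding has_derivative_iff_norm
proof
 show "bounded_linear (%v. SU i. v$i * mconv (pd i k) h x)"
 by (intro bounded_linear_sum bounded_linear_mult_const bounded_linear_vec_nth)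
 show "((%y. norm (mconv k h y - mconv k h x - (SU i. (y - x)$i * mconv (pd i k) h x)) / norm (y - x)) \<longlongrightarrow> 0) (at x)"
 proof (rule Lim_null_comparison)
 have "norm (norm (mconv k h y - mconv k h x - (SU i. (y - x)$i * mconv (pd i k) h x)) / norm (y - x)) <= C * ?N * norm (y - x)"
  if "y ~= x" for y
  using bound[of y] that by (simp add: field_simps power2_eq_square)
 then show "\<forall>\<^sub>F y in at x. norm (norm (mconv k h y - mconv k h x - (SU i. (y - x)$i * mconv (pd i k) h x)) / norm (y - x)) <= C * ?N * norm (y - x)"
  by (auto simp: eventually_at_filter)
 show "((%y. C * ?N * norm (y - x)) \<longlongrightarrow> 0) (at x)" by (auto intro!: tendsto_eq_intros)
 qed
qed
qed

lemma pd_mconv: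
assumes "test_fun V k" "integrable lborel h"
shows "pd i (mconv k h) = mconv (pd i k) h"
using pd_eqI[OF mconv_has_derivative[OF assms], of i]
by (auto simp: axis_def if_distrib[where f="%c. c * _"] cong: if_cong)

lemma smooth_on_mconv:
assumes "test_fun V k" "integrable lborel h"
shows "smooth_on UNIV (mconv k h)"
proof (rule smooth_onI)
fix m show "Ck_on m UNIV (mconv k h)" using assms(1)
proof (induction m arbitrary: k)
 case 0
 then show ?case using mconv_has_derivative[OF 0 assms(2)]
 by (auto intro!: continuous_at_imp_continuous_on has_derivative_continuous)
next
 case (Suc m)
 have "mconv k h differentiable (at x)" for x
 using mconv_has_derivative[OF Suc.prems assms(2)] unfolding differentiable_def by blast
 then show ?case using Suc.IH[OF test_fun_pd[OF Suc.prems]] pd_mconv[OF Suc.prems assms(2)] by simp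
qed
qed

lemma integral_affine:
fixes f :: "'a::euclidean_space => real"
assumes [measurable]: "f : borel_measurable borel" and c: "c ~= 0"
shows "(LINT x|lborel. f x) = abs c^DIM('a) * (LINT x|lborel. f (t + c *R x))"
proof -
have "(LINT x|lborel. f x) = (LINT x|(density (distr lborel borel (%x. t + c *R x)) (%_. ennreal (abs c^DIM('a)))). f x)"
 using lborel_affine[OF c, of t] by simp
also have "... = (LINT x|(distr lborel borel (%x. t + c *R x)). abs c^DIM('a) *R f x)"
 by (rule integral_density) auto
also have "... = (LINT x|lborel. abs c^DIM('a) *R f (t + c *R x))"
 by (rule integral_distr) auto
finally show ?thesis by simp
qed

text \<open>The kernel may have any integral. With integral one this is an approximation error; for
  a differentiated mollifier, whose integral is zero, it bounds the derivative of the mollification.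
  The bound by an integrated oscillation, rather than a supremum, is what later reaches the
  Gagliardo seminorm.\<close>

lemma mconv_diff_bound:
fixes k h :: "real^'n::finite => real"
assumes k: "test_fun V k" and A: "!!x. abs (k x) <= A" and k0: "!!x. norm x > e ==> k x = 0"
 and h: "integrable lborel h"
shows "abs (mconv k h x - (LINT y|lborel. k y) * h x) <= A * (LINT y:cball x e|lborel. abs (h y - h x))"
proof -
have km[measurable]: "k : borel_measurable borel" using test_fun_measurable[OF k] .
have [measurable]: "h : borel_measurable borel" using borel_measurable_integrable[OF h] by simp
have kx: "integrable lborel (%y. k (x - y))"
proof -
 have "test_fun UNIV (%y. k (x - y))"
 proof -
 obtain K where K: "compact K" "!!y. y ~: K ==> k y = 0" using test_fun_obtain[OF k] by metis
 have "smooth_on UNIV (%y. k (x - y))"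
  by (rule smooth_on_compose[OF open_UNIV _ test_fun_smooth[OF k]])
  (auto intro!: smooth_on_diff smooth_on_coord)
 moreover have "compact ((%y. x - y) ` K)"
  by (intro compact_continuous_image continuous_intros K)
 moreover have "k (x - y) = 0" if "y ~: (%y. x - y) ` K" for y
  using that K(2)[of "x - y"] by (metis diff_diff_eq2 add_diff_cancel_left' image_iff)
 ultimately show ?thesis unfolding test_fun_def by blast
 qed
 then show ?thesis by (rule test_fun_integrable)
qed
have ik: "(LINT y|lborel. k (x - y)) = (LINT y|lborel. k y)"
 using integral_affine[OF km, of "-1" x] by simp
have ball_int: "set_integrable lborel (cball x e) (%y. abs (h y - h x))"
 unfolding set_integrable_def
proof (rule Bochner_Integration.integrable_bound)
 show "integrable lborel (%y. abs (h y) + abs (h x) * indicator (cball x e) y)"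
 using h emeasure_lborel_cball_finite[of x e]
 by (intro Bochner_Integration.integrable_add integrable_mult_right integrable_real_indicator) auto
qed (auto simp: indicator_def)
have "mconv k h x - (LINT y|lborel. k y) * h x = (LINT y|lborel. k (x - y) * h y - k (x - y) * h x)"
 unfolding mconv_def ik[symmetric] using mconv_integrable[OF k h] kx by simp
also have "\<bar>...\<bar> <= (LINT y|lborel. A * (indicator (cball x e) y *R \<bar>h y - h x\<bar>))"
proof (rule integral_abs_bound_integral)
 show "integrable lborel (%y. k (x - y) * h y - k (x - y) * h x)" using mconv_integrable[OF k h] kx by simp
 show "integrable lborel (%y. A * (indicator (cball x e) y *R (abs (h y - h x))))"
 using ball_int unfolding set_integrable_def by simp
 fix y
 have A0: "A >= 0" using A[of 0] by linarith
 show "abs (k (x - y) * h y - k (x - y) * h x) <= A * (indicator (cball x e) y *R (abs (h y - h x)))"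
 using A[of "x - y"] k0[of "x - y"] A0
 by (cases "y : cball x e") (auto simp: right_diff_distrib[symmetric] abs_mult dist_norm intro!: mult_right_mono)
qed
finally show ?thesis by (simp add: set_integral_def)
qed

section \<open>Mollifiers\<close>

definition moll :: "real => real^'n::finite => real" where
"moll e x = bump 0 1 ((1 / e) *R x) / (e ^ CARD('n) * (LINT y|lborel. bump 0 1 (y :: real^'n)))"

lemma integral_bump_pos: "(LINT y|lborel. bump 0 1 (y :: real^'n::finite)) > 0"
proof -
have i: "integrable lborel (bump 0 1 :: real^'n => real)" by (rule test_fun_integrable[OF test_fun_bump]) simp
have "(LINT y|lborel. bump 0 1 (y :: real^'n)) ~= 0"
proof
 assume "(LINT y|lborel. bump 0 1 (y :: real^'n)) = 0"
 then have "AE y in lborel. bump 0 1 (y :: real^'n) = 0"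
 using integral_nonneg_eq_0_iff_AE[OF i] bump_nonneg by (auto simp: bump_nonneg)
 then have "AE y in lborel. (y :: real^'n) ~: ball 0 1"
 by eventually_elim (use bump_pos_iff[of 1 "0::real^'n"] in force)
 then have "ball (0::real^'n) 1 : null_sets lborel"
 by (subst (asm) AE_iff_null_sets[symmetric]) auto
 then have "negligible (ball (0::real^'n) 1)"
 using negligible_iff_null_sets null_sets_completionI by blast
 then show False using open_not_negligible[of "ball (0::real^'n) 1"] by auto
qed
moreover have "(LINT y|lborel. bump 0 1 (y :: real^'n)) >= 0" by (intro Bochner_Integration.integral_nonneg bump_nonneg)
ultimately show ?thesis by simp
qed

lemma moll_nonneg: "e > 0 ==> moll e x >= 0"
using integral_bump_pos[where 'n='a] by (simp add: moll_def bump_nonneg less_imp_le)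

lemma moll_zero: "e > 0 ==> norm x >= e ==> moll e x = 0"
by (simp add: moll_def bump_zero)

lemma test_fun_moll:
assumes "e > 0" shows "test_fun UNIV (moll e)"
proof -
have "smooth_on UNIV (%x. bump 0 1 ((1 / e) *R x) * inverse (e ^ CARD('a) * (LINT y|lborel. bump 0 1 (y :: real^'a))))"
 by (intro smooth_on_mult smooth_on_const open_UNIV smooth_on_compose[OF open_UNIV _ smooth_on_bump])
 (auto simp: divide_inverse intro!: smooth_on_mult smooth_on_coord)
then have "smooth_on UNIV (moll e :: real^'a => real)" by (simp add: moll_def[abs_def] divide_inverse)
then show ?thesis unfolding test_fun_def
 by (intro conjI exI[of _ "cball 0 e"]) (auto intro: moll_zero[OF assms])
qed

lemma integral_moll: "e > 0 ==> (LINT x|lborel. moll e x) = 1"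
using integral_affine[of "moll e :: real^'a => real" e 0] test_fun_measurable[OF test_fun_moll, of e] integral_bump_pos[where 'n='a]
by (simp add: moll_def)

lemma integral_pd_test_fun: "test_fun V phi ==> (LINT x|lborel. pd i phi x) = 0"
by (rule test_fun_obtain, assumption) (auto intro!: integral_pd_zero smooth_onD test_fun_smooth)

text \<open>The powers of \<open>e\<close> come from scaling: the normalising volume gives
  \<open>CARD('n)\<close> of them and a derivative one more, so a single constant serves all
  scales.\<close>

lemma moll_bounds:
"EX C>0. ALL e>0. ALL x::real^'n::finite. abs (moll e x) <= C / e ^ CARD('n) & (ALL i. abs (pd i (moll e) x) <= C / e ^ Suc CARD('n))"
proof -
let ?I = "\<integral>y. bump 0 1 (y :: real^'n) \<partial>lborel"
have tb: "test_fun UNIV (bump 0 1 :: real^'n => real)" by (rule test_fun_bump) simp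
obtain C0 where C0: "C0 >= 0" "!!x::real^'n. abs (bump 0 1 x) <= C0" using test_fun_bounded[OF tb] by blast
obtain C1 where C1: "!!i. C1 i >= 0" "!!i x. abs (pd i (bump 0 1 :: real^'n => real) x) <= C1 i"
 using test_fun_bounded[OF test_fun_pd[OF tb]] by metis
define C where "C = 1 + C0 / ?I + (SU i. C1 i) / ?I"
have I: "?I > 0" by (rule integral_bump_pos)
have Cpos: "C > 0" using I C0 C1 unfolding C_def by (intro add_pos_nonneg) (auto simp: sum_nonneg)
have C0C: "C0 / ?I <= C" unfolding C_def using I C1 C0 by (auto simp: sum_nonneg)
have C1C: "C1 i / ?I <= C" for i
proof -
 have "C1 i / ?I <= (SU i. C1 i) / ?I" using I C1(1) by (intro divide_right_mono member_le_sum) auto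
 also have "... <= C" using C0 I unfolding C_def by simp
 finally show ?thesis .
qed
show ?thesis
proof (intro exI[of _ C] conjI allI impI Cpos)
 fix e :: real and x :: "real^'n" and i assume e: "e > 0"
 have "abs (moll e x) <= (C0 / ?I) / e ^ CARD('n)"
 using C0(2)[of "(1/e) *R x"] e I by (simp add: moll_def abs_mult power_abs field_simps)
 also have "... <= C / e ^ CARD('n)" using C0C e by (intro divide_right_mono) auto
 finally show "abs (moll e x) <= C / e ^ CARD('n)" .
 have "((%x. bump 0 1 ((1/e) *R x)) has_derivative
 (%h. frechet_derivative (bump 0 1) (at ((1/e) *R x)) ((1/e) *R h))) (at x)"
 by (rule has_derivative_compose[where f="%x. (1/e) *R x" and g="bump 0 1"])
  (use test_fun_diffble[OF tb] in \<open>auto intro!: derivative_eq_intros simp: frechet_derivative_works[symmetric]\<close>)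
 then have "((%x. bump 0 1 ((1/e) *R x) / (e ^ CARD('n) * ?I)) has_derivative
 (%h. frechet_derivative (bump 0 1) (at ((1/e) *R x)) ((1/e) *R h) / (e ^ CARD('n) * ?I))) (at x)"
 using has_derivative_mult_left[of _ _ _ "inverse (e ^ CARD('n) * ?I)"] by (simp add: divide_inverse)
 then have "pd i (moll e) x = frechet_derivative (bump 0 1) (at ((1/e) *R x)) ((1/e) *R axis i 1) / (e ^ CARD('n) * ?I)"
 unfolding moll_def[abs_def] by (rule pd_eqI)
 moreover have "frechet_derivative (bump 0 1) (at ((1/e) *R x)) ((1/e) *R axis i 1) = (1/e) * pd i (bump 0 1) ((1/e) *R x)"
 using linear_cmul[OF linear_frechet_derivative[OF test_fun_diffble[OF tb, of "(1/e) *R x"]], of "1/e" "axis i 1"]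
 by (simp only: pd_def real_scaleR_def)
 ultimately have "abs (pd i (moll e) x) <= (C1 i / ?I) / e ^ Suc CARD('n)"
 using C1(2)[of i "(1/e) *R x"] e I by (simp add: abs_mult power_abs field_simps)
 also have "... <= C / e ^ Suc CARD('n)" using C1C e by (intro divide_right_mono) auto
 finally show "abs (pd i (moll e) x) <= C / e ^ Suc CARD('n)" .
qed
qed

text \<open>Derivatives can be moved from the kernel to a function that is \<open>C\<^sup>1\<close> near the support.\<close>

lemma mconv_pd_right:
fixes k h :: "real^'n::finite => real"
assumes k: "test_fun V k" and k0: "!!x. norm x > e ==> k x = 0"
 and W: "open W" "Ck_on 1 W h" and x: "cball x e <= W" "cball x e <= B"
shows "mconv (pd i k) (%y. indicator B y * h y) x = mconv k (%y. indicator B y * pd i h y) x"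
proof -
have p0: "pd i k y = 0" if "norm y > e" for y
 using pd_zero_outside[of "cball 0 e" k y i] k0 that by auto
let ?f = "%y. k (x - y)"
have G: "(%y. x - y) differentiable (at y)" for y by simp
have Gd: "pd i (%y. (x - y)$a) y = (if i = a then -1 else 0)" for i a y
 using pd_diff[of "%_. x$a" y "%y. y$a" i] smooth_on_diffble[OF smooth_on_coord, of y UNIV a]
 by (simp add: pd_coord)
have pf: "pd i ?f y = - pd i k (x - y)" for i y
 using pd_compose[where f=k and G="%y. x - y" and i=i and x=y, OF test_fun_diffble[OF k] G]
 unfolding Gd by (simp add: if_distrib cong: if_cong)
have smf: "smooth_on UNIV ?f"
 by (rule smooth_on_compose[OF open_UNIV _ test_fun_smooth[OF k]]) (auto intro!: smooth_on_diff smooth_on_coord)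
have fd: "?f differentiable (at y)" for y using smooth_on_diffble[OF smf] by simp
have hd: "h differentiable (at y)" if "y : W" for y using W(2) that by simp
have hc: "continuous_on W h" "continuous_on W (pd i h)" using W(2) Ck_on_imp_continuous_on[OF W(2)] by auto
have fc: "continuous_on S ?f" "continuous_on S (%y. pd i k (x - y))" for S
 by (rule continuous_on_compose2[OF test_fun_continuous[OF k, of UNIV]], auto intro!: continuous_intros,
  rule continuous_on_compose2[OF test_fun_continuous[OF test_fun_pd[OF k], of UNIV]], auto intro!: continuous_intros)
have "0 = (LINT y:W|lborel. pd i (%y. ?f y * h y) y)"
proof (rule set_integral_pd_zero[OF W(1), symmetric, where K="cball x e"])
 show "Ck_on 1 W (%y. ?f y * h y)" by (intro Ck_on_mult W Ck_on_subset[OF smooth_onD[OF smf]]) simp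
qed (use x k0 in \<open>auto simp: dist_norm\<close>)
also have "... = (LINT y:cball x e|lborel. k (x - y) * pd i h y - pd i k (x - y) * h y)"
 unfolding set_integral_def
proof (rule bochner_cong[OF refl])
 fix y
 show "indicator W y *R pd i (%y. ?f y * h y) y = indicator (cball x e) y *R (k (x - y) * pd i h y - pd i k (x - y) * h y)"
 proof (cases "y : W")
 case True
 then show ?thesis using pd_mult[OF fd hd[OF True], of i] pf p0[of "x - y"] k0[of "x - y"]
  by (auto simp: indicator_def dist_norm)
 next
 case False
 then have "y ~: cball x e" using x(1) by blast
 then show ?thesis using False by simp
 qed
qed
also have "... = (LINT y:cball x e|lborel. k (x - y) * pd i h y) - (LINT y:cball x e|lborel. pd i k (x - y) * h y)"
 by (intro set_integral_diff borel_integrable_compact[unfolded set_integrable_def[symmetric]] continuous_intros fc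
  continuous_on_subset[OF hc(1)] continuous_on_subset[OF hc(2)] x) auto
also have "(LINT y:cball x e|lborel. k (x - y) * pd i h y) = mconv k (%y. indicator B y * pd i h y) x"
 unfolding mconv_def set_integral_def
 by (rule bochner_cong[OF refl]) (use x k0 in \<open>auto simp: indicator_def dist_norm\<close>)
also have "(LINT y:cball x e|lborel. pd i k (x - y) * h y) = mconv (pd i k) (%y. indicator B y * h y) x"
 unfolding mconv_def set_integral_def
 by (rule bochner_cong[OF refl]) (use x p0 in \<open>auto simp: indicator_def dist_norm\<close>)
finally show ?thesis by simp
qed

section \<open>Partitions of unity\<close>

text \<open>\<open>eta y\<close> is a bump divided by the sum \<open>B\<close> of all bumps. It is
  smooth only where \<open>B\<close> is positive, an open set containing \<open>C\<close>, so
  smoothness is claimed for products with functions supported in \<open>C\<close>. Everywhere else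
  it is still Borel with values between 0 and 1, which allows its use as a density. The bumps have
  half the given radius, so that their closed supports lie in the open balls.\<close>

lemma test_fun_partition:
fixes C :: "(real^'n::finite) set"
assumes C: "compact C" and r: "!!y. y : C ==> r y > 0"
obtains F eta where "finite F" "F <= C" "!!y. y : F ==> eta y : borel_measurable borel"
 "!!y x. y : F ==> 0 <= eta y x & eta y x <= 1"
 "!!phi K y. smooth_on UNIV phi ==> compact K ==> K <= C ==> (!!x. x ~: K ==> phi x = 0) ==> y : F
 ==> test_fun (K \<inter> ball y (r y)) (%x. eta y x * phi x)"
 "!!phi K x. K <= C ==> (!!x. x ~: K ==> phi x = 0) ==> phi x = (\<Sum>y\<in>F. eta y x * phi x)"
proof -
let ?b = "%y. bump y (r y / 2)"
have "C <= (\<Union>y\<in>C. ball y (r y / 2))" using r by force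
then obtain F where F: "F <= C" "finite F" "C <= (\<Union>y\<in>F. ball y (r y / 2))"
 using compactE_image[OF C, of C "%y. ball y (r y / 2)"] by auto
define B where "B x = (\<Sum>y\<in>F. ?b y x)" for x
define eta where "eta y x = ?b y x / B x" for y x
have r2: "r y / 2 > 0" if "y : F" for y using r[of y] that F(1) by auto
have B0: "B x >= 0" "!!y. y : F ==> ?b y x <= B x" for x
 unfolding B_def using F(2) by (auto intro!: sum_nonneg member_le_sum simp: bump_nonneg)
have Bpos: "B x > 0" if xC: "x : C" for x
proof -
 obtain y where "y : F" "x : ball y (r y / 2)" using F(3) xC by blast
 then have "?b y x > 0" using bump_pos_iff[OF r2] by blast
 then show ?thesis using B0(2)[OF \<open>y : F\<close>, of x] by linarith
qed
have smB: "smooth_on UNIV B" unfolding B_def[abs_def] by (intro smooth_on_sum smooth_on_bump open_UNIV)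
have cB: "continuous_on UNIV B" by (rule smooth_on_cont[OF smB])
define S where "S = {x. B x > 0}"
have oS: "open S" unfolding S_def
 by (rule open_Collect_less[OF _ cB]) (auto intro: continuous_intros)
have bm: "?b y : borel_measurable borel" for y
 by (rule borel_measurable_continuous_onI[OF smooth_on_cont[OF smooth_on_bump]])
show thesis
proof (rule that[of F eta])
 show "eta y : borel_measurable borel" for y
 unfolding eta_def[abs_def] using bm[of y] borel_measurable_continuous_onI[OF cB] by (rule borel_measurable_divide)
 show "0 <= eta y x & eta y x <= 1" if "y : F" for y x
 using B0(2)[OF that, of x] B0(1)[of x] bump_nonneg[of y "r y / 2" x] by (auto simp: eta_def divide_le_eq)
 show "phi x = (\<Sum>y\<in>F. eta y x * phi x)" if "K <= C" "!!x. x ~: K ==> phi x = 0" for phi K x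
 proof (cases "x : K")
 case True
 then have "B x ~= 0" using Bpos[of x] that(1) by auto
 then have "(\<Sum>y\<in>F. eta y x) = 1" unfolding eta_def sum_divide_distrib[symmetric] B_def by simp
 then show ?thesis by (simp add: sum_distrib_right[symmetric])
 qed (use that in simp)
 fix phi :: "real^'n => real" and K y
 assume a: "smooth_on UNIV phi" "compact K" "K <= C" "!!x. x ~: K ==> phi x = 0" "y : F"
 let ?K = "K \<inter> cball y (r y / 2)"
 have z: "eta y x * phi x = 0" if "x ~: ?K" for x
 using that a(4)[of x] bump_zero[OF r2[OF a(5)], of x] ball_subset_cball[of y "r y / 2"] by (auto simp: eta_def)
 have "smooth_on S (%x. eta y x * phi x)"
 unfolding eta_def by (intro smooth_on_mult smooth_on_divide oS smooth_on_subset[OF smooth_on_bump]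
  smooth_on_subset[OF smB] smooth_on_subset[OF a(1)]) (auto simp: S_def)
 moreover have "?K <= S" using a(3) Bpos unfolding S_def by auto
 moreover have cK: "compact ?K" using a(2) by (intro compact_Int) auto
 ultimately have "smooth_on UNIV (%x. eta y x * phi x)"
 using smooth_on_extend_zero[OF oS _ compact_imp_closed] z by blast
 moreover have "?K <= K \<inter> ball y (r y)" using r2[OF a(5)] by auto
 ultimately show "test_fun (K \<inter> ball y (r y)) (%x. eta y x * phi x)"
 unfolding test_fun_def using cK z by blast
qed (use F in auto)
qed

section \<open>The fundamental lemma of the calculus of variations\<close>

lemma test_fun_measurable_lebesgue:
fixes phi :: "real^'n::finite => real"
assumes "test_fun V phi" shows "phi : borel_measurable lebesgue"
by (rule measurable_completion) (use test_fun_measurable[OF assms] in simp)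

lemma smooth_on_prod:
fixes f :: "'a => real^'n::finite => real"
shows "open S ==> (!!a. a : A ==> smooth_on S (f a)) ==> smooth_on S (%x. \<Prod>a\<in>A. f a x)"
by (induction A rule: infinite_finite_induct) (auto intro: smooth_on_mult)

text \<open>Boxes are used because, unlike balls, they are stable under intersection, as the
  measure-theoretic uniqueness argument requires.\<close>

lemma ex_test_fun_box:
fixes a b :: "real^'n::finite"
assumes ne: "box a b ~= {}"
shows "EX F :: real^'n => real. smooth_on UNIV F & (ALL x. F x >= 0) & (ALL x. F x > 0 \<longleftrightarrow> x : box a b)"
proof -
have ab: "a$i < b$i" for i using ne unfolding interval_ne_empty_cart by blast
have pos: "flat_exp 0 ((x$i - a$i) * (b$i - x$i)) > 0 \<longleftrightarrow> a$i < x$i & x$i < b$i" for x :: "real^'n" and i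
 using ab[of i] by (auto simp: flat_exp_def mult_le_0_iff not_le)
have nn: "flat_exp 0 t >= 0" for t by (simp add: flat_exp_def)
let ?F = "%x::real^'n. \<Prod>i\<in>UNIV. flat_exp 0 ((x$i - a$i) * (b$i - x$i))"
have "smooth_on UNIV ?F"
 by (intro smooth_on_prod smooth_onI Ck_on_flat_exp smooth_on_mult smooth_on_diff smooth_on_coord smooth_on_const open_UNIV)
moreover have "?F x >= 0" for x by (intro prod_nonneg nn)
moreover have "?F x > 0 \<longleftrightarrow> x : box a b" for x
proof
 assume "x : box a b"
 then have "flat_exp 0 ((x$i - a$i) * (b$i - x$i)) > 0" for i
 unfolding pos by (simp add: mem_box_cart)
 then show "?F x > 0" by (intro prod_pos) simp
next
 assume Fp: "?F x > 0"
 have "flat_exp 0 ((x$i - a$i) * (b$i - x$i)) ~= 0" for i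
 proof
 assume "flat_exp 0 ((x$i - a$i) * (b$i - x$i)) = 0"
 then have "?F x = 0" by (intro prod_zero) auto
 with Fp show False by simp
 qed
 then have "flat_exp 0 ((x$i - a$i) * (b$i - x$i)) > 0" for i
 using nn[of "(x$i - a$i) * (b$i - x$i)"] by (simp add: order_less_le)
 then show "x : box a b" unfolding pos by (simp add: mem_box_cart)
qed
ultimately show ?thesis by (intro exI[of _ ?F]) simp
qed

lemma integral_box_zero:
fixes h :: "real^'n::finite => real"
assumes h: "locally_integrable_on V h"
 and z: "!!phi. test_fun V phi ==> set_lebesgue_integral lebesgue V (%x. h x * phi x) = 0"
 and V: "cbox a b <= V"
shows "set_lebesgue_integral lebesgue (box a b) h = 0"
proof (cases "box a b = {}")
case False
obtain F :: "real^'n => real" where F: "smooth_on UNIV F" "!!x. F x >= 0" "!!x. F x > 0 \<longleftrightarrow> x : box a b"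
 using ex_test_fun_box[OF False] by blast
\<comment> \<open>These functions lie between 0 and 1, vanish off the box, and converge pointwise to
  its indicator as \<open>n\<close> grows.\<close>
define phi where "phi n x = real n * F x / (1 + real n * F x)" for n x
have F0: "F x = 0" if "x ~: box a b" for x using F(2)[of x] F(3)[of x] that by linarith
have pos: "1 + real n * F x > 0" for n x using F(2)[of x] by (simp add: add_pos_nonneg)
have sub: "box a b <= cbox a b" by (rule box_subset_cbox)
have tf: "test_fun V (phi n)" for n
proof -
 have "smooth_on UNIV (phi n)" unfolding phi_def
 by (intro smooth_on_divide smooth_on_mult smooth_on_add smooth_on_const F(1) open_UNIV)
  (use pos in \<open>simp add: less_imp_neq[symmetric]\<close>)
 then show ?thesis unfolding test_fun_def using F0 V sub by (auto simp: phi_def intro!: exI[of _ "cbox a b"])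
qed
have bd: "0 <= phi n x" "phi n x <= 1" for n x
 using F(2)[of x] pos[of n x] by (auto simp: phi_def divide_le_eq)
have hi: "integrable lebesgue (%x. indicator (cbox a b) x * h x)"
 using h V unfolding locally_integrable_on_def set_integrable_def by simp
then have hm[measurable]: "(%x. indicator (cbox a b) x * h x) : borel_measurable lebesgue" by simp
have lim: "(%n. phi n x) \<longlonglongrightarrow> indicator (box a b) x" for x
proof (cases "x : box a b")
 case True
 then have Fx: "F x > 0" using F(3) by blast
 have "(%n. 1 - inverse (1 + F x * real n)) \<longlonglongrightarrow> 1 - 0"
 by (intro tendsto_diff tendsto_const tendsto_inverse_0_at_top filterlim_tendsto_add_at_top[OF tendsto_const]
  filterlim_tendsto_pos_mult_at_top[OF tendsto_const Fx] filterlim_real_sequentially)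
 moreover have "1 - inverse (1 + F x * real n) = phi n x" for n
 using pos[of n x] by (simp add: phi_def field_simps)
 ultimately show ?thesis using True by simp
qed (simp add: phi_def F0)
have "(%n. \<integral>x. (indicator (cbox a b) x * h x) * phi n x \<partial>lebesgue) \<longlonglongrightarrow> (LINT x|lebesgue. (indicator (cbox a b) x * h x) * indicator (box a b) x)"
proof (rule integral_dominated_convergence[where w="%x. abs (indicator (cbox a b) x * h x)"])
 show "(%x. (indicator (cbox a b) x * h x) * phi n x) : borel_measurable lebesgue" for n
 by (rule borel_measurable_times[OF hm test_fun_measurable_lebesgue[OF tf]])
 show "(%x. (indicator (cbox a b) x * h x) * indicator (box a b) x) : borel_measurable lebesgue"
 by (rule borel_measurable_times[OF hm borel_measurable_indicator]) simp
 show "AE x in lebesgue. (%n. indicator (cbox a b) x * h x * phi n x) \<longlonglongrightarrow> indicator (cbox a b) x * h x * indicator (box a b) x"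
 by (intro AE_I2 tendsto_mult tendsto_const lim)
 show "AE x in lebesgue. norm (indicator (cbox a b) x * h x * phi n x) <= abs (indicator (cbox a b) x * h x)" for n
 using bd by (auto simp: abs_mult intro!: AE_I2 mult_left_le)
qed (use hi in auto)
moreover have "(LINT x|lebesgue. (indicator (cbox a b) x * h x) * phi n x) = 0" for n
proof -
 have eq: "(indicator (cbox a b) x * h x) * phi n x = indicator V x *R (h x * phi n x)" for x
 using F0[of x] V sub by (auto simp: indicator_def phi_def)
 show ?thesis using z[OF tf[of n]] unfolding set_integral_def eq .
qed
moreover have "(LINT x|lebesgue. (indicator (cbox a b) x * h x) * indicator (box a b) x) = set_lebesgue_integral lebesgue (box a b) h"
 unfolding set_integral_def
 by (rule bochner_cong[OF refl]) (use sub in \<open>auto simp: indicator_def\<close>)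
ultimately show ?thesis by (simp add: LIMSEQ_const_iff)
qed (simp add: set_integral_def)

text \<open>Boxes form an intersection-stable generator of the Borel sets, so by Dynkin's argument
  the integral vanishes over every Borel set, and the density is zero almost everywhere.\<close>

lemma AE_zero_if_box_integrals_zero:
fixes g :: "'a::euclidean_space => real"
assumes g: "integrable lborel g" and out: "!!x. x ~: box c d ==> g x = 0"
 and z: "!!a b. box a b <= box c d ==> (LINT x:box a b|lborel. g x) = 0"
shows "AE x in lborel. g x = 0"
proof -
have gm[measurable]: "g : borel_measurable borel" using borel_measurable_integrable[OF g] by simp
have si: "set_integrable lborel A g" if "A : sets borel" for A
 using integrable_mult_indicator[of A lborel g] that g unfolding set_integrable_def by simp
have zb: "(LINT x:box a b|lborel. g x) = 0" for a b
proof -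
 obtain a' b' where ab: "box a b \<inter> box c d = box a' b'" by (rule that[OF box_Int_box])
 have "(LINT x:box a b|lborel. g x) = (LINT x:box a' b'|lborel. g x)"
 unfolding set_integral_def ab[symmetric]
 by (rule bochner_cong[OF refl]) (use out in \<open>auto simp: indicator_def\<close>)
 also have "... = 0" by (rule z) (use ab in blast)
 finally show ?thesis .
qed
have zU: "(LINT x|lborel. g x) = 0"
proof -
 have "(LINT x|lborel. g x) = (LINT x:box c d|lborel. g x)"
 unfolding set_integral_def
 by (rule bochner_cong[OF refl]) (use out in \<open>auto simp: indicator_def\<close>)
 then show ?thesis using zb by simp
qed
have "(LINT x:A|lborel. g x) = 0" if "A : sigma_sets UNIV (range (%(a, b). box a b :: 'a set))" for A
proof -
 have Is: "Int_stable (range (%(a, b). box a b :: 'a set))"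
 proof (rule Int_stableI)
 fix A B assume "A : range (%(a, b). box a b :: 'a set)" "B : range (%(a, b). box a b :: 'a set)"
 then obtain a b c d where "A = box a b" "B = box c d" by auto
 then show "A \<inter> B : range (%(a, b). box a b :: 'a set)" by (auto simp: box_Int_box)
 qed
 show ?thesis
 proof (rule sigma_sets_induct_disjoint[OF Is _ that])
 show "(LINT x:A|lborel. g x) = 0" if "A : range (%(a, b). box a b :: 'a set)" for A using that zb by auto
 next
 fix A assume compl: "A : sigma_sets UNIV (range (%(a, b). box a b :: 'a set))" "(LINT x:A|lborel. g x) = 0"
 have A: "A : sets borel" using compl(1) by (simp add: borel_eq_box)
 have "(LINT x:UNIV - A|lborel. g x) = (LINT x|lborel. g x - indicator A x *R g x)"
 unfolding set_integral_def
 by (rule bochner_cong[OF refl]) (auto simp: indicator_def)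
 also have "... = 0" using si[OF A] g zU compl(2) unfolding set_integrable_def set_integral_def by simp
 finally show "(LINT x:UNIV - A|lborel. g x) = 0" .
next
 fix A :: "nat => 'a set" assume union: "disjoint_family A" "range A <= sigma_sets UNIV (range (%(a, b). box a b :: 'a set))"
 "!!i. (LINT x:A i|lborel. g x) = 0"
 have A: "A i : sets lborel" for i using union(2) by (auto simp: borel_eq_box)
 have d: "A i \<inter> A j = {}" if "i ~= j" for i j using union(1) that by (auto simp: disjoint_family_on_def)
 have "\<Union> (range A) : sets borel" using A by auto
 then have "(LINT x:\<Union> (range A)|lborel. g x) = (\<Sum>i. LINT x:A i|lborel. g x)"
 by (intro lebesgue_integral_countable_add A d si)
 then show "(LINT x:\<Union> (range A)|lborel. g x) = 0" using union(3) by simp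
qed (auto simp: set_integral_def)
qed
then have "(LINT x:A|lborel. g x) = (LINT x:A|lborel. 0)" if "A : sets lborel" for A
 using that by (simp add: borel_eq_box)
then show ?thesis by (intro density_unique_real g) auto
qed

lemma fundamental_lemma:
fixes h :: "real^'n::finite => real"
assumes V: "open V" and h: "locally_integrable_on V h"
 and z: "!!phi. test_fun V phi ==> set_lebesgue_integral lebesgue V (%x. h x * phi x) = 0"
shows "AE x in lebesgue. x : V --> h x = 0"
proof -
have box0: "AE x in lebesgue. x : cbox c d --> h x = 0" if cd: "cbox c d <= V" for c d
proof -
 let ?g = "%x. indicator (box c d) x * h x"
 have sub: "box c d <= cbox c d" by (rule box_subset_cbox)
 have "set_integrable lebesgue (cbox c d) h" using h cd unfolding locally_integrable_on_def by simp
 then have "set_integrable lebesgue (box c d) h" by (rule set_integrable_subset) (use sub in auto)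
 then have gi: "integrable lebesgue ?g" by (simp add: set_integrable_def)
 then have gm: "?g : borel_measurable lebesgue" by (rule borel_measurable_integrable)
 \<comment> \<open>\<open>h\<close> is only Lebesgue measurable; a Borel representative allows the
   argument to run in \<open>lborel\<close>.\<close>
 obtain g' where g'm: "g' : borel_measurable lborel" "AE x in lborel. ?g x = g' x"
 using completion_ex_borel_measurable_real[OF gm] by blast
 define g2 where "g2 x = indicator (box c d) x * g' x" for x
 have g2m: "g2 : borel_measurable lborel" unfolding g2_def using g'm(1) by (intro borel_measurable_times) auto
 have ae: "AE x in lborel. ?g x = g2 x" using g'm(2) by eventually_elim (auto simp: g2_def indicator_def)
 then have ael: "AE x in lebesgue. ?g x = g2 x" by (rule AE_completion)
 have g2ml: "g2 : borel_measurable lebesgue" by (rule measurable_completion[OF g2m])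
 have g2i: "integrable lborel g2"
 using gi integrable_cong_AE[OF gm g2ml ael] integrable_completion[OF g2m] by simp
 have "AE x in lborel. g2 x = 0"
 proof (rule AE_zero_if_box_integrals_zero[OF g2i])
 show "g2 x = 0" if "x ~: box c d" for x using that by (simp add: g2_def)
 fix a b :: "real^'n" assume ab: "box a b <= box c d"
 show "(LINT x:box a b|lborel. g2 x) = 0"
 proof (cases "box a b = {}")
  case False
  have "closure (box a b) <= cbox c d" by (rule closure_minimal) (use ab sub in auto)
  then have "cbox a b <= V" unfolding closure_box[OF False] using cd by simp
  then have "0 = set_lebesgue_integral lebesgue (box a b) h"
  using integral_box_zero[OF h z] by simp
  also have "... = (LINT x|lebesgue. indicator (box a b) x *R ?g x)"
  unfolding set_integral_def
  by (rule bochner_cong[OF refl]) (use ab in \<open>auto simp: indicator_def\<close>)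
  also have "... = (LINT x|lebesgue. indicator (box a b) x *R g2 x)"
  proof (rule integral_cong_AE)
  show "(%x. indicator (box a b) x *R ?g x) : borel_measurable lebesgue"
   by (intro borel_measurable_scaleR[OF _ gm] borel_measurable_indicator) simp
  show "(%x. indicator (box a b) x *R g2 x) : borel_measurable lebesgue"
   by (intro borel_measurable_scaleR[OF _ g2ml] borel_measurable_indicator) simp
  qed (use ael in \<open>eventually_elim; simp\<close>)
  also have "... = (LINT x|lborel. indicator (box a b) x *R g2 x)"
  by (intro integral_completion borel_measurable_scaleR[OF _ g2m]) simp
  finally show ?thesis by (simp add: set_integral_def)
 qed (simp add: set_integral_def)
 qed
 then have 1: "AE x in lebesgue. g2 x = 0" by (rule AE_completion)
 have "negligible (cbox c d - box c d)" by (rule negligible_frontier_interval)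
 then have 2: "AE x in lebesgue. x ~: cbox c d - box c d"
 unfolding negligible_iff_null_sets by (rule AE_not_in)
 show ?thesis using 1 2 ael by eventually_elim (auto simp: indicator_def split: if_splits)
qed
obtain D where D: "countable D" "D <= Pow V" "!!X. X : D ==> EX a b. X = cbox a b" "\<Union>D = V"
 using open_countable_Union_open_cbox[OF V] by blast
have "AE x in lebesgue. ALL X:D. x : X --> h x = 0"
 unfolding AE_ball_countable[OF D(1)]
proof
 fix X assume X: "X : D"
 then obtain a b where "X = cbox a b" using D(3) by blast
 then show "AE x in lebesgue. x : X --> h x = 0" using box0[of a b] D(2) X by auto
qed
then show ?thesis by eventually_elim (use D(4) in blast)
qed

section \<open>Weak derivatives of \<open>C\<^sup>1\<close> functions\<close>

lemma continuous_locally_integrable: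
"continuous_on V h ==> locally_integrable_on V h"
unfolding locally_integrable_on_def
proof (intro allI impI, elim conjE)
fix K assume h: "continuous_on V h" and K: "compact K" "K <= V"
have "integrable lborel (%x. indicator K x *R h x)"
 by (rule borel_integrable_compact[OF K(1) continuous_on_subset[OF h K(2)]])
then show "set_integrable lebesgue K h"
 unfolding set_integrable_def by (subst integrable_completion) auto
qed

lemma locally_integrable_mult_test_fun:
assumes h: "locally_integrable_on V h" and phi: "test_fun V phi"
shows "set_integrable lebesgue V (%x. h x * phi x)"
proof -
obtain K where K: "compact K" "K <= V" "!!x. x ~: K ==> phi x = 0" using test_fun_obtain[OF phi] by metis
obtain C where C: "!!x. abs (phi x) <= C" using test_fun_bounded[OF phi] by blast
have hi: "integrable lebesgue (%x. indicator K x * h x)"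
 using h K unfolding locally_integrable_on_def set_integrable_def by simp
have "integrable lebesgue (%x. (indicator K x * h x) * phi x)"
proof (rule Bochner_Integration.integrable_bound)
 show "integrable lebesgue (%x. C * (indicator K x * h x))" using hi by simp
 show "(%x. (indicator K x * h x) * phi x) : borel_measurable lebesgue"
 by (rule borel_measurable_times[OF borel_measurable_integrable[OF hi] test_fun_measurable_lebesgue[OF phi]])
 show "AE x in lebesgue. norm (indicator K x * h x * phi x) <= norm (C * (indicator K x * h x))"
 proof (rule AE_I2)
 fix x
 have "abs (phi x) <= abs C" using C[of x] by linarith
 then show "norm (indicator K x * h x * phi x) <= norm (C * (indicator K x * h x))"
  using mult_left_mono[of "abs (phi x)" "abs C" "abs (indicator K x * h x)"] by (simp add: abs_mult mult_ac)
 qed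
qed
moreover have "(indicator K x * h x) * phi x = indicator V x *R (h x * phi x)" for x
 using K(2) K(3)[of x] by (auto simp: indicator_def)
ultimately show ?thesis by (simp add: set_integrable_def)
qed

lemma set_integral_lebesgue_lborel:
fixes f :: "'a::euclidean_space => real"
assumes "open V" "continuous_on V f"
shows "set_lebesgue_integral lebesgue V f = set_lebesgue_integral lborel V f"
 "set_integrable lebesgue V f \<longleftrightarrow> set_integrable lborel V f"
using borel_measurable_continuous_on_indicator[OF _ assms(2)] assms(1)
unfolding set_integral_def set_integrable_def
by (auto intro!: integral_completion integrable_completion)

lemma continuous_mult_test_fun:
assumes "open V" "continuous_on V h" "test_fun V phi"
shows "distr_of_fun V h phi = (LINT x:V|lborel. h x * phi x)" "set_integrable lborel V (%x. h x * phi x)"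
using set_integral_lebesgue_lborel[OF assms(1), of "%x. h x * phi x"] assms(2) test_fun_continuous[OF assms(3)]
 locally_integrable_mult_test_fun[OF continuous_locally_integrable[OF assms(2)] assms(3)]
by (auto simp: distr_of_fun_def intro: continuous_intros)

lemma has_weak_pd_C1:
fixes h :: "real^'n::finite => real"
assumes V: "open V" and h: "Ck_on 1 V h"
shows "has_weak_pd V i h (pd i h)"
proof -
have hc: "continuous_on V h" "continuous_on V (pd i h)" using h Ck_on_imp_continuous_on[OF h] by auto
show ?thesis unfolding has_weak_pd_def eq_distr_def distr_pd_def
proof (intro conjI allI impI continuous_locally_integrable hc)
 fix phi assume phi: "test_fun V phi"
 obtain K where K: "compact K" "K <= V" "!!x. x ~: K ==> phi x = 0" using test_fun_obtain[OF phi] by metis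
 have "0 = (LINT x:V|lborel. pd i (%x. h x * phi x) x)"
 proof (rule set_integral_pd_zero[OF V _ K(1,2), symmetric])
 show "Ck_on 1 V (%x. h x * phi x)"
  by (intro Ck_on_mult V h Ck_on_subset[OF smooth_onD[OF test_fun_smooth[OF phi]]]) simp
 qed (use K(3) in auto)
 also have "... = (LINT x:V|lborel. pd i h x * phi x + h x * pd i phi x)"
 by (rule set_lebesgue_integral_cong)
  (use V h test_fun_diffble[OF phi] in \<open>auto simp: pd_mult\<close>)
 also have "... = distr_of_fun V (pd i h) phi + distr_of_fun V h (pd i phi)"
 using continuous_mult_test_fun[OF V hc(2) phi] continuous_mult_test_fun[OF V hc(1) test_fun_pd[OF phi]]
 by (simp add: set_integral_add)
 finally show "- distr_of_fun V h (pd i phi) = distr_of_fun V (pd i h) phi" by simp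
qed
qed

lemma weak_pd_unique:
fixes h :: "real^'n::finite => real"
assumes V: "open V" and w: "has_weak_pd V i h w" "has_weak_pd V i h w'"
shows "AE x in lebesgue. x : V --> w x = w' x"
proof -
have l: "locally_integrable_on V w" "locally_integrable_on V w'" using w by (auto simp: has_weak_pd_def)
have "AE x in lebesgue. x : V --> w x - w' x = 0"
proof (rule fundamental_lemma[OF V])
 show "locally_integrable_on V (%x. w x - w' x)" using l unfolding locally_integrable_on_def by (auto intro: set_integral_diff)
 fix phi assume phi: "test_fun V phi"
 have "set_lebesgue_integral lebesgue V (%x. w x * phi x) = set_lebesgue_integral lebesgue V (%x. w' x * phi x)"
 proof -
 have "distr_pd i (distr_of_fun V h) phi = distr_of_fun V w phi" "distr_pd i (distr_of_fun V h) phi = distr_of_fun V w' phi"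
  using w phi unfolding has_weak_pd_def eq_distr_def by simp_all
 then show ?thesis unfolding distr_of_fun_def by simp
 qed
 then show "set_lebesgue_integral lebesgue V (%x. (w x - w' x) * phi x) = 0"
 using locally_integrable_mult_test_fun[OF l(1) phi] locally_integrable_mult_test_fun[OF l(2) phi]
 by (simp add: left_diff_distrib set_integral_diff)
qed
then show ?thesis by eventually_elim simp
qed

lemma weak_pd_C1:
fixes h :: "real^'n::finite => real"
assumes "open V" "Ck_on 1 V h"
shows "AE x in lebesgue. x : V --> weak_pd V i h x = pd i h x" "has_weak_pd V i h (weak_pd V i h)"
proof -
show "has_weak_pd V i h (weak_pd V i h)"
 unfolding weak_pd_def by (rule someI[of "has_weak_pd V i h", OF has_weak_pd_C1[OF assms]])
then show "AE x in lebesgue. x : V --> weak_pd V i h x = pd i h x"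
 by (rule weak_pd_unique[OF assms(1) _ has_weak_pd_C1[OF assms]])
qed

lemma distr_of_fun_weak_pd_mult:
fixes f :: "real^'n::finite => real"
assumes V: "open V" and f: "Ck_on 1 V f" and phi: "test_fun V phi"
shows "distr_of_fun V (%x. weak_pd V i f x * weak_pd V j f x) phi = (LINT x:V|lborel. pd i f x * pd j f x * phi x)"
proof -
obtain K where K: "compact K" "K <= V" "!!x. x ~: K ==> phi x = 0" using test_fun_obtain[OF phi] by metis
have fc: "continuous_on V (pd i f)" for i using f by simp
have c: "continuous_on V (%x. pd i f x * pd j f x)" by (intro continuous_intros fc)
have wm: "(%x. indicator K x * weak_pd V i f x) : borel_measurable lebesgue" for i
 using weak_pd_C1(2)[OF V f, of i] K unfolding has_weak_pd_def locally_integrable_on_def set_integrable_def by auto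
have phim: "phi : borel_measurable lebesgue"
 by (rule test_fun_measurable_lebesgue[OF phi])
have "distr_of_fun V (%x. weak_pd V i f x * weak_pd V j f x) phi = distr_of_fun V (%x. pd i f x * pd j f x) phi"
 unfolding distr_of_fun_def set_integral_def
proof (rule integral_cong_AE)
 \<comment> \<open>Local integrability yields measurability on compact sets only, so both factors
   are cut off to the support of \<open>phi\<close>.\<close>
 have "indicator V x *R (weak_pd V i f x * weak_pd V j f x * phi x)
 = (indicator K x * weak_pd V i f x) * (indicator K x * weak_pd V j f x) * phi x" for x
 using K(2) K(3)[of x] by (auto simp: indicator_def)
 then show "(%x. indicator V x *R (weak_pd V i f x * weak_pd V j f x * phi x)) : borel_measurable lebesgue"
 by (simp only:) (intro borel_measurable_times wm phim)
 show "(%x. indicator V x *R (pd i f x * pd j f x * phi x)) : borel_measurable lebesgue"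
 using locally_integrable_mult_test_fun[OF continuous_locally_integrable[OF c] phi]
 unfolding set_integrable_def by (rule borel_measurable_integrable)
 show "AE x in lebesgue. indicator V x *R (weak_pd V i f x * weak_pd V j f x * phi x) = indicator V x *R (pd i f x * pd j f x * phi x)"
 using weak_pd_C1(1)[OF V f, of i] weak_pd_C1(1)[OF V f, of j]
 by eventually_elim (auto simp: indicator_def)
qed
then show ?thesis using continuous_mult_test_fun(1)[OF V c phi] by simp
qed

text \<open>For a \<open>C^1\<close> function the chosen weak derivatives are the classical ones
  almost everywhere. Each term carries two distributional derivatives, so their signs
  cancel.\<close>

lemma Det_D2_C1:
fixes f :: "fun2"
assumes V: "open V" and f: "Ck_on 1 V f" and phi: "test_fun V phi"
shows "Det_D2 V f phi = (LINT x:V|lborel. pd 1 f x * pd 2 f x * pd 1 (pd 2 phi) x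
 - (1/2) * (pd 1 f x)^2 * pd 2 (pd 2 phi) x - (1/2) * (pd 2 f x)^2 * pd 1 (pd 1 phi) x)"
proof -
have fc: "continuous_on V (pd i f)" for i using f by simp
have c: "continuous_on V (%x. pd i f x * pd j f x)" for i j by (intro continuous_intros fc)
have t: "test_fun V (pd i (pd j phi))" for i j using test_fun_pd[OF test_fun_pd[OF phi]] .
have i: "set_integrable lborel V (%x. pd i f x * pd j f x * pd k (pd l phi) x)" for i j k l
 by (rule continuous_mult_test_fun(2)[OF V c t])
have "Det_D2 V f phi = (LINT x:V|lborel. pd 1 f x * pd 2 f x * pd 1 (pd 2 phi) x)
 - (1/2) * (LINT x:V|lborel. pd 1 f x * pd 1 f x * pd 2 (pd 2 phi) x) - (1/2) * (LINT x:V|lborel. pd 2 f x * pd 2 f x * pd 1 (pd 1 phi) x)"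
 unfolding Det_D2_def distr_pd_def power2_eq_square by (simp add: distr_of_fun_weak_pd_mult[OF V f t])
also have "... = (LINT x:V|lborel. pd 1 f x * pd 2 f x * pd 1 (pd 2 phi) x
 - (1/2) * (pd 1 f x * pd 1 f x * pd 2 (pd 2 phi) x) - (1/2) * (pd 2 f x * pd 2 f x * pd 1 (pd 1 phi) x))"
 using i by (simp add: set_integral_diff)
finally show ?thesis by (simp add: power2_eq_square mult.assoc)
qed

section \<open>The Gauss equation for smooth maps\<close>

lemma vanishing_set_integrable:
fixes f :: "'a::euclidean_space => real"
assumes "continuous_on W f" "compact K" "K <= W" "!!x. x : W ==> x ~: K ==> f x = 0"
shows "set_integrable lborel W f"
proof -
have "integrable lborel (%x. indicator K x *R f x)"
 by (rule borel_integrable_compact[OF assms(2) continuous_on_subset[OF assms(1) assms(3)]])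
moreover have "(%x. indicator K x *R f x) = (%x. indicator W x *R f x)"
 using assms(3,4) by (force simp: indicator_def)
ultimately show ?thesis unfolding set_integrable_def by simp
qed

text \<open>The coefficient of the two-form \<open>da\<close> wedge \<open>db\<close>; the integral
  identities below are instances of Stokes' theorem in this notation.\<close>

definition jac :: "(fun2) => (fun2) => fun2" where
"jac a b x = pd 1 a x * pd 2 b x - pd 2 a x * pd 1 b x"

lemma smooth_on_jac: "open W ==> smooth_on W a ==> smooth_on W b ==> smooth_on W (jac a b)"
unfolding jac_def[abs_def] by (intro smooth_on_diff smooth_on_mult smooth_on_pd)

text \<open>\<open>da\<close> wedge \<open>db\<close> is the exterior derivative of
  \<open>a db\<close>, and that one-form is compactly supported in \<open>W\<close> because
  \<open>a\<close> is.\<close>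

lemma integral_jac_zero:
assumes W: "open W" and a: "smooth_on W a" and b: "smooth_on W b"
 and K: "compact K" "K <= W" "!!x. x : W ==> x ~: K ==> a x = 0"
shows "(LINT x:W|lborel. jac a b x) = 0" "set_integrable lborel W (jac a b)"
proof -
have oWK: "open (W - K)" using W compact_imp_closed[OF K(1)] by (rule open_Diff)
have z: "pd i a x = 0" if "x : W" "x ~: K" for i x
 using pd_cong_open[OF oWK, of x a "%_. 0" i] that K(3) by auto
show "set_integrable lborel W (jac a b)"
 by (rule vanishing_set_integrable[OF smooth_on_cont[OF smooth_on_jac[OF W a b]] K(1,2)])
 (simp add: jac_def z)
have sm: "smooth_on W (%x. a x * pd i b x)" for i by (intro smooth_on_mult W a smooth_on_pd b)
have 0: "(LINT x:W|lborel. pd j (%x. a x * pd i b x) x) = 0" for i j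
 by (rule set_integral_pd_zero[OF W smooth_onD[OF sm] K(1,2)]) (simp add: K(3))
have int: "set_integrable lborel W (pd j (%x. a x * pd i b x))" for i j
proof (rule vanishing_set_integrable[OF smooth_on_cont[OF smooth_on_pd[OF sm]] K(1,2)])
 fix x assume x: "x : W" "x ~: K"
 show "pd j (%x. a x * pd i b x) x = 0"
 using pd_cong_open[OF oWK, of x "%x. a x * pd i b x" "%_. 0" j] x K(3) by auto
qed
have "(LINT x:W|lborel. jac a b x) = (LINT x:W|lborel. pd 1 (%x. a x * pd 2 b x) x - pd 2 (%x. a x * pd 1 b x) x)"
proof (rule set_lebesgue_integral_cong)
 show "ALL x. x : W --> jac a b x = pd 1 (%x. a x * pd 2 b x) x - pd 2 (%x. a x * pd 1 b x) x"
 proof (intro allI impI)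
 fix x assume x: "x : W"
 have "a differentiable (at x)" "!!i. pd i b differentiable (at x)"
  using smooth_on_diffble[OF a x] smooth_on_diffble[OF smooth_on_pd[OF b] x] by auto
 moreover have "pd 1 (pd 2 b) x = pd 2 (pd 1 b) x" by (rule pd_commute[OF W x smooth_onD[OF b]])
 ultimately show "jac a b x = pd 1 (%x. a x * pd 2 b x) x - pd 2 (%x. a x * pd 1 b x) x"
  by (simp add: pd_mult jac_def)
 qed
qed (use W in simp)
also have "... = 0" using 0 int by (simp add: set_integral_diff)
finally show "(LINT x:W|lborel. jac a b x) = 0" .
qed

lemma pd_divide_const:
fixes f :: "real^'n::finite => real"
assumes "f differentiable (at x)"
shows "pd i (%x. f x / c) x = pd i f x / c"
using pd_cmult[OF assms, where i=i and c="1 / c"] by simp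

lemma vector_2_smooth: "smooth_on W y1 ==> smooth_on W y2 ==> smooth_on W (%x. (vector [y1 x, y2 x] :: real^2) $ a)"
using exhaust_2[of a] by auto

lemma pd_compose_vector_2:
assumes "f differentiable (at (vector [y1 x, y2 x] :: real^2))" "y1 differentiable (at x)" "y2 differentiable (at x)"
shows "pd i (%x. f (vector [y1 x, y2 x] :: real^2)) x =
 pd 1 f (vector [y1 x, y2 x]) * pd i y1 x + pd 2 f (vector [y1 x, y2 x]) * pd i y2 x"
proof -
have "(%x. vector [y1 x, y2 x] :: real^2) differentiable (at x)"
proof (rule differentiable_vecI)
 fix a :: 2
 show "(%x. (vector [y1 x, y2 x] :: real^2) $ a) differentiable (at x)"
 using exhaust_2[of a] assms(2,3) by auto
qed
from pd_compose[where f=f and G="%x. vector [y1 x, y2 x] :: real^2", OF assms(1) this]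
show ?thesis by (simp add: sum_2)
qed

text \<open>The graph setting before passing to the limit: \<open>y1, y2, v\<close> are the components of a smooth map and
\<open>p1, p2\<close> the slopes of its image, that is, \<open>dv = p1 dy1 + p2 dy2\<close>.\<close>

locale smooth_graph =
fixes W K :: "(real^2) set" and y1 y2 v phi p1 p2 J :: "fun2" and S :: "(real^2) set" and Psi
assumes W: "open W" and K: "compact K" "K <= W"
 and sy1: "smooth_on W y1" and sy2: "smooth_on W y2" and sv: "smooth_on W v"
 and phi: "test_fun UNIV phi" and S: "closed S" "!!x. x ~: S ==> phi x = 0"
 and Psi: "!!x. Psi x = vector [y1 x, y2 x]"
 and KS: "!!x. x : W ==> x ~: K ==> Psi x ~: S"
 and J: "!!x. J x = pd 1 y1 x * pd 2 y2 x - pd 2 y1 x * pd 1 y2 x"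
 and J0: "!!x. x : W ==> J x ~= 0"
 and p1: "!!x. p1 x = (pd 1 v x * pd 2 y2 x - pd 2 v x * pd 1 y2 x) / J x"
 and p2: "!!x. p2 x = (pd 1 y1 x * pd 2 v x - pd 2 y1 x * pd 1 v x) / J x"
begin

lemma sJ: "smooth_on W J"
unfolding J[abs_def] by (intro smooth_on_diff smooth_on_mult smooth_on_pd sy1 sy2 W)

lemma sp1: "smooth_on W p1"
unfolding p1[abs_def] by (intro smooth_on_divide smooth_on_diff smooth_on_mult smooth_on_pd sy1 sy2 sv sJ W J0)

lemma sp2: "smooth_on W p2"
unfolding p2[abs_def] by (intro smooth_on_divide smooth_on_diff smooth_on_mult smooth_on_pd sy1 sy2 sv sJ W J0)

lemma sphiPsi: "test_fun UNIV f ==> smooth_on W (%x. f (Psi x))"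
unfolding Psi by (rule smooth_on_compose[OF W _ test_fun_smooth]) (auto intro: vector_2_smooth sy1 sy2)

lemmas test_funs = phi test_fun_pd[OF phi] test_fun_pd[OF test_fun_pd[OF phi]]

lemma phi0: "x : W ==> x ~: K ==> phi (Psi x) = 0" "x : W ==> x ~: K ==> pd i phi (Psi x) = 0"
"x : W ==> x ~: K ==> pd i (pd j phi) (Psi x) = 0"
using KS S(2) pd_zero_outside[OF S] pd_zero_outside[OF S(1) pd_zero_outside[OF S]] by auto

text \<open>Cramer's rule: \<open>p1\<close> and \<open>p2\<close> are defined as the solution of
  these two linear equations.\<close>

lemma slope: "x : W ==> pd i v x = p1 x * pd i y1 x + p2 x * pd i y2 x"
proof -
assume x: "x : W"
let ?N = "(pd 1 v x * pd 2 y2 x - pd 2 v x * pd 1 y2 x) * pd i y1 x + (pd 1 y1 x * pd 2 v x - pd 2 y1 x * pd 1 v x) * pd i y2 x"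
have "J x * pd i v x = ?N" using exhaust_2[of i] by (elim disjE) (simp_all add: J algebra_simps)
then have "?N / J x = pd i v x" using J0[OF x] by (simp add: divide_eq_eq mult.commute[of _ "J x"])
then show ?thesis unfolding p1 p2 by (simp add: add_divide_distrib)
qed

lemma dd: "x : W ==> smooth_on W f ==> f differentiable (at x)"
by (rule smooth_on_diffble)

lemma slope2:
assumes x: "x : W"
shows "pd j (pd i v) x = pd j p1 x * pd i y1 x + p1 x * pd j (pd i y1) x + pd j p2 x * pd i y2 x + p2 x * pd j (pd i y2) x"
proof -
have "pd j (pd i v) x = pd j (%x. p1 x * pd i y1 x + p2 x * pd i y2 x) x"
 by (rule pd_cong_open[OF W x]) (rule slope)
also have "... = pd j (%x. p1 x * pd i y1 x) x + pd j (%x. p2 x * pd i y2 x) x"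
 by (rule pd_add) (intro differentiable_mult dd[OF x] sp1 sp2 smooth_on_pd sy1 sy2)+
also have "... = pd j p1 x * pd i y1 x + p1 x * pd j (pd i y1) x + (pd j p2 x * pd i y2 x + p2 x * pd j (pd i y2) x)"
 by (subst (1 2) pd_mult) (intro dd[OF x] sp1 sp2 smooth_on_pd sy1 sy2 refl)+
finally show ?thesis by simp
qed

text \<open>The exterior derivative of \<open>dv = p1 dy1 + p2 dy2\<close> vanishes, by symmetry of
  the mixed second derivatives.\<close>

lemma slope_closed: "x : W ==> jac p1 y1 x + jac p2 y2 x = 0"
proof -
assume x: "x : W"
have c: "pd 2 (pd 1 f) x = pd 1 (pd 2 f) x" if "smooth_on W f" for f :: "fun2"
 by (rule pd_commute[OF W x smooth_onD[OF that]])
show ?thesis using slope2[OF x, of 1 2] slope2[OF x, of 2 1] c[OF sv] c[OF sy1] c[OF sy2]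
 by (simp add: jac_def algebra_simps)
qed

lemma pd_phiPsi: "x : W ==> test_fun UNIV f ==> pd i (%x. f (Psi x)) x = pd 1 f (Psi x) * pd i y1 x + pd 2 f (Psi x) * pd i y2 x"
unfolding Psi by (rule pd_compose_vector_2) (auto intro: dd sy1 sy2 test_fun_diffble)

text \<open>Where the image is the graph of a function, \<open>jac p1 p2 / J\<close> is its Hessian
  determinant. The left side is then the pulled-back form with all derivatives on the test function,
  the right side the pointwise form. The identity itself is proved without any such graph
  function.\<close>

lemma weak_hessian:
"(LINT x:W|lborel. (p1 x * p2 x * pd 1 (pd 2 phi) (Psi x) - (1/2) * (p1 x)^2 * pd 2 (pd 2 phi) (Psi x)
 - (1/2) * (p2 x)^2 * pd 1 (pd 1 phi) (Psi x)) * J x)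
= (LINT x:W|lborel. phi (Psi x) * jac p1 p2 x)" (is "(LINT x:W|lborel. ?L x) = (LINT x:W|lborel. ?R x)")
proof -
note sm = smooth_on_mult smooth_on_power W sphiPsi sp1 sp2 sy1 sy2 sv test_funs
\<comment> \<open>Paired with the differentials of \<open>p2\<close>, \<open>y1\<close>,
  \<open>y2\<close> and \<open>v\<close> and weighted by 1, -1/2, -1/2 and 1, these give exact
  two-forms whose sum is the difference of the integrands up to a multiple of the closedness
  relation \<open>slope_closed\<close>.\<close>
let ?a1 = "%x. phi (Psi x) * p1 x" and ?a2 = "%x. pd 2 phi (Psi x) * (p1 x * p1 x)"
 and ?a3 = "%x. pd 1 phi (Psi x) * (p2 x * p2 x)" and ?a4 = "%x. pd 1 phi (Psi x) * p2 x"
have sa: "smooth_on W ?a1" "smooth_on W ?a2" "smooth_on W ?a3" "smooth_on W ?a4" by (intro sm)+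
have i1: "(LINT x:W|lborel. jac ?a1 p2 x) = 0" "set_integrable lborel W (jac ?a1 p2)"
 by (rule integral_jac_zero[OF W sa(1) sp2 K]; simp add: phi0)+
have i2: "(LINT x:W|lborel. jac ?a2 y1 x) = 0" "set_integrable lborel W (jac ?a2 y1)"
 by (rule integral_jac_zero[OF W sa(2) sy1 K]; simp add: phi0)+
have i3: "(LINT x:W|lborel. jac ?a3 y2 x) = 0" "set_integrable lborel W (jac ?a3 y2)"
 by (rule integral_jac_zero[OF W sa(3) sy2 K]; simp add: phi0)+
have i4: "(LINT x:W|lborel. jac ?a4 v x) = 0" "set_integrable lborel W (jac ?a4 v)"
 by (rule integral_jac_zero[OF W sa(4) sv K]; simp add: phi0)+
have ci: "set_integrable lborel W f" if "smooth_on W f" "!!x. x : W ==> x ~: K ==> f x = 0" for f :: "fun2"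
 by (rule vanishing_set_integrable[OF smooth_on_cont[OF that(1)] K that(2)])
have iL: "set_integrable lborel W ?L"
proof (rule ci)
 show "smooth_on W ?L" by (intro smooth_on_diff smooth_on_const sm sJ)
qed (simp add: phi0)
have iR: "set_integrable lborel W ?R"
 by (rule ci) (auto simp: phi0 intro!: sm smooth_on_jac)
have "(LINT x:W|lborel. ?R x - ?L x) = (LINT x:W|lborel. jac ?a1 p2 x - (1/2) * jac ?a2 y1 x - (1/2) * jac ?a3 y2 x + jac ?a4 v x)"
proof (rule set_lebesgue_integral_cong)
 show "ALL x. x : W --> ?R x - ?L x = jac ?a1 p2 x - (1/2) * jac ?a2 y1 x - (1/2) * jac ?a3 y2 x + jac ?a4 v x"
 proof (intro allI impI)
 fix x assume x: "x : W"
 note d = dd[OF x sphiPsi[OF phi]] dd[OF x sphiPsi[OF test_fun_pd[OF phi]]] dd[OF x sp1] dd[OF x sp2]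
 have c: "pd 2 (pd 1 phi) = pd 1 (pd 2 phi)" by (rule test_fun_pd_commute[OF phi])
 have v: "pd i v x = p1 x * pd i y1 x + p2 x * pd i y2 x" for i by (rule slope[OF x])
 have a: "pd i ?a1 x = (pd 1 phi (Psi x) * pd i y1 x + pd 2 phi (Psi x) * pd i y2 x) * p1 x + phi (Psi x) * pd i p1 x"
  "pd i ?a2 x = (pd 1 (pd 2 phi) (Psi x) * pd i y1 x + pd 2 (pd 2 phi) (Psi x) * pd i y2 x) * (p1 x * p1 x) + pd 2 phi (Psi x) * (2 * p1 x * pd i p1 x)"
  "pd i ?a3 x = (pd 1 (pd 1 phi) (Psi x) * pd i y1 x + pd 1 (pd 2 phi) (Psi x) * pd i y2 x) * (p2 x * p2 x) + pd 1 phi (Psi x) * (2 * p2 x * pd i p2 x)"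
  "pd i ?a4 x = (pd 1 (pd 1 phi) (Psi x) * pd i y1 x + pd 1 (pd 2 phi) (Psi x) * pd i y2 x) * p2 x + pd 1 phi (Psi x) * pd i p2 x" for i
  using d by (simp_all add: pd_mult differentiable_mult pd_phiPsi[OF x phi] pd_phiPsi[OF x test_fun_pd[OF phi]] c)
 have "?R x - ?L x - (jac ?a1 p2 x - (1/2) * jac ?a2 y1 x - (1/2) * jac ?a3 y2 x + jac ?a4 v x)
  = p1 x * pd 2 phi (Psi x) * (jac p1 y1 x + jac p2 y2 x)"
  unfolding jac_def a v J power2_eq_square by (simp add: algebra_simps)
 then show "?R x - ?L x = jac ?a1 p2 x - (1/2) * jac ?a2 y1 x - (1/2) * jac ?a3 y2 x + jac ?a4 v x"
  using slope_closed[OF x] by simp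
 qed
qed (use W in simp)
also have "... = 0" using i1 i2 i3 i4 by (simp add: set_integral_diff set_integral_add)
finally show ?thesis using iL iR by (simp add: set_integral_diff)
qed

end

text \<open>The Gauss curvature \<open>K\<close> of the metric \<open>E dx\<^sub>1\<^sup>2 + 2 F dx\<^sub>1 dx\<^sub>2 + G dx\<^sub>2\<^sup>2\<close> with determinant \<open>D\<close> satisfies
\<open>K D\<^sup>2 = D (\<partial>\<^sub>2 A - \<partial>\<^sub>1 B) + q\<close>, where \<open>A, B\<close> are linear and \<open>q\<close> is quadratic in the first derivatives.\<close>

definition curvA :: "(fun2) => (fun2) => fun2" where
"curvA E F x = pd 1 F x - (1/2) * pd 2 E x"

definition curvB :: "(fun2) => fun2" where
"curvB G x = (1/2) * pd 1 G x"

definition curvq :: "(fun2) => (fun2) => (fun2) => fun2" where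
"curvq E F G x =
 F x * ((1/2) * pd 1 E x * ((1/2) * pd 2 G x) + (pd 1 F x - (1/2) * pd 2 E x) * (pd 2 F x - (1/2) * pd 1 G x))
 - G x * ((1/2) * pd 1 E x * (pd 2 F x - (1/2) * pd 1 G x)) - E x * ((pd 1 F x - (1/2) * pd 2 E x) * ((1/2) * pd 2 G x))
 + G x * ((1/2) * pd 2 E x * ((1/2) * pd 2 E x)) - 2 * F x * ((1/2) * pd 2 E x * ((1/2) * pd 1 G x))
 + E x * ((1/2) * pd 1 G x * ((1/2) * pd 1 G x))"

text \<open>Two triple products sharing the vectors \<open>a\<close> and \<open>b\<close> multiply
  to a Gram determinant, expanded here. The terms in \<open>Xa\<close>, \<open>Xb\<close>,
  \<open>Za\<close>, \<open>Zb\<close> are the tangential contribution; for second derivatives of a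
  map these are Christoffel symbols of the first kind, and they make up
  \<open>curvq\<close>.\<close>

lemma cross_product_identity:
fixes a1 a2 a3 b1 b2 b3 X1 X2 X3 Z1 Z2 Z3 :: real
defines "n1 \<equiv> a2 * b3 - a3 * b2" and "n2 \<equiv> a3 * b1 - a1 * b3" and "n3 \<equiv> a1 * b2 - a2 * b1"
 and "E \<equiv> a1 * a1 + a2 * a2 + a3 * a3" and "F \<equiv> a1 * b1 + a2 * b2 + a3 * b3" and "G \<equiv> b1 * b1 + b2 * b2 + b3 * b3"
 and "Xa \<equiv> X1 * a1 + X2 * a2 + X3 * a3" and "Xb \<equiv> X1 * b1 + X2 * b2 + X3 * b3"
 and "Za \<equiv> Z1 * a1 + Z2 * a2 + Z3 * a3" and "Zb \<equiv> Z1 * b1 + Z2 * b2 + Z3 * b3"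
shows "(X1 * n1 + X2 * n2 + X3 * n3) * (Z1 * n1 + Z2 * n2 + Z3 * n3)
 = (E * G - F * F) * (X1 * Z1 + X2 * Z2 + X3 * Z3) + F * (Xa * Zb + Xb * Za) - G * (Xa * Za) - E * (Xb * Zb)"
unfolding assms by (simp add: algebra_simps)

context smooth_graph
begin

text \<open>The Theorema Egregium. The cross product of the first derivatives is
  \<open>J * (-p1, -p2, 1)\<close>; the left side is the determinant of the second derivatives
  paired with this unnormalised normal, and the triple product identity expresses it through the
  metric.\<close>

lemma jac_slopes:
fixes E F G
assumes E: "!!x. E x = pd 1 y1 x * pd 1 y1 x + pd 1 y2 x * pd 1 y2 x + pd 1 v x * pd 1 v x"
 and F: "!!x. F x = pd 1 y1 x * pd 2 y1 x + pd 1 y2 x * pd 2 y2 x + pd 1 v x * pd 2 v x"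
 and G: "!!x. G x = pd 2 y1 x * pd 2 y1 x + pd 2 y2 x * pd 2 y2 x + pd 2 v x * pd 2 v x"
 and x: "x : W"
shows "J x ^ 3 * jac p1 p2 x = (E x * G x - F x * F x) * (pd 2 (curvA E F) x - pd 1 (curvB G) x) + curvq E F G x"
proof -
have c: "pd 2 (pd 1 f) z = pd 1 (pd 2 f) z" if "smooth_on W f" "z : W" for f :: "fun2" and z
 by (rule pd_commute[OF W that(2) smooth_onD[OF that(1)]])
note sm1 = smooth_on_pd[OF sy1] smooth_on_pd[OF sy2] smooth_on_pd[OF sv]
note sm2 = smooth_on_pd[OF sm1(1)] smooth_on_pd[OF sm1(2)] smooth_on_pd[OF sm1(3)]
have d1: "pd i y1 differentiable (at z)" "pd i y2 differentiable (at z)" "pd i v differentiable (at z)"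
 "pd j (pd i y1) differentiable (at z)" "pd j (pd i y2) differentiable (at z)" "pd j (pd i v) differentiable (at z)" if "z : W" for i j z
 using that by (auto intro!: dd[OF that] sm1 sm2)
have cc: "pd 2 (pd 1 y1) z = pd 1 (pd 2 y1) z" "pd 2 (pd 1 y2) z = pd 1 (pd 2 y2) z" "pd 2 (pd 1 v) z = pd 1 (pd 2 v) z" if "z : W" for z
 using c[OF _ that] sy1 sy2 sv by auto
have EE: "pd i E z = 2 * (pd i (pd 1 y1) z * pd 1 y1 z + pd i (pd 1 y2) z * pd 1 y2 z + pd i (pd 1 v) z * pd 1 v z)" if "z : W" for i z
 unfolding E[abs_def] using d1[OF that] by (simp add: pd_add pd_mult differentiable_add differentiable_mult algebra_simps)
have GG: "pd i G z = 2 * (pd i (pd 2 y1) z * pd 2 y1 z + pd i (pd 2 y2) z * pd 2 y2 z + pd i (pd 2 v) z * pd 2 v z)" if "z : W" for i z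
 unfolding G[abs_def] using d1[OF that] by (simp add: pd_add pd_mult differentiable_add differentiable_mult algebra_simps)
have FF: "pd i F z = (pd i (pd 1 y1) z * pd 2 y1 z + pd i (pd 1 y2) z * pd 2 y2 z + pd i (pd 1 v) z * pd 2 v z)
 + (pd 1 y1 z * pd i (pd 2 y1) z + pd 1 y2 z * pd i (pd 2 y2) z + pd 1 v z * pd i (pd 2 v) z)" if "z : W" for i z
 unfolding F[abs_def] using d1[OF that] by (simp add: pd_add pd_mult differentiable_add differentiable_mult algebra_simps)
have A: "curvA E F z = pd 1 (pd 1 y1) z * pd 2 y1 z + pd 1 (pd 1 y2) z * pd 2 y2 z + pd 1 (pd 1 v) z * pd 2 v z" if "z : W" for z
 unfolding curvA_def EE[OF that] FF[OF that] cc[OF that] by (simp add: algebra_simps)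
have B: "curvB G z = pd 1 (pd 2 y1) z * pd 2 y1 z + pd 1 (pd 2 y2) z * pd 2 y2 z + pd 1 (pd 2 v) z * pd 2 v z" if "z : W" for z
 unfolding curvB_def GG[OF that] by simp
have A2: "pd 2 (curvA E F) x = (pd 2 (pd 1 (pd 1 y1)) x * pd 2 y1 x + pd 1 (pd 1 y1) x * pd 2 (pd 2 y1) x)
 + (pd 2 (pd 1 (pd 1 y2)) x * pd 2 y2 x + pd 1 (pd 1 y2) x * pd 2 (pd 2 y2) x) + (pd 2 (pd 1 (pd 1 v)) x * pd 2 v x + pd 1 (pd 1 v) x * pd 2 (pd 2 v) x)"
 apply (rule trans[OF pd_cong_open[where f="curvA E F", OF W x]], rule A, assumption)
 using d1[OF x] by (simp add: pd_add pd_mult differentiable_add differentiable_mult)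
have B1: "pd 1 (curvB G) x = (pd 1 (pd 1 (pd 2 y1)) x * pd 2 y1 x + pd 1 (pd 2 y1) x * pd 1 (pd 2 y1) x)
 + (pd 1 (pd 1 (pd 2 y2)) x * pd 2 y2 x + pd 1 (pd 2 y2) x * pd 1 (pd 2 y2) x) + (pd 1 (pd 1 (pd 2 v)) x * pd 2 v x + pd 1 (pd 2 v) x * pd 1 (pd 2 v) x)"
 apply (rule trans[OF pd_cong_open[where f="curvB G", OF W x]], rule B, assumption)
 using d1[OF x] by (simp add: pd_add pd_mult differentiable_add differentiable_mult)
have c3: "pd 2 (pd 1 (pd 1 f)) x = pd 1 (pd 1 (pd 2 f)) x" if "smooth_on W f" for f :: "fun2"
 using c[OF smooth_on_pd[where i=1, OF that] x] pd_cong_open[OF W x c[OF that], where i=1] by simp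
let ?X1 = "pd 1 (pd 1 y1) x" and ?X2 = "pd 1 (pd 1 y2) x" and ?X3 = "pd 1 (pd 1 v) x"
let ?Y1 = "pd 1 (pd 2 y1) x" and ?Y2 = "pd 1 (pd 2 y2) x" and ?Y3 = "pd 1 (pd 2 v) x"
let ?Z1 = "pd 2 (pd 2 y1) x" and ?Z2 = "pd 2 (pd 2 y2) x" and ?Z3 = "pd 2 (pd 2 v) x"
\<comment> \<open>The third derivatives of the map cancel in this difference, which leaves inner
  products of second derivatives.\<close>
have AB: "pd 2 (curvA E F) x - pd 1 (curvB G) x = (?X1 * ?Z1 + ?X2 * ?Z2 + ?X3 * ?Z3) - (?Y1 * ?Y1 + ?Y2 * ?Y2 + ?Y3 * ?Y3)"
 unfolding A2 B1 c3[OF sy1] c3[OF sy2] c3[OF sv] by simp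
let ?n1 = "pd 1 y2 x * pd 2 v x - pd 1 v x * pd 2 y2 x" and ?n2 = "pd 1 v x * pd 2 y1 x - pd 1 y1 x * pd 2 v x"
 and ?n3 = "pd 1 y1 x * pd 2 y2 x - pd 1 y2 x * pd 2 y1 x"
have n: "?n1 = - (J x * p1 x)" "?n2 = - (J x * p2 x)" "?n3 = J x"
proof -
 have "J x * p1 x = pd 1 v x * pd 2 y2 x - pd 2 v x * pd 1 y2 x" "J x * p2 x = pd 1 y1 x * pd 2 v x - pd 2 y1 x * pd 1 v x"
 using J0[OF x] by (simp_all add: p1 p2)
 then show "?n1 = - (J x * p1 x)" "?n2 = - (J x * p2 x)" "?n3 = J x" by (simp_all add: J)
qed
have B11: "?X1 * ?n1 + ?X2 * ?n2 + ?X3 * ?n3 = J x * (pd 1 p1 x * pd 1 y1 x + pd 1 p2 x * pd 1 y2 x)"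
 unfolding n slope2[OF x] by (simp add: algebra_simps)
\<comment> \<open>The mixed entry is written in two ways, one for each order of differentiation;
  using one of each lets the determinant of a product of matrices be recognised.\<close>
have B12: "?Y1 * ?n1 + ?Y2 * ?n2 + ?Y3 * ?n3 = J x * (pd 1 p1 x * pd 2 y1 x + pd 1 p2 x * pd 2 y2 x)"
 unfolding n slope2[OF x] by (simp add: algebra_simps)
have B21: "?Y1 * ?n1 + ?Y2 * ?n2 + ?Y3 * ?n3 = J x * (pd 2 p1 x * pd 1 y1 x + pd 2 p2 x * pd 1 y2 x)"
 unfolding n cc[OF x, symmetric] unfolding slope2[OF x] by (simp add: algebra_simps)
have B22: "?Z1 * ?n1 + ?Z2 * ?n2 + ?Z3 * ?n3 = J x * (pd 2 p1 x * pd 2 y1 x + pd 2 p2 x * pd 2 y2 x)"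
 unfolding n slope2[OF x] by (simp add: algebra_simps)
have "J x ^ 3 * jac p1 p2 x = (?X1 * ?n1 + ?X2 * ?n2 + ?X3 * ?n3) * (?Z1 * ?n1 + ?Z2 * ?n2 + ?Z3 * ?n3)
 - (?Y1 * ?n1 + ?Y2 * ?n2 + ?Y3 * ?n3) * (?Y1 * ?n1 + ?Y2 * ?n2 + ?Y3 * ?n3)"
proof -
 have "J x ^ 3 * jac p1 p2 x = J x * J x * ((pd 1 y1 x * pd 2 y2 x - pd 2 y1 x * pd 1 y2 x) * jac p1 p2 x)"
 unfolding J[symmetric] by (simp add: power3_eq_cube)
 also have "... = J x * (pd 1 p1 x * pd 1 y1 x + pd 1 p2 x * pd 1 y2 x) * (J x * (pd 2 p1 x * pd 2 y1 x + pd 2 p2 x * pd 2 y2 x))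
 - J x * (pd 1 p1 x * pd 2 y1 x + pd 1 p2 x * pd 2 y2 x) * (J x * (pd 2 p1 x * pd 1 y1 x + pd 2 p2 x * pd 1 y2 x))"
 unfolding jac_def by (simp add: algebra_simps)
 also have "... = (?X1 * ?n1 + ?X2 * ?n2 + ?X3 * ?n3) * (?Z1 * ?n1 + ?Z2 * ?n2 + ?Z3 * ?n3)
 - (?Y1 * ?n1 + ?Y2 * ?n2 + ?Y3 * ?n3) * (?Y1 * ?n1 + ?Y2 * ?n2 + ?Y3 * ?n3)"
 by (simp only: B11 B22 flip: B12 B21)
 finally show ?thesis .
qed
also have "... = (E x * G x - F x * F x) * (pd 2 (curvA E F) x - pd 1 (curvB G) x) + curvq E F G x"
 unfolding cross_product_identity AB curvq_def EE[OF x] FF[OF x] GG[OF x] cc[OF x] E[symmetric] F[symmetric] G[symmetric]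
 by (simp add: algebra_simps)
finally show ?thesis .
qed

text \<open>Second derivatives of the metric occur only in the divergence of \<open>curvA\<close>
  and \<open>curvB\<close> and are moved onto \<open>w\<close>. What remains involves first
  derivatives of the metric and of the gradient of the map, quantities that the mollification
  estimates control. The power of \<open>J\<close> from the Theorema Egregium is absorbed into
  \<open>omega\<close>.\<close>

lemma gauss_weak:
fixes E F G omega w
assumes E: "!!x. E x = pd 1 y1 x * pd 1 y1 x + pd 1 y2 x * pd 1 y2 x + pd 1 v x * pd 1 v x"
 and F: "!!x. F x = pd 1 y1 x * pd 2 y1 x + pd 1 y2 x * pd 2 y2 x + pd 1 v x * pd 2 v x"
 and G: "!!x. G x = pd 2 y1 x * pd 2 y1 x + pd 2 y2 x * pd 2 y2 x + pd 2 v x * pd 2 v x"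
 and omega: "!!x. omega x = phi (Psi x) / J x ^ 3" and w: "!!x. w x = omega x * (E x * G x - F x * F x)"
shows "(LINT x:W|lborel. phi (Psi x) * jac p1 p2 x)
 = (LINT x:W|lborel. pd 1 w x * curvB G x - pd 2 w x * curvA E F x + omega x * curvq E F G x)"
 "smooth_on W w" "smooth_on W omega" "!!x. x : W ==> x ~: K ==> w x = 0"
proof -
note sm = smooth_on_mult smooth_on_power smooth_on_add smooth_on_diff smooth_on_const smooth_on_pd W sy1 sy2 sv
have sE: "smooth_on W E" "smooth_on W F" "smooth_on W G"
 unfolding E[abs_def] F[abs_def] G[abs_def] by (intro sm)+
show somega: "smooth_on W omega" unfolding omega[abs_def] by (intro smooth_on_divide sphiPsi phi sm sJ) (simp add: J0)
show sw: "smooth_on W w" unfolding w[abs_def] by (intro sm somega sE)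
have sA: "smooth_on W (curvA E F)" "smooth_on W (curvB G)" "smooth_on W (curvq E F G)"
 unfolding curvA_def[abs_def] curvB_def[abs_def] curvq_def[abs_def] by (intro sm sE)+
have w0: "w x = 0" "omega x = 0" if "x : W" "x ~: K" for x using phi0[OF that] by (simp_all add: w omega)
then show "!!x. x : W ==> x ~: K ==> w x = 0" by blast
have oWK: "open (W - K)" using W compact_imp_closed[OF K(1)] by (rule open_Diff)
have pw0: "pd i w x = 0" if "x : W" "x ~: K" for i x
 using pd_cong_open[OF oWK, of x w "%_. 0" i] that w0 by auto
have ci: "set_integrable lborel W f" if "smooth_on W f" "!!x. x : W ==> x ~: K ==> f x = 0" for f :: "fun2"
 by (rule vanishing_set_integrable[OF smooth_on_cont[OF that(1)] K that(2)])
have swA: "smooth_on W (%x. w x * curvA E F x)" "smooth_on W (%x. w x * curvB G x)" by (intro sm sw sA)+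
have pz: "pd i (%x. w x * f x) x = 0" if "x : W" "x ~: K" for i f x
 using pd_cong_open[OF oWK, of x "%x. w x * f x" "%_. 0" i] that w0 by auto
have z: "(LINT x:W|lborel. pd 2 (%x. w x * curvA E F x) x) = 0" "(LINT x:W|lborel. pd 1 (%x. w x * curvB G x) x) = 0"
 by (rule set_integral_pd_zero[OF W smooth_onD[OF swA(1)] K], simp add: w0,
  rule set_integral_pd_zero[OF W smooth_onD[OF swA(2)] K], simp add: w0)
have i: "set_integrable lborel W (pd 2 (%x. w x * curvA E F x))" "set_integrable lborel W (pd 1 (%x. w x * curvB G x))"
 by (intro ci smooth_on_pd swA pz; assumption)+
have i2: "set_integrable lborel W (%x. pd 1 w x * curvB G x - pd 2 w x * curvA E F x + omega x * curvq E F G x)"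
 by (rule ci) (auto simp: pw0 w0 intro!: sm sw sA somega)
have "(LINT x:W|lborel. phi (Psi x) * jac p1 p2 x) = (LINT x:W|lborel. (pd 1 w x * curvB G x - pd 2 w x * curvA E F x + omega x * curvq E F G x)
 + (pd 2 (%x. w x * curvA E F x) x - pd 1 (%x. w x * curvB G x) x))"
proof (rule set_lebesgue_integral_cong)
 show "ALL x. x : W --> phi (Psi x) * jac p1 p2 x = (pd 1 w x * curvB G x - pd 2 w x * curvA E F x + omega x * curvq E F G x)
 + (pd 2 (%x. w x * curvA E F x) x - pd 1 (%x. w x * curvB G x) x)"
 proof (intro allI impI)
 fix x assume x: "x : W"
 have "phi (Psi x) * jac p1 p2 x = omega x * (J x ^ 3 * jac p1 p2 x)" using J0[OF x] by (simp add: omega)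
 also have "... = w x * (pd 2 (curvA E F) x - pd 1 (curvB G) x) + omega x * curvq E F G x"
  unfolding jac_slopes[OF E F G x] w by (simp add: algebra_simps)
 also have "... = (pd 1 w x * curvB G x - pd 2 w x * curvA E F x + omega x * curvq E F G x)
 + (pd 2 (%x. w x * curvA E F x) x - pd 1 (%x. w x * curvB G x) x)"
  using dd[OF x sw] dd[OF x sA(1)] dd[OF x sA(2)] by (simp add: pd_mult algebra_simps)
 finally show "phi (Psi x) * jac p1 p2 x = ..." .
 qed
qed (use W in simp)
also have "... = (LINT x:W|lborel. pd 1 w x * curvB G x - pd 2 w x * curvA E F x + omega x * curvq E F G x)"
 using i i2 z by (simp add: set_integral_add set_integral_diff)
finally show "(LINT x:W|lborel. phi (Psi x) * jac p1 p2 x)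
 = (LINT x:W|lborel. pd 1 w x * curvB G x - pd 2 w x * curvA E F x + omega x * curvq E F G x)" .
qed

end

section \<open>The Gauss curvature of a smooth metric\<close>

lemma matrix_inv_2x2:
fixes A :: "real^2^2"
assumes "det A ~= 0"
shows "matrix_inv A $ 1 $ 1 = A$2$2 / det A" "matrix_inv A $ 1 $ 2 = - A$1$2 / det A"
 "matrix_inv A $ 2 $ 1 = - A$2$1 / det A" "matrix_inv A $ 2 $ 2 = A$1$1 / det A"
proof -
define B :: "real^2^2" where "B = (\<chi> i j. (if i = j then (if i = 1 then A$2$2 else A$1$1) else - A$i$j) / det A)"
have ne: "(2::2) ~= 1" by simp
have 1: "A ** B = mat 1" "B ** A = mat 1"
 using assms unfolding B_def matrix_matrix_mult_def mat_def vec_eq_iff forall_2 sum_2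
 by (auto simp: ne divide_simps; simp add: det_2 algebra_simps)+
have "matrix_inv A = B"
 unfolding matrix_inv_def
proof (rule some_equality)
 fix C assume C: "A ** C = mat 1 & C ** A = mat 1"
 have "C = (C ** A) ** B" using 1(1) by (simp add: matrix_mul_assoc[symmetric])
 then show "C = B" using C by simp
qed (use 1 in simp)
then show "matrix_inv A $ 1 $ 1 = A$2$2 / det A" "matrix_inv A $ 1 $ 2 = - A$1$2 / det A"
 "matrix_inv A $ 2 $ 1 = - A$2$1 / det A" "matrix_inv A $ 2 $ 2 = A$1$1 / det A"
 by (simp_all add: B_def ne)
qed

lemma smooth_metric_det_pos:
assumes "smooth_metric_on U g" "x : U"
shows "g x $ 2 $ 1 = g x $ 1 $ 2" "det (g x) = g x $ 1 $ 1 * g x $ 2 $ 2 - g x $ 1 $ 2 * g x $ 1 $ 2" "det (g x) > 0"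
proof -
have t: "transpose (g x) = g x" and p: "!!\<xi>. \<xi> ~= 0 ==> \<xi> \<bullet> (g x *v \<xi>) > 0"
 using assms by (auto simp: smooth_metric_on_def)
from t have "transpose (g x) $ 1 $ 2 = g x $ 1 $ 2" by simp
then show s: "g x $ 2 $ 1 = g x $ 1 $ 2" by (simp add: transpose_def)
show d: "det (g x) = g x $ 1 $ 1 * g x $ 2 $ 2 - g x $ 1 $ 2 * g x $ 1 $ 2" by (simp add: det_2 s)
have quad: "0 < a * a * (g x $ 1 $ 1) + 2 * a * b * (g x $ 1 $ 2) + b * b * (g x $ 2 $ 2)" if "a ~= 0 \<or> b ~= 0" for a b
proof -
 have "(vector [a, b] :: real^2) ~= 0" using that by (auto simp: vec_eq_iff forall_2)
 from p[OF this] show ?thesis by (simp add: inner_vec_def matrix_vector_mult_def sum_2 s algebra_simps)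
qed
have 1: "g x $ 1 $ 1 > 0" using quad[of 1 0] by simp
\<comment> \<open>At the vector with entries \<open>- g12\<close> and \<open>g11\<close> the
  quadratic form equals \<open>g11\<close> times the determinant.\<close>
have "0 < (g x $ 1 $ 1) * (g x $ 1 $ 1 * g x $ 2 $ 2 - g x $ 1 $ 2 * g x $ 1 $ 2)"
 using quad[of "- (g x $ 1 $ 2)" "g x $ 1 $ 1"] 1 by (simp add: algebra_simps)
with 1 show "det (g x) > 0" unfolding d by (simp add: zero_less_mult_iff)
qed

text \<open>Connects the definition by Christoffel symbols with the expression in the weak equation.
  The upper index is lowered before differentiating: the product rule is applied to
  \<open>E * christoffel g 1 i j + F * christoffel g 2 i j\<close>, which equals
  \<open>L 1 i j\<close>, so derivatives of the inverse metric never have to be expanded.\<close>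

lemma gauss_curvature_formula:
assumes U: "open U" and g: "smooth_metric_on U g" and x: "x : U"
defines "E \<equiv> %x. g x $ 1 $ 1" and "F \<equiv> %x. g x $ 1 $ 2" and "G \<equiv> %x. g x $ 2 $ 2"
shows "gauss_curvature g x * (det (g x))^2 = det (g x) * (pd 2 (curvA E F) x - pd 1 (curvB G) x) + curvq E F G x"
proof -
define H where "H = (%x. g x $ 2 $ 1)"
have HF: "H z = F z" if "z : U" for z using smooth_metric_det_pos(1)[OF g that] by (simp add: H_def F_def)
have sg: "smooth_on U (%x. g x $ i $ j)" for i j
 using g by (intro smooth_on_vec_nth U) (simp add: smooth_metric_on_def)
then have sm: "smooth_on U E" "smooth_on U F" "smooth_on U G" "smooth_on U H"
 by (simp_all add: E_def F_def G_def H_def)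
have pH: "pd i H z = pd i F z" if "z : U" for i z by (rule pd_cong_open[OF U that HF])
define D where "D z = E z * G z - F z * F z" for z
have D: "D z = det (g z)" "D z > 0" if "z : U" for z
 using smooth_metric_det_pos[OF g that] by (simp_all add: D_def E_def F_def G_def)
have sD: "smooth_on U D" unfolding D_def[abs_def] by (intro smooth_on_diff smooth_on_mult sm U)
have ginv: "matrix_inv (g z) $ 1 $ 1 = G z / D z" "matrix_inv (g z) $ 1 $ 2 = - F z / D z"
 "matrix_inv (g z) $ 2 $ 1 = - F z / D z" "matrix_inv (g z) $ 2 $ 2 = E z / D z" if "z : U" for z
 using matrix_inv_2x2[of "g z"] D[OF that] HF[OF that] by (simp_all add: E_def F_def G_def H_def)
\<comment> \<open>The Christoffel symbols of the first kind, with \<open>k\<close> as the lowered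
  index.\<close>
define L where "L k i j = (%x. (1/2) * (pd i (%y. g y $ j $ k) x + pd j (%y. g y $ i $ k) x - pd k (%y. g y $ i $ j) x))" for k i j
have L: "L 1 1 1 z = (1/2) * pd 1 E z" "L 2 1 1 z = pd 1 F z - (1/2) * pd 2 E z"
 "L 1 1 2 z = (1/2) * pd 2 E z" "L 2 1 2 z = (1/2) * pd 1 G z"
 "L 1 2 2 z = pd 2 F z - (1/2) * pd 1 G z" "L 2 2 2 z = (1/2) * pd 2 G z"
 "L 1 2 1 z = (1/2) * pd 2 E z" "L 2 2 1 z = (1/2) * pd 1 G z" if "z : U" for z
 using pH[OF that] unfolding L_def E_def F_def G_def H_def by (simp_all add: algebra_simps)
have sL: "smooth_on U (L k i j)" for k i j
 unfolding L_def by (intro smooth_on_mult smooth_on_const smooth_on_diff smooth_on_add smooth_on_pd sg U)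
have ch1: "christoffel g 1 i j z = (G z * L 1 i j z - F z * L 2 i j z) / D z"
 and ch2: "christoffel g 2 i j z = (E z * L 2 i j z - F z * L 1 i j z) / D z" if "z : U" for i j z
 unfolding christoffel_def sum_2 ginv[OF that] L_def using D(2)[OF that] by (simp_all add: divide_simps)
have sch: "smooth_on U (christoffel g k i j)" for k i j
proof -
 have "smooth_on U (%z. (G z * L 1 i j z - F z * L 2 i j z) / D z)" "smooth_on U (%z. (E z * L 2 i j z - F z * L 1 i j z) / D z)"
 using D(2) by (intro smooth_on_divide smooth_on_diff smooth_on_mult sm sL sD U; force)+
 note s12 = this
 have "smooth_on U (christoffel g 1 i j)" by (rule smooth_on_cong[OF U _ s12(1)]) (simp add: ch1)
 moreover have "smooth_on U (christoffel g 2 i j)" by (rule smooth_on_cong[OF U _ s12(2)]) (simp add: ch2)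
 ultimately show ?thesis using exhaust_2[of k] by auto
qed
have low: "E z * christoffel g 1 i j z + F z * christoffel g 2 i j z = L 1 i j z" if "z : U" for i j z
 unfolding ch1[OF that] ch2[OF that] using D(2)[OF that] by (simp add: divide_simps) (simp add: D_def algebra_simps)
have dlow: "E x * pd k (christoffel g 1 i j) x + F x * pd k (christoffel g 2 i j) x
 = pd k (L 1 i j) x - pd k E x * christoffel g 1 i j x - pd k F x * christoffel g 2 i j x" for i j k
proof -
 have "pd k (L 1 i j) x = pd k (%z. E z * christoffel g 1 i j z + F z * christoffel g 2 i j z) x"
 by (rule pd_cong_open[OF U x]) (simp add: low)
 also have "... = pd k E x * christoffel g 1 i j x + E x * pd k (christoffel g 1 i j) x + (pd k F x * christoffel g 2 i j x + F x * pd k (christoffel g 2 i j) x)"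
 using smooth_on_diffble[OF sm(1) x] smooth_on_diffble[OF sm(2) x] smooth_on_diffble[OF sch x]
 by (simp add: pd_add pd_mult differentiable_mult)
 finally show ?thesis by simp
qed
have dE: "pd i E differentiable (at x)" "pd i F differentiable (at x)" "pd i G differentiable (at x)" for i
 using smooth_on_diffble[OF smooth_on_pd x] sm by auto
have dL1: "pd 1 (L 1 2 2) x = pd 1 (pd 2 F) x - (1/2) * pd 1 (pd 1 G) x"
 apply (rule trans[OF pd_cong_open[where f="L 1 2 2", OF U x]], rule L(5), assumption)
 using dE by (simp add: pd_diff pd_divide_const)
have dL2: "pd 2 (L 1 1 2) x = (1/2) * pd 2 (pd 2 E) x"
 apply (rule trans[OF pd_cong_open[where f="L 1 1 2", OF U x]], rule L(3), assumption)
 using dE by (simp add: pd_divide_const)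
have dA: "pd 2 (curvA E F) x = pd 2 (pd 1 F) x - (1/2) * pd 2 (pd 2 E) x"
 unfolding curvA_def[abs_def] using dE by (simp add: pd_diff pd_divide_const)
have dB: "pd 1 (curvB G) x = (1/2) * pd 1 (pd 1 G) x"
 unfolding curvB_def[abs_def] using dE by (simp add: pd_divide_const)
have cF: "pd 1 (pd 2 F) x = pd 2 (pd 1 F) x" by (rule pd_commute[OF U x smooth_onD[OF sm(2)]])
let ?c = "%k i j. christoffel g k i j x"
have "gauss_curvature g x * D x = E x * riemann g 1 2 1 2 x + F x * riemann g 2 2 1 2 x"
 using D[OF x] by (simp add: gauss_curvature_def sum_2 E_def F_def)
also have "... = (E x * pd 1 (christoffel g 1 2 2) x + F x * pd 1 (christoffel g 2 2 2) x)
 - (E x * pd 2 (christoffel g 1 1 2) x + F x * pd 2 (christoffel g 2 1 2) x)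
 + (E x * ?c 1 1 1 + F x * ?c 2 1 1) * ?c 1 2 2 + (E x * ?c 1 1 2 + F x * ?c 2 1 2) * ?c 2 2 2
 - (E x * ?c 1 2 1 + F x * ?c 2 2 1) * ?c 1 1 2 - (E x * ?c 1 2 2 + F x * ?c 2 2 2) * ?c 2 1 2"
 unfolding riemann_def sum_2 by (simp add: algebra_simps)
also have "... = pd 2 (curvA E F) x - pd 1 (curvB G) x - (1/2) * pd 1 E x * ?c 1 2 2 - (pd 1 F x - (1/2) * pd 2 E x) * ?c 2 2 2
 + (1/2) * pd 2 E x * ?c 1 1 2 + (1/2) * pd 1 G x * ?c 2 1 2"
 unfolding dlow low[OF x] L[OF x] dL1 dL2 dA dB cF by (simp add: algebra_simps)
finally have KD: "gauss_curvature g x * D x = ..." .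
have cD: "D x * ?c 1 i j = G x * L 1 i j x - F x * L 2 i j x" "D x * ?c 2 i j = E x * L 2 i j x - F x * L 1 i j x" for i j
 unfolding ch1[OF x] ch2[OF x] using D(2)[OF x] by simp_all
have "gauss_curvature g x * (D x)^2 = D x * (pd 2 (curvA E F) x - pd 1 (curvB G) x) - (1/2) * pd 1 E x * (D x * ?c 1 2 2)
 - (pd 1 F x - (1/2) * pd 2 E x) * (D x * ?c 2 2 2) + (1/2) * pd 2 E x * (D x * ?c 1 1 2) + (1/2) * pd 1 G x * (D x * ?c 2 1 2)"
proof -
 have "gauss_curvature g x * (D x)^2 = D x * (gauss_curvature g x * D x)" by (simp add: power2_eq_square)
 then show ?thesis unfolding KD by (simp add: algebra_simps)
qed
also have "... = D x * (pd 2 (curvA E F) x - pd 1 (curvB G) x) + curvq E F G x"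
 unfolding cD L[OF x] curvq_def by (simp add: algebra_simps)
finally show ?thesis using D(1)[OF x] by simp
qed

section \<open>Mollification of a \<open>C\<^sup>1\<close> map\<close>

lemma measure_lborel_cball_2: "e >= 0 ==> measure lborel (cball (x::real^2) e) = pi * e^2"
using content_cball[of e x] by (simp add: unit_ball_vol_2)

lemma set_integral_nonneg:
fixes f :: "'a => real"
shows "(!!x. x : A ==> 0 <= f x) ==> 0 <= (LINT x:A|M. f x)"
unfolding set_integral_def
by (intro Bochner_Integration.integral_nonneg) (auto simp: indicator_def)

text \<open>With \<open>c\<close> the mean of \<open>f\<close>, both inequalities come from
  integrating nonnegative polynomials: \<open>(f - c)^2\<close> for the first and
  \<open>(f - c)^2 * (f + c)\<close> for the second.\<close>

lemma power_mean_integrals: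
fixes f :: "'a => real"
assumes B: "B : sets M" "emeasure M B < \<infinity>" and m: "m = measure M B" "m > 0"
 and f: "set_integrable M B f" "set_integrable M B (%x. (f x)^2)" "set_integrable M B (%x. (f x)^3)"
 and f0: "!!x. x : B ==> f x >= 0"
shows "(LINT x:B|M. f x)^2 <= m * (LINT x:B|M. (f x)^2)"
 "(LINT x:B|M. f x) * (LINT x:B|M. (f x)^2) <= m * (LINT x:B|M. (f x)^3)"
proof -
let ?I1 = "LINT x:B|M. f x" and ?I2 = "LINT x:B|M. (f x)^2" and ?I3 = "LINT x:B|M. (f x)^3"
define c where "c = ?I1 / m"
have c: "?I1 = m * c" "c >= 0"
 using m set_integral_nonneg[of B f M] f0 by (auto simp: c_def)
have k: "set_integrable M B (%x. k)" "(LINT x:B|M. k) = k * m" for k :: real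
 using B m by (auto simp: set_integrable_def set_integral_def)
have "0 <= (LINT x:B|M. (f x)^2 - 2 * c * f x + c^2)"
proof (rule set_integral_nonneg)
 fix x show "0 <= (f x)^2 - 2 * c * f x + c^2"
 using zero_le_power2[of "f x - c"] by (simp add: power2_diff mult_ac)
qed
also have "... = ?I2 - 2 * c * ?I1 + c^2 * m"
 using f k by (simp add: set_integral_add set_integral_diff)
finally have 2: "0 <= ?I2 - m * c^2" using c by (simp add: power2_eq_square mult_ac)
then have "m * (m * c^2) <= m * ?I2" using m by (intro mult_left_mono) auto
then show "?I1^2 <= m * ?I2" using c by (simp add: power2_eq_square mult_ac)
have "0 <= (LINT x:B|M. (f x)^3 - c * (f x)^2 - c^2 * f x + c^3)"
proof (rule set_integral_nonneg)
 fix x assume "x : B"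
 then have "0 <= (f x - c)^2 * (f x + c)" using f0 c by (intro mult_nonneg_nonneg) auto
 then show "0 <= (f x)^3 - c * (f x)^2 - c^2 * f x + c^3"
 by (simp add: power2_eq_square power3_eq_cube algebra_simps)
qed
also have "... = ?I3 - c * ?I2 - c^2 * ?I1 + c^3 * m"
 using f k by (simp add: set_integral_add set_integral_diff)
finally have "c * ?I2 <= ?I3" using c by (simp add: power2_eq_square power3_eq_cube mult_ac)
then have "m * (c * ?I2) <= m * ?I3" using m by (intro mult_left_mono) auto
then show "?I1 * ?I2 <= m * ?I3" using c by (simp add: mult_ac)
qed

lemma eventually_at_right_0I: "(!!e. 0 < e ==> e < d ==> P e) ==> 0 < d ==> eventually P (at_right (0::real))"
using eventually_at_right[of 0 1 P] by (auto simp: eventually_at_right_field)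

lemma compact_bound:
fixes h :: "'a::metric_space => real"
assumes "compact K" "continuous_on K h"
obtains C where "C > 0" "!!x. x : K ==> abs (h x) <= C"
proof -
obtain C where C: "!!y. y : h ` K ==> norm y <= C"
 using compact_imp_bounded[OF compact_continuous_image[OF assms(2,1)]] unfolding bounded_iff by blast
have "abs (h x) <= max C 1" if "x : K" for x using C[OF imageI[OF that]] by simp
then show ?thesis using that[of "max C 1"] by simp
qed

lemma C1_Lipschitz_cball:
fixes h :: "real^'n::finite => real"
assumes h: "Ck_on 1 V h" and V: "cball z s <= V"
obtains L where "L > 0" "!!x y. x : cball z s ==> y : cball z s ==> abs (h x - h y) <= L * dist x y"
proof -
let ?K = "cball z s"
have cont: "continuous_on ?K (pd m h)" for m
 using h by (intro continuous_on_subset[OF _ V]) simp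
have "EX C>0. ALL x:?K. abs (pd m h x) <= C" for m
 by (rule compact_bound[OF compact_cball cont]) blast
then have "ALL m. EX C>0. ALL x:?K. abs (pd m h x) <= C" by (rule allI)
from choice[OF this] obtain C where C: "!!m. C m > 0" "!!m x. x : ?K ==> abs (pd m h x) <= C m" by blast
let ?L = "SU m. C m"
have "norm (h x - h y) <= ?L * norm (x - y)" if "x : ?K" "y : ?K" for x y
proof (rule differentiable_bound[of ?K h "%x h'. SU m. (h'$m) *R pd m h x", OF convex_cball _ _ that])
 fix w assume w: "w : ?K"
 have "h differentiable (at w)" using h subsetD[OF V w] by simp
 then show "(h has_derivative (%h'. SU m. (h'$m) *R pd m h w)) (at w within ?K)"
 by (rule has_derivative_at_withinI[OF has_derivative_pd])
 show "onorm (%h'. SU m. (h'$m) *R pd m h w) <= ?L"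
 proof (rule onorm_le)
 fix v :: "real^'n"
 have "abs (SU m. v$m * pd m h w) <= (SU m. abs (v$m) * abs (pd m h w))"
  using sum_abs[of "%m. v$m * pd m h w"] by (simp add: abs_mult)
 also have "... <= (SU m. norm v * C m)"
  by (intro sum_mono mult_mono component_le_norm_cart C(2)[OF w]) auto
 finally show "norm (SU m. (v$m) *R pd m h w) <= ?L * norm v" by (simp add: sum_distrib_left mult.commute)
 qed
qed
moreover have "?L > 0" by (rule sum_pos) (auto simp: C)
ultimately show ?thesis using that[of ?L] by (simp add: dist_norm)
qed

text \<open>Two radii leave room for mollification: at points of the ball of radius \<open>r\<close>
  and scales up to \<open>r\<close>, a mollifier sees values only on
  \<open>cball x0 (2 * r)\<close>, which lies in \<open>U\<close>.\<close>

locale C1_map =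
fixes U :: "(real^2) set" and x0 :: "real^2" and r :: real and u :: "3 => fun2"
assumes U: "open U" and r: "r > 0" and K2U: "cball x0 (2 * r) <= U" and u: "!!k. Ck_on 1 U (u k)"
begin

abbreviation "K2 \<equiv> cball x0 (2 * r)"
abbreviation "Kr \<equiv> cball x0 r"
abbreviation "W \<equiv> ball x0 r"

text \<open>Makes a function known on \<open>U\<close> globally integrable; at points of
  \<open>Kr\<close> and scales up to \<open>r\<close> the mollifier does not see the cut.\<close>

definition cut :: "(fun2) => fun2" where "cut h y = indicator K2 y * h y"

definition ue :: "real => 3 => fun2" where "ue e k = mconv (moll e) (cut (u k))"

lemma cballK2: "x : Kr ==> e <= r ==> cball x e <= K2"
proof
fix y assume "x : Kr" "e <= r" "y : cball x e"
then show "y : K2" using dist_triangle[of x0 y x] by simp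
qed

lemma KrK2: "Kr <= K2" using r by auto

lemma u_cont: "continuous_on U (u k)" "continuous_on U (pd i (u k))"
using u[of k] Ck_on_imp_continuous_on[OF u] by auto

lemma cut_integrable: "continuous_on U h ==> integrable lborel (cut h)"
using borel_integrable_compact[OF _ continuous_on_subset[OF _ K2U], of h] by (simp add: cut_def[abs_def])

lemma smooth_ue: "e > 0 ==> smooth_on S (ue e k)"
unfolding ue_def by (rule smooth_on_subset[OF smooth_on_mconv[OF test_fun_moll cut_integrable[OF u_cont(1)]]]) auto

text \<open>The map is only \<open>C^1\<close>, so one derivative can be moved from the kernel to
  the map; in a second derivative the other one stays on the kernel.\<close>

lemma pd_ue:
assumes "0 < e" "e <= r" "x : Kr"
shows "pd i (ue e k) x = mconv (moll e) (cut (pd i (u k))) x"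
 "pd j (pd i (ue e k)) x = mconv (pd j (moll e)) (cut (pd i (u k))) x"
proof -
note t = test_fun_moll[OF assms(1), where 'a=2] and ci = cut_integrable[OF u_cont(1)]
have z: "norm x > e ==> moll e x = 0" for x :: "real^2" by (rule moll_zero[OF assms(1)]) simp
have z1: "norm x > e ==> pd j (moll e) x = 0" for x :: "real^2" and j
 using pd_zero_outside[of "cball 0 e" "moll e" x j] z by auto
have sub: "cball x e <= U" "cball x e <= K2" using cballK2[OF assms(3,2)] K2U by auto
show "pd i (ue e k) x = mconv (moll e) (cut (pd i (u k))) x"
 unfolding ue_def pd_mconv[OF t ci] unfolding cut_def[abs_def]
 by (rule mconv_pd_right[OF t z U u sub])
have "pd j (pd i (ue e k)) = mconv (pd i (pd j (moll e))) (cut (u k))"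
 unfolding ue_def pd_mconv[OF t ci] pd_mconv[OF test_fun_pd[OF t] ci] test_fun_pd_commute[OF t, of j i] ..
then show "pd j (pd i (ue e k)) x = mconv (pd j (moll e)) (cut (pd i (u k))) x"
 unfolding cut_def[abs_def] using mconv_pd_right[OF test_fun_pd[OF t] z1 U u sub] by simp
qed

definition C0 :: real where
"C0 = (SOME C. C > 0 & (ALL e>0. ALL x::real^2. abs (moll e x) <= C / e^2 & (ALL i. abs (pd i (moll e) x) <= C / e^3)))"

lemma C0: "C0 > 0" "!!e x. e > 0 ==> abs (moll e (x::real^2)) <= C0 / e^2"
"!!e x i. e > 0 ==> abs (pd i (moll e) (x::real^2)) <= C0 / e^3"
proof -
have "EX C. C > 0 & (ALL e>0. ALL x::real^2. abs (moll e x) <= C / e^2 & (ALL i. abs (pd i (moll e) x) <= C / e^3))"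
 using moll_bounds[where 'n=2] by (simp add: numeral_2_eq_2 numeral_3_eq_3)
from someI_ex[OF this] show "C0 > 0" "!!e x. e > 0 ==> abs (moll e (x::real^2)) <= C0 / e^2"
 "!!e x i. e > 0 ==> abs (pd i (moll e) (x::real^2)) <= C0 / e^3"
 unfolding C0_def[symmetric] by auto
qed

lemma cut_eq: "x : Kr ==> e <= r ==> y : cball x e ==> cut h y = h y"
using cballK2 by (force simp: cut_def)

text \<open>The second bound contains no term in \<open>h x\<close>, because the differentiated
  kernel has mean zero.\<close>

lemma mconv_cut_bounds:
assumes h: "continuous_on U h" and e: "0 < e" "e <= r" and x: "x : Kr"
shows "abs (mconv (moll e) (cut h) x - h x) <= C0 / e^2 * (LINT y:cball x e|lborel. abs (h y - h x))"
 "abs (mconv (pd j (moll e)) (cut h) x) <= C0 / e^3 * (LINT y:cball x e|lborel. abs (h y - h x))"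
proof -
note t = test_fun_moll[OF e(1), where 'a=2] and ci = cut_integrable[OF h]
have z: "norm x > e ==> moll e x = 0" for x :: "real^2" by (rule moll_zero[OF e(1)]) simp
have z1: "norm x > e ==> pd j (moll e) x = 0" for x :: "real^2" and j
 using pd_zero_outside[of "cball 0 e" "moll e" x j] z by auto
have cx: "cut h x = h x" by (rule cut_eq[OF x e(2)]) (use e in simp)
have eq: "(LINT y:cball x e|lborel. abs (cut h y - h x)) = (LINT y:cball x e|lborel. abs (h y - h x))"
 by (rule set_lebesgue_integral_cong) (auto simp: cx cut_eq[OF x e(2)])
show "abs (mconv (moll e) (cut h) x - h x) <= C0 / e^2 * (LINT y:cball x e|lborel. abs (h y - h x))"
 using mconv_diff_bound[where x=x and e=e, OF t C0(2)[OF e(1)] z ci] unfolding eq integral_moll[OF e(1)] cx by simp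
show "abs (mconv (pd j (moll e)) (cut h) x) <= C0 / e^3 * (LINT y:cball x e|lborel. abs (h y - h x))"
 using mconv_diff_bound[where x=x and e=e, OF test_fun_pd[OF t] C0(3)[OF e(1)] z1 ci]
 unfolding eq cx integral_pd_test_fun[OF t] by simp
qed

lemma set_integrable_cball:
fixes h :: "fun2"
assumes "continuous_on U h" "x : Kr" "e <= r" shows "set_integrable lborel (cball x e) h"
using borel_integrable_compact[OF compact_cball continuous_on_subset[OF assms(1) order_trans[OF cballK2[OF assms(2,3)] K2U]]]
by (simp add: set_integrable_def)

text \<open>The constant 4 is a convenient bound for pi in the area of the disc.\<close>

lemma cball_integral_le:
assumes "set_integrable lborel (cball x e) h" "!!y. y : cball x e ==> h y <= c" "e >= 0" "c >= 0"
shows "(LINT y:cball (x::real^2) e|lborel. h y) <= 4 * e^2 * c"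
proof -
have "(LINT y:cball x e|lborel. h y) <= (LINT y:cball x e|lborel. c)"
 by (rule set_integral_mono[OF assms(1) _ assms(2)])
 (use emeasure_lborel_cball_finite[of x e] in \<open>auto simp: set_integrable_def\<close>)
also have "... = c * (pi * e^2)"
 using measure_lborel_cball_2[OF assms(3), of x] by (simp add: set_integral_def)
also have "... <= c * (4 * e^2)" using pi_less_4 assms(4) by (intro mult_left_mono mult_right_mono) auto
finally show ?thesis by (simp add: mult_ac)
qed

lemma unif_cont:
fixes h :: "fun2"
assumes h: "continuous_on U h" and eta: "eta > 0"
shows "EV e. ALL x:Kr. ALL y:cball x e. abs (h y - h x) <= eta"
proof -
have "uniformly_continuous_on K2 h"
 by (rule compact_uniformly_continuous[OF continuous_on_subset[OF h K2U] compact_cball])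
then obtain d where d: "d > 0" "!!x y. x : K2 ==> y : K2 ==> dist y x < d ==> dist (h y) (h x) < eta"
 using eta unfolding uniformly_continuous_on_def by metis
show ?thesis
proof (rule eventually_at_right_0I[of "min d r"])
 fix e assume e: "0 < e" "e < min d r"
 show "ALL x:Kr. ALL y:cball x e. abs (h y - h x) <= eta"
 proof (intro ballI)
 fix x y assume xy: "x : Kr" "y : cball x e"
 then have "x : K2" "y : K2" "dist y x < d" using cballK2[of x e] KrK2 e by (auto simp: dist_commute)
 then show "abs (h y - h x) <= eta" using d(2)[of x y] by (simp add: dist_real_def)
 qed
qed (use d r in simp)
qed

lemma mconv_uniform_limit:
assumes h: "continuous_on U h"
shows "uniform_limit Kr (%e. mconv (moll e) (cut h)) h (at_right 0)"
proof (rule uniform_limitI)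
fix eta :: real assume eta: "eta > 0"
let ?q = "eta / (8 * C0)"
have q: "?q > 0" using eta C0(1) by simp
have "EV e. 0 < e & e < r"
 by (rule eventually_at_right_0I[of r]) (use r in auto)
with unif_cont[OF h q] show "EV e. ALL x:Kr. dist (mconv (moll e) (cut h) x) (h x) < eta"
proof eventually_elim
 case (elim e)
 show ?case
 proof
 fix x assume x: "x : Kr"
 have e: "0 < e" "e <= r" using elim by auto
 have "(LINT y:cball x e|lborel. abs (h y - h x)) <= 4 * e^2 * ?q"
  by (rule cball_integral_le[OF set_integrable_cball[OF _ x e(2)]])
  (use elim x e q in \<open>auto intro!: continuous_intros h\<close>)
 then have "C0 / e^2 * (LINT y:cball x e|lborel. abs (h y - h x)) <= C0 / e^2 * (4 * e^2 * ?q)"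
  using C0(1) e by (intro mult_left_mono) auto
 also have "... = eta / 2" using C0(1) e by (simp add: field_simps)
 finally have "abs (mconv (moll e) (cut h) x - h x) <= eta / 2"
  by (rule order_trans[OF mconv_cut_bounds(1)[OF h e x]])
 then show "dist (mconv (moll e) (cut h) x) (h x) < eta" using eta by (simp add: dist_real_def)
 qed
qed
qed

lemma small: "EV e. 0 < e & e < r"
by (rule eventually_at_right_0I[of r]) (use r in auto)

lemma ue_uniform: "uniform_limit Kr (%e. ue e k) (u k) (at_right 0)"
unfolding ue_def by (rule mconv_uniform_limit[OF u_cont(1)])

lemma pd_ue_uniform: "uniform_limit Kr (%e. pd i (ue e k)) (pd i (u k)) (at_right 0)"
proof (rule iffD1[OF uniform_limit_cong _ ])
show "uniform_limit Kr (%e. mconv (moll e) (cut (pd i (u k)))) (pd i (u k)) (at_right 0)"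
 by (rule mconv_uniform_limit[OF u_cont(2)])
show "EV e. ALL x:Kr. mconv (moll e) (cut (pd i (u k))) x = pd i (ue e k) x"
 using small by eventually_elim (use pd_ue(1) in auto)
qed auto

definition s :: "real^2 => fun2" where
"s x y = (SU k. SU i. abs (pd i (u k) y - pd i (u k) x))"

text \<open>Moments of the oscillation of the gradient over a disc: the first controls second
  derivatives of the mollified map, the second the error in the derivatives of its metric, the third
  is comparable with the Gagliardo energy near the diagonal.\<close>

definition I :: "nat => real => fun2" where
"I m e x = (LINT y:cball x e|lborel. s x y ^ m)"

lemma s_nonneg: "s x y >= 0" unfolding s_def by (intro sum_nonneg) auto

lemma s_ge: "abs (pd i (u k) y - pd i (u k) x) <= s x y"
proof -
have "abs (pd i (u k) y - pd i (u k) x) <= (SU i. abs (pd i (u k) y - pd i (u k) x))"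
 by (rule member_le_sum) auto
also have "... <= s x y" unfolding s_def
 by (rule member_le_sum[of k UNIV "%k. SU i. abs (pd i (u k) y - pd i (u k) x)"]) (auto intro: sum_nonneg)
finally show ?thesis .
qed

lemma s_cont: "continuous_on U (s x)"
unfolding s_def[abs_def] by (intro continuous_intros u_cont)

lemma s_int: "x : Kr ==> e <= r ==> set_integrable lborel (cball x e) (%y. s x y ^ m)"
by (rule set_integrable_cball) (intro continuous_intros s_cont)+

lemma I_nonneg: "I m e x >= 0"
unfolding I_def by (rule set_integral_nonneg) (simp add: s_nonneg)

lemma I_mean:
assumes "x : Kr" "0 < e" "e <= r"
shows "(I 1 e x)^2 <= 4 * e^2 * I 2 e x" "I 1 e x * I 2 e x <= 4 * e^2 * I 3 e x"
proof -
have p: "pi * e^2 <= 4 * e^2" using pi_less_4 by (intro mult_right_mono) auto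
have B: "cball x e : sets lborel" "emeasure lborel (cball x e) < \<infinity>"
 and m: "pi * e^2 = measure lborel (cball x e)" "pi * e^2 > 0"
 using measure_lborel_cball_2[of e x] assms emeasure_lborel_cball_finite[of x e] by auto
note si = s_int[OF assms(1,3), of 1, simplified] s_int[OF assms(1,3), of 2] s_int[OF assms(1,3), of 3]
have 12: "(I 1 e x)^2 <= pi * e^2 * I 2 e x" "I 1 e x * I 2 e x <= pi * e^2 * I 3 e x"
 using power_mean_integrals[OF B m si] s_nonneg by (simp_all add: I_def)
show "(I 1 e x)^2 <= 4 * e^2 * I 2 e x" "I 1 e x * I 2 e x <= 4 * e^2 * I 3 e x"
 using order_trans[OF 12(1) mult_right_mono[OF p I_nonneg]] order_trans[OF 12(2) mult_right_mono[OF p I_nonneg]] by simp_all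
qed

lemma int_le_I:
assumes "x : Kr" "0 < e" "e <= r" "continuous_on U h" "!!y. y : cball x e ==> h y <= s x y ^ m"
shows "(LINT y:cball x e|lborel. h y) <= I m e x"
unfolding I_def by (rule set_integral_mono[OF set_integrable_cball[OF assms(4,1,3)] s_int[OF assms(1,3)] assms(5)])

lemma ue_bounds:
assumes e: "0 < e" "e <= r" and x: "x : Kr"
shows "abs (pd i (ue e k) x - pd i (u k) x) <= C0 / e^2 * I 1 e x"
 "abs (pd j (pd i (ue e k)) x) <= C0 / e^3 * I 1 e x"
proof -
have 1: "(LINT y:cball x e|lborel. abs (pd i (u k) y - pd i (u k) x)) <= I 1 e x"
 by (rule int_le_I[OF x e]) (use s_ge in \<open>auto intro!: continuous_intros u_cont\<close>)
have p: "C0 / e^2 >= 0" "C0 / e^3 >= 0" using C0(1) e by auto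
show "abs (pd i (ue e k) x - pd i (u k) x) <= C0 / e^2 * I 1 e x"
 using order_trans[OF mconv_cut_bounds(1)[OF u_cont(2) e x] mult_left_mono[OF 1 p(1)]] pd_ue(1)[OF e x] by simp
show "abs (pd j (pd i (ue e k)) x) <= C0 / e^3 * I 1 e x"
 using order_trans[OF mconv_cut_bounds(2)[OF u_cont(2) e x] mult_left_mono[OF 1 p(2)]] pd_ue(2)[OF e x] by simp
qed

text \<open>The commutator estimate of Constantin, E and Titi: the derivative of the product of mollifications minus the
mollification of the product is quadratic in the oscillation.\<close>

lemma commutator:
assumes e: "0 < e" "e <= r" and x: "x : Kr"
shows "abs (pd l (pd i (ue e k)) x * pd j (ue e k) x + pd i (ue e k) x * pd l (pd j (ue e k)) x
 - mconv (pd l (moll e)) (cut (%y. pd i (u k) y * pd j (u k) y)) x) <= (8 * C0^2 + C0) / e^3 * I 2 e x"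
proof -
let ?a = "pd i (u k)" and ?b = "pd j (u k)" and ?k = "pd l (moll e)"
note t = test_fun_pd[OF test_fun_moll[OF e(1), where 'a=2], of l]
have ac: "continuous_on U ?a" "continuous_on U ?b" by (intro u_cont)+
let ?h = "%y. (?a y - ?a x) * (?b y - ?b x)"
have hc: "continuous_on U ?h" by (intro continuous_intros ac)
have mi: "integrable lborel (%y. ?k (x - y) * cut h y)" if "continuous_on U h" for h
 by (rule mconv_integrable[OF t cut_integrable[OF that]])
\<comment> \<open>A differentiated mollifier annihilates constants, so the constant term disappears
  when the product of increments is expanded.\<close>
have mk: "mconv ?k (cut (%_. 1)) x = 0"
 using mconv_cut_bounds(2)[OF continuous_on_const e x, of l 1] by (simp add: set_integral_def)
have "mconv ?k (cut ?h) x = (LINT y|lborel. ?k (x - y) * cut (%y. ?a y * ?b y) y - ?a x * (?k (x - y) * cut ?b y)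
 - ?b x * (?k (x - y) * cut ?a y) + ?a x * ?b x * (?k (x - y) * cut (%_. 1) y))"
 unfolding mconv_def by (rule bochner_cong[OF refl]) (simp add: cut_def algebra_simps)
also have "... = mconv ?k (cut (%y. ?a y * ?b y)) x - ?a x * mconv ?k (cut ?b) x - ?b x * mconv ?k (cut ?a) x
 + ?a x * ?b x * mconv ?k (cut (%_. 1)) x"
 unfolding mconv_def using mi[OF continuous_on_mult[OF ac]] mi[OF ac(1)] mi[OF ac(2)] mi[of "%_. 1"] by simp
finally have split: "mconv ?k (cut (%y. ?a y * ?b y)) x = mconv ?k (cut ?h) x + ?a x * mconv ?k (cut ?b) x + ?b x * mconv ?k (cut ?a) x"
 using mk by simp
have p3: "C0 / e^3 >= 0" "C0 / e^2 >= 0" using C0(1) e by auto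
have I0: "I 1 e x >= 0" "I 2 e x >= 0" by (rule I_nonneg)+
have "(LINT y:cball x e|lborel. abs (?h y - ?h x)) <= I 2 e x"
proof (rule int_le_I[OF x e])
 show "continuous_on U (%y. abs (?h y - ?h x))" by (intro continuous_intros hc)
 show "abs (?h y - ?h x) <= s x y ^ 2" for y
 using mult_mono[OF s_ge[of i k y x] s_ge[of j k y x]] s_nonneg[of x y] by (simp add: abs_mult power2_eq_square)
qed
from order_trans[OF mconv_cut_bounds(2)[OF hc e x, of l] mult_left_mono[OF this p3(1)]]
have h: "abs (mconv ?k (cut ?h) x) <= C0 / e^3 * I 2 e x" by simp
have prod: "abs (pd l (pd i' (ue e k)) x) * abs (pd j' (ue e k) x - pd j' (u k) x) <= 4 * C0^2 / e^3 * I 2 e x" for i' j'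
proof -
 have "abs (pd l (pd i' (ue e k)) x) * abs (pd j' (ue e k) x - pd j' (u k) x) <= (C0 / e^3 * I 1 e x) * (C0 / e^2 * I 1 e x)"
 using p3 I0 by (intro mult_mono ue_bounds[OF e x] mult_nonneg_nonneg) auto
 also have "... = C0^2 / e^5 * (I 1 e x)^2" by (simp add: eval_nat_numeral mult_ac)
 also have "... <= C0^2 / e^5 * (4 * e^2 * I 2 e x)" using e by (intro mult_left_mono I_mean(1)[OF x e]) auto
 also have "... = 4 * C0^2 / e^3 * I 2 e x" using e by (simp add: field_simps eval_nat_numeral)
 finally show ?thesis .
qed
have tri: "abs (P + Q - R) <= abs P + abs Q + abs R" for P Q R :: real by linarith
\<comment> \<open>All terms linear in the oscillation cancel. There remain two products of a second
  derivative with a first-order error, of sizes \<open>I 1 / e^3\<close> and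
  \<open>I 1 / e^2\<close>, and the mollified product of increments.\<close>
have E: "pd l (pd i (ue e k)) x * pd j (ue e k) x + pd i (ue e k) x * pd l (pd j (ue e k)) x
 - mconv ?k (cut (%y. ?a y * ?b y)) x
 = pd l (pd i (ue e k)) x * (pd j (ue e k) x - ?b x) + pd l (pd j (ue e k)) x * (pd i (ue e k) x - ?a x) - mconv ?k (cut ?h) x"
 unfolding split pd_ue(2)[OF e x] by (simp add: algebra_simps)
have "abs (pd l (pd i (ue e k)) x * (pd j (ue e k) x - ?b x) + pd l (pd j (ue e k)) x * (pd i (ue e k) x - ?a x) - mconv ?k (cut ?h) x)
 <= 4 * C0^2 / e^3 * I 2 e x + 4 * C0^2 / e^3 * I 2 e x + C0 / e^3 * I 2 e x"
 by (rule order_trans[OF tri add_mono[OF add_mono[OF prod[of i j, folded abs_mult] prod[of j i, folded abs_mult]] h]])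
also have "... = (8 * C0^2 + C0) / e^3 * I 2 e x"
proof -
 have 1: "(8 * C0^2 + C0) / e^3 * I 2 e x = 8 * (C0^2 / e^3 * I 2 e x) + C0 / e^3 * I 2 e x"
 by (simp only: add_divide_distrib distrib_right times_divide_eq_right times_divide_eq_left mult.assoc)
 have 2: "4 * C0^2 / e^3 * I 2 e x = 4 * (C0^2 / e^3 * I 2 e x)"
 by (simp only: times_divide_eq_right times_divide_eq_left mult.assoc)
 show ?thesis unfolding 1 2 by linarith
qed
finally show ?thesis unfolding E .
qed

end

text \<open>The metric induced by the map, assumed to be smooth.\<close>

locale C1_metric_map = C1_map +
fixes g :: "2 => 2 => fun2"
assumes sg: "!!i j. smooth_on U (g i j)"
 and g: "!!i j x. x : U ==> g i j x = (SU k. pd i (u k) x * pd j (u k) x)"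
begin

definition ge :: "real => 2 => 2 => fun2" where
"ge e i j x = (SU k. pd i (ue e k) x * pd j (ue e k) x)"

lemma g_cont: "continuous_on U (g i j)" "continuous_on U (pd l (g i j))"
using smooth_on_cont sg smooth_on_pd by blast+

lemma smooth_ge: "e > 0 ==> open S ==> smooth_on S (ge e i j)"
unfolding ge_def[abs_def] by (intro smooth_on_sum smooth_on_mult smooth_on_pd smooth_ue)

lemma pd_ge: "e > 0 ==> pd l (ge e i j) x = (SU k. pd l (pd i (ue e k)) x * pd j (ue e k) x + pd i (ue e k) x * pd l (pd j (ue e k)) x)"
proof -
assume e: "e > 0"
have d: "pd i (ue e k) differentiable (at x)" for i k
 by (rule smooth_on_diffble[OF smooth_on_pd[OF smooth_ue[OF e, of UNIV]]]) simp
show ?thesis unfolding ge_def[abs_def] using d by (simp add: pd_sum pd_mult differentiable_mult)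
qed

lemma pd_g_Lipschitz: "EX L>=0. ALL x:K2. ALL y:K2. ALL l i j. abs (pd l (g i j) y - pd l (g i j) x) <= L * dist y x"
proof -
have one: "EX L>=0. ALL x:K2. ALL y:K2. abs (f y - f x) <= L * dist y x" if f: "smooth_on U f" for f :: "fun2"
proof -
 obtain L where "L > 0" "!!x y. x : K2 ==> y : K2 ==> abs (f x - f y) <= L * dist x y"
 by (rule C1_Lipschitz_cball[OF smooth_onD[OF f] K2U]) blast
 then show ?thesis by (intro exI[of _ L]) simp
qed
have "EX L>=0. ALL x:K2. ALL y:K2. abs (pd l (g i j) y - pd l (g i j) x) <= L * dist y x" for l i j
 by (rule one[OF smooth_on_pd[OF sg]])
then obtain L where L: "!!l i j. L l i j >= 0" "!!l i j x y. x : K2 ==> y : K2 ==> abs (pd l (g i j) y - pd l (g i j) x) <= L l i j * dist y x"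
 by metis
have m: "L l i j <= (SU l. SU i. SU j. L l i j)" for l i j
proof -
 have "L l i j <= (SU j. L l i j)" by (rule member_le_sum) (auto simp: L)
 also have "... <= (SU i. SU j. L l i j)"
 by (rule member_le_sum[of i UNIV "%i. SU j. L l i j"]) (auto simp: L intro!: sum_nonneg)
 also have "... <= (SU l. SU i. SU j. L l i j)"
 by (rule member_le_sum[of l UNIV "%l. SU i. SU j. L l i j"]) (auto simp: L intro!: sum_nonneg)
 finally show ?thesis .
qed
show ?thesis
 by (intro exI[of _ "SU l. SU i. SU j. L l i j"] conjI ballI allI sum_nonneg L
  order_trans[OF L(2) mult_right_mono[OF m]]) auto
qed

text \<open>The derivative of the mollified metric is inserted between the two. On one side stands
  the commutator, quadratic in the oscillation; on the other the mollification error of the smooth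
  metric, whose derivatives are Lipschitz, which accounts for the term \<open>C * e\<close>.\<close>

lemma pd_ge_bound:
"EX C>0. ALL e x l i j. 0 < e --> e <= r --> x : Kr --> abs (pd l (ge e i j) x - pd l (g i j) x) <= C / e^3 * I 2 e x + C * e"
proof -
obtain L where L: "L >= 0" "!!x y l i j. x : K2 ==> y : K2 ==> abs (pd l (g i j) y - pd l (g i j) x) <= L * dist y x"
 using pd_g_Lipschitz by blast
define C where "C = 3 * (8 * C0^2 + C0) + 4 * C0 * L"
have Cp: "C > 0" using C0(1) L by (auto simp: C_def intro!: add_pos_nonneg)
have "abs (pd l (ge e i j) x - pd l (g i j) x) <= C / e^3 * I 2 e x + C * e" if e: "0 < e" "e <= r" and x: "x : Kr" for e x l i j
proof -
 note t = test_fun_moll[OF e(1), where 'a=2]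
 have z: "norm x > e ==> moll e x = 0" for x :: "real^2" by (rule moll_zero[OF e(1)]) simp
 have sub: "cball x e <= U" "cball x e <= K2" using cballK2[OF x e(2)] K2U by auto
 have "(LINT y:cball x e|lborel. abs (pd l (g i j) y - pd l (g i j) x)) <= 4 * e^2 * (L * e)"
 proof (rule cball_integral_le[OF set_integrable_cball[OF _ x e(2)]])
 fix y assume y: "y : cball x e"
 have "abs (pd l (g i j) y - pd l (g i j) x) <= L * dist y x" using L(2) y sub x KrK2 by blast
 also have "... <= L * e" using y L(1) by (intro mult_left_mono) (auto simp: dist_commute)
 finally show "abs (pd l (g i j) y - pd l (g i j) x) <= L * e" .
 qed (use e L in \<open>auto intro!: continuous_intros g_cont\<close>)
 then have "C0 / e^2 * (LINT y:cball x e|lborel. abs (pd l (g i j) y - pd l (g i j) x)) <= C0 / e^2 * (4 * e^2 * (L * e))"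
 using C0(1) e by (intro mult_left_mono) auto
 also have "... = 4 * C0 * L * e" using e by (simp add: field_simps)
 finally have 1: "abs (mconv (moll e) (cut (pd l (g i j))) x - pd l (g i j) x) <= 4 * C0 * L * e"
 using mconv_cut_bounds(1)[OF g_cont(2) e x] by (rule order_trans[rotated])
 have c1: "continuous_on U (g i j)" "Ck_on 1 U (g i j)" using g_cont smooth_onD[OF sg] by auto
 have 2: "mconv (moll e) (cut (pd l (g i j))) x = mconv (pd l (moll e)) (cut (g i j)) x"
 unfolding cut_def[abs_def] by (rule mconv_pd_right[OF t z U c1(2) sub, symmetric])
 have 3: "mconv (pd l (moll e)) (cut (g i j)) x = (SU k. mconv (pd l (moll e)) (cut (%y. pd i (u k) y * pd j (u k) y)) x)"
 proof -
 have ii: "integrable lborel (%y. pd l (moll e) (x - y) * cut (%y. pd i (u k) y * pd j (u k) y) y)" for k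
  by (intro mconv_integrable[OF test_fun_pd[OF t] cut_integrable] continuous_intros u_cont)
 have "cut (g i j) y = (SU k. cut (%y. pd i (u k) y * pd j (u k) y) y)" for y
  using g[of y i j] K2U by (auto simp: cut_def indicator_def sum_distrib_left)
 then show ?thesis unfolding mconv_def using ii by (simp add: sum_distrib_left bochner_sum)
 qed
 have E: "pd l (ge e i j) x - pd l (g i j) x = (SU k. pd l (pd i (ue e k)) x * pd j (ue e k) x + pd i (ue e k) x * pd l (pd j (ue e k)) x
 - mconv (pd l (moll e)) (cut (%y. pd i (u k) y * pd j (u k) y)) x) + (mconv (moll e) (cut (pd l (g i j))) x - pd l (g i j) x)"
 unfolding pd_ge[OF e(1)] 2 3 by (simp add: sum_subtractf)
 have "abs (pd l (ge e i j) x - pd l (g i j) x) <= (\<Sum>k\<in>(UNIV::3 set). (8 * C0^2 + C0) / e^3 * I 2 e x) + 4 * C0 * L * e"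
 unfolding E by (rule order_trans[OF abs_triangle_ineq add_mono[OF order_trans[OF sum_abs sum_mono[OF commutator[OF e x]]] 1]])
 also have "... = 3 * (8 * C0^2 + C0) * (I 2 e x / e^3) + 4 * C0 * L * e" by simp
 also have "... <= C * (I 2 e x / e^3) + C * e"
 using I_nonneg[of 2 e x] e C0(1) L(1) unfolding C_def by (intro add_mono mult_right_mono) auto
 finally show ?thesis by simp
qed
then show ?thesis using Cp by blast
qed

end

section \<open>The weak Gauss equation in the limit\<close>

lemma bounded_continuous_set_integrable:
fixes f :: "'a::euclidean_space => real"
assumes W: "open W" "bounded W" and f: "continuous_on W f" and b: "!!x. x : W ==> abs (f x) <= C"
shows "set_integrable lborel W f"
unfolding set_integrable_def
proof (rule Bochner_Integration.integrable_bound)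
show "integrable lborel (%x. C * indicator W x :: real)"
 using W emeasure_bounded_finite[OF W(2)] by (intro integrable_mult_right integrable_real_indicator) auto
show "(%x. indicator W x *R f x) : borel_measurable lborel"
 using borel_measurable_continuous_on_indicator[OF _ f] W(1) by simp
show "AE x in lborel. norm (indicator W x *R f x) <= norm (C * indicator W x)"
 using order_trans[OF b abs_ge_self] by (auto simp: indicator_def)
qed

lemma set_integral_abs_le:
fixes f g :: "'a::euclidean_space => real"
assumes "set_integrable M A f" "set_integrable M A g" "!!x. x : A ==> abs (f x) <= g x"
shows "abs (LINT x:A|M. f x) <= (LINT x:A|M. g x)"
unfolding set_integral_def
by (rule integral_abs_bound_integral) (use assms in \<open>auto simp: set_integrable_def indicator_def\<close>)

context C1_metric_map
begin

text \<open>Continuity of the limit on the compact \<open>Kr\<close> is part of the notion: it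
  supplies the bounds, and for nonvanishing limits the lower bounds, that products and quotients
  need.\<close>

definition ul :: "(real => fun2) => (fun2) => bool" where
"ul h hl \<longleftrightarrow> uniform_limit Kr h hl (at_right 0) & continuous_on Kr hl"

lemma ul_bounded: "ul h hl ==> bounded (hl ` Kr)"
unfolding ul_def by (intro compact_imp_bounded compact_continuous_image) auto

lemma ul_bound: "ul h hl ==> EX C. ALL x:Kr. abs (hl x) <= C"
using ul_bounded[of h hl] unfolding bounded_iff by simp

lemma ulD: "ul h hl ==> eta > 0 ==> EV e. ALL x:Kr. dist (h e x) (hl x) < eta"
unfolding ul_def by (erule conjE) (rule uniform_limitD)

lemma ul_mult: "ul f fl ==> ul h hl ==> ul (%e x. f e x * h e x) (%x. fl x * hl x)"
using ul_bounded[of f fl] ul_bounded[of h hl] unfolding ul_def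
by (auto intro!: uniform_lim_mult continuous_intros)

lemma ul_add: "ul f fl ==> ul h hl ==> ul (%e x. f e x + h e x) (%x. fl x + hl x)"
unfolding ul_def by (auto intro!: uniform_limit_add continuous_intros)

lemma ul_diff: "ul f fl ==> ul h hl ==> ul (%e x. f e x - h e x) (%x. fl x - hl x)"
unfolding ul_def by (auto intro!: uniform_limit_minus continuous_intros)

lemma ul_const: "continuous_on Kr h ==> ul (%e. h) h"
unfolding ul_def by (auto intro!: uniform_limitI)

lemma ul_power: "ul f fl ==> ul (%e x. f e x ^ n) (%x. fl x ^ n)"
by (induction n) (use ul_const[of "%_. 1"] in \<open>auto intro: ul_mult\<close>)

lemma ul_inverse:
assumes f: "ul f fl" and n0: "!!x. x : Kr ==> fl x ~= 0"
shows "ul (%e x. inverse (f e x)) (%x. inverse (fl x))"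
 "EX b>0. EV e. ALL x:Kr. b <= abs (f e x)"
proof -
have c: "continuous_on Kr fl" using f by (simp add: ul_def)
have "Kr ~= {}" using r by simp
from continuous_attains_inf[OF compact_cball this continuous_on_rabs[OF c]]
obtain z where z: "z : Kr" "!!x. x : Kr ==> abs (fl z) <= abs (fl x)" by blast
have b: "abs (fl z) > 0" using n0[OF z(1)] by simp
have "uniform_limit Kr (%e x. inverse (f e x)) (inverse \<circ> fl) (at_right 0)"
 by (rule uniform_lim_inverse[of _ _ _ _ "abs (fl z)"]) (use f z(2) b in \<open>auto simp: ul_def\<close>)
then show "ul (%e x. inverse (f e x)) (%x. inverse (fl x))"
 unfolding ul_def using c n0 by (auto simp: o_def intro!: continuous_intros)
have "EV e. ALL x:Kr. dist (f e x) (fl x) < abs (fl z) / 2"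
 by (rule ulD[OF f]) (use b in simp)
then have "EV e. ALL x:Kr. abs (fl z) / 2 <= abs (f e x)"
proof eventually_elim
 case (elim e)
 show ?case
 proof
 fix x assume x: "x : Kr"
 show "abs (fl z) / 2 <= abs (f e x)" using z(2)[OF x] bspec[OF elim x] unfolding dist_real_def by linarith
 qed
qed
then show "EX b>0. EV e. ALL x:Kr. b <= abs (f e x)" using b by (intro exI[of _ "abs (fl z) / 2"]) auto
qed

lemma ul_divide: "ul f fl ==> ul h hl ==> (!!x. x : Kr ==> hl x ~= 0) ==> ul (%e x. f e x / h e x) (%x. fl x / hl x)"
unfolding divide_inverse by (intro ul_mult ul_inverse)

lemma ul_eventually_bounded: "ul h hl ==> EX C>=0. EV e. ALL x:Kr. abs (h e x) <= C"
proof -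
assume h: "ul h hl"
obtain C where "ALL x:Kr. abs (hl x) <= C" using ul_bound[OF h] by blast
then have C: "abs (hl x) <= C" if "x : Kr" for x using that by blast
have "EV e. ALL x:Kr. dist (h e x) (hl x) < 1"
 by (rule ulD[OF h]) simp
then have "EV e. ALL x:Kr. abs (h e x) <= abs C + 1"
proof eventually_elim
 case (elim e)
 show ?case
 proof
 fix x assume x: "x : Kr"
 show "abs (h e x) <= abs C + 1" using C[OF x] bspec[OF elim x] unfolding dist_real_def by linarith
 qed
qed
then show ?thesis by (intro exI[of _ "abs C + 1"]) auto
qed

lemma W_bounded: "open W" "bounded W" "W <= Kr" by auto

text \<open>Continuity of \<open>h e\<close> is demanded for small \<open>e\<close> only, since
  quotients by a mollified Jacobian are under control only there.\<close>

lemma ul_integral: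
assumes h: "ul h hl" and c: "EV e. continuous_on W (h e)"
shows "((%e. LINT x:W|lborel. h e x) \<longlongrightarrow> (LINT x:W|lborel. hl x)) (at_right 0)"
proof (rule tendstoI)
fix eta :: real assume eta: "eta > 0"
define m where "m = measure lborel W"
define q where "q = eta / (2 * (m + 1))"
have m: "m >= 0" by (simp add: m_def)
have q: "q > 0" using eta m by (simp add: q_def)
have hlc: "continuous_on W hl" using h unfolding ul_def by (elim conjE) (rule continuous_on_subset[OF _ W_bounded(3)])
obtain C where "ALL x:Kr. abs (hl x) <= C" using ul_bound[OF h] by blast
then have C: "abs (hl x) <= C" if "x : Kr" for x using that by blast
have hli: "set_integrable lborel W hl"
 by (rule bounded_continuous_set_integrable[OF W_bounded(1,2) hlc C]) auto
have ki: "set_integrable lborel W (%x. q)"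
 by (rule bounded_continuous_set_integrable[OF W_bounded(1,2), where C="abs q"]) auto
have "EV e. ALL x:Kr. dist (h e x) (hl x) < q"
 by (rule ulD[OF h q])
with c show "EV e. dist (LINT x:W|lborel. h e x) (LINT x:W|lborel. hl x) < eta"
proof eventually_elim
 case (elim e)
 have le: "abs (h e x - hl x) <= q" if "x : W" for x
 using elim(2) that W_bounded(3) unfolding dist_real_def by (force intro: less_imp_le)
 have di: "set_integrable lborel W (%x. h e x - hl x)"
 by (rule bounded_continuous_set_integrable[OF W_bounded(1,2) _ le]) (intro continuous_intros elim(1) hlc)
 have hi: "set_integrable lborel W (h e)"
 using set_integral_add(1)[OF di hli] by simp
 have "abs (LINT x:W|lborel. h e x - hl x) <= (LINT x:W|lborel. q)"
 by (rule set_integral_abs_le[OF di ki le])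
 also have "... = m * q" using emeasure_bounded_finite[OF W_bounded(2)] by (simp add: set_integral_def m_def)
 also have "... < eta" using eta m by (simp add: q_def divide_less_eq)
 finally show ?case using hi hli by (simp add: set_integral_diff dist_real_def)
qed
qed

definition T :: "real => fun2" where
"T e x = (SU k. SU i. SU j. abs (pd j (pd i (ue e k)) x))"

definition Gs :: "real => fun2" where
"Gs e x = (SU l. SU i. SU j. abs (pd l (ge e i j) x - pd l (g i j) x))"

lemma T_nonneg: "T e x >= 0" unfolding T_def by (intro sum_nonneg) auto
lemma Gs_nonneg: "Gs e x >= 0" unfolding Gs_def by (intro sum_nonneg) auto

lemma sum3_ge: "abs (f a b c) <= (SU a. SU b. SU c. abs (f a b c))"
for f :: "'a::finite => 'b::finite => 'c::finite => real"
proof -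
have "abs (f a b c) <= (SU c. abs (f a b c))" by (rule member_le_sum) auto
also have "... <= (SU b. SU c. abs (f a b c))"
 by (rule member_le_sum[of b UNIV "%b. SU c. abs (f a b c)"]) (auto intro!: sum_nonneg)
also have "... <= (SU a. SU b. SU c. abs (f a b c))"
 by (rule member_le_sum[of a UNIV "%a. SU b. SU c. abs (f a b c)"]) (auto intro!: sum_nonneg)
finally show ?thesis .
qed

lemma T_ge: "abs (pd j (pd i (ue e k)) x) <= T e x"
unfolding T_def by (rule sum3_ge[of "%k i j. pd j (pd i (ue e k)) x"])

lemma Gs_ge: "abs (pd l (ge e i j) x - pd l (g i j) x) <= Gs e x"
unfolding Gs_def by (rule sum3_ge[of "%l i j. pd l (ge e i j) x - pd l (g i j) x"])

lemma T_cont: "e > 0 ==> continuous_on A (T e)"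
unfolding T_def[abs_def] by (intro continuous_intros smooth_on_cont[OF smooth_on_pd[OF smooth_on_pd[OF smooth_ue]]])

lemma WU: "W <= U" "Kr <= U"
by (rule order_trans[OF ball_subset_cball order_trans[OF KrK2 K2U]], rule order_trans[OF KrK2 K2U])

lemma Gs_cont: "e > 0 ==> continuous_on Kr (Gs e)"
unfolding Gs_def[abs_def]
by (intro continuous_intros continuous_on_subset[OF smooth_on_cont[OF smooth_on_pd[OF smooth_ge[OF _ open_UNIV]]]]
 continuous_on_subset[OF g_cont(2) WU(2)]) auto

lemma Kr_integrable: "continuous_on Kr h ==> set_integrable lborel W (h :: fun2)"
using set_integrable_subset[of lborel Kr h W] borel_integrable_compact[of Kr h] W_bounded by (auto simp: set_integrable_def)

text \<open>Families that converge uniformly and whose derivatives are controlled by the second derivatives of \<open>ue\<close>.\<close>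

definition good :: "(real => fun2) => (fun2) => bool" where
"good h hl \<longleftrightarrow> ul h hl & (EV e. smooth_on W (h e)) \<and>
 (ALL j. EX C>=0. EV e. ALL x:W. abs (pd j (h e) x) <= C * (1 + T e x))"

lemma good_ul: "good h hl ==> ul h hl" by (simp add: good_def)

lemma good_mult:
assumes f: "good f fl" and h: "good h hl"
shows "good (%e x. f e x * h e x) (%x. fl x * hl x)"
unfolding good_def
proof (intro conjI allI)
show "ul (%e x. f e x * h e x) (%x. fl x * hl x)" by (intro ul_mult good_ul f h)
have sf: "EV e. smooth_on W (f e)" and sh: "EV e. smooth_on W (h e)"
 using f h by (auto simp: good_def)
show "EV e. smooth_on W (%x. f e x * h e x)"
 using sf sh by eventually_elim (intro smooth_on_mult open_ball)
fix j
obtain A where A: "A >= 0" "EV e. ALL x:Kr. abs (f e x) <= A" using ul_eventually_bounded[OF good_ul[OF f]] by blast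
obtain B where B: "B >= 0" "EV e. ALL x:Kr. abs (h e x) <= B" using ul_eventually_bounded[OF good_ul[OF h]] by blast
obtain C where C: "C >= 0" "EV e. ALL x:W. abs (pd j (f e) x) <= C * (1 + T e x)" using f by (auto simp: good_def)
obtain D where D: "D >= 0" "EV e. ALL x:W. abs (pd j (h e) x) <= D * (1 + T e x)" using h by (auto simp: good_def)
have "EV e. ALL x:W. abs (pd j (%x. f e x * h e x) x) <= (C * B + A * D) * (1 + T e x)"
 using sf sh A(2) B(2) C(2) D(2)
proof eventually_elim
 case (elim e)
 show ?case
 proof
 fix x assume x: "x : W"
 have xK: "x : Kr" using x by simp
 have "pd j (%x. f e x * h e x) x = pd j (f e) x * h e x + f e x * pd j (h e) x"
  using smooth_on_diffble[OF elim(1) x] smooth_on_diffble[OF elim(2) x] by (rule pd_mult)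
 then have "abs (pd j (%x. f e x * h e x) x) <= abs (pd j (f e) x) * abs (h e x) + abs (f e x) * abs (pd j (h e) x)"
  using abs_triangle_ineq[of "pd j (f e) x * h e x" "f e x * pd j (h e) x"] by (simp add: abs_mult)
 also have "... <= (C * (1 + T e x)) * B + A * (D * (1 + T e x))"
  using bspec[OF elim(3) xK] bspec[OF elim(4) xK] bspec[OF elim(5) x] bspec[OF elim(6) x] A B C D T_nonneg[of e x]
  by (intro add_mono mult_mono mult_nonneg_nonneg) auto
 finally show "abs (pd j (%x. f e x * h e x) x) <= (C * B + A * D) * (1 + T e x)" by (simp add: algebra_simps)
 qed
qed
then show "EX C>=0. EV e. ALL x:W. abs (pd j (%x. f e x * h e x) x) <= C * (1 + T e x)"
 using A B C D by (intro exI[of _ "C * B + A * D"]) auto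
qed

lemma good_add:
assumes f: "good f fl" and h: "good h hl"
shows "good (%e x. f e x + h e x) (%x. fl x + hl x)"
unfolding good_def
proof (intro conjI allI)
show "ul (%e x. f e x + h e x) (%x. fl x + hl x)" by (intro ul_add good_ul f h)
have sf: "EV e. smooth_on W (f e)" and sh: "EV e. smooth_on W (h e)"
 using f h by (auto simp: good_def)
show "EV e. smooth_on W (%x. f e x + h e x)"
 using sf sh by eventually_elim (intro smooth_on_add open_ball)
fix j
obtain C where C: "C >= 0" "EV e. ALL x:W. abs (pd j (f e) x) <= C * (1 + T e x)" using f by (auto simp: good_def)
obtain D where D: "D >= 0" "EV e. ALL x:W. abs (pd j (h e) x) <= D * (1 + T e x)" using h by (auto simp: good_def)
have "EV e. ALL x:W. abs (pd j (%x. f e x + h e x) x) <= (C + D) * (1 + T e x)"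
 using sf sh C(2) D(2)
proof eventually_elim
 case (elim e)
 show ?case
 proof
 fix x assume x: "x : W"
 have "pd j (%x. f e x + h e x) x = pd j (f e) x + pd j (h e) x"
  using smooth_on_diffble[OF elim(1) x] smooth_on_diffble[OF elim(2) x] by (rule pd_add)
 then show "abs (pd j (%x. f e x + h e x) x) <= (C + D) * (1 + T e x)"
  using order_trans[OF abs_triangle_ineq add_mono[OF bspec[OF elim(3) x] bspec[OF elim(4) x]]] by (simp add: distrib_right)
 qed
qed
then show "EX C>=0. EV e. ALL x:W. abs (pd j (%x. f e x + h e x) x) <= C * (1 + T e x)"
 using C D by (intro exI[of _ "C + D"]) auto
qed

lemma good_inverse:
assumes f: "good f fl" and n0: "!!x. x : Kr ==> fl x ~= 0"
shows "good (%e x. inverse (f e x)) (%x. inverse (fl x))"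
unfolding good_def
proof (intro conjI allI)
show "ul (%e x. inverse (f e x)) (%x. inverse (fl x))" by (intro ul_inverse good_ul f n0)
have sf: "EV e. smooth_on W (f e)" using f by (auto simp: good_def)
obtain b where b: "b > 0" "EV e. ALL x:Kr. b <= abs (f e x)" using ul_inverse(2)[OF good_ul[OF f] n0] by blast
have n0e: "f e x ~= 0" if "ALL x:Kr. b <= abs (f e x)" "x : W" for e x
proof -
 have "b <= abs (f e x)" using that by (auto simp: less_imp_le)
 then show ?thesis using b(1) by auto
qed
show "EV e. smooth_on W (%x. inverse (f e x))"
 using sf b(2) by eventually_elim (intro smooth_on_inverse open_ball n0e)
fix j
obtain C where C: "C >= 0" "EV e. ALL x:W. abs (pd j (f e) x) <= C * (1 + T e x)" using f by (auto simp: good_def)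
have "EV e. ALL x:W. abs (pd j (%x. inverse (f e x)) x) <= (C * inverse b * inverse b) * (1 + T e x)"
 using sf b(2) C(2)
proof eventually_elim
 case (elim e)
 show ?case
 proof
 fix x assume x: "x : W"
 have bi: "abs (inverse (f e x)) <= inverse b"
  using elim(2) x b(1) n0e[OF elim(2) x] by (auto simp: abs_inverse intro!: le_imp_inverse_le)
 have "pd j (%x. inverse (f e x)) x = - pd j (f e) x * inverse (f e x) * inverse (f e x)"
  by (rule pd_inverse[OF smooth_on_diffble[OF elim(1) x] n0e[OF elim(2) x]])
 then have "abs (pd j (%x. inverse (f e x)) x) = abs (pd j (f e) x) * abs (inverse (f e x)) * abs (inverse (f e x))" by (simp add: abs_mult)
 also have "... <= (C * (1 + T e x)) * inverse b * inverse b"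
  using bspec[OF elim(3) x] bi b(1) C(1) T_nonneg[of e x] by (intro mult_mono mult_nonneg_nonneg) auto
 finally show "abs (pd j (%x. inverse (f e x)) x) <= (C * inverse b * inverse b) * (1 + T e x)" by (simp add: mult_ac)
 qed
qed
then show "EX C>=0. EV e. ALL x:W. abs (pd j (%x. inverse (f e x)) x) <= C * (1 + T e x)"
 using b(1) C(1) by (intro exI[of _ "C * inverse b * inverse b"]) auto
qed

lemma good_const: "good (%e x. c) (%x. c)"
unfolding good_def using ul_const[of "%x. c"] T_nonneg by (auto intro!: exI[of _ 0])

lemma good_diff: "good f fl ==> good h hl ==> good (%e x. f e x - h e x) (%x. fl x - hl x)"
using good_add[of f fl "%e x. (-1) * h e x" "%x. (-1) * hl x"] good_mult[OF good_const[of "-1"]] by simp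

lemma pd_ue_ul: "ul (%e. pd i (ue e k)) (pd i (u k))"
unfolding ul_def by (intro conjI pd_ue_uniform continuous_on_subset[OF u_cont(2) WU(2)])

lemma good_pd_ue: "good (%e. pd i (ue e k)) (pd i (u k))"
unfolding good_def
proof (intro conjI allI pd_ue_ul)
show "EV e. smooth_on W (pd i (ue e k))"
 using small by eventually_elim (intro smooth_on_pd smooth_ue, simp)
show "EX C>=0. EV e. ALL x:W. abs (pd j (pd i (ue e k)) x) <= C * (1 + T e x)" for j
 by (intro exI[of _ 1] conjI always_eventually allI ballI) (use order_trans[OF T_ge] in auto)
qed

definition Psie :: "real => real^2 => real^2" where "Psie e x = vector [ue e 1 x, ue e 2 x]"
definition Psi :: "real^2 => real^2" where "Psi x = vector [u 1 x, u 2 x]"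

lemma norm_vector_2_diff: "norm (vector [a, b] - vector [c, d] :: real^2) <= abs (a - c) + abs (b - d)"
using norm_le_l1_cart[of "vector [a, b] - vector [c, d] :: real^2"] by (simp add: sum_2)

lemma Psi_cont: "continuous_on U Psi"
proof -
have "Psi = (%x. \<chi> i. if i = 1 then u 1 x else u 2 x)"
 by (auto simp: Psi_def vec_eq_iff forall_2)
then show ?thesis by (simp only:) (rule continuous_on_vec_lambda, rename_tac i, case_tac "i = 1", auto intro: u_cont)
qed

lemma Psie_close: "eta > 0 ==> EV e. ALL x:Kr. norm (Psie e x - Psi x) < eta"
proof -
assume eta: "eta > 0"
have "EV e. ALL x:Kr. dist (ue e k x) (u k x) < eta / 2" for k
 using uniform_limitD[OF ue_uniform, of "eta / 2" k] eta by simp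
from this[of 1] this[of 2] show ?thesis
proof eventually_elim
 case (elim e)
 show ?case
 proof
 fix x assume x: "x : Kr"
 show "norm (Psie e x - Psi x) < eta"
  using norm_vector_2_diff[of "ue e 1 x" "ue e 2 x" "u 1 x" "u 2 x"] bspec[OF elim(1) x] bspec[OF elim(2) x]
  unfolding Psie_def Psi_def dist_real_def by linarith
 qed
qed
qed

text \<open>A test function is globally Lipschitz, so uniform closeness of the mollified projection
  carries over to the composition.\<close>

lemma ul_Psi: "test_fun V phi ==> ul (%e x. phi (Psie e x)) (%x. phi (Psi x))"
unfolding ul_def
proof
assume phi: "test_fun V phi"
obtain L where L: "L >= 0" "!!x y. abs (phi x - phi y) <= L * norm (x - y)" using test_fun_Lipschitz[OF phi] by blast
show "uniform_limit Kr (%e x. phi (Psie e x)) (%x. phi (Psi x)) (at_right 0)"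
proof (rule uniform_limitI)
 fix eta :: real assume eta: "eta > 0"
 have "eta / (L + 1) > 0" using eta L by simp
 from Psie_close[OF this] show "EV e. ALL x:Kr. dist (phi (Psie e x)) (phi (Psi x)) < eta"
 proof eventually_elim
 case (elim e)
 show ?case
 proof
  fix x assume x: "x : Kr"
  have "abs (phi (Psie e x) - phi (Psi x)) <= L * norm (Psie e x - Psi x)" by (rule L)
  also have "... <= (L + 1) * norm (Psie e x - Psi x)" by (intro mult_right_mono) auto
  also have "... < (L + 1) * (eta / (L + 1))" using bspec[OF elim x] L(1) by (intro mult_strict_left_mono) auto
  finally show "dist (phi (Psie e x)) (phi (Psi x)) < eta" using L(1) by (simp add: dist_real_def)
 qed
 qed
qed
show "continuous_on Kr (%x. phi (Psi x))"
 by (rule continuous_on_compose2[OF test_fun_continuous[OF phi, of UNIV] continuous_on_subset[OF Psi_cont WU(2)]]) auto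
qed

lemma good_Psi:
assumes phi: "test_fun V phi"
shows "good (%e x. phi (Psie e x)) (%x. phi (Psi x))"
unfolding good_def
proof (intro conjI allI ul_Psi[OF phi])
show "EV e. smooth_on W (%x. phi (Psie e x))"
 using small
proof eventually_elim
 case (elim e)
 show ?case unfolding Psie_def
 by (rule smooth_on_compose[OF open_ball _ test_fun_smooth[OF phi]]) (use elim in \<open>auto intro: vector_2_smooth smooth_ue\<close>)
qed
fix j
obtain C where C: "!!a. C a >= 0" "!!a x. abs (pd a phi x) <= C a" using test_fun_bounded[OF test_fun_pd[OF phi]] by metis
have "EX B. ALL k. B k >= 0 & (EV e. ALL x:Kr. abs (pd j (ue e k) x) <= B k)"
 using ul_eventually_bounded[OF pd_ue_ul] by (intro choice) blast
then obtain B where B: "!!k. B k >= 0" "!!k. EV e. ALL x:Kr. abs (pd j (ue e k) x) <= B k" by blast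
have "EV e. ALL x:W. abs (pd j (%x. phi (Psie e x)) x) <= (C 1 * B 1 + C 2 * B 2) * (1 + T e x)"
 using small B(2)[of 1] B(2)[of 2]
proof eventually_elim
 case (elim e)
 show ?case
 proof
 fix x assume x: "x : W"
 then have xK: "x : Kr" by simp
 have d: "ue e k differentiable (at x)" for k
  using smooth_on_diffble[OF smooth_ue[of e W k] x] elim(1) by simp
 have "pd j (%x. phi (Psie e x)) x = pd 1 phi (Psie e x) * pd j (ue e 1) x + pd 2 phi (Psie e x) * pd j (ue e 2) x"
  unfolding Psie_def by (rule pd_compose_vector_2[OF test_fun_diffble[OF phi] d d])
 then have "abs (pd j (%x. phi (Psie e x)) x) <= abs (pd 1 phi (Psie e x)) * abs (pd j (ue e 1) x) + abs (pd 2 phi (Psie e x)) * abs (pd j (ue e 2) x)"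
  using abs_triangle_ineq[of "pd 1 phi (Psie e x) * pd j (ue e 1) x" "pd 2 phi (Psie e x) * pd j (ue e 2) x"] by (simp add: abs_mult)
 also have "... <= C 1 * B 1 + C 2 * B 2"
  using bspec[OF elim(2) xK] bspec[OF elim(3) xK] by (intro add_mono mult_mono C) auto
 also have "... <= (C 1 * B 1 + C 2 * B 2) * (1 + T e x)"
  using T_nonneg[of e x] C(1) B(1) by (simp add: distrib_left)
 finally show "abs (pd j (%x. phi (Psie e x)) x) <= (C 1 * B 1 + C 2 * B 2) * (1 + T e x)" .
 qed
qed
then show "EX C>=0. EV e. ALL x:W. abs (pd j (%x. phi (Psie e x)) x) <= C * (1 + T e x)"
 using C(1) B(1) by (intro exI[of _ "C 1 * B 1 + C 2 * B 2"]) auto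
qed

lemma ge_good: "good (%e. ge e i j) (g i j)"
proof -
have 1: "ge e i j = (%x. pd i (ue e 1) x * pd j (ue e 1) x + pd i (ue e 2) x * pd j (ue e 2) x + pd i (ue e 3) x * pd j (ue e 3) x)" for e
 by (simp add: ge_def[abs_def] sum_3)
have "good (%e. ge e i j) (%x. pd i (u 1) x * pd j (u 1) x + pd i (u 2) x * pd j (u 2) x + pd i (u 3) x * pd j (u 3) x)"
 unfolding 1 by (intro good_add good_mult good_pd_ue)
moreover have "g i j x = pd i (u 1) x * pd j (u 1) x + pd i (u 2) x * pd j (u 2) x + pd i (u 3) x * pd j (u 3) x" if "x : Kr" for x
 using g[of x i j] that WU(2) by (auto simp: sum_3)
ultimately show ?thesis unfolding good_def ul_def
 using uniform_limit_cong'[of Kr "%e. ge e i j" "%e. ge e i j" "%x. pd i (u 1) x * pd j (u 1) x + pd i (u 2) x * pd j (u 2) x + pd i (u 3) x * pd j (u 3) x" "g i j" "at_right 0"]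
 continuous_on_subset[OF g_cont(1)[of i j] WU(2)] by auto
qed

text \<open>Closeness of polynomial expressions in the metric and its first derivatives, with an error of size \<open>Gs + Gs\<^sup>2\<close>.\<close>

definition close1 :: "(real => fun2) => (fun2) => bool" where
"close1 h hl \<longleftrightarrow> continuous_on U hl & (EX C>=0. ALL e>0. ALL x:W. abs (h e x - hl x) <= C * Gs e x)"

definition close2 :: "(real => fun2) => (fun2) => bool" where
"close2 h hl \<longleftrightarrow> (EX C>=0. ALL eta>0. EV e. ALL x:W. abs (h e x - hl x) <= C * (Gs e x + (Gs e x)^2) + eta)"

lemma close1_pd: "close1 (%e. pd l (ge e i j)) (pd l (g i j))"
unfolding close1_def using g_cont Gs_ge by (auto intro!: exI[of _ 1])

lemma close1_cmult: "close1 h hl ==> close1 (%e x. c * h e x) (%x. c * hl x)"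
unfolding close1_def
proof (elim conjE exE, intro conjI)
fix C assume c: "continuous_on U hl" and C: "0 <= C" "ALL e>0. ALL x:W. abs (h e x - hl x) <= C * Gs e x"
show "continuous_on U (%x. c * hl x)" by (intro continuous_intros c)
have "abs (c * h e x - c * hl x) <= (abs c * C) * Gs e x" if "e > 0" "x : W" for e x
proof -
 have "abs (h e x - hl x) <= C * Gs e x" using C(2) that by blast
 from mult_left_mono[OF this, of "abs c"] show ?thesis by (simp add: abs_mult[symmetric] right_diff_distrib mult.assoc)
qed
then show "EX C>=0. ALL e>0. ALL x:W. abs (c * h e x - c * hl x) <= C * Gs e x" using C(1) by (intro exI[of _ "abs c * C"]) auto
qed

lemma close1_diff: "close1 f fl ==> close1 h hl ==> close1 (%e x. f e x - h e x) (%x. fl x - hl x)"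
unfolding close1_def
proof (elim conjE exE, intro conjI)
fix C D assume c: "continuous_on U hl" "continuous_on U fl" and D: "0 <= D" "ALL e>0. ALL x:W. abs (h e x - hl x) <= D * Gs e x"
 and C: "0 <= C" "ALL e>0. ALL x:W. abs (f e x - fl x) <= C * Gs e x"
show "continuous_on U (%x. fl x - hl x)" by (intro continuous_intros c)
have "abs (f e x - h e x - (fl x - hl x)) <= (C + D) * Gs e x" if "e > 0" "x : W" for e x
proof -
 have 1: "abs (h e x - hl x) <= D * Gs e x" and 2: "abs (f e x - fl x) <= C * Gs e x" using C(2) D(2) that by blast+
 show ?thesis using 1 2 unfolding distrib_right by linarith
qed
then show "EX C>=0. ALL e>0. ALL x:W. abs (f e x - h e x - (fl x - hl x)) <= C * Gs e x" using C(1) D(1) by (intro exI[of _ "C + D"]) auto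
qed

lemma cont_bound: "continuous_on U hl ==> EX M>=0. ALL x:W. abs (hl x) <= (M::real)"
proof -
assume c: "continuous_on U hl"
have "bounded (hl ` Kr)" by (intro compact_imp_bounded compact_continuous_image continuous_on_subset[OF c WU(2)]) simp
then obtain M where M: "ALL x:Kr. abs (hl x) <= M" unfolding bounded_iff by auto
have "abs (hl x) <= abs M" if "x : W" for x using bspec[OF M subsetD[OF W_bounded(3) that]] by linarith
then show ?thesis by (intro exI[of _ "abs M"]) auto
qed

text \<open>The coefficient \<open>c\<close> converges uniformly but without a rate, which the
  summand \<open>eta\<close> in \<open>close2\<close> absorbs. The product of two first-order errors
  produces the square of \<open>Gs\<close>.\<close>

lemma close2_mult:
assumes c: "ul c cl" and f: "close1 f fl" and h: "close1 h hl"
shows "close2 (%e x. c e x * (f e x * h e x)) (%x. cl x * (fl x * hl x))"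
proof -
obtain A where A: "A >= 0" "!!e x. e > 0 ==> x : W ==> abs (f e x - fl x) <= A * Gs e x" using f by (auto simp: close1_def)
obtain B where B: "B >= 0" "!!e x. e > 0 ==> x : W ==> abs (h e x - hl x) <= B * Gs e x" using h by (auto simp: close1_def)
obtain M where M: "M >= 0" "!!x. x : W ==> abs (fl x) <= M" using f cont_bound[of fl] by (auto simp: close1_def)
obtain N where N: "N >= 0" "!!x. x : W ==> abs (hl x) <= N" using h cont_bound[of hl] by (auto simp: close1_def)
obtain D where D: "D >= 0" "EV e. ALL x:Kr. abs (c e x) <= D" using ul_eventually_bounded[OF c] by blast
define P where "P = A * B + A * N + M * B"
have P: "P >= 0" using A B M N by (simp add: P_def)
have ab: "abs (f e x * h e x - fl x * hl x) <= P * (Gs e x + (Gs e x)^2)" if e: "e > 0" "x : W" for e x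
proof -
 let ?G = "Gs e x"
 have G: "?G >= 0" by (rule Gs_nonneg)
 have "f e x * h e x - fl x * hl x = (f e x - fl x) * (h e x - hl x) + (f e x - fl x) * hl x + fl x * (h e x - hl x)"
 by (simp add: algebra_simps)
 then have "abs (f e x * h e x - fl x * hl x) <= abs (f e x - fl x) * abs (h e x - hl x) + abs (f e x - fl x) * abs (hl x) + abs (fl x) * abs (h e x - hl x)"
 unfolding abs_mult[symmetric] by linarith
 also have "... <= (A * ?G) * (B * ?G) + (A * ?G) * N + M * (B * ?G)"
 using A B M N e G by (intro add_mono mult_mono mult_nonneg_nonneg) auto
 also have "... <= P * (?G + ?G^2)"
 using A(1) B(1) M(1) N(1) G by (simp add: P_def power2_eq_square algebra_simps)
 finally show ?thesis .
qed
show ?thesis unfolding close2_def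
proof (intro exI[of _ "D * P"] conjI allI impI)
 show "D * P >= 0" using D P by simp
 fix eta :: real assume eta: "eta > 0"
 have q: "eta / (M * N + 1) > 0" using eta M N by (auto intro!: divide_pos_pos add_nonneg_pos)
 have "EV e. ALL x:Kr. dist (c e x) (cl x) < eta / (M * N + 1)"
 by (rule ulD[OF c q])
 with small D(2) show "EV e. ALL x:W. abs (c e x * (f e x * h e x) - cl x * (fl x * hl x)) <= D * P * (Gs e x + (Gs e x)^2) + eta"
 proof eventually_elim
 case (elim e)
 show ?case
 proof
  fix x assume x: "x : W"
  then have xK: "x : Kr" by simp
  have "c e x * (f e x * h e x) - cl x * (fl x * hl x) = c e x * (f e x * h e x - fl x * hl x) + (c e x - cl x) * (fl x * hl x)"
  by (simp add: algebra_simps)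
  then have "abs (c e x * (f e x * h e x) - cl x * (fl x * hl x)) <= abs (c e x) * abs (f e x * h e x - fl x * hl x) + abs (c e x - cl x) * (abs (fl x) * abs (hl x))"
  unfolding abs_mult[symmetric] by linarith
  also have "... <= D * (P * (Gs e x + (Gs e x)^2)) + eta / (M * N + 1) * (M * N)"
  using bspec[OF elim(2) xK] bspec[OF elim(3) xK] ab[of e x] elim(1) x D(1) M N q
  by (intro add_mono mult_mono mult_nonneg_nonneg) (auto simp: dist_real_def)
  also have "eta / (M * N + 1) * (M * N) <= eta"
  proof -
  have "M * N >= 0" using M N by simp
  then show ?thesis using eta by (simp add: divide_le_eq)
  qed
  finally show "abs (c e x * (f e x * h e x) - cl x * (fl x * hl x)) <= D * P * (Gs e x + (Gs e x)^2) + eta" by (simp add: mult.assoc)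
 qed
 qed
qed
qed

lemma close2_add:
assumes f: "close2 f fl" and h: "close2 h hl"
shows "close2 (%e x. f e x + h e x) (%x. fl x + hl x)" "close2 (%e x. f e x - h e x) (%x. fl x - hl x)"
proof -
obtain A where A: "A >= 0" "!!eta. eta > 0 ==> EV e. ALL x:W. abs (f e x - fl x) <= A * (Gs e x + (Gs e x)^2) + eta"
 using f by (auto simp: close2_def)
obtain B where B: "B >= 0" "!!eta. eta > 0 ==> EV e. ALL x:W. abs (h e x - hl x) <= B * (Gs e x + (Gs e x)^2) + eta"
 using h by (auto simp: close2_def)
have *: "EV e. ALL x:W. abs (f e x - fl x) + abs (h e x - hl x) <= (A + B) * (Gs e x + (Gs e x)^2) + eta" if "eta > 0" for eta
 using A(2)[OF half_gt_zero[OF that]] B(2)[OF half_gt_zero[OF that]]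
proof eventually_elim
 case (elim e)
 show ?case
 proof
 fix x assume x: "x : W"
 show "abs (f e x - fl x) + abs (h e x - hl x) <= (A + B) * (Gs e x + (Gs e x)^2) + eta"
  using add_mono[OF bspec[OF elim(1) x] bspec[OF elim(2) x]] unfolding distrib_right by linarith
 qed
qed
have t1: "abs ((a + b) - (c + d)) <= abs (a - c) + abs (b - d)" and t2: "abs ((a - b) - (c - d)) <= abs (a - c) + abs (b - d)" for a b c d :: real by linarith+
show "close2 (%e x. f e x + h e x) (%x. fl x + hl x)" unfolding close2_def
proof (intro exI[of _ "A + B"] conjI allI impI)
 fix eta :: real assume "eta > 0"
 from *[OF this] show "EV e. ALL x:W. abs (f e x + h e x - (fl x + hl x)) <= (A + B) * (Gs e x + (Gs e x)^2) + eta"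
 by eventually_elim (intro ballI, rule order_trans[OF t1], blast)
qed (use A B in simp)
show "close2 (%e x. f e x - h e x) (%x. fl x - hl x)" unfolding close2_def
proof (intro exI[of _ "A + B"] conjI allI impI)
 fix eta :: real assume "eta > 0"
 from *[OF this] show "EV e. ALL x:W. abs (f e x - h e x - (fl x - hl x)) <= (A + B) * (Gs e x + (Gs e x)^2) + eta"
 by eventually_elim (intro ballI, rule order_trans[OF t2], blast)
qed (use A B in simp)
qed

lemma close2_curvq: "close2 (%e. curvq (ge e 1 1) (ge e 1 2) (ge e 2 2)) (curvq (g 1 1) (g 1 2) (g 2 2))"
proof -
note c1 = close1_cmult close1_diff close1_pd
have u2: "ul (%e x. 2 * ge e i j x) (%x. 2 * g i j x)" for i j
 by (intro ul_mult ul_const good_ul[OF ge_good] continuous_on_const)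
have "close2 (%e x. curvq (ge e 1 1) (ge e 1 2) (ge e 2 2) x) (%x. curvq (g 1 1) (g 1 2) (g 2 2) x)"
 unfolding curvq_def distrib_left
 by (intro close2_add close2_mult c1 u2 good_ul[OF ge_good])
then show ?thesis by simp
qed

end

text \<open>\<open>S\<close> is a closed set carrying the test function. Its preimage under
  \<open>Psi\<close> within \<open>Kr\<close> is confined to the half ball, which leaves an annulus
  in which the mollified projection also avoids \<open>S\<close>; this gives compact support in
  \<open>W\<close> before the limit.\<close>

locale graph_limit = C1_metric_map +
fixes phi :: "fun2" and S :: "(real^2) set" and J p1 p2 :: "fun2"
assumes phi: "test_fun UNIV phi" and S: "closed S" "!!x. x ~: S ==> phi x = 0"
 and S_half: "!!x. x : Kr ==> Psi x : S ==> x : ball x0 (r / 2)"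
 and J: "!!x. J x = pd 1 (u 1) x * pd 2 (u 2) x - pd 2 (u 1) x * pd 1 (u 2) x"
 and J0: "!!x. x : Kr ==> J x ~= 0"
 and p1: "!!x. p1 x = (pd 1 (u 3) x * pd 2 (u 2) x - pd 2 (u 3) x * pd 1 (u 2) x) / J x"
 and p2: "!!x. p2 x = (pd 1 (u 1) x * pd 2 (u 3) x - pd 2 (u 1) x * pd 1 (u 3) x) / J x"
begin

definition Je :: "real => fun2" where
"Je e x = pd 1 (ue e 1) x * pd 2 (ue e 2) x - pd 2 (ue e 1) x * pd 1 (ue e 2) x"
definition p1e :: "real => fun2" where
"p1e e x = (pd 1 (ue e 3) x * pd 2 (ue e 2) x - pd 2 (ue e 3) x * pd 1 (ue e 2) x) / Je e x"
definition p2e :: "real => fun2" where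
"p2e e x = (pd 1 (ue e 1) x * pd 2 (ue e 3) x - pd 2 (ue e 1) x * pd 1 (ue e 3) x) / Je e x"
definition omegae :: "real => fun2" where "omegae e x = phi (Psie e x) / Je e x ^ 3"
definition we :: "real => fun2" where
"we e x = omegae e x * (ge e 1 1 x * ge e 2 2 x - ge e 1 2 x * ge e 1 2 x)"
definition omega :: "fun2" where "omega x = phi (Psi x) / J x ^ 3"
definition w :: "fun2" where
"w x = omega x * (g 1 1 x * g 2 2 x - g 1 2 x * g 1 2 x)"

lemma good_Je: "good Je J"
unfolding Je_def[abs_def] J[abs_def] by (intro good_diff good_mult good_pd_ue)

lemma good_omegae: "good omegae omega"
proof -
have "good (%e x. Je e x * Je e x * Je e x) (%x. J x * J x * J x)" by (intro good_mult good_Je)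
from good_mult[OF good_Psi[OF phi] good_inverse[OF this]]
show ?thesis using J0 by (simp add: omegae_def[abs_def] omega_def[abs_def] divide_inverse power3_eq_cube)
qed

lemma good_we: "good we w"
unfolding we_def[abs_def] w_def[abs_def] by (intro good_mult good_diff good_omegae ge_good)

lemma ul_p: "ul p1e p1" "ul p2e p2"
unfolding p1e_def[abs_def] p2e_def[abs_def] p1[abs_def] p2[abs_def]
by (intro ul_divide ul_diff ul_mult pd_ue_ul good_ul[OF good_Je] J0; assumption)+

lemma Je_nonzero: "EV e. ALL x:Kr. Je e x ~= 0"
proof -
obtain b where b: "b > 0" "EV e. ALL x:Kr. b <= abs (Je e x)" using ul_inverse(2)[OF good_ul[OF good_Je] J0] by blast
from b(2) show ?thesis
proof eventually_elim
 case (elim e)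
 show ?case
 proof
 fix x assume "x : Kr"
 from bspec[OF elim this] b(1) show "Je e x ~= 0" by auto
 qed
qed
qed

text \<open>The image under \<open>Psi\<close> of the compact annulus has positive distance from the
  closed set \<open>S\<close>, and the mollified projection is uniformly close to
  \<open>Psi\<close>.\<close>

lemma Psie_avoids: "EV e. ALL x:Kr. x ~: ball x0 (r / 2) --> Psie e x ~: S"
proof -
let ?A = "Kr - ball x0 (r / 2)"
have cA: "compact (Psi ` ?A)"
 by (intro compact_continuous_image continuous_on_subset[OF Psi_cont] compact_diff) (use WU(2) in auto)
have "Psi ` ?A \<inter> S = {}" using S_half by blast
from separate_compact_closed[OF cA S(1) this]
obtain d where d: "d > 0" "ALL x:Psi ` ?A. ALL y:S. d <= dist x y" by blast
from Psie_close[OF d(1)] show ?thesis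
proof eventually_elim
 case (elim e)
 show ?case
 proof (intro ballI impI notI)
 fix x assume x: "x : Kr" "x ~: ball x0 (r / 2)" and "Psie e x : S"
 then have "d <= dist (Psi x) (Psie e x)" using d(2) by blast
 with bspec[OF elim x(1)] show False by (simp add: dist_norm norm_minus_commute)
 qed
qed
qed

abbreviation "E \<equiv> g 1 1"
abbreviation "F \<equiv> g 1 2"
abbreviation "G \<equiv> g 2 2"

definition L :: "real => fun2" where
"L e x = (p1e e x * p2e e x * pd 1 (pd 2 phi) (Psie e x) - (1/2) * (p1e e x)^2 * pd 2 (pd 2 phi) (Psie e x)
 - (1/2) * (p2e e x)^2 * pd 1 (pd 1 phi) (Psie e x)) * Je e x"
definition R :: "real => fun2" where
"R e x = pd 1 (we e) x * curvB (ge e 2 2) x - pd 2 (we e) x * curvA (ge e 1 1) (ge e 1 2) x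
 + omegae e x * curvq (ge e 1 1) (ge e 1 2) (ge e 2 2) x"
text \<open>The intermediate quantity between \<open>R\<close> and its limit: the curvature terms
  are those of the smooth metric \<open>g\<close>, while \<open>we\<close> and \<open>omegae\<close>
  still belong to the mollified map. As \<open>g\<close> has second derivatives, no derivative has
  to stand on \<open>we\<close>, and uniform convergence suffices for the limit.\<close>

definition R0 :: "real => fun2" where
"R0 e x = we e x * (pd 2 (curvA E F) x - pd 1 (curvB G) x) + omegae e x * curvq E F G x"

lemma smooth_curv: "smooth_on U (curvA E F)" "smooth_on U (curvB G)" "smooth_on U (curvq E F G)"
unfolding curvA_def[abs_def] curvB_def[abs_def] curvq_def[abs_def]
by (intro smooth_on_diff smooth_on_add smooth_on_mult smooth_on_const smooth_on_pd sg U)+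

text \<open>For small \<open>e\<close> the identities for smooth graphs apply to \<open>ue e\<close>.\<close>

lemma approx:
"EV e. (LINT x:W|lborel. L e x) = (LINT x:W|lborel. R e x) & smooth_on W (we e) & smooth_on W (omegae e)
 & continuous_on W (L e) & (ALL x:W. x ~: cball x0 (r / 2) --> we e x = 0 & omegae e x = 0)"
using small Je_nonzero Psie_avoids
proof eventually_elim
case (elim e)
have e: "e > 0" using elim by simp
have Jn: "Je e x ~= 0" if "x : W" for x using elim(2) that W_bounded(3) by blast
interpret s: smooth_graph W "cball x0 (r / 2)" "ue e 1" "ue e 2" "ue e 3" phi "p1e e" "p2e e" "Je e" S "Psie e"
proof
 show "cball x0 (r / 2) <= W" using r by auto
 show "smooth_on W (ue e k)" for k by (rule smooth_ue[OF e])
 show "!!x. x : W ==> x ~: cball x0 (r / 2) ==> Psie e x ~: S"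
 using elim(3) W_bounded(3) ball_subset_cball[of x0 "r / 2"] by blast
qed (use phi S Jn smooth_ue[OF e] in \<open>simp_all add: Je_def p1e_def p2e_def Psie_def\<close>)
have ge: "ge e i j x = pd i (ue e 1) x * pd j (ue e 1) x + pd i (ue e 2) x * pd j (ue e 2) x + pd i (ue e 3) x * pd j (ue e 3) x" for i j x
 by (simp add: ge_def sum_3)
note gw = s.gauss_weak[where omega="omegae e" and w="we e", OF ge ge ge omegae_def we_def]
have "(LINT x:W|lborel. L e x) = (LINT x:W|lborel. R e x)"
 using s.weak_hessian gw(1) unfolding L_def R_def by simp
moreover have "continuous_on W (L e)" unfolding L_def[abs_def]
 by (intro continuous_intros smooth_on_cont[OF s.sp1] smooth_on_cont[OF s.sp2] smooth_on_cont[OF s.sJ]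
  smooth_on_cont[OF s.sphiPsi] test_fun_pd phi)
moreover have "we e x = 0 & omegae e x = 0" if "x : W" "x ~: cball x0 (r / 2)" for x
 using s.phi0(1)[OF that] by (simp add: we_def omegae_def)
ultimately show ?case using gw(2,3) by blast
qed

lemma L_lim: "((%e. LINT x:W|lborel. L e x) \<longlongrightarrow> (LINT x:W|lborel. (p1 x * p2 x * pd 1 (pd 2 phi) (Psi x) - (1/2) * (p1 x)^2 * pd 2 (pd 2 phi) (Psi x)
 - (1/2) * (p2 x)^2 * pd 1 (pd 1 phi) (Psi x)) * J x)) (at_right 0)"
proof (rule ul_integral)
show "ul L (%x. (p1 x * p2 x * pd 1 (pd 2 phi) (Psi x) - (1/2) * (p1 x)^2 * pd 2 (pd 2 phi) (Psi x)
 - (1/2) * (p2 x)^2 * pd 1 (pd 1 phi) (Psi x)) * J x)"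
 unfolding L_def[abs_def]
 by (intro ul_mult ul_diff ul_power ul_p ul_Psi[OF test_fun_pd[OF test_fun_pd[OF phi]]] good_ul[OF good_Je] ul_const continuous_on_const)
show "EV e. continuous_on W (L e)" using approx by eventually_elim simp
qed

lemma R0_lim: "((%e. LINT x:W|lborel. R0 e x) \<longlongrightarrow>
 (LINT x:W|lborel. w x * (pd 2 (curvA E F) x - pd 1 (curvB G) x) + omega x * curvq E F G x)) (at_right 0)"
proof (rule ul_integral)
have c: "continuous_on V (curvq E F G)" "continuous_on V (%x. pd 2 (curvA E F) x - pd 1 (curvB G) x)" if "V <= U" for V
 using continuous_on_subset[OF smooth_on_cont[OF smooth_curv(3)] that]
 continuous_on_subset[OF smooth_on_cont[OF smooth_on_pd[OF smooth_curv(1)]] that]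
 continuous_on_subset[OF smooth_on_cont[OF smooth_on_pd[OF smooth_curv(2)]] that]
 by (auto intro: continuous_on_diff)
show "ul R0 (%x. w x * (pd 2 (curvA E F) x - pd 1 (curvB G) x) + omega x * curvq E F G x)"
 unfolding R0_def[abs_def]
 by (intro ul_add ul_mult good_ul[OF good_we] good_ul[OF good_omegae] ul_const c WU)
show "EV e. continuous_on W (R0 e)" using approx
proof eventually_elim
 case (elim e)
 then have "smooth_on W (we e)" "smooth_on W (omegae e)" by auto
 then show ?case unfolding R0_def[abs_def]
 by (intro continuous_on_add continuous_on_mult c WU smooth_on_cont)
qed
qed

lemma close1_curv: "close1 (%e. curvA (ge e 1 1) (ge e 1 2)) (curvA E F)" "close1 (%e. curvB (ge e 2 2)) (curvB G)"
proof -
have "close1 (%e x. curvA (ge e 1 1) (ge e 1 2) x) (%x. curvA E F x)" "close1 (%e x. curvB (ge e 2 2) x) (%x. curvB G x)"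
 unfolding curvA_def curvB_def by (intro close1_diff close1_cmult close1_pd)+
then show "close1 (%e. curvA (ge e 1 1) (ge e 1 2)) (curvA E F)" "close1 (%e. curvB (ge e 2 2)) (curvB G)" by simp_all
qed

text \<open>Once \<open>R0\<close> is integrated by parts, its integrand differs from that of
  \<open>R\<close> only in first derivatives of the metric and in the undifferentiated coefficients
  of \<open>curvq\<close>. These differences meet the gradient of \<open>we\<close>, bounded by a
  multiple of \<open>1 + T\<close>, and the bounded \<open>omegae\<close>.\<close>

lemma R_minus_R0:
"EX C>=0. ALL eta>0. EV e. abs ((LINT x:W|lborel. R e x) - (LINT x:W|lborel. R0 e x))
 <= C * ((LINT x:W|lborel. T e x * Gs e x) + (LINT x:W|lborel. Gs e x) + (LINT x:W|lborel. (Gs e x)^2)) + C * eta"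
proof -
obtain Cw1 where Cw1: "Cw1 >= 0" "EV e. ALL x:W. abs (pd 1 (we e) x) <= Cw1 * (1 + T e x)" using good_we by (auto simp: good_def)
obtain Cw2 where Cw2: "Cw2 >= 0" "EV e. ALL x:W. abs (pd 2 (we e) x) <= Cw2 * (1 + T e x)" using good_we by (auto simp: good_def)
obtain CA where CA: "CA >= 0" "!!e x. e > 0 ==> x : W ==> abs (curvA (ge e 1 1) (ge e 1 2) x - curvA E F x) <= CA * Gs e x"
 using close1_curv(1) by (auto simp: close1_def)
obtain CB where CB: "CB >= 0" "!!e x. e > 0 ==> x : W ==> abs (curvB (ge e 2 2) x - curvB G x) <= CB * Gs e x"
 using close1_curv(2) by (auto simp: close1_def)
obtain D where D: "D >= 0" "EV e. ALL x:Kr. abs (omegae e x) <= D" using ul_eventually_bounded[OF good_ul[OF good_omegae]] by blast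
obtain Q where Q: "Q >= 0" "!!eta. eta > 0 ==> EV e. ALL x:W. abs (curvq (ge e 1 1) (ge e 1 2) (ge e 2 2) x - curvq E F G x) <= Q * (Gs e x + (Gs e x)^2) + eta"
 using close2_curvq by (auto simp: close2_def)
define m where "m = measure lborel W"
have m: "m >= 0" by (simp add: m_def)
define P where "P = Cw1 * CB + Cw2 * CA + D * Q"
have P: "P >= 0" "Cw1 * CB + Cw2 * CA <= P" using Cw1 Cw2 CA CB D Q by (auto simp: P_def)
define C where "C = P + D * m"
have C: "C >= P" "C >= D * m" "C >= 0" using P D m by (auto simp: C_def)
show ?thesis
proof (intro exI[of _ C] conjI allI impI C)
 fix eta :: real assume eta: "eta > 0"
 show "EV e. abs ((LINT x:W|lborel. R e x) - (LINT x:W|lborel. R0 e x))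
 <= C * ((LINT x:W|lborel. T e x * Gs e x) + (LINT x:W|lborel. Gs e x) + (LINT x:W|lborel. (Gs e x)^2)) + C * eta"
 using small approx Cw1(2) Cw2(2) D(2) Q(2)[OF eta]
 proof eventually_elim
 case (elim e)
 have e: "e > 0" using elim(1) by simp
 let ?K = "cball x0 (r / 2)"
 have K: "compact ?K" "?K <= W" using r by auto
 have sw: "smooth_on W (we e)" "smooth_on W (omegae e)" and w0: "!!x. x : W ==> x ~: ?K ==> we e x = 0 & omegae e x = 0"
  using elim(2) by auto
 have sc: "smooth_on W (curvA E F)" "smooth_on W (curvB G)" "smooth_on W (curvq E F G)"
  using smooth_curv smooth_on_subset[OF _ WU(1)] by auto
 have sce: "smooth_on W (curvA (ge e 1 1) (ge e 1 2))" "smooth_on W (curvB (ge e 2 2))" "smooth_on W (curvq (ge e 1 1) (ge e 1 2) (ge e 2 2))"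
  unfolding curvA_def[abs_def] curvB_def[abs_def] curvq_def[abs_def]
  by (intro smooth_on_diff smooth_on_add smooth_on_mult smooth_on_const smooth_on_pd smooth_ge[OF e] open_ball)+
 have oWK: "open (W - ?K)" by (intro open_Diff) auto
 have pw0: "pd i (we e) x = 0" if "x : W" "x ~: ?K" for i x
  using pd_cong_open[OF oWK, of x "we e" "%_. 0" i] that w0 by auto
 have ci: "set_integrable lborel W f" if "smooth_on W f" "!!x. x : W ==> x ~: ?K ==> f x = 0" for f :: "fun2"
  by (rule vanishing_set_integrable[OF smooth_on_cont[OF that(1)] K that(2)])
 \<comment> \<open>The integrand of \<open>R0\<close> with the derivatives moved onto
   \<open>we\<close>, so that it can be compared with \<open>R\<close> pointwise.\<close>
 let ?R1 = "%x. pd 1 (we e) x * curvB G x - pd 2 (we e) x * curvA E F x + omegae e x * curvq E F G x"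
 have iR: "set_integrable lborel W (R e)" unfolding R_def[abs_def]
  by (rule ci) (auto simp: pw0 w0 intro!: smooth_on_diff smooth_on_add smooth_on_mult smooth_on_pd sw sce)
 have iR1: "set_integrable lborel W ?R1"
  by (rule ci) (auto simp: pw0 w0 intro!: smooth_on_diff smooth_on_add smooth_on_mult smooth_on_pd sw sc)
 have swA: "smooth_on W (%x. we e x * curvA E F x)" "smooth_on W (%x. we e x * curvB G x)" by (intro smooth_on_mult open_ball sw sc)+
 have pz: "pd i (%x. we e x * f x) x = 0" if "x : W" "x ~: ?K" for i f x
  using pd_cong_open[OF oWK, of x "%x. we e x * f x" "%_. 0" i] that w0 by auto
 have z: "(LINT x:W|lborel. pd 2 (%x. we e x * curvA E F x) x) = 0" "(LINT x:W|lborel. pd 1 (%x. we e x * curvB G x) x) = 0"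
  by (rule set_integral_pd_zero[OF open_ball smooth_onD[OF swA(1)] K], simp add: w0,
   rule set_integral_pd_zero[OF open_ball smooth_onD[OF swA(2)] K], simp add: w0)
 have i2: "set_integrable lborel W (pd 2 (%x. we e x * curvA E F x))" "set_integrable lborel W (pd 1 (%x. we e x * curvB G x))"
  by (intro ci smooth_on_pd swA pz; assumption)+
 have "(LINT x:W|lborel. R0 e x) = (LINT x:W|lborel. ?R1 x + (pd 2 (%x. we e x * curvA E F x) x - pd 1 (%x. we e x * curvB G x) x))"
 proof (rule set_lebesgue_integral_cong)
  show "ALL x. x : W --> R0 e x = ?R1 x + (pd 2 (%x. we e x * curvA E F x) x - pd 1 (%x. we e x * curvB G x) x)"
  proof (intro allI impI)
  fix x assume x: "x : W"
  show "R0 e x = ?R1 x + (pd 2 (%x. we e x * curvA E F x) x - pd 1 (%x. we e x * curvB G x) x)"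
   using smooth_on_diffble[OF sw(1) x] smooth_on_diffble[OF sc(1) x] smooth_on_diffble[OF sc(2) x]
   by (simp add: pd_mult R0_def algebra_simps)
  qed
 qed simp
 then have R01: "(LINT x:W|lborel. R0 e x) = (LINT x:W|lborel. ?R1 x)"
  using iR1 i2 z by (simp add: set_integral_add set_integral_diff)
 have iT: "set_integrable lborel W (%x. T e x * Gs e x)" "set_integrable lborel W (Gs e)" "set_integrable lborel W (%x. (Gs e x)^2)"
  by (intro Kr_integrable continuous_intros T_cont Gs_cont e)+
 have ki: "set_integrable lborel W (%x. k)" for k :: real
  by (intro Kr_integrable continuous_intros)
 let ?H = "%x. P * (T e x * Gs e x) + P * Gs e x + P * (Gs e x)^2 + D * eta"
 have iH: "set_integrable lborel W ?H" using iT ki by (intro set_integral_add set_integrable_mult_right) auto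
 have bound: "abs (R e x - ?R1 x) <= ?H x" if x: "x : W" for x
 proof -
  have xK: "x : Kr" using x by simp
  let ?g = "Gs e x" and ?t = "T e x"
  have gt: "?g >= 0" "?t >= 0" by (rule Gs_nonneg, rule T_nonneg)
  have b1: "abs (pd 1 (we e) x * (curvB (ge e 2 2) x - curvB G x)) <= (Cw1 * (1 + ?t)) * (CB * ?g)"
  unfolding abs_mult by (intro mult_mono bspec[OF elim(3) x] CB(2)[OF e x] mult_nonneg_nonneg) (use Cw1 gt in auto)
  have b2: "abs (pd 2 (we e) x * (curvA (ge e 1 1) (ge e 1 2) x - curvA E F x)) <= (Cw2 * (1 + ?t)) * (CA * ?g)"
  unfolding abs_mult by (intro mult_mono bspec[OF elim(4) x] CA(2)[OF e x] mult_nonneg_nonneg) (use Cw2 gt in auto)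
  have b3: "abs (omegae e x * (curvq (ge e 1 1) (ge e 1 2) (ge e 2 2) x - curvq E F G x)) <= D * (Q * (?g + ?g^2) + eta)"
  unfolding abs_mult by (intro mult_mono bspec[OF elim(5) xK] bspec[OF elim(6) x]) (use D in auto)
  have "R e x - ?R1 x = pd 1 (we e) x * (curvB (ge e 2 2) x - curvB G x) - pd 2 (we e) x * (curvA (ge e 1 1) (ge e 1 2) x - curvA E F x)
  + omegae e x * (curvq (ge e 1 1) (ge e 1 2) (ge e 2 2) x - curvq E F G x)" by (simp add: R_def algebra_simps)
  then have "abs (R e x - ?R1 x) <= (Cw1 * (1 + ?t)) * (CB * ?g) + (Cw2 * (1 + ?t)) * (CA * ?g) + D * (Q * (?g + ?g^2) + eta)"
  using b1 b2 b3 by linarith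
  also have "... = (Cw1 * CB + Cw2 * CA) * (?t * ?g) + P * ?g + D * Q * ?g^2 + D * eta"
  by (simp add: P_def algebra_simps)
  also have "... <= ?H x"
  using P Cw1 Cw2 CA CB gt by (intro add_mono mult_right_mono order_refl) (auto simp: P_def)
  finally show ?thesis .
 qed
 have "(LINT x:W|lborel. R e x) - (LINT x:W|lborel. R0 e x) = (LINT x:W|lborel. R e x - ?R1 x)"
  unfolding R01 using iR iR1 by (simp add: set_integral_diff)
 moreover have "abs (LINT x:W|lborel. R e x - ?R1 x) <= (LINT x:W|lborel. ?H x)"
  by (rule set_integral_abs_le[OF _ iH bound]) (use iR iR1 in \<open>auto intro: set_integral_diff\<close>)
 moreover have "(LINT x:W|lborel. D * eta) = D * eta * m"
  using emeasure_bounded_finite[OF W_bounded(2)] by (simp add: set_integral_def m_def)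
 then have "(LINT x:W|lborel. ?H x) = P * ((LINT x:W|lborel. T e x * Gs e x) + (LINT x:W|lborel. Gs e x) + (LINT x:W|lborel. (Gs e x)^2)) + D * eta * m"
  using iT ki by (simp add: set_integral_add distrib_left)
 moreover have "P * ((LINT x:W|lborel. T e x * Gs e x) + (LINT x:W|lborel. Gs e x) + (LINT x:W|lborel. (Gs e x)^2))
  <= C * ((LINT x:W|lborel. T e x * Gs e x) + (LINT x:W|lborel. Gs e x) + (LINT x:W|lborel. (Gs e x)^2))"
  using C(1) by (intro mult_right_mono add_nonneg_nonneg set_integral_nonneg) (auto simp: T_nonneg Gs_nonneg)
 moreover have "D * eta * m <= C * eta" using mult_right_mono[OF C(2), of eta] eta by (simp add: mult_ac)
 ultimately show ?case by linarith
 qed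
qed
qed

text \<open>Both sides are limits of integrals that agree for small \<open>e\<close>: uniform
  convergence handles the left side and \<open>R0\<close>, and the two hypotheses remove the
  difference between \<open>R\<close> and \<open>R0\<close>.\<close>

lemma weak_gauss:
assumes TG: "((%e. LINT x:W|lborel. T e x * Gs e x) \<longlongrightarrow> 0) (at_right 0)"
 and GG: "((%e. LINT x:W|lborel. (Gs e x)^2) \<longlongrightarrow> 0) (at_right 0)"
shows "(LINT x:W|lborel. (p1 x * p2 x * pd 1 (pd 2 phi) (Psi x) - (1/2) * (p1 x)^2 * pd 2 (pd 2 phi) (Psi x)
 - (1/2) * (p2 x)^2 * pd 1 (pd 1 phi) (Psi x)) * J x)
 = (LINT x:W|lborel. w x * (pd 2 (curvA E F) x - pd 1 (curvB G) x) + omega x * curvq E F G x)"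
proof -
define m where "m = measure lborel W"
have m: "m >= 0" by (simp add: m_def)
have G1: "((%e. LINT x:W|lborel. Gs e x) \<longlongrightarrow> 0) (at_right 0)"
proof (rule tendstoI)
 fix eta :: real assume eta: "eta > 0"
 define q where "q = eta / (2 * (m + 1))"
 have q: "q > 0" "q * m < eta / 2" using eta m by (auto simp: q_def field_simps)
 have "EV e. dist (LINT x:W|lborel. (Gs e x)^2) 0 < q * (eta / 2)"
 by (rule tendstoD[OF GG]) (use q eta in simp)
 with small show "EV e. dist (LINT x:W|lborel. Gs e x) 0 < eta"
 proof eventually_elim
 case (elim e)
 have e: "e > 0" using elim by simp
 have i: "set_integrable lborel W (Gs e)" "set_integrable lborel W (%x. (Gs e x)^2)" "set_integrable lborel W (%x. q)"
  by (intro Kr_integrable continuous_intros Gs_cont e)+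
 have "(LINT x:W|lborel. Gs e x) <= (LINT x:W|lborel. q + inverse q * (Gs e x)^2)"
 proof (rule set_integral_mono)
  \<comment> \<open>Convergence in L^1 on a bounded set follows from that of the square integral:
    where \<open>Gs\<close> exceeds \<open>q\<close> it is at most its square divided by
    \<open>q\<close>.\<close>
  show "Gs e x <= q + inverse q * (Gs e x)^2" for x
  proof (cases "Gs e x <= q")
  case False
  then have "q * Gs e x <= Gs e x * Gs e x" using Gs_nonneg by (intro mult_right_mono) auto
  then show ?thesis using q(1) by (simp add: field_simps power2_eq_square add_nonneg_nonneg add_increasing)
  qed (use q in \<open>auto intro: order_trans\<close>)
 qed (use i in auto)
 also have "... = q * m + inverse q * (LINT x:W|lborel. (Gs e x)^2)"
 proof -
  have "(LINT x:W|lborel. q) = q * m"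
  using emeasure_bounded_finite[OF W_bounded(2)] by (simp add: set_integral_def m_def)
  then show ?thesis using i by (simp add: set_integral_add)
 qed
 also have "... < eta / 2 + eta / 2"
 proof (rule add_strict_mono[OF q(2)])
  have "(LINT x:W|lborel. (Gs e x)^2) < q * (eta / 2)" using elim(2) by (simp add: dist_real_def)
  then show "inverse q * (LINT x:W|lborel. (Gs e x)^2) < eta / 2" using q(1) by (simp add: field_simps)
 qed
 finally show ?case using set_integral_nonneg[of W "Gs e" lborel] Gs_nonneg by (simp add: dist_real_def)
 qed
qed
obtain C where C: "C >= 0" "!!eta. eta > 0 ==> EV e. abs ((LINT x:W|lborel. R e x) - (LINT x:W|lborel. R0 e x))
 <= C * ((LINT x:W|lborel. T e x * Gs e x) + (LINT x:W|lborel. Gs e x) + (LINT x:W|lborel. (Gs e x)^2)) + C * eta"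
 using R_minus_R0 by blast
have X: "((%e. C * ((LINT x:W|lborel. T e x * Gs e x) + (LINT x:W|lborel. Gs e x) + (LINT x:W|lborel. (Gs e x)^2))) \<longlongrightarrow> C * (0 + 0 + 0)) (at_right 0)"
 by (intro tendsto_intros TG GG G1)
have dif: "((%e. (LINT x:W|lborel. R e x) - (LINT x:W|lborel. R0 e x)) \<longlongrightarrow> 0) (at_right 0)"
proof (rule tendstoI)
 fix eta :: real assume eta: "eta > 0"
 define q where "q = eta / (2 * (C + 1))"
 have q: "q > 0" "C * q < eta / 2" using eta C(1) by (auto simp: q_def field_simps)
 have "EV e. dist (C * ((LINT x:W|lborel. T e x * Gs e x) + (LINT x:W|lborel. Gs e x) + (LINT x:W|lborel. (Gs e x)^2))) (C * (0 + 0 + 0)) < eta / 2"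
 by (rule tendstoD[OF X]) (use eta in simp)
 with C(2)[OF q(1)] show "EV e. dist ((LINT x:W|lborel. R e x) - (LINT x:W|lborel. R0 e x)) 0 < eta"
 proof eventually_elim
 case (elim e)
 have "abs (C * ((LINT x:W|lborel. T e x * Gs e x) + (LINT x:W|lborel. Gs e x) + (LINT x:W|lborel. (Gs e x)^2))) < eta / 2"
  using elim(2) by (simp add: dist_real_def)
 then show ?case using elim(1) q(2) unfolding dist_real_def by linarith
 qed
qed
have "((%e. ((LINT x:W|lborel. R e x) - (LINT x:W|lborel. R0 e x)) + (LINT x:W|lborel. R0 e x)) \<longlongrightarrow>
 0 + (LINT x:W|lborel. w x * (pd 2 (curvA E F) x - pd 1 (curvB G) x) + omega x * curvq E F G x)) (at_right 0)"
 by (intro tendsto_add dif R0_lim)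
then have Rl: "((%e. LINT x:W|lborel. R e x) \<longlongrightarrow> (LINT x:W|lborel. w x * (pd 2 (curvA E F) x - pd 1 (curvB G) x) + omega x * curvq E F G x)) (at_right 0)"
 by simp
have "EV e. (LINT x:W|lborel. R e x) = (LINT x:W|lborel. L e x)" using approx by eventually_elim simp
from tendsto_cong[THEN iffD1, OF this Rl]
have "((%e. LINT x:W|lborel. L e x) \<longlongrightarrow> (LINT x:W|lborel. w x * (pd 2 (curvA E F) x - pd 1 (curvB G) x) + omega x * curvq E F G x)) (at_right 0)" .
with L_lim show ?thesis by (intro tendsto_unique[OF trivial_limit_at_right_real])
qed

end

section \<open>The error terms\<close>

context C1_metric_map
begin

text \<open>The factor 8 counts the index triples of the differentiated metric; in
  \<open>T_bound\<close> the factor 12 counts the components of the second derivative of the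
  map.\<close>

lemma Gs_bound: "EX C>0. ALL e x. 0 < e --> e <= r --> x : Kr --> Gs e x <= C * (I 2 e x / e^3 + e)"
proof -
obtain C where C: "C > 0" "!!e x l i j. 0 < e ==> e <= r ==> x : Kr ==> abs (pd l (ge e i j) x - pd l (g i j) x) <= C / e^3 * I 2 e x + C * e"
 using pd_ge_bound by blast
have "Gs e x <= (8 * C) * (I 2 e x / e^3 + e)" if e: "0 < e" "e <= r" "x : Kr" for e x
proof -
 have "Gs e x <= (\<Sum>l\<in>(UNIV::2 set). \<Sum>i\<in>(UNIV::2 set). \<Sum>j\<in>(UNIV::2 set). C / e^3 * I 2 e x + C * e)"
 unfolding Gs_def by (intro sum_mono C e)
 also have "... = (8 * C) * (I 2 e x / e^3 + e)" by (simp add: distrib_left)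
 finally show ?thesis .
qed
then show ?thesis using C(1) by (intro exI[of _ "8 * C"]) auto
qed

lemma T_bound: "0 < e ==> e <= r ==> x : Kr ==> T e x <= 12 * C0 * (I 1 e x / e^3)"
proof -
assume e: "0 < e" "e <= r" "x : Kr"
have "T e x <= (\<Sum>k\<in>(UNIV::3 set). \<Sum>i\<in>(UNIV::2 set). \<Sum>j\<in>(UNIV::2 set). C0 / e^3 * I 1 e x)"
 unfolding T_def by (intro sum_mono ue_bounds(2) e)
then show ?thesis by simp
qed

lemma s_le_eventually:
assumes "!!k i. EV e. ALL x:Kr. ALL y:cball x e. abs (pd i (u k) y - pd i (u k) x) <= b e"
shows "EV e. ALL x:Kr. ALL y:cball x e. s x y <= 6 * b e"
proof -
have "EV e. ALL k:(UNIV::3 set). ALL i:(UNIV::2 set). ALL x:Kr. ALL y:cball x e. abs (pd i (u k) y - pd i (u k) x) <= b e"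
 by (intro eventually_ball_finite ballI assms) auto
then show ?thesis
proof eventually_elim
 case (elim e)
 show ?case
 proof (intro ballI)
 fix x y assume xy: "x : Kr" "y : cball x e"
 have "s x y <= (\<Sum>k\<in>(UNIV::3 set). \<Sum>i\<in>(UNIV::2 set). b e)"
  unfolding s_def by (intro sum_mono) (use elim xy in blast)
 then show "s x y <= 6 * b e" by simp
 qed
qed
qed

lemma osc_eventually: "eta > 0 ==> EV e. ALL x:Kr. ALL y:cball x e. s x y <= eta"
proof -
assume "eta > 0"
then have "eta / 6 > 0" by simp
from s_le_eventually[of "%_. eta / 6", OF unif_cont[OF u_cont(2) this]] show ?thesis by simp
qed

lemma I_le:
assumes "x : Kr" "0 < e" "e <= r" "!!y. y : cball x e ==> s x y <= b" "b >= 0"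
shows "I m e x <= 4 * e^2 * b ^ m"
unfolding I_def
proof (rule cball_integral_le[OF s_int[OF assms(1,3)]])
show "s x y ^ m <= b ^ m" if "y : cball x e" for y
 by (rule power_mono[OF assms(4)[OF that] s_nonneg])
qed (use assms in auto)

text \<open>The disc of integration moves with \<open>x\<close>. Expressed as a condition on
  \<open>dist x y\<close> inside an integral over the plane, with the Borel functions
  \<open>cut\<close>, it becomes a parametrised integral of a jointly measurable function.\<close>

lemma I_measurable:
assumes e: "0 < e" "e <= r"
shows "(%x. ennreal (I m e x / c) * indicator W x) : borel_measurable borel"
proof -
have [measurable]: "cut (pd i (u k)) : borel_measurable borel" for i k
 using borel_measurable_integrable[OF cut_integrable[OF u_cont(2)], of i k] by simp
define s' where "s' x y = (SU k. SU i. abs (cut (pd i (u k)) y - cut (pd i (u k)) x))" for x y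
define I' where "I' x = (LINT y|lborel. (if dist x y <= e then s' x y ^ m else 0))" for x
have [measurable]: "I' : borel_measurable borel" unfolding I'_def s'_def by measurable
have [measurable]: "W : sets borel" by simp
have "I m e x = I' x" if "x : W" for x
proof -
 have xK: "x : Kr" using that by simp
 have cx: "cut h x = h x" for h by (rule cut_eq[OF xK e(2)]) (use e in simp)
 show ?thesis unfolding I_def I'_def set_integral_def
 by (rule bochner_cong[OF refl]) (auto simp: s'_def s_def cx cut_eq[OF xK e(2)] indicator_def)
qed
then have "ennreal (I m e x / c) * indicator W x = ennreal (I' x / c) * indicator W x" for x
 by (cases "x : W") auto
then show ?thesis by (simp only:) measurable
qed

lemma I2_le:
assumes "x : Kr" "0 < e" "e <= r" "!!y. y : cball x e ==> s x y <= b"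
shows "I 2 e x <= b * I 1 e x"
proof -
have si: "set_integrable lborel (cball x e) (%y. s x y)" using s_int[OF assms(1,3), of 1] by simp
have "I 2 e x <= (LINT y:cball x e|lborel. b * s x y)"
 unfolding I_def
proof (rule set_integral_mono[OF s_int[OF assms(1,3)] set_integrable_mult_right[OF si]])
 show "s x y ^ 2 <= b * s x y" if "y : cball x e" for y
 using mult_right_mono[OF assms(4)[OF that] s_nonneg[of x y]] by (simp add: power2_eq_square)
qed
then show ?thesis using si by (simp add: I_def)
qed

text \<open>By the bounds on \<open>T\<close> and \<open>Gs\<close> their product is at most a
  multiple of \<open>I 1 * I 2 / e^6 + I 1 / e^2\<close>. The mean inequality turns the first term
  into \<open>I 3 / e^4\<close>, and uniform continuity of the gradient makes the second
  small.\<close>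

lemma errors_vanish_I3:
assumes I3: "!!eta. eta > 0 ==> EV e. (\<integral>\<^sup>+x\<in>W. ennreal (I 3 e x / e^4) \<partial>lborel) <= ennreal eta"
shows "((%e. LINT x:W|lborel. T e x * Gs e x) \<longlongrightarrow> 0) (at_right 0)"
 "((%e. LINT x:W|lborel. (Gs e x)^2) \<longlongrightarrow> 0) (at_right 0)"
proof -
obtain C where C: "C > 0" "!!e x. 0 < e ==> e <= r ==> x : Kr ==> Gs e x <= C * (I 2 e x / e^3 + e)"
 using Gs_bound by blast
define B where "B = 48 * C0 * C + 8 * C^2"
have B: "B > 0" using C(1) C0(1) by (simp add: B_def add_pos_pos)
have point: "T e x * Gs e x <= B * (I 3 e x / e^4 + eta) & (Gs e x)^2 <= B * (I 3 e x / e^4 + eta)"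
 if e: "0 < e" "e <= r" "e^2 <= eta" and x: "x : Kr" and os: "!!y. y : cball x e ==> s x y <= eta" and eta: "0 < eta" "eta <= 1" for e x eta
proof -
 let ?I1 = "I 1 e x" and ?I2 = "I 2 e x" and ?I3 = "I 3 e x"
 have I0: "?I1 >= 0" "?I2 >= 0" "?I3 >= 0" by (rule I_nonneg)+
 have I1: "?I1 <= 4 * e^2 * eta" using I_le[OF x e(1,2) os, of 1] eta by simp
 have I12: "?I1 * ?I2 <= 4 * e^2 * ?I3" by (rule I_mean(2)[OF x e(1,2)])
 have a: "?I1 * ?I2 / e^6 <= 4 * (?I3 / e^4)"
 using divide_right_mono[OF I12, of "e^6"] e by (simp add: eval_nat_numeral field_simps)
 have b: "?I1 / e^2 <= 4 * eta" using I1 e by (simp add: field_simps)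
 have "T e x * Gs e x <= (12 * C0 * (?I1 / e^3)) * (C * (?I2 / e^3 + e))"
 using T_bound[OF e(1,2) x] C(2)[OF e(1,2) x] T_nonneg Gs_nonneg I0 C0(1) e C(1) by (intro mult_mono mult_nonneg_nonneg) auto
 also have "... = 12 * C0 * C * (?I1 * ?I2 / e^6 + ?I1 / e^2)"
 using e by (simp add: eval_nat_numeral field_simps)
 also have "... <= 12 * C0 * C * (4 * (?I3 / e^4) + 4 * eta)"
 using a b C0(1) C(1) by (intro mult_left_mono add_mono) auto
 also have "... = 48 * C0 * C * (?I3 / e^4 + eta)" by (simp add: algebra_simps)
 also have "... <= B * (?I3 / e^4 + eta)"
 using I0 e eta by (intro mult_right_mono) (auto simp: B_def)
 finally have 1: "T e x * Gs e x <= B * (?I3 / e^4 + eta)" .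
 \<comment> \<open>Since the oscillation is at most \<open>eta <= 1\<close>, the second moment is
   dominated by the first, and the square of \<open>Gs\<close> is governed by the same product
   \<open>I 1 * I 2\<close>.\<close>
 have "?I2 <= ?I1" using I2_le[OF x e(1,2) os] I0 eta mult_right_mono[OF eta(2) I0(1)] by simp
 then have "?I2 * ?I2 <= ?I1 * ?I2" using I0 by (intro mult_right_mono) auto
 then have c: "?I2 * ?I2 / e^6 <= 4 * (?I3 / e^4)" using a divide_right_mono[of "?I2 * ?I2" "?I1 * ?I2" "e^6"] e by simp
 have "(Gs e x)^2 <= (C * (?I2 / e^3 + e))^2"
 using C(2)[OF e(1,2) x] Gs_nonneg by (intro power_mono) auto
 also have "... = C^2 * (?I2 / e^3 + e)^2" by (simp add: power_mult_distrib)
 also have "... <= C^2 * (2 * (?I2 * ?I2 / e^6) + 2 * e^2)"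
 proof (intro mult_left_mono)
 have "(?I2 / e^3 + e)^2 <= 2 * (?I2 / e^3)^2 + 2 * e^2"
  using zero_le_power2[of "?I2 / e^3 - e"] by (simp add: power2_sum power2_diff)
 then show "(?I2 / e^3 + e)^2 <= 2 * (?I2 * ?I2 / e^6) + 2 * e^2"
  by (simp add: power_divide power2_eq_square flip: power_add)
 qed simp
 also have "... <= C^2 * (8 * (?I3 / e^4) + 2 * eta)" using c e(3) by (intro mult_left_mono) auto
 also have "... <= 8 * C^2 * (?I3 / e^4 + eta)"
 proof -
 have "C^2 * (8 * (?I3 / e^4) + 2 * eta) <= C^2 * (8 * (?I3 / e^4) + 8 * eta)" using eta by (intro mult_left_mono add_left_mono) auto
 then show ?thesis by (simp add: algebra_simps)
 qed
 also have "... <= B * (?I3 / e^4 + eta)"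
 using I0 e eta C0(1) C(1) by (intro mult_right_mono) (auto simp: B_def)
 finally show ?thesis using 1 by simp
qed
define m where "m = measure lborel W"
have m: "m >= 0" "emeasure lborel W = ennreal m" using emeasure_bounded_finite[OF W_bounded(2)]
 by (simp_all add: m_def emeasure_eq_ennreal_measure)
have lim: "((%e. LINT x:W|lborel. f e x) \<longlongrightarrow> 0) (at_right 0)"
 if f: "!!e. e > 0 ==> continuous_on Kr (f e)" "!!e x. f e x >= 0"
 and fb: "!!e x eta. 0 < e ==> e <= r ==> e^2 <= eta ==> x : Kr ==> (!!y. y : cball x e ==> s x y <= eta) ==> 0 < eta ==> eta <= 1
  ==> f e x <= B * (I 3 e x / e^4 + eta)" for f :: "real => fun2"
proof (rule tendstoI)
 fix delta :: real assume delta: "delta > 0"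
 define eta where "eta = min 1 (delta / (2 * B * (m + 1)))"
 have eta: "0 < eta" "eta <= 1" "B * (eta + eta * m) < delta"
 proof -
 show 1: "0 < eta" "eta <= 1" using delta B m by (auto simp: eta_def)
 have "eta <= delta / (2 * B * (m + 1))" by (simp add: eta_def)
 then have "eta * (2 * B * (m + 1)) <= delta" using B m by (simp add: pos_le_divide_eq)
 moreover have "eta * (2 * B * (m + 1)) = 2 * (B * (eta + eta * m))" by (simp add: algebra_simps)
 moreover have "B * (eta + eta * m) > 0" using B 1 m by (intro mult_pos_pos add_pos_nonneg) auto
 ultimately show "B * (eta + eta * m) < delta" by linarith
 qed
 have "((%e::real. e^2) \<longlongrightarrow> 0) (at_right 0)" by (auto intro!: tendsto_eq_intros)
 then have "\<forall>\<^sub>F e in at_right (0::real). e^2 < eta" using eta(1) by (rule order_tendstoD)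
 with small osc_eventually[OF eta(1)] I3[OF eta(1)]
 show "EV e. dist (LINT x:W|lborel. f e x) 0 < delta"
 proof eventually_elim
 case (elim e)
 have e: "0 < e" "e <= r" using elim by auto
 have fi: "set_integrable lborel W (f e)" by (rule Kr_integrable[OF f(1)[OF e(1)]])
 have "ennreal (LINT x:W|lborel. f e x) = (\<integral>\<^sup>+x. ennreal (indicator W x *R f e x) \<partial>lborel)"
  unfolding set_integral_def
  by (rule nn_integral_eq_integral[symmetric]) (use fi f(2) in \<open>auto simp: set_integrable_def\<close>)
 also have "... <= (\<integral>\<^sup>+x. ennreal B * (ennreal (I 3 e x / e^4) * indicator W x + ennreal eta * indicator W x) \<partial>lborel)"
 proof (rule nn_integral_mono)
  fix x
  show "ennreal (indicator W x *R f e x) <= ennreal B * (ennreal (I 3 e x / e^4) * indicator W x + ennreal eta * indicator W x)"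
  proof (cases "x : W")
  case True
  have "f e x <= B * (I 3 e x / e^4 + eta)"
   by (rule fb[OF e less_imp_le[OF elim(4)] subsetD[OF W_bounded(3) True] _ eta(1,2)]) (use elim(2) subsetD[OF W_bounded(3) True] in blast)
  moreover have "ennreal (B * (I 3 e x / e^4 + eta)) = ennreal B * (ennreal (I 3 e x / e^4) + ennreal eta)"
   using B eta(1) I_nonneg[of 3 e x] e by (subst ennreal_plus[symmetric]) (auto simp: ennreal_mult')
  ultimately show ?thesis using True ennreal_leI by (metis indicator_simps(1) mult.right_neutral scaleR_one)
  qed simp
 qed
 also have "... = ennreal B * (\<integral>\<^sup>+x. ennreal (I 3 e x / e^4) * indicator W x + ennreal eta * indicator W x \<partial>lborel)"
 proof (rule nn_integral_cmult)
  have [measurable]: "(%x. ennreal (I 3 e x / e^4) * indicator W x) : borel_measurable borel" by (rule I_measurable[OF e])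
  have [measurable]: "W : sets borel" by simp
  show "(%x. ennreal (I 3 e x / e^4) * indicator W x + ennreal eta * indicator W x) : borel_measurable lborel" by measurable
 qed
 also have "... <= ennreal B * ((\<integral>\<^sup>+x\<in>W. ennreal (I 3 e x / e^4) \<partial>lborel) + ennreal eta * ennreal m)"
 proof (rule mult_left_mono)
  show "(\<integral>\<^sup>+x. ennreal (I 3 e x / e^4) * indicator W x + ennreal eta * indicator W x \<partial>lborel) <= (\<integral>\<^sup>+x\<in>W. ennreal (I 3 e x / e^4) \<partial>lborel) + ennreal eta * ennreal m"
  proof -
  have [measurable]: "(%x. ennreal (I 3 e x / e^4) * indicator W x) : borel_measurable borel" by (rule I_measurable[OF e])
  have [measurable]: "W : sets borel" by simp
  have "(\<integral>\<^sup>+x. ennreal (I 3 e x / e^4) * indicator W x + ennreal eta * indicator W x \<partial>lborel)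
   = (\<integral>\<^sup>+x\<in>W. ennreal (I 3 e x / e^4) \<partial>lborel) + (\<integral>\<^sup>+x. ennreal eta * indicator W x \<partial>lborel)"
   by (rule nn_integral_add) measurable
  moreover have "(\<integral>\<^sup>+x. ennreal eta * indicator W x \<partial>lborel) = ennreal eta * ennreal m"
   using m(2) by (subst nn_integral_cmult_indicator) auto
  ultimately show ?thesis by simp
  qed
 qed simp
 also have "... <= ennreal B * (ennreal eta + ennreal eta * ennreal m)"
  by (intro mult_left_mono add_right_mono elim(3)) simp
 also have "... = ennreal (B * (eta + eta * m))"
 proof -
  have "ennreal (B * (eta + eta * m)) = ennreal B * ennreal (eta + eta * m)" using B by (intro ennreal_mult') simp
  also have "ennreal (eta + eta * m) = ennreal eta + ennreal (eta * m)" using eta(1) m(1) by (intro ennreal_plus) auto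
  also have "ennreal (eta * m) = ennreal eta * ennreal m" using eta(1) by (intro ennreal_mult') simp
  finally show ?thesis ..
 qed
 finally have "(LINT x:W|lborel. f e x) <= B * (eta + eta * m)"
  using B eta(1) m(1) by (subst (asm) ennreal_le_iff) auto
 moreover have "(LINT x:W|lborel. f e x) >= 0" by (rule set_integral_nonneg) (rule f(2))
 ultimately show ?case using eta(3) by (simp add: dist_real_def)
 qed
qed
show "((%e. LINT x:W|lborel. T e x * Gs e x) \<longlongrightarrow> 0) (at_right 0)"
 by (rule lim) (use point in \<open>auto intro!: continuous_intros T_cont Gs_cont mult_nonneg_nonneg T_nonneg Gs_nonneg\<close>)
show "((%e. LINT x:W|lborel. (Gs e x)^2) \<longlongrightarrow> 0) (at_right 0)"
 by (rule lim) (use point in \<open>auto intro!: continuous_intros Gs_cont\<close>)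
qed

text \<open>An oscillation of size o(sqrt e) makes \<open>I 2 / e^3\<close> tend to zero uniformly,
  so \<open>Gs\<close> is uniformly small; multiplying it by \<open>T\<close> then needs no more
  than the L^1 bound \<open>A\<close>.\<close>

lemma errors_vanish_BV:
assumes hol: "!!k i eta. eta > 0 ==> EV e. ALL x:Kr. ALL y:cball x e. abs (pd i (u k) y - pd i (u k) x) <= eta * sqrt e"
 and BV: "EV e. (LINT x:W|lborel. T e x) <= A"
shows "((%e. LINT x:W|lborel. T e x * Gs e x) \<longlongrightarrow> 0) (at_right 0)"
 "((%e. LINT x:W|lborel. (Gs e x)^2) \<longlongrightarrow> 0) (at_right 0)"
proof -
obtain C where C: "C > 0" "!!e x. 0 < e ==> e <= r ==> x : Kr ==> Gs e x <= C * (I 2 e x / e^3 + e)"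
 using Gs_bound by blast
have Gs_small: "EV e. ALL x:Kr. Gs e x <= delta" if delta: "delta > 0" for delta
proof -
 \<comment> \<open>Chosen so that the oscillation part \<open>4 * (6 * eta)^2\<close> equals
   \<open>delta / (2 * C)\<close>; the summand \<open>e\<close> takes the other half.\<close>
 define eta where "eta = sqrt (delta / (8 * C)) / 6"
 have q: "delta / (8 * C) > 0" using delta C by simp
 have eta: "eta > 0" using q by (simp add: eta_def)
 have eta2: "(6 * eta)^2 = delta / (8 * C)" using q by (simp add: eta_def)
 have "((%e::real. e) \<longlongrightarrow> 0) (at_right 0)" by (auto intro!: tendsto_eq_intros)
 moreover have "delta / (2 * C) > 0" using delta C by simp
 ultimately have "\<forall>\<^sub>F e in at_right (0::real). e < delta / (2 * C)" by (rule order_tendstoD)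
 with small s_le_eventually[OF hol[OF eta]] show ?thesis
 proof eventually_elim
 case (elim e)
 have e: "0 < e" "e <= r" using elim by auto
 show ?case
 proof
  fix x assume x: "x : Kr"
  have "s x y <= 6 * eta * sqrt e" if "y : cball x e" for y using elim(2) x that by (simp add: mult.assoc)
  from I_le[OF x e this, of 2] have "I 2 e x <= 4 * e^2 * ((6 * eta)^2 * e)"
  using eta e by (simp add: power_mult_distrib)
  then have "I 2 e x / e^3 <= 4 * (6 * eta)^2" using e by (simp add: field_simps eval_nat_numeral)
  then have "I 2 e x / e^3 + e <= 4 * (delta / (8 * C)) + delta / (2 * C)" using elim(3) unfolding eta2 by linarith
  then have "C * (I 2 e x / e^3 + e) <= C * (4 * (delta / (8 * C)) + delta / (2 * C))" using C(1) by (intro mult_left_mono) auto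
  also have "... = delta" using C(1) by (simp add: field_simps)
  finally show "Gs e x <= delta" using C(2)[OF e x] by simp
 qed
 qed
qed
have A0: "A >= 0"
proof -
 from BV obtain e where "(LINT x:W|lborel. T e x) <= A" using eventually_happens[OF BV] by auto
 moreover have "(LINT x:W|lborel. T e x) >= 0" by (rule set_integral_nonneg) (rule T_nonneg)
 ultimately show ?thesis by linarith
qed
define m where "m = measure lborel W"
have m: "m >= 0" by (simp add: m_def)
show "((%e. LINT x:W|lborel. T e x * Gs e x) \<longlongrightarrow> 0) (at_right 0)"
proof (rule tendstoI)
 fix delta :: real assume delta: "delta > 0"
 define q where "q = delta / (A + 1)"
 have q: "q > 0" "q * A < delta" using delta A0 by (auto simp: q_def field_simps)
 from small BV Gs_small[OF q(1)] show "EV e. dist (LINT x:W|lborel. T e x * Gs e x) 0 < delta"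
 proof eventually_elim
 case (elim e)
 have e: "e > 0" using elim by simp
 have i: "set_integrable lborel W (%x. T e x * Gs e x)" "set_integrable lborel W (T e)"
  by (intro Kr_integrable continuous_intros T_cont Gs_cont e)+
 have "(LINT x:W|lborel. T e x * Gs e x) <= (LINT x:W|lborel. q * T e x)"
 proof (rule set_integral_mono[OF i(1) set_integrable_mult_right[OF i(2)]])
  fix x assume "x : W"
  then have "Gs e x <= q" using elim(3) W_bounded(3) by blast
  from mult_left_mono[OF this T_nonneg[of e x]] show "T e x * Gs e x <= q * T e x" by (simp add: mult.commute)
 qed
 also have "... = q * (LINT x:W|lborel. T e x)" by simp
 also have "... <= q * A" using elim(2) q by (intro mult_left_mono) auto
 finally have "(LINT x:W|lborel. T e x * Gs e x) < delta" using q(2) by linarith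
 moreover have "(LINT x:W|lborel. T e x * Gs e x) >= 0" by (rule set_integral_nonneg) (simp add: T_nonneg Gs_nonneg)
 ultimately show ?case by (simp add: dist_real_def)
 qed
qed
show "((%e. LINT x:W|lborel. (Gs e x)^2) \<longlongrightarrow> 0) (at_right 0)"
proof (rule tendstoI)
 fix delta :: real assume delta: "delta > 0"
 define q where "q = sqrt (delta / (m + 1))"
 have d: "delta / (m + 1) > 0" using delta m by simp
 have q: "q > 0" "q^2 * m < delta" using delta m d by (auto simp: q_def field_simps)
 from small Gs_small[OF q(1)] show "EV e. dist (LINT x:W|lborel. (Gs e x)^2) 0 < delta"
 proof eventually_elim
 case (elim e)
 have e: "e > 0" using elim by simp
 have i: "set_integrable lborel W (%x. (Gs e x)^2)" "set_integrable lborel W (%x. q^2)"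
  by (intro Kr_integrable continuous_intros Gs_cont e)+
 have "(LINT x:W|lborel. (Gs e x)^2) <= (LINT x:W|lborel. q^2)"
 proof (rule set_integral_mono[OF i])
  fix x assume "x : W"
  then have "Gs e x <= q" using elim(2) W_bounded(3) by blast
  then show "(Gs e x)^2 <= q^2" using Gs_nonneg by (intro power_mono) auto
 qed
 also have "... = q^2 * m" using emeasure_bounded_finite[OF W_bounded(2)] by (simp add: set_integral_def m_def)
 finally have "(LINT x:W|lborel. (Gs e x)^2) < delta" using q(2) by linarith
 moreover have "(LINT x:W|lborel. (Gs e x)^2) >= 0" by (rule set_integral_nonneg) simp
 ultimately show ?case by (simp add: dist_real_def)
 qed
qed
qed

end

section \<open>Convolution with measures\<close>

lemma moll_even: "moll e (x - y) = moll e (y - x)"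
by (simp add: moll_def bump_def norm_minus_commute)

lemma moll_Fubini:
fixes V :: "(real^'n::finite) set"
assumes e: "e > 0" and M: "finite_measure M" "sets M = sets (restrict_space borel V)"
 and c: "c : borel_measurable borel" "!!x. abs (c x) <= B" "bounded S" "!!x. x ~: S ==> c x = 0"
shows "(LINT x|lborel. c x * (LINT y|M. moll e (x - y))) = (LINT y|M. (LINT x|lborel. c x * moll e (x - y)))"
 "integrable lborel (%x. c x * (LINT y|M. moll e (x - y)))"
 "integrable M (%y. moll e (x - y))"
 "integrable M (%y. \<integral>x. c x * moll e (x - y) \<partial>lborel)"
proof -
interpret M: finite_measure M by (rule M)
interpret pair_sigma_finite lborel M ..
obtain C where C: "C > 0" "!!x::real^'n. abs (moll e x) <= C" using moll_bounds[where 'n='n] e by (metis divide_pos_pos zero_less_power)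
have [measurable]: "c : borel_measurable borel" "(moll e :: real^'n => real) : borel_measurable borel"
 using c(1) test_fun_measurable[OF test_fun_moll[OF e]] by auto
\<comment> \<open>\<open>M\<close> lives on the trace sigma-algebra of \<open>V\<close>; the
  inclusion into the whole space makes Borel functions measurable for it.\<close>
have idm[measurable]: "(%y. y) : M \<rightarrow>\<^sub>M borel"
 unfolding measurable_cong_sets[OF M(2) refl] by (rule measurable_restrict_space1) simp
have m1[measurable]: "(%y. moll e (x - y)) : borel_measurable M" for x by measurable
show mi: "integrable M (%y. moll e (x - y))" for x
 by (rule M.integrable_const_bound[where B=C]) (use C in auto)
have m2: "(%(x, y). c x * moll e (x - y)) : borel_measurable (lborel \<Otimes>\<^sub>M M)" by measurable
have "(%(x, y). moll e (x - y)) : borel_measurable (lborel \<Otimes>\<^sub>M M)" by measurable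
from M.borel_measurable_lebesgue_integral[OF this]
have m3[measurable]: "(%x. \<integral>y. moll e (x - y) \<partial>M) : borel_measurable lborel" .
have B0: "B >= 0" using c(2)[of 0] by linarith
obtain r where r: "S <= cball 0 r" using c(3) by (auto simp: bounded_pos subset_iff intro: that)
have gi: "integrable lborel (%x. K * indicator (cball 0 r) (x::real^'n) :: real)" for K
 using emeasure_lborel_cball_finite[of "0::real^'n" r] by (intro integrable_mult_right integrable_real_indicator) auto
have cb: "abs (c x) <= B * indicator (cball 0 r) x" for x
proof (cases "x : cball 0 r")
 case False
 then have "x ~: S" using r by blast
 then show ?thesis using False c(4)[of x] by simp
qed (use c(2)[of x] in simp)
have bI: "abs (\<integral>y. moll e (x - y) \<partial>M) <= C * measure M (space M)" for x
proof -
 have "abs (\<integral>y. moll e (x - y) \<partial>M) <= (LINT y|M. C)"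
 using mi[of x] C(2) integral_norm_bound[of M "%y. moll e (x - y)"]
 by (intro order_trans[OF _ integral_mono[of M "%y. norm (moll e (x - y))" "%y. C"]]) auto
 then show ?thesis by (simp add: mult.commute)
qed
show "integrable lborel (%x. c x * (LINT y|M. moll e (x - y)))"
proof (rule Bochner_Integration.integrable_bound[OF gi[of "B * (C * measure M (space M))"]])
 show "(%x. c x * (LINT y|M. moll e (x - y))) : borel_measurable lborel"
 using c(1) by (intro borel_measurable_times m3) simp
 show "AE x in lborel. norm (c x * (LINT y|M. moll e (x - y))) <= norm (B * (C * measure M (space M)) * indicator (cball 0 r) x)"
 proof (rule AE_I2)
 fix x
 have "abs (c x) * abs (\<integral>y. moll e (x - y) \<partial>M) <= (B * indicator (cball 0 r) x) * (C * measure M (space M))"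
  using C(1) B0 by (intro mult_mono cb bI) auto
 then show "norm (c x * (LINT y|M. moll e (x - y))) <= norm (B * (C * measure M (space M)) * indicator (cball 0 r) x)"
  using B0 C(1) by (simp add: abs_mult mult_ac)
 qed
qed
have int: "integrable (lborel \<Otimes>\<^sub>M M) (%(x, y). c x * moll e (x - y))"
proof (rule Fubini_integrable[OF m2])
 show "AE x in lborel. integrable M (%y. case (x, y) of (x, y) => c x * moll e (x - y))" using mi by auto
 show "integrable lborel (%x. \<integral>y. norm (case (x, y) of (x, y) => c x * moll e (x - y)) \<partial>M)"
 proof (rule Bochner_Integration.integrable_bound[OF gi[of "B * (C * measure M (space M))"]])
 show "(%x. \<integral>y. norm (case (x, y) of (x, y) => c x * moll e (x - y)) \<partial>M) : borel_measurable lborel"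
 proof -
  have "(%(x, y). norm (c x * moll e (x - y))) : borel_measurable (lborel \<Otimes>\<^sub>M M)" by measurable
  from M.borel_measurable_lebesgue_integral[OF this] show ?thesis by simp
 qed
 show "AE x in lborel. norm (LINT y|M. norm (case (x, y) of (x, y) => c x * moll e (x - y))) <= norm (B * (C * measure M (space M)) * indicator (cball 0 r) x)"
 proof (rule AE_I2)
  fix x
  have "(LINT y|M. norm (case (x, y) of (x, y) => c x * moll e (x - y))) = abs (c x) * abs (\<integral>y. moll e (x - y) \<partial>M)"
  by (simp add: abs_mult moll_nonneg[OF e] Bochner_Integration.integral_nonneg)
  also have "... <= (B * indicator (cball 0 r) x) * (C * measure M (space M))"
  using C(1) B0 by (intro mult_mono cb bI) auto
  finally show "norm (LINT y|M. norm (case (x, y) of (x, y) => c x * moll e (x - y))) <= norm (B * (C * measure M (space M)) * indicator (cball 0 r) x)"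
  using B0 C(1) by (simp add: mult_ac Bochner_Integration.integral_nonneg)
 qed
 qed
qed
show "(LINT x|lborel. c x * (LINT y|M. moll e (x - y))) = (LINT y|M. (LINT x|lborel. c x * moll e (x - y)))"
 using Fubini_integral[OF int] by simp
show "integrable M (%y. \<integral>x. c x * moll e (x - y) \<partial>lborel)"
 using integrable_snd[OF int] by simp
qed

lemma pd_reflect:
fixes f :: "real^'n::finite => real"
assumes "!!y. f differentiable (at y)"
shows "pd i (%y. f (x - y)) y = - pd i f (x - y)"
proof -
have "((%y. f (x - y)) has_derivative (%h. frechet_derivative f (at (x - y)) (- h))) (at y)"
 by (rule has_derivative_compose[of "%y. x - y" "%h. - h" _ _ f, OF _ assms[unfolded frechet_derivative_works]])
 (auto intro!: derivative_eq_intros)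
from pd_eqI[OF this, of i] show ?thesis
 using linear_neg[OF linear_frechet_derivative[OF assms[of "x - y"]], of "axis i 1"] by (simp add: pd_def)
qed

lemma test_fun_moll_reflect:
assumes e: "e > 0" and V: "cball x e <= V"
shows "test_fun V (%y. moll e (x - y))"
 "pd j (pd i (%y. moll e (x - y))) = (%y. pd j (pd i (moll e)) (x - y))"
proof -
note t = test_fun_moll[OF e]
have "smooth_on UNIV (%y. moll e (x - y))"
 by (rule smooth_on_compose[OF open_UNIV _ test_fun_smooth[OF t]]) (auto intro!: smooth_on_diff smooth_on_coord)
then show "test_fun V (%y. moll e (x - y))" unfolding test_fun_def
 using V by (intro conjI exI[of _ "cball x e"]) (auto simp: dist_norm intro!: moll_zero[OF e])
have p: "pd i (%y. moll e (x - y)) = (%y. - pd i (moll e) (x - y))"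
 using pd_reflect[where f="moll e", OF test_fun_diffble[OF t]] by auto
have d: "(%y. pd i (moll e) (x - y)) differentiable (at y)" for y
 by (rule differentiable_compose[OF test_fun_diffble[OF test_fun_pd[OF t]]]) simp
show "pd j (pd i (%y. moll e (x - y))) = (%y. pd j (pd i (moll e)) (x - y))"
 unfolding p using pd_uminus[OF d] pd_reflect[where f="pd i (moll e)", OF test_fun_diffble[OF test_fun_pd[OF t]]] by auto
qed

lemma moll_integrable_reflect:
fixes x :: "real^'n::finite"
assumes e: "e > 0"
shows "integrable lborel (%y. moll e (x - y))" "(LINT y|lborel. moll e (x - y)) = 1"
 "integrable lborel (%y. moll e (y - x))" "(LINT y|lborel. moll e (y - x)) = 1"
proof -
have m: "(moll e :: real^'n => real) : borel_measurable borel" by (rule test_fun_measurable[OF test_fun_moll[OF e]])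
show 1: "integrable lborel (%y. moll e (y - x))" "(LINT y|lborel. moll e (y - x)) = 1"
 using integrable_translation[OF test_fun_integrable[OF test_fun_moll[OF e]], of "- x"] integral_translation[OF m, of "- x"] integral_moll[OF e, where 'a='n]
 by simp_all
show "integrable lborel (%y. moll e (x - y))" "(LINT y|lborel. moll e (x - y)) = 1"
 using 1 unfolding moll_even[of e x] by simp_all
qed

text \<open>The kernel is nonnegative with mass one, so the bound passes through with constant 1,
  which the Hoelder estimates and the weak limits use.\<close>

lemma mconv_moll_uniform:
fixes c :: "real^'n::finite => real"
assumes c: "integrable lborel c" and e: "e > 0" and close: "!!y. dist x y <= e ==> abs (c y - c x) <= eta"
shows "abs (mconv (moll e) c x - c x) <= eta"
proof -
note mi = moll_integrable_reflect[OF e, of x] and ci = mconv_integrable[OF test_fun_moll[OF e] c, of x]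
have "mconv (moll e) c x - c x = (LINT y|lborel. moll e (x - y) * c y) - (LINT y|lborel. moll e (x - y) * c x)"
 unfolding mconv_def using mi by simp
also have "... = (LINT y|lborel. moll e (x - y) * c y - moll e (x - y) * c x)"
 using ci mi by (intro bochner_diff[symmetric]) auto
finally have E: "mconv (moll e) c x - c x = ..." .
have "abs (\<integral>y. moll e (x - y) * c y - moll e (x - y) * c x \<partial>lborel) <= (LINT y|lborel. moll e (x - y) * eta)"
proof (rule integral_abs_bound_integral)
 fix y
 show "abs (moll e (x - y) * c y - moll e (x - y) * c x) <= moll e (x - y) * eta"
 proof (cases "dist x y <= e")
 case True
 from mult_left_mono[OF close[OF True] moll_nonneg[OF e, of "x - y"]] show ?thesis
  using moll_nonneg[OF e, of "x - y"] by (simp add: abs_mult right_diff_distrib[symmetric])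
 next
 case False
 then have "moll e (x - y) = 0" by (intro moll_zero[OF e]) (simp add: dist_norm)
 then show ?thesis by simp
 qed
qed (use ci mi in auto)
then show ?thesis unfolding E using mi by simp
qed

text \<open>The part of a finite double integral near the diagonal vanishes.\<close>

lemma nn_integral_near_diagonal:
fixes F :: "'a::euclidean_space => 'a => ennreal"
assumes Fm[measurable]: "(%(x, y). F x y) : borel_measurable (lborel \<Otimes>\<^sub>M lborel)"
 and fin: "(\<integral>\<^sup>+x. \<integral>\<^sup>+y. F x y \<partial>lborel \<partial>lborel) < \<infinity>" and diag: "!!x. F x x = 0" and eta: "eta > 0"
shows "EV e. (\<integral>\<^sup>+x. \<integral>\<^sup>+y. F x y * indicator {y. dist x y <= e} y \<partial>lborel \<partial>lborel) <= ennreal eta"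
proof -
let ?P = "lborel \<Otimes>\<^sub>M lborel :: ('a \<times> 'a) measure"
define t where "t n = 1 / real (Suc n)" for n
define f where "f e z = F (fst z) (snd z) * indicator {z. dist (fst z) (snd z) <= e} z" for e :: real and z :: "'a \<times> 'a"
have Fm2[measurable]: "(%z. F (fst z) (snd z)) : borel_measurable ?P" using Fm by (simp add: case_prod_beta')
have S[measurable]: "{z. dist (fst z) (snd z) <= e} : sets ?P" for e :: real
 unfolding lborel_prod by (simp add: closed_Collect_le continuous_on_dist continuous_on_fst continuous_on_snd continuous_on_id continuous_on_const borel_closed)
have fm[measurable]: "f e : borel_measurable ?P" for e unfolding f_def by measurable
have it: "(\<integral>\<^sup>+x. \<integral>\<^sup>+y. F x y * indicator {y. dist x y <= e} y \<partial>lborel \<partial>lborel) = (\<integral>\<^sup>+z. f e z \<partial>?P)" for e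
 by (subst lborel.nn_integral_fst[OF fm, symmetric]) (simp add: f_def indicator_def)
have fin2: "(\<integral>\<^sup>+z. F (fst z) (snd z) \<partial>?P) < \<infinity>"
 using fin lborel.nn_integral_fst[OF Fm2] by simp
\<comment> \<open>Off the diagonal every point eventually leaves the strip, and on the diagonal the
  integrand is zero by \<open>diag\<close>; finiteness of the whole integral provides the dominating
  function.\<close>
have "(%n. \<integral>\<^sup>+z. f (t n) z \<partial>?P) \<longlonglongrightarrow> (\<integral>\<^sup>+z. 0 \<partial>?P)"
proof (rule nn_integral_dominated_convergence[where w="%z. F (fst z) (snd z)"])
 show "AE z in ?P. (%n. f (t n) z) \<longlonglongrightarrow> 0"
 proof (rule AE_I2)
 fix z :: "'a \<times> 'a"
 show "(%n. f (t n) z) \<longlonglongrightarrow> 0"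
 proof (cases "fst z = snd z")
  case True
  then show ?thesis by (simp add: f_def diag)
 next
  case False
  then have "dist (fst z) (snd z) > 0" by simp
  moreover have "t \<longlonglongrightarrow> 0" unfolding t_def using LIMSEQ_inverse_real_of_nat by (simp add: inverse_eq_divide)
  ultimately have "\<forall>\<^sub>F n in sequentially. t n < dist (fst z) (snd z)" by (rule order_tendstoD(2)[rotated])
  then have "\<forall>\<^sub>F n in sequentially. f (t n) z = 0" by eventually_elim (simp add: f_def)
  then show ?thesis by (rule tendsto_eventually)
 qed
 qed
 show "AE z in ?P. f (t n) z <= F (fst z) (snd z)" for n by (intro AE_I2) (simp add: f_def indicator_def)
qed (use fin2 in auto)
then have "(%n. \<integral>\<^sup>+z. f (t n) z \<partial>?P) \<longlonglongrightarrow> 0" by simp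
then have "\<forall>\<^sub>F n in sequentially. (\<integral>\<^sup>+z. f (t n) z \<partial>?P) < ennreal eta"
 by (rule order_tendstoD(2)) (use eta in simp)
then obtain n where n: "(\<integral>\<^sup>+z. f (t n) z \<partial>?P) < ennreal eta" by (auto simp: eventually_sequentially)
show ?thesis
proof (rule eventually_at_right_0I[of "t n"])
 fix e assume e: "0 < e" "e < t n"
 have "(\<integral>\<^sup>+z. f e z \<partial>?P) <= (\<integral>\<^sup>+z. f (t n) z \<partial>?P)"
 by (rule nn_integral_mono) (use e in \<open>auto simp: f_def indicator_def\<close>)
 then show "(\<integral>\<^sup>+x. \<integral>\<^sup>+y. F x y * indicator {y. dist x y <= e} y \<partial>lborel \<partial>lborel) <= ennreal eta"
 unfolding it using n by simp
qed (simp add: t_def)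
qed

section \<open>Mollification of maps whose second derivatives are measures\<close>

context C1_map
begin

text \<open>Any two finite measures with the right difference qualify; no Jordan decomposition is
  involved, and the sums of their masses serve as bounds.\<close>

definition measure_rep :: "3 => 2 => 2 => (real^2) measure => (real^2) measure => bool" where
"measure_rep k i j M N \<longleftrightarrow> finite_measure M & finite_measure N \<and>
 sets M = sets (restrict_space borel (ball x0 (2 * r))) & sets N = sets (restrict_space borel (ball x0 (2 * r))) \<and>
 eq_distr (ball x0 (2 * r)) (distr_pd i (distr_pd j (distr_of_fun (ball x0 (2 * r)) (u k)))) (%phi. (LINT x|M. phi x) - (LINT x|N. phi x))"

text \<open>The distributional derivative is tested with \<open>moll e (x - y)\<close> as a function
  of \<open>y\<close>, whose support lies in the ball of radius \<open>2 * r\<close> when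
  \<open>x\<close> is in \<open>Kr\<close> and \<open>e < r\<close>.\<close>

lemma pd_ue_measure:
assumes MN: "measure_rep k i j M N" and e: "0 < e" "e < r" and x: "x : Kr"
shows "pd i (pd j (ue e k)) x = (LINT y|M. moll e (x - y)) - (LINT y|N. moll e (x - y))"
proof -
let ?V = "ball x0 (2 * r)"
note t = test_fun_moll[OF e(1), where 'a=2] and ci = cut_integrable[OF u_cont(1)]
have sub: "cball x e <= ?V"
proof
 fix y assume "y : cball x e"
 then show "y : ?V" using x e(2) dist_triangle[of x0 y x] by simp
qed
let ?phi = "%y. moll e (x - y)"
have tf: "test_fun ?V ?phi" by (rule test_fun_moll_reflect(1)[OF e(1) sub])
have p0: "pd j (pd i ?phi) y = 0" if "y ~: cball x e" for y
proof -
 have z: "?phi y = 0" if "y ~: cball x e" for y using that by (intro moll_zero[OF e(1)]) (simp add: dist_norm)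
 show ?thesis by (rule pd_zero_outside[OF closed_cball pd_zero_outside[OF closed_cball z]]) (use that in auto)
qed
have uc: "continuous_on ?V (u k)" using continuous_on_subset[OF u_cont(1) order_trans[OF ball_subset_cball K2U]] .
have "(LINT y|M. ?phi y) - (LINT y|N. ?phi y) = distr_of_fun ?V (u k) (pd j (pd i ?phi))"
 using MN tf unfolding measure_rep_def eq_distr_def distr_pd_def by simp
also have "... = (LINT y:?V|lborel. u k y * pd j (pd i ?phi) y)"
 by (rule continuous_mult_test_fun(1)[OF open_ball uc test_fun_pd[OF test_fun_pd[OF tf]]])
also have "... = (LINT y|lborel. pd i (pd j (moll e)) (x - y) * cut (u k) y)"
 unfolding set_integral_def
proof (rule bochner_cong[OF refl])
 fix y
 have c: "pd j (pd i ?phi) y = pd i (pd j (moll e)) (x - y)"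
 unfolding test_fun_moll_reflect(2)[OF e(1) sub] test_fun_pd_commute[OF t, of i j] ..
 show "indicator ?V y *R (u k y * pd j (pd i ?phi) y) = pd i (pd j (moll e)) (x - y) * cut (u k) y"
 proof (cases "y : cball x e")
 case True
 then have "y : ?V" using sub by blast
 then show ?thesis using c by (simp add: cut_def)
 next
 case False
 then show ?thesis using p0[OF False] c by simp
 qed
qed
also have "... = pd i (pd j (ue e k)) x"
 unfolding ue_def pd_mconv[OF t ci] pd_mconv[OF test_fun_pd[OF t] ci] mconv_def ..
finally show ?thesis by simp
qed

lemma moll_measure_L1:
assumes M: "finite_measure M" "sets M = sets (restrict_space borel (ball x0 (2 * r)))" and e: "e > 0"
shows "set_integrable lborel W (%x. \<integral>y. moll e (x - y) \<partial>M)"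
 "(LINT x:W|lborel. \<integral>y. moll e (x - y) \<partial>M) <= measure M (space M)"
proof -
interpret finite_measure M by (rule M)
have F: "(LINT x|lborel. indicat_real W x * (LINT y|M. moll e (x - y))) = (LINT y|M. (LINT x|lborel. indicat_real W x * moll e (x - y)))"
 "integrable lborel (%x. indicat_real W x * (LINT y|M. moll e (x - y)))"
 "integrable M (%y. \<integral>x. indicat_real W x * moll e (x - y) \<partial>lborel)"
 by (rule moll_Fubini[OF e M, of _ 1 W]; auto simp: indicator_def)+
then show "set_integrable lborel W (%x. \<integral>y. moll e (x - y) \<partial>M)" by (simp add: set_integrable_def)
have "(LINT y|M. (LINT x|lborel. indicat_real W x * moll e (x - y))) <= (LINT y|M. 1)"
proof (rule integral_mono[OF F(3)])
 fix y :: "real^2"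
 have "(LINT x|lborel. indicat_real W x * moll e (x - y)) <= (LINT x|lborel. moll e (x - y))"
 proof (rule integral_mono)
 show "integrable lborel (%x. indicat_real W x * moll e (x - y))"
  using integrable_mult_indicator[OF _ moll_integrable_reflect(3)[OF e, of y], of W] by simp
 qed (use moll_integrable_reflect[OF e, of y] moll_nonneg[OF e] in \<open>auto simp: indicator_def\<close>)
 then show "(LINT x|lborel. indicat_real W x * moll e (x - y)) <= 1" using moll_integrable_reflect(4)[OF e, of y] by simp
qed simp
then show "(LINT x:W|lborel. \<integral>y. moll e (x - y) \<partial>M) <= measure M (space M)"
 using F(1) by (simp add: set_integral_def)
qed

lemma pd2_ue_L1:
assumes MN: "measure_rep k i j M N" and e: "0 < e" "e < r"
shows "(LINT x:W|lborel. abs (pd i (pd j (ue e k)) x)) <= measure M (space M) + measure N (space N)"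
proof -
have M: "finite_measure M" "sets M = sets (restrict_space borel (ball x0 (2 * r)))"
 and N: "finite_measure N" "sets N = sets (restrict_space borel (ball x0 (2 * r)))"
 using MN by (auto simp: measure_rep_def)
note m = moll_measure_L1[OF M e(1)] moll_measure_L1[OF N e(1)]
have i: "set_integrable lborel W (%x. abs (pd i (pd j (ue e k)) x))"
proof -
 have "continuous_on Kr (%x. abs (pd i (pd j (ue e k)) x))"
 by (intro continuous_intros smooth_on_cont smooth_on_pd smooth_ue e)
 then show ?thesis using set_integrable_subset[of lborel Kr "%x. abs (pd i (pd j (ue e k)) x)" W]
  borel_integrable_compact[of Kr "%x. abs (pd i (pd j (ue e k)) x)"]
 by (auto simp: set_integrable_def)
qed
have "(LINT x:W|lborel. abs (pd i (pd j (ue e k)) x)) <= (LINT x:W|lborel. (LINT y|M. moll e (x - y)) + (LINT y|N. moll e (x - y)))"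
proof (rule set_integral_mono[OF i set_integral_add(1)[OF m(1,3)]])
 fix x assume "x : W"
 then have "x : Kr" by simp
 moreover have "(LINT y|M. moll e (x - y)) >= 0" "(LINT y|N. moll e (x - y)) >= 0"
 by (intro Bochner_Integration.integral_nonneg moll_nonneg[OF e(1)])+
 ultimately show "abs (pd i (pd j (ue e k)) x) <= (LINT y|M. moll e (x - y)) + (LINT y|N. moll e (x - y))"
 using pd_ue_measure[OF MN e] by (simp add: abs_le_iff)
qed
also have "... = (LINT x:W|lborel. (LINT y|M. moll e (x - y))) + (LINT x:W|lborel. (LINT y|N. moll e (x - y)))"
 by (rule set_integral_add(2)[OF m(1,3)])
also have "... <= measure M (space M) + measure N (space N)" by (intro add_mono m)
finally show ?thesis .
qed

text \<open>By Fubini and the evenness of the mollifier the convolution moves from the measure to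
  \<open>c\<close>, which is uniformly continuous; finite mass turns uniform convergence into
  convergence of the integrals.\<close>

lemma moll_measure_limit:
assumes M: "finite_measure M" "sets M = sets (restrict_space borel (ball x0 (2 * r)))"
 and c: "continuous_on UNIV c" "compact K" "!!x. x ~: K ==> c x = 0"
shows "((%e. \<integral>x. c x * (LINT y|M. moll e (x - y)) \<partial>lborel) \<longlongrightarrow> (LINT y|M. c y)) (at_right 0)"
 "e > 0 ==> integrable lborel (%x. c x * (LINT y|M. moll e (x - y)))"
proof -
interpret finite_measure M by (rule M)
obtain B where B: "!!x. abs (c x) <= B" using continuous_zero_outside_compact_bounded[OF c] by blast
have cm[measurable]: "c : borel_measurable borel" by (rule borel_measurable_continuous_onI[OF c(1)])
have ci: "integrable lborel c" by (rule continuous_compact_support_integrable[OF continuous_on_subset[OF c(1)] c(2,3)]) auto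
show "e > 0 ==> integrable lborel (%x. c x * (LINT y|M. moll e (x - y)))" for e
 by (rule moll_Fubini(2)[OF _ M cm B compact_imp_bounded[OF c(2)] c(3)])
have uc: "uniformly_continuous_on UNIV c"
proof -
 obtain R where R: "K <= cball 0 R" "R > 0" using compact_imp_bounded[OF c(2)] by (auto simp: bounded_pos subset_iff)
 have u1: "uniformly_continuous_on (cball 0 (R + 1)) c"
 by (rule compact_uniformly_continuous[OF continuous_on_subset[OF c(1)] compact_cball]) simp
 show ?thesis unfolding uniformly_continuous_on_def
 proof (intro allI impI)
 fix eta :: real assume "eta > 0"
 then obtain d where d: "d > 0" "!!x y. x : cball 0 (R + 1) ==> y : cball 0 (R + 1) ==> dist y x < d ==> dist (c y) (c x) < eta"
  using u1 unfolding uniformly_continuous_on_def by metis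
 show "EX d>0. ALL x:UNIV. ALL x':UNIV. dist x' x < d --> dist (c x') (c x) < eta"
 proof (intro exI[of _ "min d 1"] conjI ballI impI)
  fix x y :: "real^2" assume yx: "dist y x < min d 1"
  show "dist (c y) (c x) < eta"
  proof (cases "x : K \<or> y : K")
  case True
  then have "norm x <= R \<or> norm y <= R" using R by auto
  moreover have "norm (y - x) < 1" using yx by (simp add: dist_norm)
  ultimately have "norm x <= R + 1" "norm y <= R + 1"
   using norm_triangle_ineq2[of x y] norm_triangle_ineq2[of y x] by (auto simp: norm_minus_commute)
  then show ?thesis using d(2)[of x y] yx by simp
  qed (use c(3) \<open>eta > 0\<close> in auto)
 qed (use d in auto)
 qed
qed
show "((%e. \<integral>x. c x * (LINT y|M. moll e (x - y)) \<partial>lborel) \<longlongrightarrow> (LINT y|M. c y)) (at_right 0)"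
proof (rule tendstoI)
 fix eta :: real assume eta: "eta > 0"
 define q where "q = eta / (measure M (space M) + 1)"
 have q: "q > 0" "q * measure M (space M) < eta" using eta by (auto simp: q_def divide_less_eq add_pos_nonneg add_nonneg_pos)
 obtain d where d: "d > 0" "!!x y. dist y x < d ==> dist (c y) (c x) < q"
 using uc q(1) unfolding uniformly_continuous_on_def by (metis UNIV_I)
 show "EV e. dist (LINT x|lborel. c x * (LINT y|M. moll e (x - y))) (LINT y|M. c y) < eta"
 proof (rule eventually_at_right_0I[OF _ d(1)])
 fix e assume e: "0 < e" "e < d"
 have eq: "(LINT x|lborel. c x * moll e (x - y)) = mconv (moll e) c y" for y
  unfolding mconv_def by (rule bochner_cong[OF refl]) (simp add: moll_even[of e _ y] mult.commute)
 note F = moll_Fubini[OF e(1) M cm B compact_imp_bounded[OF c(2)] c(3)]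
 have cM: "integrable M c"
 proof (rule integrable_const_bound[where B=B])
  have "(%y. y) : M \<rightarrow>\<^sub>M borel" unfolding measurable_cong_sets[OF M(2) refl] by (rule measurable_restrict_space1) simp
  from measurable_compose[OF this cm] show "c : borel_measurable M" .
 qed (use B in auto)
 have mM: "integrable M (mconv (moll e) c)" using F(4) unfolding eq .
 have F1: "(LINT x|lborel. c x * (LINT y|M. moll e (x - y))) = (LINT y|M. mconv (moll e) c y)"
  using F(1) unfolding eq .
 have "(LINT x|lborel. c x * (LINT y|M. moll e (x - y))) - (LINT y|M. c y) = (LINT y|M. mconv (moll e) c y - c y)"
  unfolding F1 by (rule bochner_diff[OF mM cM, symmetric])
 moreover have "abs (\<integral>y. mconv (moll e) c y - c y \<partial>M) <= (LINT y|M. q)"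
 proof -
  have b: "abs (mconv (moll e) c y - c y) <= q" for y
  by (rule mconv_moll_uniform[OF ci e(1)]) (use d(2)[of _ y] e(2) in \<open>force simp: dist_real_def dist_commute intro: less_imp_le\<close>)
  have "norm (LINT y|M. mconv (moll e) c y - c y) <= (LINT y|M. norm (mconv (moll e) c y - c y))" by (rule integral_norm_bound)
  also have "... <= (LINT y|M. q)" using mM cM b by (intro integral_mono) auto
  finally show ?thesis by simp
 qed
 ultimately have "abs ((LINT x|lborel. c x * (LINT y|M. moll e (x - y))) - (LINT y|M. c y)) <= measure M (space M) * q" by simp
 then show "dist (LINT x|lborel. c x * (LINT y|M. moll e (x - y))) (LINT y|M. c y) < eta"
  using q(2) by (simp add: dist_real_def mult.commute)
 qed
qed
qed

text \<open>For a fixed continuous \<open>c\<close> this is weak convergence of the mollified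
  measures. Replacing \<open>c\<close> by \<open>ce e\<close> costs the uniform distance times the
  L^1 norm of the second derivatives, which is bounded by the total masses.\<close>

lemma pd2_ue_weak_limit:
assumes MN: "measure_rep k i j M N"
 and c: "continuous_on UNIV c" "compact K" "K <= W" "!!x. x ~: K ==> c x = 0"
 and ce: "!!eta. eta > 0 ==> EV e. ALL x:W. abs (ce e x - c x) <= eta"
 and cc: "EV e. continuous_on W (ce e)"
shows "((%e. LINT x:W|lborel. ce e x * pd i (pd j (ue e k)) x) \<longlongrightarrow> (LINT x|M. c x) - (LINT x|N. c x)) (at_right 0)"
proof -
have M: "finite_measure M" "sets M = sets (restrict_space borel (ball x0 (2 * r)))"
 and N: "finite_measure N" "sets N = sets (restrict_space borel (ball x0 (2 * r)))"
 using MN by (auto simp: measure_rep_def)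
define A where "A = measure M (space M) + measure N (space N)"
have A: "A >= 0" by (simp add: A_def)
let ?D = "%e. pd i (pd j (ue e k))"
have Dc: "continuous_on S (?D e)" if "e > 0" for S e
 by (intro smooth_on_cont smooth_on_pd smooth_ue that)
have Kri: "set_integrable lborel W h" if "continuous_on Kr h" for h :: "fun2"
 using set_integrable_subset[of lborel Kr h W] borel_integrable_compact[of Kr h] that by (auto simp: set_integrable_def)
have sm: "EV e. 0 < e & e < r" by (rule small)
have cK: "continuous_on Kr c" by (rule continuous_on_subset[OF c(1)]) simp
have W: "open W" "bounded W" "W <= Kr" by auto
have l2: "((%e. LINT x:W|lborel. c x * ?D e x) \<longlongrightarrow> (LINT x|M. c x) - (LINT x|N. c x)) (at_right 0)"
proof -
 have "EV e. (LINT x|lborel. c x * (LINT y|M. moll e (x - y))) - (LINT x|lborel. c x * (LINT y|N. moll e (x - y))) = (LINT x:W|lborel. c x * ?D e x)"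
 using sm
 proof eventually_elim
 case (elim e)
 have "(LINT x:W|lborel. c x * ?D e x) = (LINT x|lborel. c x * (LINT y|M. moll e (x - y)) - c x * (LINT y|N. moll e (x - y)))"
  unfolding set_integral_def
 proof (rule bochner_cong[OF refl])
  fix x
  show "indicator W x *R (c x * ?D e x) = c x * (LINT y|M. moll e (x - y)) - c x * (LINT y|N. moll e (x - y))"
  proof (cases "x : W")
  case True
  then have "x : Kr" by simp
  then show ?thesis using pd_ue_measure[OF MN _ _ \<open>x : Kr\<close>, of e] elim True by (simp add: right_diff_distrib)
  next
  case False
  then have "x ~: K" using c(3) by blast
  then show ?thesis using False c(4) by simp
  qed
 qed
 then show ?case
  using moll_measure_limit(2)[OF M c(1,2,4), of e] moll_measure_limit(2)[OF N c(1,2,4), of e] elim by simp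
 qed
 from tendsto_cong[THEN iffD1, OF this tendsto_diff[OF moll_measure_limit(1)[OF M c(1,2,4)] moll_measure_limit(1)[OF N c(1,2,4)]]]
 show ?thesis .
qed
have l1: "((%e. (LINT x:W|lborel. ce e x * ?D e x) - (LINT x:W|lborel. c x * ?D e x)) \<longlongrightarrow> 0) (at_right 0)"
proof (rule tendstoI)
 fix eta :: real assume eta: "eta > 0"
 define q where "q = eta / (A + 1)"
 have q: "q > 0" "q * A < eta" using eta A by (auto simp: q_def divide_less_eq)
 from sm cc ce[OF q(1)] show "EV e. dist ((LINT x:W|lborel. ce e x * ?D e x) - (LINT x:W|lborel. c x * ?D e x)) 0 < eta"
 proof eventually_elim
 case (elim e)
 have e: "0 < e" "e < r" using elim by auto
 have i1: "set_integrable lborel W (%x. c x * ?D e x)" by (intro Kri continuous_intros cK Dc e)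
 have i3: "set_integrable lborel W (%x. abs (?D e x))" by (intro Kri continuous_intros Dc e)
 obtain B where B: "ALL x:Kr. abs (?D e x) <= B"
  using compact_imp_bounded[OF compact_continuous_image[OF Dc[OF e(1), of Kr] compact_cball]] unfolding bounded_iff by auto
 have B2: "abs ((ce e x - c x) * ?D e x) <= q * B" if "x : W" for x
  unfolding abs_mult using elim(3) B that q(1) W(3) by (intro mult_mono) auto
 have i2: "set_integrable lborel W (%x. (ce e x - c x) * ?D e x)"
  by (rule bounded_continuous_set_integrable[OF W(1,2) _ B2]) (intro continuous_intros elim(2) continuous_on_subset[OF c(1)] Dc e, auto)
 have "(LINT x:W|lborel. ce e x * ?D e x) = (LINT x:W|lborel. (ce e x - c x) * ?D e x + c x * ?D e x)"
  by (simp add: algebra_simps)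
 then have E: "(LINT x:W|lborel. ce e x * ?D e x) - (LINT x:W|lborel. c x * ?D e x) = (LINT x:W|lborel. (ce e x - c x) * ?D e x)"
  using i1 i2 by (simp add: set_integral_add)
 have "abs (LINT x:W|lborel. (ce e x - c x) * ?D e x) <= (LINT x:W|lborel. q * abs (?D e x))"
 proof (rule set_integral_abs_le[OF i2 set_integrable_mult_right[OF i3]])
  fix x assume "x : W"
  then show "abs ((ce e x - c x) * ?D e x) <= q * abs (?D e x)" unfolding abs_mult using elim(3) by (intro mult_right_mono) auto
 qed
 also have "... = q * (LINT x:W|lborel. abs (?D e x))" by simp
 also have "... <= q * A" using pd2_ue_L1[OF MN e] q(1) unfolding A_def by (intro mult_left_mono) auto
 also have "... < eta" by (rule q)
 finally show ?case unfolding E by (simp add: dist_real_def)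
 qed
qed
from tendsto_add[OF l1 l2] show ?thesis by simp
qed

end

text \<open>For these parameters the exponent of the distance is 2 + (2/3) * 3 = 4, so real powers
  become cubes and fourth powers. The function \<open>w'\<close> leaves room for a globally Borel
  representative of a function known only on \<open>V\<close>.\<close>

lemma gagliardo_lborel:
fixes w :: "fun2"
assumes "!!x. x : V ==> w' x = w x"
shows "gagliardo (2/3) 3 V w = (\<integral>\<^sup>+x. \<integral>\<^sup>+y. indicator V x * indicator V y * ennreal (abs (w' x - w' y) ^ 3 / dist x y ^ 4) \<partial>lborel \<partial>lborel)"
unfolding gagliardo_def nn_integral_completion
proof (rule nn_integral_cong)
fix x
have e: "abs (w x - w y) powr 3 / dist x y powr (real CARD(2) + 2/3 * 3) = abs (w x - w y) ^ 3 / dist x y ^ 4" for y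
proof (cases "x = y")
 case False
 then have "dist x y powr (real CARD(2) + 2/3 * 3) = dist x y ^ 4" by (simp add: powr_numeral)
 then show ?thesis by simp
qed simp
show "(\<integral>\<^sup>+y\<in>V. ennreal (abs (w x - w y) powr 3 / dist x y powr (real CARD(2) + 2/3 * 3)) \<partial>lborel) * indicator V x
 = (\<integral>\<^sup>+y. indicator V x * indicator V y * ennreal (abs (w' x - w' y) ^ 3 / dist x y ^ 4) \<partial>lborel)"
proof (cases "x : V")
 case True
 have "ennreal (abs (w x - w y) powr 3 / dist x y powr (real CARD(2) + 2/3 * 3)) * indicator V y
 = indicator V x * indicator V y * ennreal (abs (w' x - w' y) ^ 3 / dist x y ^ 4)" for y
 unfolding e using True by (cases "y : V") (simp_all add: assms)
 then show ?thesis using True by simp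
qed simp
qed

section \<open>Bounds on the mollified derivatives from the two regularity classes\<close>

context C1_metric_map
begin

lemma T_L1_bounded:
assumes "!!k i j. EX M N. measure_rep k i j M N"
shows "EX A. EV e. (LINT x:W|lborel. T e x) <= A"
proof -
obtain M N where MN: "!!k i j. measure_rep k i j (M k i j) (N k i j)" using assms by metis
let ?A = "SU k. SU i. SU j. measure (M k j i) (space (M k j i)) + measure (N k j i) (space (N k j i))"
have "EV e. (LINT x:W|lborel. T e x) <= ?A"
 using small
proof eventually_elim
 case (elim e)
 have e: "0 < e" "e < r" using elim by auto
 have i: "set_integrable lborel W (%x. abs (pd j (pd i (ue e k)) x))" for i j k
 by (intro Kr_integrable continuous_intros smooth_on_cont smooth_on_pd smooth_ue e)
 have "(LINT x:W|lborel. T e x) = (SU k. SU i. SU j. LINT x:W|lborel. abs (pd j (pd i (ue e k)) x))"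
 unfolding T_def set_integral_def scaleR_sum_right
 by (simp only: bochner_sum bochner_integrable_sum i[unfolded set_integrable_def])
 also have "... <= ?A" by (intro sum_mono pd2_ue_L1[OF MN e])
 finally show ?case .
qed
then show ?thesis by blast
qed

text \<open>On the disc of radius \<open>e\<close> the distance is at most \<open>e\<close>, so
  \<open>1 / e^4\<close> is at most the Gagliardo weight. The left side is thus bounded by the part
  of the seminorm near the diagonal.\<close>

lemma I3_vanishes:
assumes gag: "!!k i. gagliardo (2/3) 3 (ball x0 (2 * r)) (pd i (u k)) < \<infinity>" and eta: "eta > 0"
shows "EV e. (\<integral>\<^sup>+x\<in>W. ennreal (I 3 e x / e^4) \<partial>lborel) <= ennreal eta"
proof -
let ?V = "ball x0 (2 * r)"
define F where "F k i x y = ennreal (indicator ?V x * indicator ?V y * (abs (cut (pd i (u k)) x - cut (pd i (u k)) y) ^ 3 / dist x y ^ 4))" for k i x y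
have [measurable]: "cut (pd i (u k)) : borel_measurable borel" for i k
 using borel_measurable_integrable[OF cut_integrable[OF u_cont(2)], of i k] by simp
have Vm[measurable]: "?V : sets borel" by simp
have Fm[measurable]: "(%(x, y). F k i x y) : borel_measurable (lborel \<Otimes>\<^sub>M lborel)" for k i unfolding F_def by measurable
have Fm1[measurable]: "F k i x : borel_measurable lborel" for k i x unfolding F_def by measurable
have Ffin: "(\<integral>\<^sup>+x. \<integral>\<^sup>+y. F k i x y \<partial>lborel \<partial>lborel) < \<infinity>" for k i
proof -
 have "cut (pd i (u k)) x = pd i (u k) x" if "x : ?V" for x using that by (simp add: cut_def)
 from gagliardo_lborel[where V="?V" and w'="cut (pd i (u k))", OF this]
 have "gagliardo (2/3) 3 ?V (pd i (u k)) = (\<integral>\<^sup>+x. \<integral>\<^sup>+y. F k i x y \<partial>lborel \<partial>lborel)"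
 proof (rule trans)
 have "indicator ?V x * indicator ?V y * ennreal c = ennreal (indicator ?V x * indicator ?V y * c)" for x y c
  by (simp add: indicator_def)
 then show "(\<integral>\<^sup>+x. \<integral>\<^sup>+y. indicator ?V x * indicator ?V y * ennreal (abs (cut (pd i (u k)) x - cut (pd i (u k)) y) ^ 3 / dist x y ^ 4) \<partial>lborel \<partial>lborel)
  = (\<integral>\<^sup>+x. \<integral>\<^sup>+y. F k i x y \<partial>lborel \<partial>lborel)" unfolding F_def by simp
 qed
 then show ?thesis using gag[of i k] by simp
qed
have cube: "s x y ^ 3 <= 216 * (SU k. SU i. abs (pd i (u k) x - pd i (u k) y) ^ 3)" for x y
proof -
 let ?S = "SU k. SU i. abs (pd i (u k) x - pd i (u k) y) ^ 3"
 have S0: "?S >= 0" by (intro sum_nonneg) simp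
 have "abs (pd i (u k) y - pd i (u k) x) <= root 3 ?S" for k i
 proof -
 have "abs (pd i (u k) x - pd i (u k) y) ^ 3 <= (SU i. abs (pd i (u k) x - pd i (u k) y) ^ 3)"
  by (rule member_le_sum) auto
 also have "... <= ?S"
  by (rule member_le_sum[of k UNIV "%k. SU i. abs (pd i (u k) x - pd i (u k) y) ^ 3"]) (auto intro: sum_nonneg)
 finally have "root 3 (abs (pd i (u k) x - pd i (u k) y) ^ 3) <= root 3 ?S" by (intro real_root_le_mono) auto
 then show ?thesis by (simp add: real_root_power_cancel abs_minus_commute)
 qed
 then have "s x y <= (\<Sum>k\<in>(UNIV::3 set). \<Sum>i\<in>(UNIV::2 set). root 3 ?S)" unfolding s_def by (intro sum_mono)
 then have "s x y <= 6 * root 3 ?S" by simp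
 then have "s x y ^ 3 <= (6 * root 3 ?S) ^ 3" by (intro power_mono s_nonneg)
 also have "... = 216 * ?S" using S0 by (simp add: power_mult_distrib)
 finally show ?thesis .
qed
\<comment> \<open>1296 is 216 * 6: the cube of a sum of six oscillations costs \<open>6 ^ 3\<close>,
  and six kernels are then added up.\<close>
have "EV e. ALL k:(UNIV::3 set). ALL i:(UNIV::2 set). (\<integral>\<^sup>+x. \<integral>\<^sup>+y. F k i x y * indicator {y. dist x y <= e} y \<partial>lborel \<partial>lborel) <= ennreal (eta / 1296)"
 by (intro eventually_ball_finite ballI nn_integral_near_diagonal[OF Fm Ffin]) (use eta in \<open>auto simp: F_def\<close>)
with small show ?thesis
proof eventually_elim
 case (elim e)
 have e: "0 < e" "e <= r" "e < r" using elim by auto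
 have inner: "ennreal (I 3 e x / e^4) * indicator W x <= (SU k. SU i. 216 * (\<integral>\<^sup>+y. F k i x y * indicator {y. dist x y <= e} y \<partial>lborel))" for x
 proof (cases "x : W")
 case True
 then have xK: "x : Kr" by simp
 have xV: "x : ?V" using True r by simp
 have sub: "cball x e <= ?V"
 proof
  fix y assume "y : cball x e"
  then show "y : ?V" using xK e(3) dist_triangle[of x0 y x] by simp
 qed
 have si: "integrable lborel (%y. indicator (cball x e) y *R (s x y ^ 3))" using s_int[OF xK e(2), of 3] by (simp add: set_integrable_def)
 have "I 3 e x / e^4 = (LINT y|lborel. indicator (cball x e) y *R (s x y ^ 3) / e^4)"
  unfolding I_def set_integral_def by simp
 then have "ennreal (I 3 e x / e^4) = (\<integral>\<^sup>+y. ennreal (indicator (cball x e) y *R (s x y ^ 3) / e^4) \<partial>lborel)"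
  using si e s_nonneg by (subst nn_integral_eq_integral) auto
 also have "... <= (\<integral>\<^sup>+y. (SU k. SU i. 216 * (F k i x y * indicator {y. dist x y <= e} y)) \<partial>lborel)"
 proof (rule nn_integral_mono)
  fix y
  show "ennreal (indicator (cball x e) y *R (s x y ^ 3) / e^4) <= (SU k. SU i. 216 * (F k i x y * indicator {y. dist x y <= e} y))"
  proof (cases "y : cball x e & x ~= y")
  case y: True
  then have yV: "y : ?V" using sub by blast
  have c: "cut (pd i (u k)) x = pd i (u k) x" "cut (pd i (u k)) y = pd i (u k) y" for i k
   using xV yV by (auto simp: cut_def)
  have d: "0 < dist x y" "dist x y <= e" using y by auto
  have "s x y ^ 3 / e^4 <= s x y ^ 3 / dist x y ^ 4"
   using d e s_nonneg by (intro divide_left_mono power_mono mult_pos_pos) auto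
  also have "... <= 216 * (SU k. SU i. abs (pd i (u k) x - pd i (u k) y) ^ 3) / dist x y ^ 4"
   using d by (intro divide_right_mono cube) auto
  also have "... = (SU k. SU i. 216 * (abs (pd i (u k) x - pd i (u k) y) ^ 3 / dist x y ^ 4))"
   by (simp add: sum_distrib_left sum_divide_distrib)
  finally have "ennreal (s x y ^ 3 / e^4) <= ennreal (SU k. SU i. 216 * (abs (pd i (u k) x - pd i (u k) y) ^ 3 / dist x y ^ 4))"
   by (rule ennreal_leI)
  also have "... = (SU k. SU i. 216 * (F k i x y * indicator {y. dist x y <= e} y))"
  proof -
   have r: "216 * (F k i x y * indicator {y. dist x y <= e} y) = ennreal (216 * (abs (pd i (u k) x - pd i (u k) y) ^ 3 / dist x y ^ 4))" for k i
   using d xV yV ennreal_mult'[of 216 "abs (pd i (u k) x - pd i (u k) y) ^ 3 / dist x y ^ 4"] by (simp add: F_def c)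
   show ?thesis unfolding r by (simp add: sum_nonneg)
  qed
  finally show ?thesis using y by simp
  next
  case False
  then have "indicator (cball x e) y *R (s x y ^ 3) / e^4 = 0" by (auto simp: s_def indicator_def)
  then show ?thesis by (simp only: ennreal_0) simp
  qed
 qed
 also have "... = (SU k. SU i. 216 * (\<integral>\<^sup>+y. F k i x y * indicator {y. dist x y <= e} y \<partial>lborel))"
 proof -
  have [measurable]: "{y. dist x y <= e} : sets borel" using closed_cball[of x e] by (simp add: cball_def borel_closed)
  show ?thesis by (simp add: nn_integral_sum nn_integral_cmult)
 qed
 finally show ?thesis using True by simp
 qed simp
 have S[measurable]: "(%x. \<integral>\<^sup>+y. F k i x y * indicator {y. dist x y <= e} y \<partial>lborel) : borel_measurable lborel" for k i
 proof -
 have "(%(x, y). F k i x y * indicator {z. dist (fst z) (snd z) <= e} (x, y)) : borel_measurable (lborel \<Otimes>\<^sub>M lborel)"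
 proof -
  have [measurable]: "{z. dist (fst z) (snd z) <= e} : sets (lborel \<Otimes>\<^sub>M (lborel :: (real^2) measure))"
  unfolding lborel_prod by (simp add: closed_Collect_le continuous_on_dist continuous_on_fst continuous_on_snd continuous_on_id continuous_on_const borel_closed)
  show ?thesis by measurable
 qed
 from lborel.borel_measurable_nn_integral[OF this] show ?thesis by (simp add: indicator_def)
 qed
 have "(\<integral>\<^sup>+x\<in>W. ennreal (I 3 e x / e^4) \<partial>lborel) <= (\<integral>\<^sup>+x. (SU k. SU i. 216 * (\<integral>\<^sup>+y. F k i x y * indicator {y. dist x y <= e} y \<partial>lborel)) \<partial>lborel)"
 by (intro nn_integral_mono inner)
 also have "... = (SU k. SU i. 216 * (\<integral>\<^sup>+x. \<integral>\<^sup>+y. F k i x y * indicator {y. dist x y <= e} y \<partial>lborel \<partial>lborel))"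
 by (simp add: nn_integral_sum nn_integral_cmult)
 also have "... <= (\<Sum>k\<in>(UNIV::3 set). \<Sum>i\<in>(UNIV::2 set). 216 * ennreal (eta / 1296))"
 using elim(2) by (intro sum_mono mult_left_mono) auto
 also have "... = ennreal eta"
 proof -
 have "(216::ennreal) * ennreal (eta / 1296) = ennreal (eta / 6)"
  using eta ennreal_mult'[of 216 "eta / 1296"] by simp
 moreover have "(6::ennreal) * ennreal (eta / 6) = ennreal eta" using eta ennreal_mult'[of 6 "eta / 6"] by simp
 ultimately show ?thesis by (simp add: mult.assoc[symmetric])
 qed
 finally show ?case .
qed
qed

end

section \<open>Change of variables to the graph\<close>

lemma UNIV_2_sum: "(\<Sum>i\<in>(UNIV::2 set). h i) = h 1 + (h 2 :: real)"
by (simp add: UNIV_2)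

locale C1_graph =
fixes U U' :: "(real^2) set" and u :: "3 => fun2" and Psi Phi :: "real^2 => real^2" and f :: "fun2"
assumes U: "open U" and U': "open U'" and u: "!!k. Ck_on 1 U (u k)"
 and Psi: "!!x. Psi x = vector [u 1 x, u 2 x]"
 and hom: "homeomorphism U U' Psi Phi" and Phi: "Ck_on 1 U' Phi"
 and f: "!!y. y : U' ==> f y = u 3 (Phi y)"
begin

definition J :: "fun2" where "J x = pd 1 (u 1) x * pd 2 (u 2) x - pd 2 (u 1) x * pd 1 (u 2) x"
definition p1 :: "fun2" where "p1 x = (pd 1 (u 3) x * pd 2 (u 2) x - pd 2 (u 3) x * pd 1 (u 2) x) / J x"
definition p2 :: "fun2" where "p2 x = (pd 1 (u 1) x * pd 2 (u 3) x - pd 2 (u 1) x * pd 1 (u 3) x) / J x"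

lemma Phi_in: "y : U' ==> Phi y : U" and Psi_in: "x : U ==> Psi x : U'"
and PhiPsi: "x : U ==> Phi (Psi x) = x" and PsiPhi: "y : U' ==> Psi (Phi y) = y"
using hom unfolding homeomorphism_def by blast+

lemma Psi_cont: "continuous_on U Psi" and Phi_cont: "continuous_on U' Phi"
using hom unfolding homeomorphism_def by blast+

lemma Psi_inj: "inj_on Psi U"
by (rule inj_on_inverseI[of _ Phi]) (rule PhiPsi)

lemma u_cont: "continuous_on U (u k)" "continuous_on U (pd i (u k))"
using Ck_on_imp_continuous_on[OF u] u[of k] by simp_all

lemma u_diff: "x : U ==> u k differentiable (at x)"
using u[of k] by simp

lemma Phi_nth: "Ck_on 1 U' (%y. Phi y $ a)"
by (rule Ck_on_vec_nth[OF U' Phi])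

lemma pd_u_Phi:
assumes "y : U'"
shows "pd i (%y. u k (Phi y)) y = pd 1 (u k) (Phi y) * pd i (%y. Phi y $ 1) y + pd 2 (u k) (Phi y) * pd i (%y. Phi y $ 2) y"
proof -
have "Phi differentiable (at y)" using Phi assms by simp
from pd_compose[OF u_diff[OF Phi_in[OF assms]] this] show ?thesis by (simp add: UNIV_2_sum)
qed

lemma u_Phi: "y : U' ==> u 1 (Phi y) = y $ 1" "y : U' ==> u 2 (Phi y) = y $ 2"
using PsiPhi[of y] Psi[of "Phi y"] by (metis vector_2)+

text \<open>Differentiating \<open>Psi (Phi y) = y\<close> gives a matrix identity: its determinant
  shows that \<open>J\<close> does not vanish, and solving it gives the entries of the derivative of
  \<open>Phi\<close>.\<close>

lemma inverse_jacobian: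
assumes y: "y : U'"
shows "J (Phi y) ~= 0"
 "pd 1 (%y. Phi y $ 1) y = pd 2 (u 2) (Phi y) / J (Phi y)" "pd 2 (%y. Phi y $ 1) y = - pd 2 (u 1) (Phi y) / J (Phi y)"
 "pd 1 (%y. Phi y $ 2) y = - pd 1 (u 2) (Phi y) / J (Phi y)" "pd 2 (%y. Phi y $ 2) y = pd 1 (u 1) (Phi y) / J (Phi y)"
proof -
have id: "pd i (%y. u 1 (Phi y)) y = (if i = 1 then 1 else 0)" "pd i (%y. u 2 (Phi y)) y = (if i = 2 then 1 else 0)" for i
 using pd_cong_open[OF U' y, where f="%y. u 1 (Phi y)" and g="%y. y $ 1"]
 pd_cong_open[OF U' y, where f="%y. u 2 (Phi y)" and g="%y. y $ 2"] by (simp_all add: u_Phi pd_coord)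
define a b c d where "a = pd 1 (u 1) (Phi y)" and "b = pd 2 (u 1) (Phi y)" and "c = pd 1 (u 2) (Phi y)" and "d = pd 2 (u 2) (Phi y)"
define a' b' c' d' where "a' = pd 1 (%y. Phi y $ 1) y" and "b' = pd 2 (%y. Phi y $ 1) y" and "c' = pd 1 (%y. Phi y $ 2) y" and "d' = pd 2 (%y. Phi y $ 2) y"
note defs = a_def b_def c_def d_def a'_def b'_def c'_def d'_def
have e: "a * a' + b * c' = 1" "a * b' + b * d' = 0" "c * a' + d * c' = 0" "c * b' + d * d' = 1"
 using id(1)[of 1] id(1)[of 2] id(2)[of 1] id(2)[of 2] unfolding pd_u_Phi[OF y] defs by simp_all
have J: "J (Phi y) = a * d - b * c" by (simp add: J_def defs)
have "(a * d - b * c) * (a' * d' - b' * c') = (a * a' + b * c') * (c * b' + d * d') - (a * b' + b * d') * (c * a' + d * c')" by algebra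
then have "(a * d - b * c) * (a' * d' - b' * c') = 1" by (simp add: e)
then have nz: "a * d - b * c ~= 0" by force
have "a' * (a * d - b * c) = d" "b' * (a * d - b * c) = - b" "c' * (a * d - b * c) = - c" "d' * (a * d - b * c) = a"
 using e by algebra+
with nz show "J (Phi y) ~= 0"
 "pd 1 (%y. Phi y $ 1) y = pd 2 (u 2) (Phi y) / J (Phi y)" "pd 2 (%y. Phi y $ 1) y = - pd 2 (u 1) (Phi y) / J (Phi y)"
 "pd 1 (%y. Phi y $ 2) y = - pd 1 (u 2) (Phi y) / J (Phi y)" "pd 2 (%y. Phi y $ 2) y = pd 1 (u 1) (Phi y) / J (Phi y)"
 unfolding J a_def[symmetric] b_def[symmetric] c_def[symmetric] d_def[symmetric]
 a'_def[symmetric] b'_def[symmetric] c'_def[symmetric] d'_def[symmetric]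
 by (simp_all add: nonzero_eq_divide_eq minus_divide_left del: minus_divide_left[symmetric])
qed

lemma J_nonzero: "x : U ==> J x ~= 0"
using inverse_jacobian(1)[OF Psi_in, of x] by (simp add: PhiPsi)

lemma J_cont: "continuous_on U J"
unfolding J_def[abs_def] by (intro continuous_intros u_cont)

lemma f_C1: "Ck_on 1 U' f"
proof (rule Ck_on_cong[OF U', where f="%y. u 3 (Phi y)"])
show "Ck_on 1 U' (%y. u 3 (Phi y))"
 using Ck_on_compose[OF U' _ u Phi_nth] Phi_in by blast
qed (simp add: f)

lemma pd_f:
assumes y: "y : U'"
shows "pd 1 f y = p1 (Phi y)" "pd 2 f y = p2 (Phi y)"
proof -
have *: "pd i f y = pd i (%y. u 3 (Phi y)) y" for i
 by (rule pd_cong_open[OF U' y]) (simp add: f)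
show "pd 1 f y = p1 (Phi y)" "pd 2 f y = p2 (Phi y)"
 unfolding * pd_u_Phi[OF y] inverse_jacobian(2-)[OF y] p1_def p2_def by (simp_all add: diff_divide_distrib mult.commute)
qed

lemma Psi_has_derivative:
assumes "x : U"
shows "(Psi has_derivative (%h. vector [h$1 * pd 1 (u 1) x + h$2 * pd 2 (u 1) x, h$1 * pd 1 (u 2) x + h$2 * pd 2 (u 2) x])) (at x)"
proof -
have *: "(u k has_derivative (%h. h$1 * pd 1 (u k) x + h$2 * pd 2 (u k) x)) (at x)" for k
 using has_derivative_pd[OF u_diff[OF assms]] by (simp add: UNIV_2_sum)
have "((%x. Psi x $ i) has_derivative (%h. (vector [h$1 * pd 1 (u 1) x + h$2 * pd 2 (u 1) x, h$1 * pd 1 (u 2) x + h$2 * pd 2 (u 2) x] :: real^2) $ i)) (at x)" for i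
 using exhaust_2[of i] by (auto simp: Psi *)
then show ?thesis by (subst has_derivative_componentwise_within) (auto simp: Basis_vec_def inner_axis)
qed

lemma emeasure_Psi_image:
assumes S: "S : sets borel" "S <= K" and K: "compact K" "K <= U"
shows "emeasure lebesgue (Psi ` S) = (\<integral>\<^sup>+x\<in>S. ennreal (abs (J x)) \<partial>lborel)" "Psi ` S : sets lebesgue"
proof -
let ?D = "%x h. vector [h$1 * pd 1 (u 1) x + h$2 * pd 2 (u 1) x, h$1 * pd 1 (u 2) x + h$2 * pd 2 (u 2) x] :: real^2"
have SU: "S <= U" using assms by auto
have der: "(Psi has_derivative ?D x) (at x within S)" if "x : S" for x
 using Psi_has_derivative[of x] that SU by (auto intro: has_derivative_at_withinI)
have inj: "inj_on Psi S" using Psi_inj SU by (rule inj_on_subset)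
have dt: "det (matrix (?D x)) = J x" for x
 by (simp add: matrix_def det_2 J_def axis_def)
have Sl: "S : sets lebesgue" using S by simp
have "set_integrable lborel K J"
 unfolding set_integrable_def by (rule borel_integrable_compact[OF K(1) continuous_on_subset[OF J_cont K(2)]])
then have "set_integrable lborel S J" by (rule set_integrable_subset) (use S in auto)
then have Ji: "set_integrable lborel S (%x. abs (J x))" by (rule set_integrable_abs)
then have JiL: "set_integrable lebesgue S (%x. abs (J x))"
 unfolding set_integrable_def by (subst integrable_completion) (auto dest: borel_measurable_integrable)
have io: "(%x. abs (det (matrix (?D x)))) integrable_on S"
 unfolding dt using set_lebesgue_integral_eq_integral(1)[OF JiL] .
have lm: "Psi ` S : lmeasurable"
 using measurable_differentiable_image_eq[OF Sl der inj] io by simp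
then show "Psi ` S : sets lebesgue" by (rule fmeasurableD)
have "emeasure lebesgue (Psi ` S) = ennreal (measure lebesgue (Psi ` S))"
 by (rule emeasure_eq_measure2[OF lm])
also have "measure lebesgue (Psi ` S) = integral S (%x. abs (J x))"
 using measure_differentiable_image_eq[OF Sl der inj io] by (simp add: dt)
also have "integral S (%x. abs (J x)) = (LINT x:S|lborel. abs (J x))"
 unfolding set_lebesgue_integral_eq_integral(2)[OF JiL, symmetric] set_integral_def
 by (rule integral_completion) (use Ji in \<open>simp add: set_integrable_def borel_measurable_integrable\<close>)
also have "ennreal (LINT x:S|lborel. abs (J x)) = (\<integral>\<^sup>+x. ennreal (indicator S x *R (abs (J x))) \<partial>lborel)"
 using Ji unfolding set_integral_def set_integrable_def
 by (intro nn_integral_eq_integral[symmetric]) (auto simp: indicator_def)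
also have "... = (\<integral>\<^sup>+x\<in>S. ennreal (abs (J x)) \<partial>lborel)"
 by (intro nn_integral_cong) (auto simp: indicator_def)
finally show "emeasure lebesgue (Psi ` S) = (\<integral>\<^sup>+x\<in>S. ennreal (abs (J x)) \<partial>lborel)" .
qed

text \<open>\<open>Psi\<close> is continuous on \<open>U\<close> only; this extension is Borel on
  the whole plane and can push measures forward.\<close>

definition Psi0 :: "real^2 => real^2" where "Psi0 x = (if x : U then Psi x else 0)"

lemma Psi0_measurable [measurable]: "Psi0 : borel_measurable borel"
unfolding Psi0_def[abs_def] by (rule borel_measurable_continuous_on_if) (use U Psi_cont in auto)

lemma open_Psi_image: "open W ==> W <= U ==> open (Psi ` W)"
using homeomorphism_imp_open_map[OF hom, of W] U U' by (simp add: openin_open_eq)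

text \<open>The area formula for Borel sets, stated as an equality of measures; the formulas for
  nonnegative and for signed integrands then both follow from push-forwards and densities.\<close>

lemma change_of_variables_measure:
assumes W: "open W" "W <= K" and K: "compact K" "K <= U"
shows "distr (density lborel (%x. indicator W x * ennreal (abs (J x)))) borel Psi0 = density lborel (indicator (Psi ` W))"
proof (rule measure_eqI)
have WU: "W <= U" using W K by auto
have [measurable]: "Psi ` W : sets borel" using open_Psi_image[OF W(1) WU] by auto
have [measurable]: "W : sets borel" using W by auto
have Jm[measurable]: "(%x. indicator W x * ennreal (abs (J x))) : borel_measurable borel"
proof -
 have "(%x. indicator W x *R J x) : borel_measurable borel"
 using borel_measurable_continuous_on_indicator[OF _ continuous_on_subset[OF J_cont WU]] W by auto
 then have "(%x. ennreal (abs (indicator W x *R J x))) : borel_measurable borel" by measurable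
 then show ?thesis by (rule back_subst[of "%f. f : _"]) (auto simp: indicator_def)
qed
fix B assume "B : sets (distr (density lborel (%x. indicator W x * ennreal (abs (J x)))) borel Psi0)"
then have B[measurable]: "B : sets borel" by simp
define S where "S = W \<inter> Psi0 -` B"
have "Psi0 -` B : sets borel" using measurable_sets[OF Psi0_measurable B] by simp
then have S: "S : sets borel" "S <= K" using W by (auto simp: S_def)
have im: "Psi ` S = Psi ` W \<inter> B" using WU by (auto simp: S_def Psi0_def)
have "emeasure (distr (density lborel (%x. indicator W x * ennreal (abs (J x)))) borel Psi0) B
 = (\<integral>\<^sup>+x. indicator W x * ennreal (abs (J x)) * indicator (Psi0 -` B) x \<partial>lborel)"
 using Jm B \<open>Psi0 -` B : sets borel\<close> by (subst emeasure_distr) (auto simp: emeasure_density)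
also have "... = (\<integral>\<^sup>+x\<in>S. ennreal (abs (J x)) \<partial>lborel)"
 by (intro nn_integral_cong) (auto simp: indicator_def S_def)
also have "... = emeasure lborel (Psi ` W \<inter> B)"
 using emeasure_Psi_image(1)[OF S K] by (simp add: im)
also have "... = emeasure (density lborel (indicator (Psi ` W))) B"
 by (subst emeasure_density) (auto simp: indicator_inter_arith[symmetric] nn_integral_indicator)
finally show "emeasure (distr (density lborel (%x. indicator W x * ennreal (abs (J x)))) borel Psi0) B
 = emeasure (density lborel (indicator (Psi ` W))) B" .
qed simp

lemma change_of_variables:
assumes W: "open W" "W <= K" and K: "compact K" "K <= U"
shows "h : borel_measurable borel ==> (\<integral>\<^sup>+y\<in>Psi ` W. h y \<partial>lborel) = (\<integral>\<^sup>+x\<in>W. h (Psi x) * ennreal (abs (J x)) \<partial>lborel)"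
 "continuous_on U' h' ==> (LINT y:Psi ` W|lborel. h' y) = (LINT x:W|lborel. h' (Psi x) * abs (J x) :: real)"
proof -
have WU: "W <= U" using W K by auto
have PsiW[measurable]: "Psi ` W : sets borel" using open_Psi_image[OF W(1) WU] by auto
have [measurable]: "W : sets borel" using W by auto
have Jr[measurable]: "(%x. indicator W x *R J x) : borel_measurable borel"
 using borel_measurable_continuous_on_indicator[OF _ continuous_on_subset[OF J_cont WU]] W by auto
have Je: "(%x. indicator W x * ennreal (abs (J x))) = (%x. ennreal (abs (indicator W x *R J x)))"
 by (auto simp: indicator_def)
have Jm[measurable]: "(%x. indicator W x * ennreal (abs (J x))) : borel_measurable borel"
 unfolding Je by measurable
note eq = change_of_variables_measure[OF W K]
show "(\<integral>\<^sup>+y\<in>Psi ` W. h y \<partial>lborel) = (\<integral>\<^sup>+x\<in>W. h (Psi x) * ennreal (abs (J x)) \<partial>lborel)" if [measurable]: "h : borel_measurable borel"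
proof -
 have "(\<integral>\<^sup>+y\<in>Psi ` W. h y \<partial>lborel) = (\<integral>\<^sup>+y. h y \<partial>density lborel (indicator (Psi ` W)))"
 by (subst nn_integral_density) (auto simp: mult.commute)
 also have "... = (\<integral>\<^sup>+x. indicator W x * ennreal (abs (J x)) * h (Psi0 x) \<partial>lborel)"
 unfolding eq[symmetric] by (subst nn_integral_distr) (auto simp: nn_integral_density)
 also have "... = (\<integral>\<^sup>+x\<in>W. h (Psi x) * ennreal (abs (J x)) \<partial>lborel)"
 by (intro nn_integral_cong) (use WU in \<open>auto simp: indicator_def Psi0_def mult.commute\<close>)
 finally show ?thesis .
qed
show "(LINT y:Psi ` W|lborel. h' y) = (LINT x:W|lborel. h' (Psi x) * abs (J x))" if h: "continuous_on U' h'"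
proof -
 define k where "k y = indicator (Psi ` W) y *R h' y" for y
 have sub: "Psi ` W <= U'" using WU Psi_in by auto
 have [measurable]: "k : borel_measurable borel"
 unfolding k_def[abs_def] by (rule borel_measurable_continuous_on_indicator[OF PsiW continuous_on_subset[OF h sub]])
 have ind: "indicator (Psi ` W) = (%y. ennreal (indicator (Psi ` W) y))" by (auto simp: indicator_def)
 have "(LINT y:Psi ` W|lborel. h' y) = (LINT y|lborel. indicator (Psi ` W) y *R k y)"
 unfolding set_integral_def by (intro bochner_cong) (auto simp: k_def indicator_def)
 also have "... = (LINT y|(density lborel (indicator (Psi ` W))). k y)"
 unfolding ind by (subst integral_density) auto
 also have "... = (LINT x|lborel. abs (indicator W x *R J x) *R k (Psi0 x))"
 unfolding eq[symmetric] Je by (subst integral_distr) (auto simp del: scaleR_conv_of_real real_scaleR_def intro!: integral_density)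
 also have "... = (LINT x:W|lborel. h' (Psi x) * abs (J x))"
 unfolding set_integral_def
 by (intro bochner_cong) (use WU in \<open>auto simp: indicator_def Psi0_def k_def mult.commute\<close>)
 finally show ?thesis .
qed
qed

end

section \<open>Localisation of distributional identities\<close>

text \<open>The type \<open>distr\<close> carries no linearity. Additivity on test functions is
  exactly what splitting by a finite partition of unity requires.\<close>

definition additive_distr :: "(real^'n::finite) set => 'n distr => bool" where
"additive_distr V T \<longleftrightarrow> T (%x. 0) = 0 \<and>
 (ALL phi psi. test_fun V phi --> test_fun V psi --> T (%x. phi x + psi x) = T phi + T psi)"

lemma test_fun_zero: "test_fun V (%x. 0)"
unfolding test_fun_def by (auto intro!: exI[of _ "{}"])

lemma test_fun_add:
assumes "test_fun V phi" "test_fun V psi"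
shows "test_fun V (%x. phi x + psi x)"
proof -
obtain K L where "compact K" "K <= V" "ALL x. x ~: K --> phi x = 0" "compact L" "L <= V" "ALL x. x ~: L --> psi x = 0"
 using assms unfolding test_fun_def by blast
then have "compact (K \<union> L) & K \<union> L <= V & (ALL x. x ~: K \<union> L --> phi x + psi x = 0)" by auto
moreover have "smooth_on UNIV (%x. phi x + psi x)"
 by (rule smooth_on_add[OF open_UNIV test_fun_smooth[OF assms(1)] test_fun_smooth[OF assms(2)]])
ultimately show ?thesis unfolding test_fun_def by blast
qed

lemma additive_distr_sum:
assumes T: "additive_distr V T" and F: "finite F" and g: "!!y. y : F ==> test_fun V (g y)"
shows "T (%x. \<Sum>y\<in>F. g y x) = (\<Sum>y\<in>F. T (g y))" "test_fun V (%x. \<Sum>y\<in>F. g y x)"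
proof -
have "T (%x. \<Sum>y\<in>F. g y x) = (\<Sum>y\<in>F. T (g y)) & test_fun V (%x. \<Sum>y\<in>F. g y x)"
 using F g
proof (induction F)
 case empty
 then show ?case using T by (simp add: additive_distr_def test_fun_zero)
next
 case (insert a F)
 then have "test_fun V (g a)" and IH: "T (%x. \<Sum>y\<in>F. g y x) = (\<Sum>y\<in>F. T (g y))" "test_fun V (%x. \<Sum>y\<in>F. g y x)" by auto
 with T have "T (%x. g a x + (\<Sum>y\<in>F. g y x)) = T (g a) + T (%x. \<Sum>y\<in>F. g y x)"
 unfolding additive_distr_def by blast
 with IH insert(1,2) test_fun_add[OF \<open>test_fun V (g a)\<close> IH(2)] show ?case by simp
qed
then show "T (%x. \<Sum>y\<in>F. g y x) = (\<Sum>y\<in>F. T (g y))" "test_fun V (%x. \<Sum>y\<in>F. g y x)" by auto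
qed

lemma additive_distr_of_fun: "locally_integrable_on V h ==> additive_distr V (distr_of_fun V h)"
unfolding additive_distr_def distr_of_fun_def
by (auto simp: distrib_left set_integral_add locally_integrable_mult_test_fun set_integral_def[of _ _ "%x. 0"])

lemma additive_distr_pd: "additive_distr V T ==> additive_distr V (distr_pd i T)"
unfolding additive_distr_def distr_pd_def
proof (intro conjI allI impI)
assume T: "T (%x. 0) = 0 & (ALL phi psi. test_fun V phi --> test_fun V psi --> T (%x. phi x + psi x) = T phi + T psi)"
show "- T (pd i (%x. 0)) = 0" using T by simp
fix phi psi :: "real^'a => real" assume phi: "test_fun V phi" and psi: "test_fun V psi"
have "pd i (%x. phi x + psi x) = (%x. pd i phi x + pd i psi x)"
 using test_fun_diffble[OF phi] test_fun_diffble[OF psi] by (intro ext pd_add)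
then show "- T (pd i (%x. phi x + psi x)) = - T (pd i phi) + - T (pd i psi)"
 using T test_fun_pd[OF phi] test_fun_pd[OF psi] by simp
qed

lemma additive_distr_combine:
"additive_distr V S ==> additive_distr V T ==> additive_distr V (%phi. S phi - T phi)"
"additive_distr V S ==> additive_distr V (%phi. c * S phi)"
by (auto simp: additive_distr_def algebra_simps)

lemma additive_distr_cong: "eq_distr V S T ==> additive_distr V T ==> additive_distr V S"
unfolding additive_distr_def eq_distr_def by (simp add: test_fun_add test_fun_zero)

lemma eq_distr_localise:
fixes V :: "(real^'n::finite) set"
assumes S: "additive_distr V S" and T: "additive_distr V T"
 and l: "!!y. y : V ==> EX rho>0. ALL phi. test_fun (V \<inter> ball y rho) phi --> S phi = T phi"
shows "eq_distr V S T"
unfolding eq_distr_def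
proof (intro allI impI)
fix phi assume "test_fun V phi"
then obtain K where phi: "smooth_on UNIV phi" and K: "compact K" "K <= V" "!!x. x ~: K ==> phi x = 0"
 unfolding test_fun_def by blast
have "ALL y:V. EX rho>0. ALL phi. test_fun (V \<inter> ball y rho) phi --> S phi = T phi" using l by blast
from bchoice[OF this] obtain rho where rho: "!!y. y : V ==> rho y > 0" "!!y phi. y : V ==> test_fun (V \<inter> ball y (rho y)) phi ==> S phi = T phi" by blast
have rhoK: "rho y > 0" if "y : K" for y using rho(1) K(2) that by auto
obtain F eta where F: "finite F" "F <= K"
 and eta: "!!phi L y. smooth_on UNIV phi ==> compact L ==> L <= K ==> (!!x. x ~: L ==> phi x = 0) ==> y : F
 ==> test_fun (L \<inter> ball y (rho y)) (%x. eta y x * phi x)"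
 "!!phi L x. L <= K ==> (!!x. x ~: L ==> phi x = 0) ==> phi x = (\<Sum>y\<in>F. eta y x * phi x)"
 by (rule test_fun_partition[OF K(1), where r=rho]) (rule rhoK, assumption, blast)
have t: "test_fun (V \<inter> ball y (rho y)) (%x. eta y x * phi x)" if "y : F" for y
 by (rule test_fun_mono[OF eta(1)[OF phi K(1) order_refl K(3) that]]) (use K in auto)
then have t': "test_fun V (%x. eta y x * phi x)" if "y : F" for y
 using that by (auto intro: test_fun_mono)
have eq: "S (%x. eta y x * phi x) = T (%x. eta y x * phi x)" if "y : F" for y
 by (rule rho(2)[OF _ t[OF that]]) (use that F K in auto)
have "phi = (%x. \<Sum>y\<in>F. eta y x * phi x)"
 by (rule ext) (rule eta(2)[OF order_refl K(3)])
note sum = this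
have ST: "S (%x. \<Sum>y\<in>F. eta y x * phi x) = T (%x. \<Sum>y\<in>F. eta y x * phi x)"
 using additive_distr_sum(1)[OF S F(1), where g="%y x. eta y x * phi x"] additive_distr_sum(1)[OF T F(1), where g="%y x. eta y x * phi x"]
 by (simp add: t' eq)
show "S phi = T phi" by (subst (1 2) sum) (rule ST)
qed

lemma additive_Det_D2:
assumes V: "open V" and f: "Ck_on 1 V f"
shows "additive_distr V (Det_D2 V f)"
proof -
have "additive_distr V (distr_of_fun V (%x. weak_pd V i f x * weak_pd V j f x))" for i j
proof (rule additive_distr_cong[OF _ additive_distr_of_fun])
 have c: "continuous_on V (%x. pd i f x * pd j f x)" using f by (auto intro!: continuous_intros)
 show "locally_integrable_on V (%x. pd i f x * pd j f x)"
 by (rule continuous_locally_integrable[OF c])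
 show "eq_distr V (distr_of_fun V (%x. weak_pd V i f x * weak_pd V j f x)) (distr_of_fun V (%x. pd i f x * pd j f x))"
 unfolding eq_distr_def using distr_of_fun_weak_pd_mult[OF V f] continuous_mult_test_fun(1)[OF V c] by simp
qed
then show ?thesis
 unfolding Det_D2_def[abs_def] power2_eq_square by (intro additive_distr_combine additive_distr_pd)
qed

section \<open>The Gauss equation\<close>

lemma set_integral_vanishing:
fixes h :: "real^'n::finite => real"
assumes "A <= B" "!!x. x : B ==> x ~: A ==> h x = 0"
shows "(LINT x:B|M. h x) = (LINT x:A|M. h x)"
unfolding set_integral_def by (intro bochner_cong) (use assms in \<open>auto simp: indicator_def\<close>)

context C1_graph
begin

text \<open>The Jacobian is continuous and nonvanishing on a connected ball. A fixed sign matters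
  because change of variables produces \<open>abs (J x)\<close>, whereas the identities for smooth
  graphs contain \<open>J x\<close>.\<close>

lemma J_sign:
assumes "cball x r <= U"
obtains sgm :: real where "sgm = 1 \<or> sgm = -1" "!!y. y : cball x r ==> abs (J y) = sgm * J y"
proof -
have "connected (J ` cball x r)"
 by (rule connected_continuous_image[OF continuous_on_subset[OF J_cont assms] connected_cball])
then have *: "False" if "a : cball x r" "b : cball x r" "J a <= 0" "0 <= J b" for a b
proof -
 have "0 : J ` cball x r"
 by (rule connectedD_interval[OF \<open>connected (J ` cball x r)\<close> imageI[OF that(1)] imageI[OF that(2)] that(3,4)])
 then obtain c where c: "c : cball x r" "J c = 0" by (metis imageE)
 then show False using J_nonzero[OF subsetD[OF assms c(1)]] by simp
qed
show ?thesis
proof (cases "EX a:cball x r. J a <= 0")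
 case True
 then obtain a where a: "a : cball x r" "J a <= 0" by blast
 have "abs (J y) = - 1 * J y" if "y : cball x r" for y using *[OF a(1) that a(2)] by (cases "0 <= J y") simp_all
 then show ?thesis using that[of "- 1"] by blast
next
 case False
 have "abs (J y) = 1 * J y" if "y : cball x r" for y
 using False bspec[OF _ that, of "%a. \<not> J a <= 0"] by simp
 then show ?thesis using that[of 1] by blast
qed
qed

lemma graph_ball:
assumes y: "y : U'" and r: "r > 0"
obtains rho where "rho > 0" "cball y rho <= Psi ` (U \<inter> ball (Phi y) r)" "cball y rho <= U'"
proof -
have "open (Psi ` (U \<inter> ball (Phi y) r))" using U by (intro open_Psi_image) auto
moreover have "y : Psi ` (U \<inter> ball (Phi y) r)"
 using y r PsiPhi[OF y] Phi_in[OF y] by (intro image_eqI[of _ _ "Phi y"]) auto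
ultimately obtain rho where rho: "rho > 0" "cball y rho <= Psi ` (U \<inter> ball (Phi y) r)"
 using open_contains_cball by blast
moreover have "Psi ` (U \<inter> ball (Phi y) r) <= U'" using Psi_in by auto
ultimately show ?thesis using that by blast
qed

end

locale C1_graph_metric = C1_graph +
fixes g :: "real^2 => real^2^2"
assumes sm: "smooth_metric_on U g"
 and g: "!!x i j. x : U ==> g x $ i $ j = (SU k. pd i (u k) x * pd j (u k) x)"
begin

lemma smooth_g: "smooth_on U (%x. g x $ i $ j)"
using sm unfolding smooth_metric_on_def by (intro smooth_on_vec_nth U) auto

text \<open>The Gram determinant of two vectors is the squared length of their cross product, which
  is \<open>J * (-p1, -p2, 1)\<close>.\<close>

lemma det_g:
assumes "x : U"
shows "det (g x) = (J x)^2 * (1 + (p1 x)^2 + (p2 x)^2)"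
proof -
have p: "(J x * p1 x) = pd 1 (u 3) x * pd 2 (u 2) x - pd 2 (u 3) x * pd 1 (u 2) x"
 "(J x * p2 x) = pd 1 (u 1) x * pd 2 (u 3) x - pd 2 (u 1) x * pd 1 (u 3) x"
 using J_nonzero[OF assms] by (auto simp: p1_def p2_def)
have *: "(J x)^2 * (1 + (p1 x)^2 + (p2 x)^2) = (J x)^2 + (J x * p1 x)^2 + (J x * p2 x)^2"
 by (simp add: algebra_simps power_mult_distrib)
show ?thesis
 unfolding * p det_2 g[OF assms] sum_3 by (simp add: J_def algebra_simps power2_eq_square)
qed

lemma gauss_curvature_cont: "continuous_on U (gauss_curvature g)"
proof -
let ?E = "%x. g x $ 1 $ 1" and ?F = "%x. g x $ 1 $ 2" and ?G = "%x. g x $ 2 $ 2"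
have s: "smooth_on U (pd 2 (curvA ?E ?F))" "smooth_on U (pd 1 (curvB ?G))" "smooth_on U (curvq ?E ?F ?G)" "smooth_on U (%x. det (g x))"
 unfolding curvA_def[abs_def] curvB_def[abs_def] curvq_def[abs_def] det_2
 by (intro smooth_on_diff smooth_on_add smooth_on_mult smooth_on_const smooth_on_pd smooth_g U)+
have "continuous_on U (%x. (det (g x) * (pd 2 (curvA ?E ?F) x - pd 1 (curvB ?G) x) + curvq ?E ?F ?G x) / (det (g x))^2)"
 using smooth_metric_det_pos(3)[OF sm] by (intro continuous_intros s[THEN smooth_on_cont]) force
then show ?thesis
proof (rule continuous_on_cong[THEN iffD1, rotated -1, OF _ refl])
 fix x assume "x : U"
 show "(det (g x) * (pd 2 (curvA ?E ?F) x - pd 1 (curvB ?G) x) + curvq ?E ?F ?G x) / (det (g x))^2 = gauss_curvature g x"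
 unfolding gauss_curvature_formula[OF U sm \<open>x : U\<close>, symmetric] using smooth_metric_det_pos(3)[OF sm \<open>x : U\<close>] by simp
qed
qed

definition gauss_rhs :: "fun2" where
"gauss_rhs y = gauss_curvature g (Phi y) * (1 + (SU i. (pd i f y)^2))^2"

lemma gauss_rhs_cont: "continuous_on U' gauss_rhs"
proof -
have "continuous_on U' (%y. gauss_curvature g (Phi y))"
 by (rule continuous_on_compose2[OF gauss_curvature_cont Phi_cont]) (use Phi_in in auto)
moreover have "continuous_on U' (pd i f)" for i using f_C1 by simp
ultimately show ?thesis unfolding gauss_rhs_def[abs_def] by (intro continuous_intros)
qed

lemma C1_metric_map: "r > 0 ==> cball x0 (2 * r) <= U ==> C1_metric_map U x0 r u (%i j x. g x $ i $ j)"
using U u g smooth_g by unfold_locales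

lemma graph_limit_ball:
assumes r: "r > 0" "cball x0 (2 * r) <= U" and rho: "cball y rho <= Psi ` ball x0 (r / 2)" and phi: "test_fun (ball y rho) phi"
shows "graph_limit U x0 r u (%i j x. g x $ i $ j) phi (cball y rho) J p1 p2"
proof -
interpret M: C1_metric_map U x0 r u "%i j x. g x $ i $ j" by (rule C1_metric_map[OF r])
have MPsi: "M.Psi = Psi" by (rule ext) (simp add: M.Psi_def Psi)
have KrU: "cball x0 r <= U" "ball x0 r <= U" by (rule M.WU)+
have half: "ball x0 (r / 2) <= ball x0 r" using r by auto
have phi0: "phi z = 0" if "z ~: cball y rho" for z
 using phi that unfolding test_fun_def by (meson ball_subset_cball subsetD)
show ?thesis
proof unfold_locales
 show "test_fun UNIV phi" by (rule test_fun_mono[OF phi]) simp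
 show "x : ball x0 (r / 2)" if x: "x : cball x0 r" "M.Psi x : cball y rho" for x
 proof -
 obtain z where z: "z : ball x0 (r / 2)" "Psi x = Psi z" using x rho MPsi by auto
 have "z : U" "x : U" by (rule subsetD[OF KrU(2) subsetD[OF half z(1)]], rule subsetD[OF KrU(1) x(1)])
 then have "x = z" by (intro inj_onD[OF Psi_inj z(2)])
 then show ?thesis using z(1) by (simp only:)
 qed
 show "J x ~= 0" if "x : cball x0 r" for x by (rule J_nonzero[OF subsetD[OF KrU(1) that]])
 show "phi z = 0" if "z ~: cball y rho" for z by (rule phi0[OF that])
qed (simp_all only: closed_cball J_def p1_def p2_def phi0 refl not_False_eq_True)
qed

text \<open>The constant sign \<open>sgm\<close> leaves the integral, so both sides of an identity
  with weight \<open>J\<close> can be carried to graph coordinates by the same factor.\<close>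

lemma integral_transfer:
assumes r: "cball x0 r <= U" and sgm: "!!x. x : cball x0 r ==> abs (J x) = sgm * J x"
 and h: "continuous_on U' h" "!!z. z : U' ==> z ~: Psi ` ball x0 r ==> h z = 0"
shows "(LINT y:U'|lborel. h y) = sgm * (LINT x:ball x0 r|lborel. h (Psi x) * J x)"
proof -
have sub: "Psi ` ball x0 r <= U'" using Psi_in subsetD[OF order_trans[OF ball_subset_cball r]] by (intro image_subsetI) blast
have "(LINT y:U'|lborel. h y) = (LINT y:Psi ` ball x0 r|lborel. h y)"
 by (rule set_integral_vanishing[OF sub h(2)])
also have "... = (LINT x:ball x0 r|lborel. h (Psi x) * abs (J x))"
 by (rule change_of_variables(2)[OF open_ball ball_subset_cball compact_cball r h(1)])
also have "... = (LINT x:ball x0 r|lborel. sgm * (h (Psi x) * J x))"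
 by (rule set_lebesgue_integral_cong) (auto simp: sgm simp del: mem_ball mem_cball intro!: arg_cong2[where f="(*)"] dest!: subsetD[OF ball_subset_cball])
finally show ?thesis by simp
qed

text \<open>The two analytic hypotheses of the weak Gauss equation, stated without reference to a
  test function, so that either regularity class can supply them.\<close>

definition errors_vanish :: "real^2 => real => bool" where
"errors_vanish x0 r \<longleftrightarrow>
 ((%e. LINT x:ball x0 r|lborel. C1_metric_map.T x0 r u e x * C1_metric_map.Gs x0 r u (%i j x. g x $ i $ j) e x) \<longlongrightarrow> 0) (at_right 0)
& ((%e. LINT x:ball x0 r|lborel. (C1_metric_map.Gs x0 r u (%i j x. g x $ i $ j) e x)^2) \<longlongrightarrow> 0) (at_right 0)"

lemma local_gauss:
assumes r: "r > 0" "cball x0 (2 * r) <= U" and ev: "errors_vanish x0 r"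
 and rho: "cball y rho <= Psi ` ball x0 (r / 2)" and phi: "test_fun (ball y rho) phi"
shows "Det_D2 U' f phi = distr_of_fun U' gauss_rhs phi"
proof -
let ?g = "%i j x. g x $ i $ j" and ?W = "ball x0 r"
interpret L: graph_limit U x0 r u ?g phi "cball y rho" J p1 p2 by (rule graph_limit_ball[OF r rho phi])
have MPsi: "L.Psi = Psi" by (rule ext) (simp add: L.Psi_def Psi)
have KrU: "cball x0 r <= U" "?W <= U" by (rule L.WU)+
have half: "ball x0 (r / 2) <= ?W" using r by auto
have phi0: "phi z = 0" if "z ~: cball y rho" for z by (rule L.S(2)[OF that])
have PsiWU: "Psi ` ?W <= U'" using KrU(2) Psi_in by (intro image_subsetI) (rule Psi_in, rule subsetD)
have rhoW: "cball y rho <= Psi ` ?W" by (rule order_trans[OF rho image_mono[OF half]])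
have phiU: "test_fun U' phi"
 by (rule test_fun_mono[OF phi order_trans[OF ball_subset_cball order_trans[OF rhoW PsiWU]]])
obtain sgm where sgm: "sgm = 1 \<or> sgm = -1" "!!y. y : cball x0 r ==> abs (J y) = sgm * J y" by (rule J_sign[OF KrU(1)]) blast
have transfer: "(LINT y:U'|lborel. h y) = sgm * (LINT x:?W|lborel. h (Psi x) * J x)"
 if h: "continuous_on U' h" "!!z. z ~: cball y rho ==> h z = 0" for h
 by (rule integral_transfer[OF KrU(1) sgm(2) h(1)], assumption, rule h(2)) (use rhoW in blast)
have pf: "continuous_on U' (pd i f)" for i using f_C1 by simp
let ?H = "%y. pd 1 f y * pd 2 f y * pd 1 (pd 2 phi) y - (1/2) * (pd 1 f y)^2 * pd 2 (pd 2 phi) y - (1/2) * (pd 2 f y)^2 * pd 1 (pd 1 phi) y"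
have pd0: "pd i phi z = 0" "pd j (pd i phi) z = 0" if "z ~: cball y rho" for z i j
proof -
 have *: "pd i phi z = 0" if "z ~: cball y rho" for z i
 by (rule pd_zero_outside[where f=phi and K="cball y rho", OF closed_cball _ that]) (rule phi0)
 show "pd i phi z = 0" by (rule *[OF that])
 show "pd j (pd i phi) z = 0"
 by (rule pd_zero_outside[where f="pd i phi" and K="cball y rho", OF closed_cball _ that]) (rule *)
qed
have "Det_D2 U' f phi = (LINT y:U'|lborel. ?H y)" by (rule Det_D2_C1[OF U' f_C1 phiU])
also have "... = sgm * (LINT x:?W|lborel. ?H (Psi x) * J x)"
proof (rule transfer)
 show "continuous_on U' ?H"
 by (intro continuous_intros pf test_fun_continuous[OF test_fun_pd[OF test_fun_pd[OF phi]]])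
qed (simp add: pd0)
also have "(LINT x:?W|lborel. ?H (Psi x) * J x) = (LINT x:?W|lborel. (p1 x * p2 x * pd 1 (pd 2 phi) (Psi x) - (1/2) * (p1 x)^2 * pd 2 (pd 2 phi) (Psi x)
 - (1/2) * (p2 x)^2 * pd 1 (pd 1 phi) (Psi x)) * J x)"
proof (rule set_lebesgue_integral_cong)
 have "x : U" if "x : ?W" for x by (rule subsetD[OF KrU(2) that])
 then show "ALL x. x : ?W --> ?H (Psi x) * J x = (p1 x * p2 x * pd 1 (pd 2 phi) (Psi x) - (1/2) * (p1 x)^2 * pd 2 (pd 2 phi) (Psi x)
 - (1/2) * (p2 x)^2 * pd 1 (pd 1 phi) (Psi x)) * J x"
 by (simp add: pd_f Psi_in PhiPsi del: mem_ball)
qed simp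
also have "... = (LINT x:?W|lborel. L.w x * (pd 2 (curvA (?g 1 1) (?g 1 2)) x - pd 1 (curvB (?g 2 2)) x) + L.omega x * curvq (?g 1 1) (?g 1 2) (?g 2 2) x)"
 using ev unfolding errors_vanish_def by (intro L.weak_gauss[unfolded MPsi]) (erule conjunct1, erule conjunct2)
also have "... = (LINT x:?W|lborel. gauss_rhs (Psi x) * phi (Psi x) * J x)"
proof (rule set_lebesgue_integral_cong)
 show "ALL x. x : ?W --> L.w x * (pd 2 (curvA (?g 1 1) (?g 1 2)) x - pd 1 (curvB (?g 2 2)) x) + L.omega x * curvq (?g 1 1) (?g 1 2) (?g 2 2) x
 = gauss_rhs (Psi x) * phi (Psi x) * J x"
 proof (intro allI impI)
 fix x assume "x : ?W"
 then have x: "x : U" by (rule subsetD[OF KrU(2)])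
 define X q D where "X = pd 2 (curvA (?g 1 1) (?g 1 2)) x - pd 1 (curvB (?g 2 2)) x"
  and "q = curvq (?g 1 1) (?g 1 2) (?g 2 2) x" and "D = det (g x)"
 have K: "gauss_curvature g x * D^2 = D * X + q"
  using gauss_curvature_formula[OF U sm x] by (simp add: X_def q_def D_def)
 have "L.w x = L.omega x * D" using smooth_metric_det_pos(2)[OF sm x] by (simp add: L.w_def D_def)
 then have "L.w x * X + L.omega x * q = L.omega x * (gauss_curvature g x * D^2)" by (simp add: K algebra_simps)
 also have "... = phi (Psi x) / J x ^ 3 * (gauss_curvature g x * ((J x)^2 * (1 + (p1 x)^2 + (p2 x)^2))^2)"
  by (simp add: L.omega_def MPsi D_def det_g[OF x])
 also have "... = gauss_rhs (Psi x) * phi (Psi x) * J x"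
 proof -
  \<comment> \<open>The squared determinant of the metric contributes the fourth power of
    \<open>J\<close>; after division by the cube one factor remains, the Jacobian needed to return
    to graph coordinates.\<close>
  have *: "a / c ^ 3 * (k * (c^2 * s)^2) = k * s^2 * a * c" if "c ~= 0" for a c k s :: real
  using that by (simp add: power2_eq_square power3_eq_cube)
  show ?thesis
  unfolding *[OF J_nonzero[OF x]] by (simp add: gauss_rhs_def UNIV_2_sum pd_f Psi_in x PhiPsi add.assoc)
 qed
 finally show "L.w x * (pd 2 (curvA (?g 1 1) (?g 1 2)) x - pd 1 (curvB (?g 2 2)) x) + L.omega x * curvq (?g 1 1) (?g 1 2) (?g 2 2) x
  = gauss_rhs (Psi x) * phi (Psi x) * J x" unfolding X_def q_def .
 qed
qed simp
also have "sgm * ... = (LINT y:U'|lborel. gauss_rhs y * phi y)"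
 by (rule transfer[symmetric]) (auto intro!: continuous_intros gauss_rhs_cont test_fun_continuous[OF phi] simp: phi0)
also have "... = distr_of_fun U' gauss_rhs phi"
 by (rule continuous_mult_test_fun(1)[OF U' gauss_rhs_cont phiU, symmetric])
finally show ?thesis .
qed

lemma gauss_equation:
assumes ev: "!!x0 r. r > 0 ==> cball x0 (2 * r) <= U ==> errors_vanish x0 r"
shows "eq_distr U' (Det_D2 U' f) (distr_of_fun U' gauss_rhs)"
proof (rule eq_distr_localise[OF additive_Det_D2[OF U' f_C1] additive_distr_of_fun[OF continuous_locally_integrable[OF gauss_rhs_cont]]])
fix y assume y: "y : U'"
obtain R where R: "R > 0" "cball (Phi y) R <= U" using Phi_in[OF y] U open_contains_cball by blast
have r: "R / 2 > 0" "cball (Phi y) (2 * (R / 2)) <= U" using R by auto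
have "R / 2 / 2 > 0" using R by simp
then obtain rho where rho: "rho > 0" "cball y rho <= Psi ` (U \<inter> ball (Phi y) (R / 2 / 2))"
 by (rule graph_ball[OF y]) blast
then have "cball y rho <= Psi ` ball (Phi y) (R / 2 / 2)" by blast
from local_gauss[OF r ev[OF r] this] test_fun_mono[of "U' \<inter> ball y rho" _ "ball y rho"] rho(1)
show "EX rho>0. ALL phi. test_fun (U' \<inter> ball y rho) phi --> Det_D2 U' f phi = distr_of_fun U' gauss_rhs phi" by blast
qed

end

section \<open>Hoelder regularity of the graph\<close>

text \<open>A Lebesgue number of the cover by the given balls; only the first point has to lie in
  \<open>K\<close>.\<close>

lemma compact_uniformly_local:
fixes K :: "'a::metric_space set"
assumes K: "compact K" and P: "!!y. y : K ==> EX t>0. ALL a:ball y t. ALL b:ball y t. P a b"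
obtains delta where "delta > 0" "!!x x'. x : K ==> dist x x' < delta ==> P x x'"
proof -
have "ALL y:K. EX t. t > 0 & (ALL a:ball y t. ALL b:ball y t. P a b)" using P by simp
from bchoice[OF this] obtain r where r: "ALL y:K. r y > 0 & (ALL a:ball y (r y). ALL b:ball y (r y). P a b)" by (rule exE)
let ?G = "(%y. ball y (r y)) ` K"
have KG: "K <= \<Union>?G"
proof
 fix y assume y: "y : K"
 then have "y : ball y (r y)" using r by simp
 with y show "y : \<Union>?G" by (rule UN_I)
qed
have oG: "open G" if "G : ?G" for G using that by (auto simp del: mem_ball)
obtain delta where delta: "delta > 0" "ALL x:K. EX G:?G. ball x delta <= G"
 by (rule Heine_Borel_lemma[OF K KG oG]) (assumption, simp)
have "P x x'" if x: "x : K" "dist x x' < delta" for x x'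
proof -
 from delta(2) x(1) obtain y where "y : K" "ball x delta <= ball y (r y)" by (metis imageE)
 moreover define t where "t = r y"
 ultimately have *: "ALL a:ball y t. ALL b:ball y t. P a b" "ball x delta <= ball y t" using r by simp_all
 have "x : ball x delta" "x' : ball x delta" using x delta(1) by auto
 from this[THEN subsetD[OF *(2)]] have "x : ball y t" "x' : ball y t" .
 then show ?thesis by (rule bspec[OF bspec[OF *(1)]])
qed
with delta(1) show ?thesis using that by blast
qed

text \<open>The local form of little Hoelder continuity of exponent 1/2: around each point of
  \<open>S\<close> the Hoelder quotient becomes arbitrarily small on small balls. Being local, it is
  stable under changes of variables.\<close>

definition osc_half :: "(real^'n::finite) set => (real^'n => real) => bool" where
"osc_half S h \<longleftrightarrow> (ALL x:S. ALL eta>0. EX t>0. ALL a:ball x t. ALL b:ball x t. abs (h a - h b) <= eta * sqrt (dist a b))"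

text \<open>A smooth approximation has locally Lipschitz derivatives, so its half-Hoelder quotient
  is small at short distances, and the remainder has small Hoelder norm. The radius \<open>t\<close>
  balances the Lipschitz constant \<open>L\<close> against \<open>eta / 2\<close>.\<close>

lemma little_holder_osc:
fixes h :: "real^'n::finite => real"
assumes h: "little_holder 1 (1/2) (ball x R) h" and R: "R > 0" and eta: "eta > 0"
shows "EX t>0. ALL a:ball x t. ALL b:ball x t. abs (pd i h a - pd i h b) <= eta * sqrt (dist a b)"
proof -
have hC: "Ck_on 1 (ball x R) h" using h by (simp add: little_holder_def holder_space_def)
have "EX psi. smooth_on UNIV psi & holder_norm 1 (1/2) (ball x R) (%x. h x - psi x) < ennreal (eta / 2)"
 using h eta unfolding little_holder_def by simp
then obtain psi where psi: "smooth_on UNIV psi" "holder_norm 1 (1/2) (ball x R) (%x. h x - psi x) < ennreal (eta / 2)" by blast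
have C1: "Ck_on 1 UNIV (pd i psi)" using smooth_on_pd[OF psi(1)] by (rule smooth_onD)
obtain L where L: "L > 0" "!!a b. a : cball x 1 ==> b : cball x 1 ==> abs (pd i psi a - pd i psi b) <= L * dist a b"
 by (rule C1_Lipschitz_cball[OF C1 subset_UNIV]) blast
define t where "t = Min {R, 1, (eta / (2 * L))^2 / 2}"
have t: "t > 0" "t <= R" "t <= 1" "2 * t <= (eta / (2 * L))^2" using R eta L(1) by (auto simp: t_def)
have "abs (pd i h a - pd i h b) <= eta * sqrt (dist a b)" if ab: "a : ball x t" "b : ball x t" for a b
proof (cases "a = b")
 case False
 define d where "d = sqrt (dist a b)"
 have d0: "d > 0" "d^2 = dist a b" using False by (auto simp: d_def)
 have abR: "a : ball x R" "b : ball x R" "a : cball x 1" "b : cball x 1" using ab t by auto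
 have dt: "dist a b < 2 * t" using ab dist_triangle3[of a b x] by simp
 then have "d <= eta / (2 * L)"
 unfolding d_def using t(4) eta L(1) by (intro real_le_lsqrt) auto
 then have "L * d <= eta / 2" using L(1) by (simp add: field_simps)
 then have 1: "abs (pd i psi a - pd i psi b) <= eta / 2 * d"
 proof -
 have "L * dist a b = L * d * d" using d0(2) by (simp add: power2_eq_square)
 also have "... <= eta / 2 * d" using \<open>L * d <= eta / 2\<close> d0(1) by (intro mult_right_mono) auto
 finally show ?thesis using L(2)[OF abR(3,4)] by linarith
 qed
 have pd: "pd i (%x. h x - psi x) c = pd i h c - pd i psi c" if "c : ball x R" for c
 using hC that smooth_on_diffble[OF psi(1)] by (intro pd_diff) auto
 let ?Q = "%is. %(x, y). ennreal (abs (pds is (%x. h x - psi x) x - pds is (%x. h x - psi x) y) / dist x y powr (1/2))"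
 let ?D = "{(y, z). y : ball x R & z : ball x R & y ~= z}"
 have "ennreal (abs (pd i (%x. h x - psi x) a - pd i (%x. h x - psi x) b) / d) = ?Q [i] (a, b)"
 by (simp add: pds_def d_def powr_half_sqrt)
 also have "... <= (SUP p\<in>?D. ?Q [i] p)"
 by (rule SUP_upper) (use abR False in auto)
 also have "... <= (SUP is\<in>{is. length is = 1}. SUP p\<in>?D. ?Q is p)"
 by (rule SUP_upper[where f="%is. SUP p\<in>?D. ?Q is p"]) simp
 also have "... <= holder_norm 1 (1/2) (ball x R) (%x. h x - psi x)" unfolding holder_norm_def by simp
 also have "... <= ennreal (eta / 2)" using psi(2) by simp
 finally have "abs (pd i (%x. h x - psi x) a - pd i (%x. h x - psi x) b) / d <= eta / 2" using eta by (simp add: ennreal_le_iff)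
 then have "abs ((pd i h a - pd i psi a) - (pd i h b - pd i psi b)) <= eta / 2 * d"
 using d0 unfolding pd[OF abR(1)] pd[OF abR(2)] by (simp add: field_simps)
 with 1 show ?thesis unfolding d_def by linarith
qed simp
with t(1) show ?thesis by blast
qed

lemma holder_norm_le:
fixes h :: "real^'n::finite => real"
assumes "A >= 0" "B >= 0" "!!x. x : V ==> abs (h x) <= A" "!!i x. x : V ==> abs (pd i h x) <= A"
 and "!!i x y. x : V ==> y : V ==> abs (pd i h x - pd i h y) <= B * sqrt (dist x y)"
shows "holder_norm 1 (1/2) V h <= ennreal (A + B)"
unfolding holder_norm_def ennreal_plus[OF assms(1,2)]
proof (intro add_mono SUP_least)
fix ns :: "'n list" and x assume "ns : {ns. length ns <= 1}" and x: "x : V"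
then consider "ns = []" | i where "ns = [i]" by (cases ns) auto
then show "ennreal (abs (pds ns h x)) <= ennreal A" by cases (auto simp: pds_def assms x)
next
fix ns :: "'n list" and p assume "ns : {ns. length ns = 1}" and p: "p : {(x, y). x : V & y : V & x ~= y}"
then obtain i where i: "ns = [i]" by (auto simp: length_Suc_conv)
obtain x y where xy: "p = (x, y)" "x : V" "y : V" "x ~= y" using p by auto
have "abs (pd i h x - pd i h y) / dist x y powr (1/2) <= B"
 using assms(5)[OF xy(2,3), of i] xy(4) by (simp add: powr_half_sqrt divide_le_eq)
then show "(case p of (x, y) => ennreal (abs (pds ns h x - pds ns h y) / dist x y powr (1/2))) <= ennreal B"
 unfolding i xy(1) by (simp add: pds_def ennreal_leI)
qed

text \<open>A difference of mollifications at \<open>x\<close> and \<open>y\<close> is the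
  mollification at \<open>x\<close> of the difference between \<open>c\<close> and its translate, so
  a bound on increments of \<open>c\<close> is inherited without loss.\<close>

lemma mconv_moll_translate:
fixes c :: "real^'n::finite => real"
assumes c: "integrable lborel c" and e: "e > 0"
 and close: "!!z. dist x z <= e ==> abs (c z - c (z + (y - x))) <= eta"
shows "abs (mconv (moll e) c x - mconv (moll e) c y) <= eta"
proof -
let ?c' = "%z. c (z + (y - x))"
note m = test_fun_moll[OF e, where 'a='n]
have ci: "integrable lborel ?c'" by (rule integrable_translation[OF c])
note mi = moll_integrable_reflect[OF e, of x]
have "mconv (moll e) c y = (LINT z|lborel. moll e (y - (z + (y - x))) * c (z + (y - x)))"
 unfolding mconv_def using mconv_integrable[OF m c, of y]
 by (intro integral_translation[symmetric, where f="%z. moll e (y - z) * c z"]) (auto dest: borel_measurable_integrable)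
also have "... = mconv (moll e) ?c' x" unfolding mconv_def by (simp add: algebra_simps)
finally have "mconv (moll e) c x - mconv (moll e) c y = (LINT z|lborel. moll e (x - z) * c z - moll e (x - z) * ?c' z)"
 unfolding mconv_def using mconv_integrable[OF m c, of x] mconv_integrable[OF m ci, of x] by simp
also have "\<bar>...\<bar> <= (LINT z|lborel. moll e (x - z) * eta)"
proof (rule integral_abs_bound_integral)
 fix z
 show "abs (moll e (x - z) * c z - moll e (x - z) * ?c' z) <= moll e (x - z) * eta"
 proof (cases "dist x z <= e")
 case True
 from mult_left_mono[OF close[OF True] moll_nonneg[OF e, of "x - z"]] show ?thesis
  using moll_nonneg[OF e, of "x - z"] by (simp add: abs_mult right_diff_distrib[symmetric])
 next
 case False
 then have "moll e (x - z) = 0" by (intro moll_zero[OF e]) (simp add: dist_norm)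
 then show ?thesis by simp
 qed
qed (use mconv_integrable[OF m c, of x] mconv_integrable[OF m ci, of x] mi in auto)
also have "... = eta" using mi by simp
finally show ?thesis .
qed

text \<open>Mollifications serve as smooth approximations. For nearby points the Hoelder quotients
  of the function and of its mollification are both small; for distant points uniform closeness of
  the derivatives is enough.\<close>

lemma little_holder_C1:
fixes f :: "real^'n::finite => real"
assumes U': "open U'" and f: "Ck_on 1 U' f" and osc: "!!i. osc_half U' (pd i f)"
 and V: "open V" "bounded V" "closure V <= U'"
shows "little_holder 1 (1/2) V f"
proof -
let ?K = "closure V"
have K: "compact ?K" using V(2) by (simp add: compact_closure)
have VK: "V <= ?K" by (rule closure_subset)
\<comment> \<open>A compact neighbourhood of the closure of \<open>V\<close> inside
  \<open>U'\<close>, of width \<open>d\<close>, on which mollification at smaller scales takes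
  place.\<close>
obtain B d where d: "d > 0" and B: "compact B" "B <= U'" and Bd: "!!x. x : V ==> cball x d <= B"
proof (cases "?K = {}")
 case True
 then have "V = {}" using VK by blast
 then show ?thesis using that[of 1 "{}"] by simp
next
 case False
 obtain d where d: "d > 0" "{x. infdist x ?K <= d} <= U'"
 by (rule compact_in_open_separated[OF False K U' V(3)]) blast
 have "cball x d <= {x. infdist x ?K <= d}" if "x : V" for x
 proof
 fix z assume "z : cball x d"
 then have "dist z x <= d" by (simp add: dist_commute)
 then show "z : {x. infdist x ?K <= d}" using infdist_le[OF subsetD[OF VK that], of z] by simp
 qed
 then show ?thesis using that[OF d(1) compact_infdist_le[OF False K d(1)] d(2)] by blast
qed
have VB: "x : B" if "x : V" for x using subsetD[OF Bd[OF that], of x] d by simp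
have VU: "V <= U'" using VB B(2) by blast
have fc: "continuous_on U' f" by (rule Ck_on_imp_continuous_on[OF f])
have pc: "continuous_on U' (pd i f)" for i using f by simp
obtain M0 where M0: "M0 > 0" "!!x. x : B ==> abs (f x) <= M0"
 by (rule compact_bound[OF B(1) continuous_on_subset[OF fc B(2)]]) blast
have "EX C>0. ALL x:B. abs (pd i f x) <= C" for i
 by (rule compact_bound[OF B(1) continuous_on_subset[OF pc B(2)]]) blast
then have "ALL i. EX C>0. ALL x:B. abs (pd i f x) <= C" by (rule allI)
from choice[OF this] obtain Mi where Mi: "!!i. Mi i > 0" "!!i x. x : B ==> abs (pd i f x) <= Mi i" by blast
define M where "M = M0 + (SU i. Mi i)"
have MiM: "Mi i <= M" for i
 using member_le_sum[of i UNIV Mi] Mi(1) M0(1) unfolding M_def by (simp add: less_imp_le add_increasing)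
have M: "M > 0" "M0 <= M"
 using sum_nonneg[of UNIV Mi] Mi(1) M0(1) unfolding M_def by (auto simp: less_imp_le add_pos_nonneg)
have osc': "EX delta>0. ALL x:B. ALL x'. dist x x' < delta --> abs (pd i f x - pd i f x') <= theta * sqrt (dist x x')" if "theta > 0" for theta i
proof -
 have "EX t>0. ALL a:ball y t. ALL b:ball y t. abs (pd i f a - pd i f b) <= theta * sqrt (dist a b)" if "y : B" for y
 using osc[of i] subsetD[OF B(2) that] \<open>theta > 0\<close> unfolding osc_half_def by simp
 then show ?thesis by (rule compact_uniformly_local[OF B(1)]) (assumption, blast)
qed
have near: "EX delta>0. ALL i. ALL x:B. ALL x'. dist x x' < delta --> abs (pd i f x - pd i f x') <= theta * sqrt (dist x x')" if "theta > 0" for theta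
proof -
 have "ALL i. EX delta>0. ALL x:B. ALL x'. dist x x' < delta --> abs (pd i f x - pd i f x') <= theta * sqrt (dist x x')"
 using osc'[OF \<open>theta > 0\<close>] by (rule allI)
 from choice[OF this] obtain delta where delta: "!!i. delta i > 0" "!!i x x'. x : B ==> dist x x' < delta i ==> abs (pd i f x - pd i f x') <= theta * sqrt (dist x x')" by blast
 have "Min (range delta) > 0" "!!i. Min (range delta) <= delta i" using delta(1) by (auto simp: Min_gr_iff)
 then show ?thesis using delta(2) by (intro exI[of _ "Min (range delta)"]) (auto intro: less_le_trans)
qed
have hs: "holder_space 1 (1/2) V f"
 unfolding holder_space_def
proof
 show "Ck_on 1 V f" by (rule Ck_on_subset[OF f VU])
 obtain delta where delta: "delta > 0" "!!i x x'. x : B ==> dist x x' < delta ==> abs (pd i f x - pd i f x') <= 1 * sqrt (dist x x')"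
 using near[of 1] by auto
 have "holder_norm 1 (1/2) V f <= ennreal (M + (1 + 2 * M / sqrt delta))"
 proof (rule holder_norm_le)
 fix i x y assume xy: "x : V" "y : V"
 show "abs (pd i f x - pd i f y) <= (1 + 2 * M / sqrt delta) * sqrt (dist x y)"
 proof (cases "dist x y < delta")
  case True
  have "0 <= 2 * M / sqrt delta * sqrt (dist x y)" using M delta(1) by simp
  with delta(2)[OF VB[OF xy(1)] True, of i] show ?thesis unfolding distrib_right by linarith
 next
  case False
  then have "sqrt delta <= sqrt (dist x y)" by simp
  then have "2 * M <= 2 * M / sqrt delta * sqrt (dist x y)" using M delta(1) by (simp add: field_simps)
  moreover have "abs (pd i f x - pd i f y) <= 2 * M" using Mi(2)[OF VB[OF xy(1)], of i] Mi(2)[OF VB[OF xy(2)], of i] MiM[of i] by linarith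
  moreover have "0 <= sqrt (dist x y)" by simp
  ultimately show ?thesis unfolding distrib_right by linarith
 qed
 next
 show "abs (f x) <= M" if "x : V" for x using M0(2)[OF VB[OF that]] M(2) by linarith
 show "abs (pd i f x) <= M" if "x : V" for i x using Mi(2)[OF VB[OF that], of i] MiM[of i] by linarith
 qed (use M delta in auto)
 then show "holder_norm 1 (1/2) V f < \<infinity>" by (rule le_less_trans) simp
qed
have "EX psi. smooth_on UNIV psi & holder_norm 1 (1/2) V (%x. f x - psi x) < ennreal \<epsilon>" if \<epsilon>: "\<epsilon> > 0" for \<epsilon>
proof -
 define theta where "theta = \<epsilon> / 8"
 have theta: "theta > 0" using \<epsilon> by (simp add: theta_def)
 obtain delta where delta: "delta > 0" "!!i x x'. x : B ==> dist x x' < delta ==> abs (pd i f x - pd i f x') <= theta * sqrt (dist x x')"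
 using near[OF theta] by auto
 \<comment> \<open>The second entry serves pairs at distance at least \<open>delta\<close>, where
   two uniform errors \<open>mu\<close> add up to at most
   \<open>2 * theta * sqrt (dist x y)\<close>; the first serves the supremum norms.\<close>
 define mu where "mu = min theta (theta * sqrt delta)"
 have mu: "mu > 0" "mu <= theta" "mu <= theta * sqrt delta" using theta delta(1) by (auto simp: mu_def)
 have uc: "EX e>0. ALL x:B. ALL x':B. dist x x' < e --> abs (h x' - h x) <= mu" if h: "continuous_on U' h" for h :: "real^'n => real"
 proof -
 have "uniformly_continuous_on B h" by (rule compact_uniformly_continuous[OF continuous_on_subset[OF h B(2)] B(1)])
 then obtain e where "e > 0" "!!x x'. x : B ==> x' : B ==> dist x' x < e ==> dist (h x') (h x) < mu"
  by (rule uniformly_continuous_onE[OF _ mu(1)]) (assumption | rule that)+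
 then show ?thesis by (intro exI[of _ e]) (auto simp: dist_real_def dist_commute less_imp_le)
 qed
 obtain e0 where e0: "e0 > 0" "!!x x'. x : B ==> x' : B ==> dist x x' < e0 ==> abs (f x' - f x) <= mu"
 using uc[OF fc] by blast
 have "ALL i. EX e>0. ALL x:B. ALL x':B. dist x x' < e --> abs (pd i f x' - pd i f x) <= mu" using uc[OF pc] by blast
 from choice[OF this] obtain ei where ei: "!!i. ei i > 0" "!!i x x'. x : B ==> x' : B ==> dist x x' < ei i ==> abs (pd i f x' - pd i f x) <= mu" by blast
 define e where "e = Min (insert d (insert e0 (range ei))) / 2"
 have "0 < Min (insert d (insert e0 (range ei)))" using d e0(1) ei(1) by (subst Min_gr_iff) auto
 moreover have "Min (insert d (insert e0 (range ei))) <= c" if "c : insert d (insert e0 (range ei))" for c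
 by (rule Min_le) (use that in auto)
 ultimately have e: "e > 0" "2 * e <= d" "2 * e <= e0" "!!i. 2 * e <= ei i" unfolding e_def by auto
 have eB: "cball x e <= B" if "x : V" for x
 by (rule order_trans[OF subset_cball Bd[OF that]]) (use e in linarith)
 define fB gB where "fB = (%y. indicator B y * f y)" and "gB = (%i y. indicator B y * pd i f y)"
 have fBi: "integrable lborel fB" and gBi: "integrable lborel (gB i)" for i
 using borel_integrable_compact[OF B(1) continuous_on_subset[OF fc B(2)]]
  borel_integrable_compact[OF B(1) continuous_on_subset[OF pc B(2)], of i] by (simp_all add: fB_def gB_def)
 note m = test_fun_moll[OF e(1), where 'a='n]
 define psi where "psi = mconv (moll e) fB"
 have psi: "smooth_on UNIV psi" unfolding psi_def by (rule smooth_on_mconv[OF m fBi])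
 have pdpsi: "pd i psi x = mconv (moll e) (gB i) x" if "x : V" for i x
 proof -
 have "pd i psi x = mconv (pd i (moll e)) fB x" unfolding psi_def by (simp add: pd_mconv[OF m fBi])
 also have "... = mconv (moll e) (gB i) x" unfolding fB_def gB_def
  by (rule mconv_pd_right[OF m _ U' f order_trans[OF eB[OF that] B(2)] eB[OF that]]) (rule moll_zero[OF e(1)], simp)
 finally show ?thesis .
 qed
 have pdh: "pd i (%x. f x - psi x) x = pd i f x - mconv (moll e) (gB i) x" if "x : V" for i x
 using f that VU smooth_on_diffble[OF psi] by (subst pd_diff) (auto simp: pdpsi[OF that])
 have small0: "abs (f x - psi x) <= mu" if x: "x : V" for x
 proof -
 have "abs (mconv (moll e) fB x - fB x) <= mu"
 proof (rule mconv_moll_uniform[OF fBi e(1)])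
  fix y assume "dist x y <= e"
  then have "y : B" "dist x y < e0" using subsetD[OF eB[OF x], of y] e by auto
  then show "abs (fB y - fB x) <= mu" using e0(2)[OF VB[OF x]] VB[OF x] by (simp add: fB_def)
 qed
 then show ?thesis using VB[OF x] by (simp add: fB_def psi_def abs_minus_commute)
 qed
 have small1: "abs (pd i f x - mconv (moll e) (gB i) x) <= mu" if x: "x : V" for x i
 proof -
 have "abs (mconv (moll e) (gB i) x - gB i x) <= mu"
 proof (rule mconv_moll_uniform[OF gBi e(1)])
  fix y assume "dist x y <= e"
  then have "y : B" "dist x y < ei i" using subsetD[OF eB[OF x], of y] e(1) e(4)[of i] by auto
  then show "abs (gB i y - gB i x) <= mu" using ei(2)[OF VB[OF x]] VB[OF x] by (simp add: gB_def)
 qed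
 then show ?thesis using VB[OF x] by (simp add: gB_def abs_minus_commute)
 qed
 have "holder_norm 1 (1/2) V (%x. f x - psi x) <= ennreal (theta + 2 * theta)"
 proof (rule holder_norm_le)
 fix i x y assume xy: "x : V" "y : V"
 have "abs ((pd i f x - mconv (moll e) (gB i) x) - (pd i f y - mconv (moll e) (gB i) y)) <= 2 * (theta * sqrt (dist x y))"
 proof (cases "dist x y < delta")
  case True
  have "abs (mconv (moll e) (gB i) x - mconv (moll e) (gB i) y) <= theta * sqrt (dist x y)"
  proof (rule mconv_moll_translate[OF gBi e(1)])
  fix z assume z: "dist x z <= e"
  then have "z : B" using subsetD[OF eB[OF xy(1)], of z] by simp
  moreover have "z + (y - x) : B"
   using z subsetD[OF eB[OF xy(2)], of "z + (y - x)"] by (simp add: dist_norm)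
  moreover have "dist z (z + (y - x)) = dist x y" by (simp add: dist_norm norm_minus_commute)
  ultimately show "abs (gB i z - gB i (z + (y - x))) <= theta * sqrt (dist x y)"
   using delta(2)[of z "z + (y - x)" i] True by (simp add: gB_def)
  qed
  with delta(2)[OF VB[OF xy(1)] True, of i] show ?thesis by linarith
 next
  case False
  then have "theta * sqrt delta <= theta * sqrt (dist x y)" using theta by (intro mult_left_mono) auto
  with small1[OF xy(1), of i] small1[OF xy(2), of i] mu(3) show ?thesis by linarith
 qed
 then show "abs (pd i (%x. f x - psi x) x - pd i (%x. f x - psi x) y) <= 2 * theta * sqrt (dist x y)"
  by (simp add: pdh xy)
 next
 show "abs (f x - psi x) <= theta" if "x : V" for x using small0[OF that] mu(2) by linarith
 show "abs (pd i (%x. f x - psi x) x) <= theta" if "x : V" for i x using small1[OF that, of i] mu(2) by (simp add: pdh[OF that])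
 qed (use theta in auto)
 also have "... < ennreal \<epsilon>" using \<epsilon> by (intro ennreal_lessI) (auto simp: theta_def)
 finally show ?thesis using psi by blast
qed
with hs show ?thesis unfolding little_holder_def by blast
qed

section \<open>Oscillation of the slopes in terms of the gradient of the map\<close>

context C1_graph
begin

definition du :: "real^2 => fun2" where
"du x y = (SU k. SU i. abs (pd i (u k) x - pd i (u k) y))"

lemma du_ge: "abs (pd i (u k) x - pd i (u k) y) <= du x y"
proof -
have "abs (pd i (u k) x - pd i (u k) y) <= (SU i. abs (pd i (u k) x - pd i (u k) y))"
 by (rule member_le_sum) auto
also have "... <= du x y" unfolding du_def
 by (rule member_le_sum[of k UNIV "%k. SU i. abs (pd i (u k) x - pd i (u k) y)"]) (auto intro: sum_nonneg)
finally show ?thesis .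
qed

lemma du_nonneg: "du x y >= 0" unfolding du_def by (intro sum_nonneg) auto

text \<open>Bounded functions whose increments are dominated by those of the gradient of the map.
  The class is stable under products, differences and nonvanishing inverses, hence contains the
  slopes; one pointwise estimate then serves both Hoelder and Sobolev regularity.\<close>

definition controlled :: "(real^2) set => (fun2) => bool" where
"controlled B h \<longleftrightarrow> (EX C>=0. (ALL x:B. abs (h x) <= C) & (ALL x:B. ALL y:B. abs (h x - h y) <= C * du x y))"

lemma controlled_mult:
assumes "controlled B h" "controlled B k" shows "controlled B (%x. h x * k x)"
proof -
obtain C D where C: "C >= 0" "!!x. x : B ==> abs (h x) <= C" "!!x y. x : B ==> y : B ==> abs (h x - h y) <= C * du x y"
 and D: "D >= 0" "!!x. x : B ==> abs (k x) <= D" "!!x y. x : B ==> y : B ==> abs (k x - k y) <= D * du x y"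
 using assms unfolding controlled_def by blast
have "abs (h x * k x - h y * k y) <= 2 * (C * D) * du x y" if xy: "x : B" "y : B" for x y
proof -
 have "abs (h x * (k x - k y)) <= C * (D * du x y)"
 unfolding abs_mult by (rule mult_mono[OF C(2)[OF xy(1)] D(3)[OF xy] C(1)]) simp
 moreover have "abs ((h x - h y) * k y) <= (C * du x y) * D"
 unfolding abs_mult by (rule mult_mono[OF C(3)[OF xy] D(2)[OF xy(2)]]) (auto simp: C du_nonneg)
 moreover have "h x * k x - h y * k y = h x * (k x - k y) + (h x - h y) * k y" by (simp add: algebra_simps)
 moreover have "2 * (C * D) * du x y = C * (D * du x y) + (C * du x y) * D" by (simp add: algebra_simps)
 ultimately show ?thesis by linarith
qed
moreover have "abs (h x * k x) <= 2 * (C * D)" if "x : B" for x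
 using mult_mono[OF C(2)[OF that] D(2)[OF that] C(1) abs_ge_zero] mult_nonneg_nonneg[OF C(1) D(1)] unfolding abs_mult by linarith
ultimately show ?thesis unfolding controlled_def using C(1) D(1) by (intro exI[of _ "2 * (C * D)"]) auto
qed

lemma controlled_diff:
assumes "controlled B h" "controlled B k" shows "controlled B (%x. h x - k x)"
proof -
obtain C D where C: "C >= 0" "!!x. x : B ==> abs (h x) <= C" "!!x y. x : B ==> y : B ==> abs (h x - h y) <= C * du x y"
 and D: "D >= 0" "!!x. x : B ==> abs (k x) <= D" "!!x y. x : B ==> y : B ==> abs (k x - k y) <= D * du x y"
 using assms unfolding controlled_def by blast
have "abs ((h x - k x) - (h y - k y)) <= (C + D) * du x y" if xy: "x : B" "y : B" for x y
 using C(3)[OF xy] D(3)[OF xy] unfolding distrib_right by linarith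
moreover have "abs (h x - k x) <= C + D" if "x : B" for x
 using C(2)[OF that] D(2)[OF that] by linarith
ultimately show ?thesis unfolding controlled_def using C(1) D(1) by (intro exI[of _ "C + D"]) auto
qed

lemma controlled_inverse:
assumes k: "controlled B k" and M: "!!x. x : B ==> abs (inverse (k x)) <= M" "!!x. x : B ==> k x ~= 0" "M > 0"
shows "controlled B (%x. inverse (k x))"
proof -
obtain D where D: "D >= 0" "!!x y. x : B ==> y : B ==> abs (k x - k y) <= D * du x y"
 using k unfolding controlled_def by blast
have "abs (inverse (k x) - inverse (k y)) <= (M * M * D) * du x y" if xy: "x : B" "y : B" for x y
proof -
 have "inverse (k x) - inverse (k y) = inverse (k x) * inverse (k y) * (k y - k x)"
 using M(2)[OF xy(1)] M(2)[OF xy(2)] by (simp add: field_simps)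
 then have "abs (inverse (k x) - inverse (k y)) = abs (inverse (k x)) * abs (inverse (k y)) * abs (k y - k x)" by (simp only: abs_mult)
 moreover have "... <= M * M * (D * du y x)"
 by (intro mult_mono M(1) xy D(2)) (use M(3) in auto)
 moreover have "du y x = du x y" unfolding du_def by (simp add: abs_minus_commute)
 ultimately show ?thesis by (simp add: mult.assoc)
qed
note 1 = this
have MD: "0 <= M * M * D" using M(3) D(1) by simp
have "abs (inverse (k x) - inverse (k y)) <= (M + M * M * D) * du x y" if xy: "x : B" "y : B" for x y
 using 1[OF xy] mult_nonneg_nonneg[OF less_imp_le[OF M(3)] du_nonneg[of x y]] unfolding distrib_right by linarith
moreover have "abs (inverse (k x)) <= M + M * M * D" if "x : B" for x using M(1)[OF that] MD by linarith
ultimately show ?thesis unfolding controlled_def using M(3) MD by (intro exI[of _ "M + M * M * D"]) simp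
qed

lemma controlled_p:
assumes B: "compact B" "B <= U"
shows "controlled B p1" "controlled B p2"
proof -
have pdu: "controlled B (pd i (u k))" for i k
proof -
 obtain C where "C > 0" "!!x. x : B ==> abs (pd i (u k) x) <= C"
 by (rule compact_bound[OF B(1) continuous_on_subset[OF u_cont(2) B(2)]]) blast
 moreover have "abs (pd i (u k) x - pd i (u k) y) <= (C + 1) * du x y" for x y
 using du_ge[of i k x y] mult_nonneg_nonneg[OF _ du_nonneg[of x y], of C] \<open>C > 0\<close> unfolding distrib_right by linarith
 ultimately show ?thesis unfolding controlled_def by (intro exI[of _ "C + 1"]) (auto intro: add_increasing2)
qed
have J: "controlled B J" unfolding J_def[abs_def] by (intro controlled_diff controlled_mult pdu)
have c: "continuous_on B (%x. inverse (J x))"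
 using J_nonzero B(2) by (intro continuous_on_inverse continuous_on_subset[OF J_cont B(2)]) auto
obtain M where "M > 0" "!!x. x : B ==> abs (inverse (J x)) <= M"
 by (rule compact_bound[OF B(1) c]) blast
then have iJ: "controlled B (%x. inverse (J x))" using J_nonzero B(2) by (intro controlled_inverse[OF J]) auto
show "controlled B p1" "controlled B p2"
 unfolding p1_def[abs_def] p2_def[abs_def] divide_inverse by (intro controlled_mult controlled_diff pdu iJ)+
qed

lemma Lipschitz_vec2:
fixes G :: "real^2 => real^2"
assumes "!!a. Ck_on 1 V (%x. G x $ a)" "cball z s <= V"
obtains L where "L > 0" "!!x y. x : cball z s ==> y : cball z s ==> dist (G x) (G y) <= L * dist x y"
proof -
have "EX L>0. ALL x:cball z s. ALL y:cball z s. abs (G x $ a - G y $ a) <= L * dist x y" for a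
 by (rule C1_Lipschitz_cball[OF assms]) blast
then have "ALL a. EX L>0. ALL x:cball z s. ALL y:cball z s. abs (G x $ a - G y $ a) <= L * dist x y" by (rule allI)
from choice[OF this] obtain L where L: "!!a. L a > 0" "!!a x y. x : cball z s ==> y : cball z s ==> abs (G x $ a - G y $ a) <= L a * dist x y" by blast
have "dist (G x) (G y) <= (L 1 + L 2) * dist x y" if "x : cball z s" "y : cball z s" for x y
 using L(2)[OF that, of 1] L(2)[OF that, of 2] norm_le_l1_cart[of "G x - G y"]
 by (simp add: dist_norm UNIV_2_sum distrib_right)
then show ?thesis using that[of "L 1 + L 2"] L(1)[of 1] L(1)[of 2] by auto
qed

text \<open>Gathers on one ball with a single constant all that transports regularity to the graph:
  the slopes vary no more than the gradient of the map, and \<open>Phi\<close> distorts distances by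
  bounded factors in both directions.\<close>

lemma control:
assumes y: "y : U'"
obtains s C R where "s > 0" "C > 0" "R > 0" "cball y s <= U'" "cball (Phi y) R <= U" "!!a. a : cball y s ==> Phi a : ball (Phi y) R"
 "!!a b i. a : cball y s ==> b : cball y s ==> abs (pd i f a - pd i f b) <= C * du (Phi a) (Phi b)"
 "!!a b. a : cball y s ==> b : cball y s ==> dist (Phi a) (Phi b) <= C * dist a b & dist a b <= C * dist (Phi a) (Phi b)"
proof -
obtain R where R: "R > 0" "cball (Phi y) R <= U" using Phi_in[OF y] U open_contains_cball by blast
obtain s where s: "s > 0" "cball y s <= Psi ` (U \<inter> ball (Phi y) R)" "cball y s <= U'" by (rule graph_ball[OF y R(1)]) blast
have Phis: "Phi a : ball (Phi y) R" if "a : cball y s" for a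
 using subsetD[OF s(2) that] PhiPsi by auto
then have Phic: "Phi a : cball (Phi y) R" if "a : cball y s" for a using that by (meson ball_subset_cball subsetD)
obtain C1 C2 where C1: "C1 >= 0" "!!x x'. x : cball (Phi y) R ==> x' : cball (Phi y) R ==> abs (p1 x - p1 x') <= C1 * du x x'"
 and C2: "C2 >= 0" "!!x x'. x : cball (Phi y) R ==> x' : cball (Phi y) R ==> abs (p2 x - p2 x') <= C2 * du x x'"
 using controlled_p[OF compact_cball R(2)] unfolding controlled_def by blast
obtain L1 where L1: "L1 > 0" "!!a b. a : cball y s ==> b : cball y s ==> dist (Phi a) (Phi b) <= L1 * dist a b"
 by (rule Lipschitz_vec2[OF Phi_nth s(3)]) blast
have Psin: "Ck_on 1 U (%x. Psi x $ a)" for a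
 using u[of 1] u[of 2] exhaust_2[of a] by (auto simp: Psi)
obtain L2 where L2: "L2 > 0" "!!a b. a : cball (Phi y) R ==> b : cball (Phi y) R ==> dist (Psi a) (Psi b) <= L2 * dist a b"
 by (rule Lipschitz_vec2[OF Psin R(2)]) blast
define C where "C = C1 + C2 + L1 + L2"
have C: "C > 0" "C1 <= C" "C2 <= C" "L1 <= C" "L2 <= C" using C1(1) C2(1) L1(1) L2(1) by (auto simp: C_def)
show ?thesis
proof (rule that[OF s(1) C(1) R(1) s(3) R(2) Phis])
 fix a b assume ab: "a : cball y s" "b : cball y s"
 then have U'ab: "a : U'" "b : U'" using s(3) by blast+
 note n = du_nonneg[of "Phi a" "Phi b"]
 show "abs (pd i f a - pd i f b) <= C * du (Phi a) (Phi b)" for i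
 using exhaust_2[of i] pd_f[OF U'ab(1)] pd_f[OF U'ab(2)] C1(2)[OF Phic Phic, OF ab] C2(2)[OF Phic Phic, OF ab]
  mult_right_mono[OF C(2) n] mult_right_mono[OF C(3) n] by auto
 show "dist (Phi a) (Phi b) <= C * dist a b & dist a b <= C * dist (Phi a) (Phi b)"
 using L1(2)[OF ab] L2(2)[OF Phic Phic, OF ab] mult_right_mono[OF C(4), of "dist a b"] mult_right_mono[OF C(5), of "dist (Phi a) (Phi b)"]
  PsiPhi[OF U'ab(1)] PsiPhi[OF U'ab(2)] by simp
qed
qed

lemma osc_half_graph:
assumes osc: "!!k i. osc_half U (pd i (u k))"
shows "osc_half U' (pd i f)"
unfolding osc_half_def
proof (intro ballI allI impI)
fix y eta :: real and z assume eta: "eta > 0" and y: "z : U'"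
obtain s C where s: "s > 0" "C > 0" "cball z s <= U'"
 and ctl: "!!a b i. a : cball z s ==> b : cball z s ==> abs (pd i f a - pd i f b) <= C * du (Phi a) (Phi b)"
 "!!a b. a : cball z s ==> b : cball z s ==> dist (Phi a) (Phi b) <= C * dist a b"
 by (rule control[OF y]) blast
\<comment> \<open>The 6 counts the first derivatives of the map, \<open>C\<close> comes from
  controlling the slopes by them, and \<open>sqrt C\<close> from the distortion of distances by
  \<open>Phi\<close>.\<close>
define theta where "theta = eta / (6 * C * sqrt C)"
have theta: "theta > 0" using eta s by (simp add: theta_def)
have "EV t. ALL a:ball (Phi z) t. ALL b:ball (Phi z) t. abs (pd i (u k) a - pd i (u k) b) <= theta * sqrt (dist a b)" for k i
proof -
 obtain t where t: "t > 0" "ALL a:ball (Phi z) t. ALL b:ball (Phi z) t. abs (pd i (u k) a - pd i (u k) b) <= theta * sqrt (dist a b)"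
 using osc[of i k] Phi_in[OF y] theta unfolding osc_half_def by blast
 show ?thesis
 proof (rule eventually_at_right_0I[OF _ t(1)])
 fix e assume "e < t"
 then have "ball (Phi z) e <= ball (Phi z) t" by (intro subset_ball) simp
 with t(2) show "ALL a:ball (Phi z) e. ALL b:ball (Phi z) e. abs (pd i (u k) a - pd i (u k) b) <= theta * sqrt (dist a b)" by blast
 qed
qed
then have "EV t. ALL k i. ALL a:ball (Phi z) t. ALL b:ball (Phi z) t. abs (pd i (u k) a - pd i (u k) b) <= theta * sqrt (dist a b)"
 by (intro eventually_all_finite)
then have "EV t. 0 < t & (ALL k i. ALL a:ball (Phi z) t. ALL b:ball (Phi z) t. abs (pd i (u k) a - pd i (u k) b) <= theta * sqrt (dist a b))"
 by (rule eventually_conj[OF eventually_at_right_less])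
then obtain t where t: "t > 0" "!!k i a b. a : ball (Phi z) t ==> b : ball (Phi z) t ==> abs (pd i (u k) a - pd i (u k) b) <= theta * sqrt (dist a b)"
 using eventually_happens[of _ "at_right (0::real)"] trivial_limit_at_right_real[of "0::real"] unfolding trivial_limit_def by blast
define \<tau> where "\<tau> = min s (t / C)"
have \<tau>: "\<tau> > 0" "\<tau> <= s" "C * \<tau> <= t" using s t by (auto simp: \<tau>_def min_def field_simps)
show "EX t>0. ALL a:ball z t. ALL b:ball z t. abs (pd i f a - pd i f b) <= eta * sqrt (dist a b)"
proof (intro exI[of _ \<tau>] conjI ballI \<tau>(1))
 fix a b assume ab: "a : ball z \<tau>" "b : ball z \<tau>"
 then have abs: "a : cball z s" "b : cball z s" and zs: "z : cball z s" using \<tau> s by auto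
 have in_t: "Phi c : ball (Phi z) t" if "c : ball z \<tau>" "c : cball z s" for c
 proof -
 have "dist (Phi z) (Phi c) <= C * dist z c" by (rule ctl(2)[OF zs that(2)])
 also have "... < C * \<tau>" using that(1) s(2) by simp
 finally show ?thesis using \<tau>(3) by simp
 qed
 have "du (Phi a) (Phi b) <= (\<Sum>k\<in>(UNIV::3 set). \<Sum>i\<in>(UNIV::2 set). theta * sqrt (dist (Phi a) (Phi b)))"
 unfolding du_def by (intro sum_mono t(2) in_t ab abs)
 then have "du (Phi a) (Phi b) <= 6 * (theta * sqrt (dist (Phi a) (Phi b)))" by simp
 also have "... <= 6 * (theta * sqrt (C * dist a b))"
 using theta ctl(2)[OF abs] by (intro mult_left_mono real_sqrt_le_mono) auto
 finally have "C * du (Phi a) (Phi b) <= C * (6 * (theta * (sqrt C * sqrt (dist a b))))"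
 using s(2) by (intro mult_left_mono) (auto simp: real_sqrt_mult)
 also have "... = eta * sqrt (dist a b)" using s(2) by (simp add: theta_def)
 finally show "abs (pd i f a - pd i f b) <= eta * sqrt (dist a b)" using ctl(1)[OF abs, of i] by linarith
qed
qed

end

section \<open>Sobolev regularity of the graph\<close>

text \<open>The local spaces are tested on Lipschitz domains, so working on balls requires this.
  Near a boundary point the ball is the epigraph, along the inner normal \<open>nu\<close>, of a
  hemisphere.\<close>

lemma bounded_lipschitz_domain_ball:
fixes x :: "real^'n::finite"
assumes R: "R > 0"
shows "bounded_lipschitz_domain (ball x R)"
unfolding bounded_lipschitz_domain_def
proof (intro conjI ballI)
fix p assume "p : frontier (ball x R)"
then have p: "norm (x - p) = R" using R by (simp add: frontier_ball dist_norm)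
define nu where "nu = (1 / R) *R (x - p)"
have nu: "norm nu = 1" "nu \<bullet> nu = 1" using p R by (auto simp: nu_def power2_norm_eq_inner[symmetric] power2_eq_square)
have pR: "p = x - R *R nu" using R by (simp add: nu_def)
define x' where "x' = x - (x \<bullet> nu) *R nu"
\<comment> \<open>Truncating the tangential distance at \<open>R / 2\<close> keeps away from the
  equator, where the hemisphere becomes vertical, and gives a globally Lipschitz function.\<close>
define m where "m z = min (norm (z - x')) (R / 2)" for z
define \<gamma> where "\<gamma> z = x \<bullet> nu - sqrt (R^2 - (m z)^2)" for z
have m0: "0 <= m z" "m z <= R / 2" for z using R by (auto simp: m_def)
have mle: "m z <= sqrt (R^2 - (m y)^2)" for y z
proof (rule real_le_rsqrt)
 have "(m z)^2 <= (R / 2)^2" "(m y)^2 <= (R / 2)^2" using m0 by (auto intro!: power_mono)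
 moreover have "(R / 2)^2 + (R / 2)^2 <= R^2" by (simp add: power2_eq_square)
 ultimately show "(m z)^2 <= R^2 - (m y)^2" by linarith
qed
have lip: "1-lipschitz_on UNIV \<gamma>"
proof (rule lipschitz_onI)
 fix y z
 define a b where "a = sqrt (R^2 - (m y)^2)" and "b = sqrt (R^2 - (m z)^2)"
 have "0 <= R^2 - (m y)^2" "0 <= R^2 - (m z)^2"
 using power_mono[OF _ m0(1), of y R 2] power_mono[OF _ m0(1), of z R 2] m0(2)[of y] m0(2)[of z] R by auto
 then have sq: "a^2 = R^2 - (m y)^2" "b^2 = R^2 - (m z)^2" by (simp_all add: a_def b_def)
 have ab: "m z <= a" "m y <= b" using mle by (auto simp: a_def b_def)
 have mm: "abs (m z - m y) <= dist y z"
 using norm_triangle_ineq3[of "z - x'" "y - x'"] by (simp add: m_def dist_norm norm_minus_commute min_def) linarith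
 \<comment> \<open>The points lie on circles of radius \<open>R\<close>; since
   \<open>m z <= a\<close> and \<open>m y <= b\<close>, dividing by \<open>a + b\<close> yields the
   Lipschitz constant 1.\<close>
 have "(a - b) * (a + b) = (m z - m y) * (m z + m y)" using sq by (simp add: algebra_simps power2_eq_square)
 then have e: "abs (a - b) * (a + b) = abs (m z - m y) * (m z + m y)"
 using ab m0(1)[of z] m0(1)[of y] by (metis abs_mult abs_of_nonneg add_nonneg_nonneg order_trans)
 have "abs (a - b) <= dist y z"
 proof (cases "a + b = 0")
 case True
 then have "a = 0" "b = 0" using ab m0(1)[of z] m0(1)[of y] by linarith+
 then show ?thesis by simp
 next
 case False
 then have pos: "a + b > 0" using ab m0(1)[of z] m0(1)[of y] by linarith
 have "abs (a - b) * (a + b) <= dist y z * (a + b)"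
  unfolding e using ab m0(1)[of z] m0(1)[of y] by (intro mult_mono mm) auto
 then show ?thesis using pos by simp
 qed
 then show "dist (\<gamma> y) (\<gamma> z) <= 1 * dist y z"
 unfolding \<gamma>_def a_def[symmetric] b_def[symmetric] dist_real_def by simp
qed simp
have eq: "y : ball x R \<longleftrightarrow> \<gamma> (y - (y \<bullet> nu) *R nu) < y \<bullet> nu" if y: "y : ball p (R / 2)" for y
proof -
 define w where "w = y - x"
 define t where "t = w \<bullet> nu"
 define a where "a = w - t *R nu"
 have za: "y - (y \<bullet> nu) *R nu - x' = a" by (simp add: a_def t_def w_def x'_def inner_diff_left algebra_simps)
 have na: "(norm a)^2 = (norm w)^2 - t^2"
 proof -
 have "(norm a)^2 = w \<bullet> w - 2 * t * (w \<bullet> nu) + t * t * (nu \<bullet> nu)"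
  unfolding power2_norm_eq_inner a_def by (simp add: inner_diff_left inner_diff_right inner_commute algebra_simps)
 moreover have "w \<bullet> w = (norm w)^2" by (simp add: power2_norm_eq_inner)
 ultimately show ?thesis unfolding nu(2) t_def[symmetric] by (simp add: power2_eq_square)
 qed
 have "y - p = w + R *R nu" by (simp add: pR w_def)
 then have np: "(norm (y - p))^2 = (norm a)^2 + (t + R)^2"
 proof -
 assume "y - p = w + R *R nu"
 then have "(norm (y - p))^2 = w \<bullet> w + 2 * R * (w \<bullet> nu) + R * R * (nu \<bullet> nu)"
  unfolding power2_norm_eq_inner by (simp add: inner_add_left inner_add_right inner_commute algebra_simps)
 moreover have "w \<bullet> w = (norm w)^2" by (simp add: power2_norm_eq_inner)
 ultimately show ?thesis unfolding na nu(2) t_def[symmetric] by (simp add: power2_eq_square algebra_simps)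
 qed
 have "norm (y - p) < R / 2" using y by (simp add: dist_norm norm_minus_commute)
 then have "(norm (y - p))^2 < (R / 2)^2" by (intro power_strict_mono) auto
 then have "(norm a)^2 < (R / 2)^2" "(t + R)^2 < (R / 2)^2" unfolding np using zero_le_power2[of "t + R"] zero_le_power2[of "norm a"] by linarith+
 then have a2: "norm a < R / 2" and "abs (t + R) < R / 2" using power2_less_imp_less[of "norm a" "R / 2"] power2_less_imp_less[of "abs (t + R)" "R / 2"] R by simp_all
 then have t0: "t < 0" by linarith
 have "m (y - (y \<bullet> nu) *R nu) = norm a" using a2 by (simp add: m_def za)
 then have "\<gamma> (y - (y \<bullet> nu) *R nu) < y \<bullet> nu \<longleftrightarrow> - t < sqrt (R^2 - (norm a)^2)"
 by (auto simp: \<gamma>_def t_def w_def inner_diff_left)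
 also have "... \<longleftrightarrow> sqrt (t^2) < sqrt (R^2 - (norm a)^2)" using t0 by simp
 also have "... \<longleftrightarrow> t^2 < R^2 - (norm a)^2" by (rule real_sqrt_less_iff)
 also have "... \<longleftrightarrow> (norm w)^2 < R^2" unfolding na by linarith
 also have "... \<longleftrightarrow> norm w < R" using R by (auto intro: power2_less_imp_less power_strict_mono)
 finally show ?thesis by (simp add: w_def dist_norm norm_minus_commute)
qed
show "EX nu L r. EX \<gamma>. norm nu = 1 & r > 0 & L-lipschitz_on UNIV \<gamma> \<and>
  ball x R \<inter> ball p r = {x : ball p r. \<gamma> (x - (x \<bullet> nu) *R nu) < x \<bullet> nu}"
proof (rule exI[of _ nu], rule exI[of _ 1], rule exI[of _ "R / 2"], rule exI[of _ \<gamma>], intro conjI)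
 show "ball x R \<inter> ball p (R / 2) = {x : ball p (R / 2). \<gamma> (x - (x \<bullet> nu) *R nu) < x \<bullet> nu}" using eq by blast
qed (use nu(1) R lip in auto)
qed auto

lemma loc_ball:
assumes "loc X U h" "R > 0" "cball x R <= U"
shows "X (ball x R) h"
using assms bounded_lipschitz_domain_ball[OF assms(2), of x] unfolding loc_def by simp

lemma gagliardo_cong_AE:
assumes "AE x in lebesgue. x : V --> w x = w' x"
shows "gagliardo s p V w = gagliardo s p V w'"
unfolding gagliardo_def
proof (rule nn_integral_cong_AE)
show "AE x in lebesgue. (\<integral>\<^sup>+y\<in>V. ennreal (abs (w x - w y) powr p / dist x y powr (real CARD('a) + s * p)) \<partial>lebesgue) * indicator V x
 = (\<integral>\<^sup>+y\<in>V. ennreal (abs (w' x - w' y) powr p / dist x y powr (real CARD('a) + s * p)) \<partial>lebesgue) * indicator V x"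
 using assms
proof eventually_elim
 case (elim x)
 show ?case
 proof (cases "x : V")
 case True
 have "(\<integral>\<^sup>+y\<in>V. ennreal (abs (w x - w y) powr p / dist x y powr (real CARD('a) + s * p)) \<partial>lebesgue)
  = (\<integral>\<^sup>+y\<in>V. ennreal (abs (w' x - w' y) powr p / dist x y powr (real CARD('a) + s * p)) \<partial>lebesgue)"
 proof (rule nn_integral_cong_AE)
  show "AE y in lebesgue. ennreal (abs (w x - w y) powr p / dist x y powr (real CARD('a) + s * p)) * indicator V y
  = ennreal (abs (w' x - w' y) powr p / dist x y powr (real CARD('a) + s * p)) * indicator V y"
  using assms by eventually_elim (use elim True in \<open>auto simp: indicator_def\<close>)
 qed
 then show ?thesis by simp
 qed simp
qed
qed

text \<open>Pairs closer than \<open>delta\<close> lie in a common ball of a finite cover, where the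
  local seminorm is finite; for all other pairs the kernel is bounded and \<open>V\<close> has
  finite measure.\<close>

lemma gagliardo_finite_local:
fixes w :: "fun2"
assumes U': "open U'" and w: "continuous_on U' w" and V: "open V" "bounded V" "closure V <= U'"
 and l: "!!y. y : U' ==> EX t>0. ball y t <= U' & gagliardo (2/3) 3 (ball y t) w < \<infinity>"
shows "gagliardo (2/3) 3 V w < \<infinity>"
proof -
let ?K = "closure V"
have K: "compact ?K" using V(2) by (simp add: compact_closure)
have VK: "V <= ?K" by (rule closure_subset)
have Vm[measurable]: "V : sets borel" using V(1) by simp
define w0 where "w0 x = indicator U' x *R w x" for x
have [measurable]: "w0 : borel_measurable borel"
 unfolding w0_def[abs_def] using U' by (intro borel_measurable_continuous_on_indicator[OF _ w]) simp
have w0: "w0 x = w x" if "x : U'" for x using that by (simp add: w0_def)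
define G where "G A x y = indicator A x * indicator A y * ennreal (abs (w0 x - w0 y) ^ 3 / dist x y ^ 4)" for A x y
have gG: "gagliardo (2/3) 3 A w = (\<integral>\<^sup>+x. \<integral>\<^sup>+y. G A x y \<partial>lborel \<partial>lborel)" if "A <= U'" for A
 unfolding G_def by (rule gagliardo_lborel, rule w0) (use that in blast)
obtain M where M: "M > 0" "!!x. x : ?K ==> abs (w x) <= M"
 by (rule compact_bound[OF K continuous_on_subset[OF w V(3)]]) blast
have "ALL y:U'. EX t. t > 0 & (ball y t <= U' & gagliardo (2/3) 3 (ball y t) w < \<infinity>)" using l by simp
from bchoice[OF this] obtain t where t: "!!y. y : U' ==> t y > 0" "!!y. y : U' ==> ball y (t y) <= U'"
 "!!y. y : U' ==> gagliardo (2/3) 3 (ball y (t y)) w < \<infinity>" by blast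
have KU: "y : U'" if "y : ?K" for y by (rule subsetD[OF V(3) that])
have op: "!!y. y : ?K ==> open (ball y (t y / 2))" by simp
have cov: "?K <= (\<Union>y\<in>?K. ball y (t y / 2))" using t(1) KU by fastforce
obtain F where F: "F <= ?K" "finite F" "?K <= (\<Union>y\<in>F. ball y (t y / 2))"
 by (rule compactE_image[OF K op cov]) blast
have FU: "z : U'" if "z : F" for z by (rule KU[OF subsetD[OF F(1) that]])
\<comment> \<open>The cover uses half radii: if \<open>x\<close> lies in a half ball and
  \<open>y\<close> is within \<open>delta\<close> of it, both lie in the full ball.\<close>
define delta where "delta = Min (insert 1 ((%y. t y / 2) ` F))"
have delta0: "delta > 0" unfolding delta_def using F(2) t(1) FU by (subst Min_gr_iff) auto
have deltat: "delta <= t z / 2" if "z : F" for z unfolding delta_def using F(2) that by (intro Min_le) auto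
define c where "c = (2 * M) ^ 3 / delta ^ 4"
have pt: "G V x y <= (\<Sum>z\<in>F. G (ball z (t z)) x y) + indicator V x * indicator V y * ennreal c" for x y
proof (cases "x : V & y : V")
 case xy: True
 then have xK: "x : ?K" "y : ?K" using VK by blast+
 show ?thesis
 proof (cases "dist x y < delta")
 case True
 obtain z where z: "z : F" "x : ball z (t z / 2)" using F(3) xK(1) by blast
 have "dist z x < t z / 2" using z(2) by simp
 moreover have "dist z y <= dist z x + dist x y" by (rule dist_triangle)
 ultimately have zz: "x : ball z (t z)" "y : ball z (t z)" using True deltat[OF z(1)] zero_le_dist[of z x] by (simp_all only: mem_ball)
 have "G V x y = G (ball z (t z)) x y" using xy zz by (simp add: G_def)
 also have "... <= (\<Sum>z\<in>F. G (ball z (t z)) x y)" using F(2) z(1) by (intro member_le_sum) auto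
 finally show ?thesis by (rule order_trans) simp
 next
 case False
 have "abs (w0 x - w0 y) <= 2 * M" using M(2)[OF xK(1)] M(2)[OF xK(2)] w0[OF KU[OF xK(1)]] w0[OF KU[OF xK(2)]] by linarith
 then have "abs (w0 x - w0 y) ^ 3 / dist x y ^ 4 <= c"
  unfolding c_def using False delta0 by (intro frac_le power_mono) auto
 then have "G V x y <= indicator V x * indicator V y * ennreal c" using xy by (simp add: G_def ennreal_leI)
 then show ?thesis by (rule order_trans) simp
 qed
qed (auto simp: G_def)
have Gm[measurable]: "(%(x, y). G A x y) : borel_measurable (lborel \<Otimes>\<^sub>M lborel)" if "A : sets borel" for A
 unfolding G_def using that by measurable
have Gm1[measurable]: "G A x : borel_measurable lborel" if "A : sets borel" for A x
 unfolding G_def using that by measurable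
have Gm2[measurable]: "(%x. \<integral>\<^sup>+y. G A x y \<partial>lborel) : borel_measurable lborel" if "A : sets borel" for A
 using Gm[OF that] by (rule lborel.borel_measurable_nn_integral)
have "gagliardo (2/3) 3 V w = (\<integral>\<^sup>+x. \<integral>\<^sup>+y. G V x y \<partial>lborel \<partial>lborel)"
 by (rule gG[OF order_trans[OF VK V(3)]])
also have "... <= (\<integral>\<^sup>+x. \<integral>\<^sup>+y. (\<Sum>z\<in>F. G (ball z (t z)) x y) + indicator V x * indicator V y * ennreal c \<partial>lborel \<partial>lborel)"
 by (intro nn_integral_mono pt)
also have "... = (\<integral>\<^sup>+x. (\<Sum>z\<in>F. \<integral>\<^sup>+y. G (ball z (t z)) x y \<partial>lborel) + indicator V x * emeasure lborel V * ennreal c \<partial>lborel)"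
proof (rule nn_integral_cong)
 fix x
 have "(\<integral>\<^sup>+y. (\<Sum>z\<in>F. G (ball z (t z)) x y) + indicator V x * indicator V y * ennreal c \<partial>lborel)
 = (\<integral>\<^sup>+y. (\<Sum>z\<in>F. G (ball z (t z)) x y) \<partial>lborel) + (\<integral>\<^sup>+y. indicator V x * indicator V y * ennreal c \<partial>lborel)"
 by (rule nn_integral_add) (auto intro!: borel_measurable_sum Gm1)
 also have "(\<integral>\<^sup>+y. (\<Sum>z\<in>F. G (ball z (t z)) x y) \<partial>lborel) = (\<Sum>z\<in>F. \<integral>\<^sup>+y. G (ball z (t z)) x y \<partial>lborel)"
 by (rule nn_integral_sum) (auto intro!: Gm1)
 also have "(\<integral>\<^sup>+y. indicator V x * indicator V y * ennreal c \<partial>lborel) = indicator V x * emeasure lborel V * ennreal c"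
 by (simp add: nn_integral_multc nn_integral_cmult)
 finally show "(\<integral>\<^sup>+y. (\<Sum>z\<in>F. G (ball z (t z)) x y) + indicator V x * indicator V y * ennreal c \<partial>lborel)
 = (\<Sum>z\<in>F. \<integral>\<^sup>+y. G (ball z (t z)) x y \<partial>lborel) + indicator V x * emeasure lborel V * ennreal c" .
qed
also have "... = (\<integral>\<^sup>+x. (\<Sum>z\<in>F. \<integral>\<^sup>+y. G (ball z (t z)) x y \<partial>lborel) \<partial>lborel) + (\<integral>\<^sup>+x. indicator V x * emeasure lborel V * ennreal c \<partial>lborel)"
 by (rule nn_integral_add) (auto intro!: borel_measurable_sum Gm2)
also have "(\<integral>\<^sup>+x. (\<Sum>z\<in>F. \<integral>\<^sup>+y. G (ball z (t z)) x y \<partial>lborel) \<partial>lborel) = (\<Sum>z\<in>F. \<integral>\<^sup>+x. \<integral>\<^sup>+y. G (ball z (t z)) x y \<partial>lborel \<partial>lborel)"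
 by (rule nn_integral_sum) (auto intro!: Gm2)
also have "... = (\<Sum>z\<in>F. gagliardo (2/3) 3 (ball z (t z)) w)"
 by (rule sum.cong[OF refl]) (rule gG[OF t(2)[OF FU], symmetric])
also have "(\<integral>\<^sup>+x. indicator V x * emeasure lborel V * ennreal c \<partial>lborel) = emeasure lborel V * emeasure lborel V * ennreal c"
 by (simp add: nn_integral_multc)
finally have le: "gagliardo (2/3) 3 V w <= (\<Sum>z\<in>F. gagliardo (2/3) 3 (ball z (t z)) w) + emeasure lborel V * emeasure lborel V * ennreal c" .
have "(\<Sum>z\<in>F. gagliardo (2/3) 3 (ball z (t z)) w) < top"
 using t(3) FU by (simp add: ennreal_sum_less_top F(2))
moreover have "emeasure lborel V < top" using emeasure_bounded_finite[OF V(2)] by simp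
ultimately have "(\<Sum>z\<in>F. gagliardo (2/3) 3 (ball z (t z)) w) + emeasure lborel V * emeasure lborel V * ennreal c < top"
 by (simp add: ennreal_mult_less_top)
with le show ?thesis by (simp add: le_less_trans)
qed

lemma sum_cube_le:
fixes a :: "'a => real"
assumes A: "finite A" and a: "!!i. i : A ==> a i >= 0"
shows "(\<Sum>i\<in>A. a i) ^ 3 <= real (card A) ^ 3 * (\<Sum>i\<in>A. a i ^ 3)"
proof -
let ?S = "\<Sum>i\<in>A. a i ^ 3"
have S: "?S >= 0" using a by (intro sum_nonneg) simp
have "a i <= root 3 ?S" if "i : A" for i
proof -
 have "a i ^ 3 <= ?S" using A that a by (intro member_le_sum) auto
 then have "root 3 (a i ^ 3) <= root 3 ?S" by (intro real_root_le_mono) auto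
 then show ?thesis using a[OF that] by (simp add: real_root_power_cancel)
qed
then have "(\<Sum>i\<in>A. a i) <= real (card A) * root 3 ?S" using sum_bounded_above[of A a] by simp
then have "(\<Sum>i\<in>A. a i) ^ 3 <= (real (card A) * root 3 ?S) ^ 3" using a by (intro power_mono sum_nonneg)
also have "... = real (card A) ^ 3 * ?S" using S by (simp add: power_mult_distrib)
finally show ?thesis .
qed

section \<open>Gagliardo seminorms under the change of variables\<close>

context C1_graph
begin

definition Phi0 :: "real^2 => real^2" where "Phi0 y = (if y : U' then Phi y else 0)"

lemma Phi0_measurable [measurable]: "Phi0 : borel_measurable borel"
unfolding Phi0_def[abs_def] by (rule borel_measurable_continuous_on_if) (use U' Phi_cont in auto)

lemma nn_integral_image_le:
assumes W: "open W" "W <= K" and K: "compact K" "K <= U" and C: "!!x. x : K ==> abs (J x) <= C"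
 and h: "h : borel_measurable borel"
shows "(\<integral>\<^sup>+y\<in>Psi ` W. h (Phi0 y) \<partial>lborel) <= ennreal C * (\<integral>\<^sup>+x\<in>W. h x \<partial>lborel)"
proof -
note [measurable] = h
have Wm[measurable]: "W : sets borel" using W by simp
have "(\<integral>\<^sup>+y\<in>Psi ` W. h (Phi0 y) \<partial>lborel) = (\<integral>\<^sup>+x\<in>W. h (Phi0 (Psi x)) * ennreal (abs (J x)) \<partial>lborel)"
 by (rule change_of_variables(1)[OF W K]) measurable
also have "... <= (\<integral>\<^sup>+x. ennreal C * (h x * indicator W x) \<partial>lborel)"
proof (rule nn_integral_mono)
 fix x
 show "h (Phi0 (Psi x)) * ennreal (abs (J x)) * indicator W x <= ennreal C * (h x * indicator W x)"
 proof (cases "x : W")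
 case True
 then have x: "x : K" "x : U" using W K by blast+
 have "h x * ennreal (abs (J x)) <= h x * ennreal C" by (intro mult_left_mono ennreal_leI C[OF x(1)]) simp
 then show ?thesis using True x(2) by (simp add: Phi0_def Psi_in PhiPsi mult.commute)
 qed simp
qed
also have "... = ennreal C * (\<integral>\<^sup>+x\<in>W. h x \<partial>lborel)" by (rule nn_integral_cmult) measurable
finally show ?thesis .
qed

text \<open>The kernel of a slope is bounded by the sum of the kernels of the first derivatives of
  the map at the preimages; changing variables separately in the two points costs a bound on the
  Jacobian each time.\<close>

lemma gagliardo_graph:
assumes gag: "!!k i x R. R > 0 ==> cball x R <= U ==> gagliardo (2/3) 3 (ball x R) (pd i (u k)) < \<infinity>"
 and y: "y : U'"
shows "EX t>0. ball y t <= U' & gagliardo (2/3) 3 (ball y t) (pd i f) < \<infinity>"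
proof -
obtain s C R where s: "s > 0" "C > 0" "R > 0" "cball y s <= U'" "cball (Phi y) R <= U" "!!a. a : cball y s ==> Phi a : ball (Phi y) R"
 and ctl: "!!a b i. a : cball y s ==> b : cball y s ==> abs (pd i f a - pd i f b) <= C * du (Phi a) (Phi b)"
 "!!a b. a : cball y s ==> b : cball y s ==> dist (Phi a) (Phi b) <= C * dist a b & dist a b <= C * dist (Phi a) (Phi b)"
 by (rule control[OF y]) blast
let ?B = "ball y s" and ?W = "ball (Phi y) R" and ?K = "cball (Phi y) R"
have BU: "?B <= U'" by (rule order_trans[OF ball_subset_cball s(4)])
have BW: "?B <= Psi ` ?W"
proof
 fix a assume a: "a : ?B"
 then have "Phi a : ?W" by (intro s(6)) simp
 moreover have "a = Psi (Phi a)" using PsiPhi[OF subsetD[OF BU a]] by simp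
 ultimately show "a : Psi ` ?W" by (rule rev_image_eqI)
qed
have PsiW[measurable]: "Psi ` ?W : sets borel" using open_Psi_image[OF open_ball order_trans[OF ball_subset_cball s(5)]] by simp
have WK: "?W <= ?K" by (rule ball_subset_cball)
have Wm[measurable]: "?W : sets borel" by simp
obtain CJ where CJ: "CJ > 0" "!!x. x : ?K ==> abs (J x) <= CJ"
 by (rule compact_bound[OF compact_cball continuous_on_subset[OF J_cont s(5)]]) blast
define q where "q k i x = indicator U x *R pd i (u k) x" for k i x
have [measurable]: "q k i : borel_measurable borel" for k i
 unfolding q_def[abs_def] using U by (intro borel_measurable_continuous_on_indicator[OF _ u_cont(2)]) simp
have q: "q k i x = pd i (u k) x" if "x : U" for k i x using that by (simp add: q_def)
define H where "H x x' = (\<Sum>j\<in>(UNIV::(3\<times>2) set). ennreal (abs (q (fst j) (snd j) x - q (fst j) (snd j) x') ^ 3 / dist x x' ^ 4))" for x x'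
\<comment> \<open>\<open>C ^ 3\<close> from the cubed increments of the slopes, \<open>C ^ 4\<close>
  from the distortion of the distance in the denominator, and 216 = \<open>6 ^ 3\<close> from the
  cube of a sum of six terms.\<close>
define D where "D = C ^ 7 * 216"
have D0: "D >= 0" using s(2) by (simp add: D_def)
have Hm[measurable]: "(%(x, x'). H x x') : borel_measurable (borel \<Otimes>\<^sub>M borel)" unfolding H_def by measurable
have Hm1[measurable]: "H x : borel_measurable borel" for x unfolding H_def by measurable
define H1 where "H1 x = (\<integral>\<^sup>+x'\<in>?W. H x x' \<partial>lborel)" for x
have H1m[measurable]: "H1 : borel_measurable borel"
proof -
 have "(%(x, x'). H x x' * indicator ?W x') : borel_measurable (borel \<Otimes>\<^sub>M lborel)" unfolding H_def by measurable
 then show ?thesis unfolding H1_def[abs_def] by (rule lborel.borel_measurable_nn_integral)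
qed
define f0 where "f0 a = indicator U' a *R pd i f a" for a
have f0: "f0 a = pd i f a" if "a : ?B" for a using subsetD[OF BU that] by (simp add: f0_def)
have pt: "indicator ?B a * indicator ?B b * ennreal (abs (f0 a - f0 b) ^ 3 / dist a b ^ 4)
 <= indicator (Psi ` ?W) a * (indicator (Psi ` ?W) b * (ennreal D * H (Phi0 a) (Phi0 b)))" for a b
proof (cases "a : ?B & b : ?B")
 case ab: True
 have abU: "a : U'" "b : U'" using ab BU by blast+
 have abW: "a : Psi ` ?W" "b : Psi ` ?W" using ab BW by blast+
 have abc: "a : cball y s" "b : cball y s" using ab by auto
 have PhiU: "Phi a : U" "Phi b : U" using Phi_in abU by auto
 show ?thesis
 proof (cases "a = b")
 case False
 let ?d = "dist (Phi a) (Phi b)"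
 have dab: "dist a b > 0" "?d <= C * dist a b" "dist a b <= C * ?d" using False ctl(2)[OF abc] by auto
 have "C * ?d > 0" using dab(1,3) by linarith
 then have d0: "?d > 0" using s(2) by (simp add: zero_less_mult_iff)
 have "abs (f0 a - f0 b) ^ 3 <= (C * du (Phi a) (Phi b)) ^ 3"
  using ctl(1)[OF abc, of i] ab f0 by (intro power_mono) auto
 also have "... <= C ^ 3 * (216 * (\<Sum>j\<in>(UNIV::(3\<times>2) set). abs (q (fst j) (snd j) (Phi a) - q (fst j) (snd j) (Phi b)) ^ 3))"
 proof -
  have "du (Phi a) (Phi b) = (\<Sum>j\<in>(UNIV::(3\<times>2) set). abs (q (fst j) (snd j) (Phi a) - q (fst j) (snd j) (Phi b)))"
  unfolding du_def UNIV_Times_UNIV[symmetric] sum.cartesian_product[symmetric] by (simp add: sum.cartesian_product split_def q PhiU)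
  moreover have "(\<Sum>j\<in>(UNIV::(3\<times>2) set). abs (q (fst j) (snd j) (Phi a) - q (fst j) (snd j) (Phi b))) ^ 3
  <= real (card (UNIV::(3\<times>2) set)) ^ 3 * (\<Sum>j\<in>(UNIV::(3\<times>2) set). abs (q (fst j) (snd j) (Phi a) - q (fst j) (snd j) (Phi b)) ^ 3)"
  by (rule sum_cube_le) auto
  ultimately show ?thesis using s(2) by (simp add: power_mult_distrib)
 qed
 finally have n: "abs (f0 a - f0 b) ^ 3 <= C ^ 3 * (216 * (\<Sum>j\<in>(UNIV::(3\<times>2) set). abs (q (fst j) (snd j) (Phi a) - q (fst j) (snd j) (Phi b)) ^ 3))" .
 have "(?d / C) ^ 4 <= dist a b ^ 4" using dab s(2) by (intro power_mono) (auto simp: field_simps)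
 then have "abs (f0 a - f0 b) ^ 3 / dist a b ^ 4 <= C ^ 3 * (216 * (\<Sum>j\<in>(UNIV::(3\<times>2) set). abs (q (fst j) (snd j) (Phi a) - q (fst j) (snd j) (Phi b)) ^ 3)) / (?d / C) ^ 4"
  using d0 s(2) by (intro frac_le n mult_nonneg_nonneg sum_nonneg) auto
 also have "... = D * (\<Sum>j\<in>(UNIV::(3\<times>2) set). abs (q (fst j) (snd j) (Phi a) - q (fst j) (snd j) (Phi b)) ^ 3 / ?d ^ 4)"
  using s(2) by (simp add: D_def sum_divide_distrib[symmetric] power_divide eval_nat_numeral)
 finally have "ennreal (abs (f0 a - f0 b) ^ 3 / dist a b ^ 4) <= ennreal (D * (\<Sum>j\<in>(UNIV::(3\<times>2) set). abs (q (fst j) (snd j) (Phi a) - q (fst j) (snd j) (Phi b)) ^ 3 / ?d ^ 4))"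
  by (rule ennreal_leI)
 also have "... = ennreal D * H (Phi a) (Phi b)"
  unfolding H_def ennreal_mult'[OF D0] by (simp add: sum_ennreal)
 finally show ?thesis using ab abW abU by (simp add: Phi0_def)
 qed simp
qed auto
have "gagliardo (2/3) 3 ?B (pd i f) = (\<integral>\<^sup>+a. \<integral>\<^sup>+b. indicator ?B a * indicator ?B b * ennreal (abs (f0 a - f0 b) ^ 3 / dist a b ^ 4) \<partial>lborel \<partial>lborel)"
 by (rule gagliardo_lborel) (rule f0)
also have "... <= (\<integral>\<^sup>+a. \<integral>\<^sup>+b. indicator (Psi ` ?W) a * (indicator (Psi ` ?W) b * (ennreal D * H (Phi0 a) (Phi0 b))) \<partial>lborel \<partial>lborel)"
 by (intro nn_integral_mono pt)
also have "... <= (\<integral>\<^sup>+a. (ennreal D * ennreal CJ * H1 (Phi0 a)) * indicator (Psi ` ?W) a \<partial>lborel)"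
proof (rule nn_integral_mono)
 fix a
 have "(\<integral>\<^sup>+b. indicator (Psi ` ?W) a * (indicator (Psi ` ?W) b * (ennreal D * H (Phi0 a) (Phi0 b))) \<partial>lborel)
 = indicator (Psi ` ?W) a * (ennreal D * (\<integral>\<^sup>+b\<in>Psi ` ?W. H (Phi0 a) (Phi0 b) \<partial>lborel))"
 by (simp add: nn_integral_cmult[symmetric] mult_ac)
 also have "... <= indicator (Psi ` ?W) a * (ennreal D * (ennreal CJ * (\<integral>\<^sup>+x'\<in>?W. H (Phi0 a) x' \<partial>lborel)))"
 by (intro mult_left_mono nn_integral_image_le[OF open_ball WK compact_cball s(5) CJ(2) Hm1]) auto
 finally show "(\<integral>\<^sup>+b. indicator (Psi ` ?W) a * (indicator (Psi ` ?W) b * (ennreal D * H (Phi0 a) (Phi0 b))) \<partial>lborel)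
 <= (ennreal D * ennreal CJ * H1 (Phi0 a)) * indicator (Psi ` ?W) a" by (simp add: H1_def mult_ac)
qed
also have "... <= ennreal CJ * (\<integral>\<^sup>+x\<in>?W. (ennreal D * ennreal CJ * H1 x) \<partial>lborel)"
 by (rule nn_integral_image_le[OF open_ball WK compact_cball s(5) CJ(2), where h="%x. ennreal D * ennreal CJ * H1 x"]) (simp, measurable)
also have "(\<integral>\<^sup>+x\<in>?W. (ennreal D * ennreal CJ * H1 x) \<partial>lborel) = ennreal D * ennreal CJ * (\<integral>\<^sup>+x\<in>?W. H1 x \<partial>lborel)"
proof -
 have "(%x. H1 x * indicator ?W x) : borel_measurable lborel" by measurable
 from nn_integral_cmult[OF this, of "ennreal D * ennreal CJ"] show ?thesis by (simp add: mult.assoc)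
qed
also have "(\<integral>\<^sup>+x\<in>?W. H1 x \<partial>lborel) = (\<Sum>j\<in>(UNIV::(3\<times>2) set). gagliardo (2/3) 3 ?W (pd (snd j) (u (fst j))))"
proof -
 define Q where "Q j x x' = indicator ?W x * indicator ?W x' * ennreal (abs (q (fst j) (snd j) x - q (fst j) (snd j) x') ^ 3 / dist x x' ^ 4)" for j :: "3 \<times> 2" and x x'
 have Qm[measurable]: "(%(x, x'). Q j x x') : borel_measurable (lborel \<Otimes>\<^sub>M lborel)" for j unfolding Q_def by measurable
 have Qm1[measurable]: "Q j x : borel_measurable lborel" for j x unfolding Q_def by measurable
 have Qm2[measurable]: "(%x. \<integral>\<^sup>+x'. Q j x x' \<partial>lborel) : borel_measurable lborel" for j
 using Qm by (rule lborel.borel_measurable_nn_integral)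
 have "H1 x * indicator ?W x = (SU j. \<integral>\<^sup>+x'. Q j x x' \<partial>lborel)" for x
 proof -
 have "H1 x * indicator ?W x = (\<integral>\<^sup>+x'. H x x' * indicator ?W x' * indicator ?W x \<partial>lborel)"
  unfolding H1_def by (rule nn_integral_multc[symmetric]) measurable
 also have "... = (\<integral>\<^sup>+x'. (SU j. Q j x x') \<partial>lborel)"
  by (rule nn_integral_cong) (simp add: H_def Q_def sum_distrib_right mult_ac)
 also have "... = (SU j. \<integral>\<^sup>+x'. Q j x x' \<partial>lborel)" by (rule nn_integral_sum) measurable
 finally show ?thesis .
 qed
 then have "(\<integral>\<^sup>+x\<in>?W. H1 x \<partial>lborel) = (SU j. \<integral>\<^sup>+x. \<integral>\<^sup>+x'. Q j x x' \<partial>lborel \<partial>lborel)"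
 by (simp add: nn_integral_sum)
 also have "... = (\<Sum>j\<in>(UNIV::(3\<times>2) set). gagliardo (2/3) 3 ?W (pd (snd j) (u (fst j))))"
 proof (rule sum.cong[OF refl])
 fix j :: "3 \<times> 2"
 have "q (fst j) (snd j) x = pd (snd j) (u (fst j)) x" if "x : ?W" for x
  by (rule q[OF subsetD[OF s(5) subsetD[OF WK that]]])
 from gagliardo_lborel[where w'="q (fst j) (snd j)" and V="?W", OF this]
 show "(\<integral>\<^sup>+x. \<integral>\<^sup>+x'. Q j x x' \<partial>lborel \<partial>lborel) = gagliardo (2/3) 3 ?W (pd (snd j) (u (fst j)))"
  unfolding Q_def by simp
 qed
 finally show ?thesis .
qed
finally have le: "gagliardo (2/3) 3 ?B (pd i f) <= ennreal CJ * (ennreal D * ennreal CJ * (\<Sum>j\<in>(UNIV::(3\<times>2) set). gagliardo (2/3) 3 ?W (pd (snd j) (u (fst j)))))" .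
have "(\<Sum>j\<in>(UNIV::(3\<times>2) set). gagliardo (2/3) 3 ?W (pd (snd j) (u (fst j)))) < top"
 using gag[OF s(3,5)] by (simp add: ennreal_sum_less_top)
then have "ennreal CJ * (ennreal D * ennreal CJ * (\<Sum>j\<in>(UNIV::(3\<times>2) set). gagliardo (2/3) 3 ?W (pd (snd j) (u (fst j))))) < top"
 by (simp add: ennreal_mult_less_top)
with le s(1) BU show ?thesis by (intro exI[of _ s]) (simp add: le_less_trans)
qed

end

section \<open>Finite signed measures\<close>

text \<open>The integral identity is proved for nonnegative functions by induction over Borel
  functions and then for positive and negative parts; the bound \<open>C\<close> guarantees
  integrability for finite measures.\<close>

lemma finite_sum_of_measures:
fixes mu :: "'i => 'a::topological_space measure"
assumes I: "finite I" and mu: "!!i. i : I ==> finite_measure (mu i)" "!!i. i : I ==> sets (mu i) = sets borel"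
obtains M where "finite_measure M" "sets M = sets (borel :: 'a measure)"
 "!!phi :: 'a => real. phi : borel_measurable borel ==> (!!x. abs (phi x) <= C) ==> (LINT x|M. phi x) = (\<Sum>i\<in>I. \<integral>x. phi x \<partial>mu i)"
proof -
define M where "M = measure_of (UNIV :: 'a set) (sets borel) (%A. \<Sum>i\<in>I. emeasure (mu i) A)"
have sM[measurable_cong]: "sets M = sets (borel :: 'a measure)"
 unfolding M_def using sets.sigma_sets_eq[of "borel :: 'a measure"] by (subst sets_measure_of) auto
have eM: "emeasure M A = (\<Sum>i\<in>I. emeasure (mu i) A)" if "A : sets borel" for A
proof (rule emeasure_measure_of[OF M_def])
 show "positive (sets M) (%A. \<Sum>i\<in>I. emeasure (mu i) A)" by (auto simp: positive_def)
 show "countably_additive (sets M) (%A. \<Sum>i\<in>I. emeasure (mu i) A)"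
 proof (rule countably_additiveI)
 fix A :: "nat => 'a set" assume A: "range A <= sets M" "disjoint_family A"
 have "(\<Sum>n. \<Sum>i\<in>I. emeasure (mu i) (A n)) = (\<Sum>i\<in>I. \<Sum>n. emeasure (mu i) (A n))"
  by (rule suminf_sum) (rule summableI)
 also have "... = (\<Sum>i\<in>I. emeasure (mu i) (\<Union>n. A n))"
  using A sM by (intro sum.cong refl suminf_emeasure) (simp_all add: mu(2))
 finally show "(\<Sum>n. \<Sum>i\<in>I. emeasure (mu i) (A n)) = (\<Sum>i\<in>I. emeasure (mu i) (\<Union>n. A n))" .
 qed
qed (use that sM in auto)
have space: "space M = UNIV" "!!i. i : I ==> space (mu i) = UNIV"
 using sets_eq_imp_space_eq[OF sM] sets_eq_imp_space_eq[OF mu(2)] by auto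
have fM: "finite_measure M"
proof (rule finite_measureI)
 have "emeasure (mu i) UNIV < top" if "i : I" for i
 using finite_measure.emeasure_finite[OF mu(1)[OF that], of UNIV] by (simp add: less_top)
 then have "(\<Sum>i\<in>I. emeasure (mu i) UNIV) < top" using I by (simp add: ennreal_sum_less_top)
 then show "emeasure M (space M) ~= \<infinity>" unfolding space by (simp add: eM)
qed
have mM: "h : borel_measurable M" if "h : borel_measurable borel" for h :: "'a => ennreal"
 by (simp only: measurable_cong_sets[OF sM refl] that)
have mmu: "h : borel_measurable (mu i)" if "h : borel_measurable borel" "i : I" for h :: "'a => ennreal" and i
 by (simp only: measurable_cong_sets[OF mu(2)[OF that(2)] refl] that(1))
have nn: "(\<integral>\<^sup>+x. h x \<partial>M) = (\<Sum>i\<in>I. \<integral>\<^sup>+x. h x \<partial>mu i)" if h: "h : borel_measurable borel" for h :: "'a => ennreal"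
 using h
proof (induction rule: borel_measurable_induct)
 case (cong f g)
 then have "f = g" by (intro ext) simp
 then show ?case using cong by simp
next
 case (set A)
 then show ?case using mu(2) sM by (simp add: eM)
next
 case (mult h c)
 have "h : borel_measurable M" "!!i. i : I ==> h : borel_measurable (mu i)"
 by (rule mM[OF mult(2)], rule mmu[OF mult(2)])
 then show ?case using mult by (simp add: nn_integral_cmult sum_distrib_left)
next
 case (add h g)
 have "h : borel_measurable M" "!!i. i : I ==> h : borel_measurable (mu i)" "g : borel_measurable M" "!!i. i : I ==> g : borel_measurable (mu i)"
 using add mM mmu by blast+
 then show ?case using add by (simp add: nn_integral_add sum.distrib)
next
 case (seq F)
 have m: "F k : borel_measurable M" "!!i. i : I ==> F k : borel_measurable (mu i)" for k
 by (rule mM[OF seq(1)], rule mmu[OF seq(1)])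
 have inc: "incseq (%k. \<integral>\<^sup>+x. F k x \<partial>N)" for N
 using seq(3) by (intro monoI nn_integral_mono) (auto dest: monoD simp: le_fun_def)
 have "(\<integral>\<^sup>+x. (SUP k. F k x) \<partial>M) = (SUP k. \<Sum>i\<in>I. \<integral>\<^sup>+x. F k x \<partial>mu i)"
 using nn_integral_monotone_convergence_SUP[OF seq(3) m(1)] seq.IH by simp
 also have "... = (\<Sum>i\<in>I. SUP k. \<integral>\<^sup>+x. F k x \<partial>mu i)"
 by (rule ennreal_SUP_sum) (rule inc)
 also have "... = (\<Sum>i\<in>I. \<integral>\<^sup>+x. (SUP k. F k x) \<partial>mu i)"
 by (rule sum.cong[OF refl]) (rule nn_integral_monotone_convergence_SUP[OF seq(3) m(2), symmetric])
 finally show ?case by (simp add: image_comp)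
qed
have "(LINT x|M. phi x) = (\<Sum>i\<in>I. \<integral>x. phi x \<partial>mu i)" if [measurable]: "phi : borel_measurable borel" and b: "!!x. abs (phi x) <= C" for phi :: "'a => real"
proof -
 have int: "integrable N phi" if "finite_measure N" "sets N = sets borel" for N
 by (rule finite_measure.integrable_const_bound[OF that(1), of _ C]) (use b that(2) in \<open>auto cong: measurable_cong_sets\<close>)
 have fin: "(\<integral>\<^sup>+x. ennreal (psi x) \<partial>N) < top" if "finite_measure N" "sets N = sets borel" "psi = phi \<or> psi = (%x. - phi x)" for N psi
 proof -
 have "integrable N psi" using int[OF that(1,2)] that(3) by auto
 then have "(\<integral>\<^sup>+x. ennreal (norm (psi x)) \<partial>N) < top" by (simp add: integrable_iff_bounded)
 then show ?thesis by (rule le_less_trans[rotated]) (intro nn_integral_mono ennreal_leI, simp)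
 qed
 have e: "enn2real (\<Sum>i\<in>I. \<integral>\<^sup>+x. ennreal (psi x) \<partial>mu i) = (\<Sum>i\<in>I. enn2real (\<integral>\<^sup>+x. ennreal (psi x) \<partial>mu i))" if "psi = phi \<or> psi = (%x. - phi x)" for psi
 using enn2real_sum[of I "%i. \<integral>\<^sup>+x. ennreal (psi x) \<partial>mu i"] fin[OF mu that] by (simp add: comp_def)
 have "(LINT x|M. phi x) = enn2real (\<Sum>i\<in>I. \<integral>\<^sup>+x. ennreal (phi x) \<partial>mu i) - enn2real (\<Sum>i\<in>I. \<integral>\<^sup>+x. ennreal (- phi x) \<partial>mu i)"
 unfolding real_lebesgue_integral_def[OF int[OF fM sM]] by (simp add: nn)
 also have "... = (\<Sum>i\<in>I. enn2real (\<integral>\<^sup>+x. ennreal (phi x) \<partial>mu i) - enn2real (\<integral>\<^sup>+x. ennreal (- phi x) \<partial>mu i))"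
 unfolding e[OF disjI1[OF refl]] e[OF disjI2[OF refl]] by (simp add: sum_subtractf)
 also have "... = (\<Sum>i\<in>I. \<integral>x. phi x \<partial>mu i)"
 by (rule sum.cong[OF refl]) (simp add: real_lebesgue_integral_def[OF int[OF mu]])
 finally show ?thesis .
qed
with fM sM show ?thesis using that by blast
qed

text \<open>The measures live on the whole space rather than on \<open>V\<close>, which is
  convenient for push-forwards, densities and sums; restriction to \<open>V\<close> comes at the end
  in \<open>signed_rep_imp\<close>.\<close>

definition signed_rep :: "(real^'n::finite) set => 'n distr => bool" where
"signed_rep V T \<longleftrightarrow> (EX mu nu. finite_measure mu & finite_measure nu & sets mu = sets borel & sets nu = sets borel \<and>
 (ALL phi. test_fun V phi --> T phi = (LINT x|(mu). phi x) - (LINT x|(nu). phi x)))"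

lemma signed_rep_imp:
fixes V :: "(real^'n::finite) set"
assumes V: "open V" and T: "signed_rep V T"
shows "is_finite_signed_measure V T"
proof -
obtain mu nu where m: "finite_measure mu" "finite_measure nu" "sets mu = sets borel" "sets nu = sets borel"
 and rep: "!!phi. test_fun V phi ==> T phi = (LINT x|(mu). phi x) - (LINT x|(nu). phi x)"
 using T unfolding signed_rep_def by blast
have r: "finite_measure (restrict_space N V)" "sets (restrict_space N V) = sets (restrict_space borel V)"
 "!!phi. test_fun V phi ==> (LINT x|(restrict_space N V). phi x) = (LINT x|N. phi x)"
 if N: "finite_measure N" "sets N = sets borel" for N
proof -
 have sp: "space N = UNIV" using sets_eq_imp_space_eq[OF N(2)] by simp
 have VN: "V \<inter> space N : sets N" using V N(2) sp by simp
 show "finite_measure (restrict_space N V)" using finite_measure_restrict_space[OF N(1), of V] V N(2) by simp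
 show "sets (restrict_space N V) = sets (restrict_space borel V)" by (rule sets_restrict_space_cong[OF N(2)])
 fix phi assume "test_fun V phi"
 then have z: "phi x = 0" if "x ~: V" for x using that unfolding test_fun_def by blast
 have "(LINT x|(restrict_space N V). phi x) = (LINT x|N. indicator V x *R phi x)" by (rule integral_restrict_space[OF VN])
 also have "... = (LINT x|N. phi x)" by (rule bochner_cong[OF refl]) (use z in \<open>auto simp: indicator_def\<close>)
 finally show "(LINT x|(restrict_space N V). phi x) = (LINT x|N. phi x)" .
qed
show ?thesis unfolding is_finite_signed_measure_def eq_distr_def
 using r[OF m(1,3)] r[OF m(2,4)] rep
 by (intro exI[of _ "restrict_space mu V"] exI[of _ "restrict_space nu V"]) simp
qed

text \<open>Only the positive part of \<open>C\<close> acts as density; used for \<open>C\<close>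
  and for its negative, this gives the two halves of a signed push-forward.\<close>

lemma push_forward_density:
fixes theta :: "'a => real^'n::finite"
assumes M: "finite_measure M" and theta[measurable]: "theta : M \<rightarrow>\<^sub>M borel"
 and C[measurable]: "C : borel_measurable M" and B: "!!x. abs (C x) <= B"
obtains mu where "finite_measure mu" "sets mu = sets borel"
 "!!phi :: real^'n => real. phi : borel_measurable borel ==> (LINT x|(mu). phi x) = (LINT x|M. phi (theta x) * max 0 (C x))"
proof -
define g where "g x = max 0 (C x)" for x
have [measurable]: "g : borel_measurable M" unfolding g_def[abs_def] by measurable
have g0: "0 <= g x" for x by (simp add: g_def)
define mu where "mu = distr (density M (%x. ennreal (g x))) borel theta"
have "finite_measure mu"
proof (rule finite_measureI)
 have "emeasure mu (space mu) = (\<integral>\<^sup>+x. ennreal (g x) \<partial>M)"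
 unfolding mu_def by (subst emeasure_distr) (auto simp: emeasure_density cong: nn_integral_cong_simp)
 also have "... <= (\<integral>\<^sup>+x. ennreal B \<partial>M)"
 proof (intro nn_integral_mono ennreal_leI)
 fix x show "g x <= B" using B[of x] unfolding g_def by linarith
 qed
 also have "... < top"
 using finite_measure.emeasure_finite[OF M, of "space M"] by (simp add: ennreal_mult_less_top less_top)
 finally show "emeasure mu (space mu) ~= \<infinity>" by simp
qed
moreover have "(LINT x|(mu). phi x) = (LINT x|M. phi (theta x) * max 0 (C x))" if [measurable]: "phi : borel_measurable borel" for phi :: "real^'n => real"
proof -
 have "(LINT x|(mu). phi x) = (LINT x|(density M (%x. ennreal (g x))). phi (theta x))"
 unfolding mu_def by (rule integral_distr) measurable
 also have "... = (LINT x|M. g x *R phi (theta x))"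
 by (rule integral_density) (auto simp: g0)
 finally show ?thesis by (simp add: g_def mult.commute)
qed
ultimately show ?thesis using that[of mu] by (simp add: mu_def)
qed

text \<open>The common tool for producing measures: it builds the second derivatives of the graph
  from those of the map, and it glues local representations. Signed densities are split into
  positive and negative parts, pushed forward, and summed separately.\<close>

lemma signed_rep_sum:
fixes M :: "'i => 'a measure" and theta :: "'i => 'a => real^'n::finite"
assumes I: "finite I" and M: "!!i. i : I ==> finite_measure (M i)" and theta: "!!i. i : I ==> theta i : M i \<rightarrow>\<^sub>M borel"
 and C: "!!i. i : I ==> C i : borel_measurable (M i)" and B: "!!i x. i : I ==> abs (C i x) <= B i"
 and T: "!!phi. test_fun V phi ==> T phi = (\<Sum>i\<in>I. \<integral>x. phi (theta i x) * C i x \<partial>M i)"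
shows "signed_rep V T"
proof -
have "EX mu. finite_measure mu & sets mu = sets borel \<and>
 (ALL phi :: real^'n => real. phi : borel_measurable borel --> (LINT x|(mu). phi x) = (LINT x|(M i). phi (theta i x) * max 0 (sgm * C i x)))"
 if i: "i : I" and sgm: "abs sgm = 1" for i and sgm :: real
proof -
 have m: "(%x. sgm * C i x) : borel_measurable (M i)" using C[OF i] by simp
 have b: "abs (sgm * C i x) <= B i" for x using B[OF i] sgm by (simp add: abs_mult)
 show ?thesis by (rule push_forward_density[OF M[OF i] theta[OF i] m b]) blast
qed
then have ex: "ALL i:I. EX mu. finite_measure mu & sets mu = sets borel \<and>
 (ALL phi :: real^'n => real. phi : borel_measurable borel --> (LINT x|(mu). phi x) = (LINT x|(M i). phi (theta i x) * max 0 (sgm * C i x)))"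
 if "abs sgm = 1" for sgm :: real using that by blast
have one: "abs (1::real) = 1" "abs (-1::real) = 1" by simp_all
obtain mu where mu: "!!i. i : I ==> finite_measure (mu i)" "!!i. i : I ==> sets (mu i) = sets borel"
 "!!i phi. i : I ==> phi : borel_measurable borel ==> (LINT x|(mu i). phi x) = (LINT x|(M i). phi (theta i x) * max 0 (1 * C i x))"
 using bchoice[OF ex[OF one(1)]] by blast
obtain nu where nu: "!!i. i : I ==> finite_measure (nu i)" "!!i. i : I ==> sets (nu i) = sets borel"
 "!!i phi. i : I ==> phi : borel_measurable borel ==> (LINT x|(nu i). phi x) = (LINT x|(M i). phi (theta i x) * max 0 (-1 * C i x))"
 using bchoice[OF ex[OF one(2)]] by blast
define D where "D = (%phi :: real^'n => real. SOME D. ALL x. abs (phi x) <= D)"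
have sums: "EX N. finite_measure N & sets N = sets (borel :: (real^'n) measure) & (ALL phi. test_fun V phi --> (LINT x|N. phi x) = (\<Sum>i\<in>I. \<integral>x. phi x \<partial>mu i))"
 if mu: "!!i. i : I ==> finite_measure (mu i)" "!!i. i : I ==> sets (mu i) = sets borel" for mu
proof -
 obtain N where N: "finite_measure N" "sets N = sets (borel :: (real^'n) measure)"
 "!!phi :: real^'n => real. phi : borel_measurable borel ==> (!!x. abs (phi x) <= 1) ==> (LINT x|N. phi x) = (\<Sum>i\<in>I. \<integral>x. phi x \<partial>mu i)"
 by (rule finite_sum_of_measures[OF I mu, where C=1]) (assumption, assumption, blast)
 have "(LINT x|N. phi x) = (\<Sum>i\<in>I. \<integral>x. phi x \<partial>mu i)" if phi: "test_fun V phi" for phi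
 proof -
 obtain D where D: "D >= 0" "!!x. abs (phi x) <= D" using test_fun_bounded[OF phi] by blast
 \<comment> \<open>The summed measure is obtained for functions bounded by one fixed constant, here
   1; rescaling lets a single measure serve all test functions.\<close>
 have "(LINT x|N. (1 / (D + 1)) * phi x) = (\<Sum>i\<in>I. \<integral>x. (1 / (D + 1)) * phi x \<partial>mu i)"
 proof (rule N(3))
  show "(%x. (1 / (D + 1)) * phi x) : borel_measurable borel" using test_fun_measurable[OF phi] by simp
  show "abs ((1 / (D + 1)) * phi x) <= 1" for x using D(1) D(2)[of x] by (simp add: abs_mult)
 qed
 then have "(1 / (D + 1)) * (LINT x|N. phi x) = (1 / (D + 1)) * (\<Sum>i\<in>I. \<integral>x. phi x \<partial>mu i)"
  by (simp only: integral_mult_right_zero sum_distrib_left)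
 then show ?thesis using D(1) by simp
 qed
 with N(1,2) show ?thesis by blast
qed
obtain mu' where mu': "finite_measure mu'" "sets mu' = sets borel" "!!phi. test_fun V phi ==> (LINT x|(mu'). phi x) = (\<Sum>i\<in>I. \<integral>x. phi x \<partial>mu i)"
 using sums[where mu=mu, OF mu(1) mu(2)] by blast
obtain nu' where nu': "finite_measure nu'" "sets nu' = sets borel" "!!phi. test_fun V phi ==> (LINT x|(nu'). phi x) = (\<Sum>i\<in>I. \<integral>x. phi x \<partial>nu i)"
 using sums[where mu=nu, OF nu(1) nu(2)] by blast
have "T phi = (LINT x|(mu'). phi x) - (LINT x|(nu'). phi x)" if phi: "test_fun V phi" for phi
proof -
 obtain D where D: "D >= 0" "!!x. abs (phi x) <= D" using test_fun_bounded[OF phi] by blast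
 note phim = test_fun_measurable[OF phi]
 have "(LINT x|(M i). phi (theta i x) * C i x) = (LINT x|(mu i). phi x) - (LINT x|(nu i). phi x)" if i: "i : I" for i
 proof -
 have [measurable]: "theta i : M i \<rightarrow>\<^sub>M borel" "C i : borel_measurable (M i)" "phi : borel_measurable borel" by (rule theta[OF i], rule C[OF i], rule phim)
 have int: "integrable (M i) (%x. phi (theta i x) * max 0 (sgm * C i x))" if "abs sgm = 1" for sgm
 proof (rule finite_measure.integrable_const_bound[OF M[OF i], of _ "D * B i"])
  have "abs (max 0 (sgm * C i x)) <= B i" for x
  proof -
  have "abs (sgm * C i x) <= B i" using B[OF i, of x] that by (simp add: abs_mult)
  then show ?thesis by linarith
  qed
  then show "AE x in M i. norm (phi (theta i x) * max 0 (sgm * C i x)) <= D * B i"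
  unfolding real_norm_def abs_mult by (intro AE_I2 mult_mono D) auto
 qed measurable
 have "(LINT x|(mu i). phi x) - (LINT x|(nu i). phi x) = (LINT x|(M i). phi (theta i x) * max 0 (1 * C i x) - phi (theta i x) * max 0 (-1 * C i x))"
  unfolding mu(3)[OF i phim] nu(3)[OF i phim]
  by (rule bochner_diff[OF int[OF one(1)] int[OF one(2)], symmetric])
 also have "... = (LINT x|(M i). phi (theta i x) * C i x)"
  by (rule bochner_cong[OF refl]) (simp add: max_def)
 finally show ?thesis by simp
 qed
 then show ?thesis unfolding T[OF phi] mu'(3)[OF phi] nu'(3)[OF phi] by (simp add: sum_subtractf)
qed
with mu' nu' show ?thesis unfolding signed_rep_def by blast
qed

lemma signed_rep_localise:
fixes V :: "(real^'n::finite) set"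
assumes U: "open U" and T: "additive_distr U T" and K: "compact (closure V)" "closure V <= U"
 and l: "!!y. y : U ==> EX rho>0. signed_rep (U \<inter> ball y rho) T"
shows "signed_rep V T"
proof -
have "ALL y:U. EX rho. rho > 0 & signed_rep (U \<inter> ball y rho) T" using l by simp
from bchoice[OF this] obtain rho where rho: "!!y. y : U ==> rho y > 0" "!!y. y : U ==> signed_rep (U \<inter> ball y (rho y)) T" by blast
have rhoK: "rho y > 0" if "y : closure V" for y by (rule rho(1)[OF subsetD[OF K(2) that]])
obtain F eta where F: "finite F" "F <= closure V" and etam: "!!y. y : F ==> eta y : borel_measurable borel"
 and etab: "!!y x. y : F ==> 0 <= eta y x & eta y x <= 1"
 and eta: "!!phi L y. smooth_on UNIV phi ==> compact L ==> L <= closure V ==> (!!x. x ~: L ==> phi x = 0) ==> y : F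
 ==> test_fun (L \<inter> ball y (rho y)) (%x. eta y x * phi x)"
 "!!phi L x. L <= closure V ==> (!!x. x ~: L ==> phi x = 0) ==> phi x = (\<Sum>y\<in>F. eta y x * phi x)"
 by (rule test_fun_partition[OF K(1), where r=rho]) (rule rhoK, assumption, blast)
have FU: "y : U" if "y : F" for y by (rule subsetD[OF K(2) subsetD[OF F(2) that]])
have "ALL y:F. EX mu nu. finite_measure mu & finite_measure nu & sets mu = sets borel & sets nu = sets borel \<and>
 (ALL phi. test_fun (U \<inter> ball y (rho y)) phi --> T phi = (LINT x|(mu). phi x) - (LINT x|(nu). phi x))"
 using rho(2)[OF FU] unfolding signed_rep_def by simp
from bchoice[OF this] obtain mu where "ALL y:F. EX nu. finite_measure (mu y) & finite_measure nu & sets (mu y) = sets borel & sets nu = sets borel \<and>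
 (ALL phi. test_fun (U \<inter> ball y (rho y)) phi --> T phi = (LINT x|(mu y). phi x) - (LINT x|(nu). phi x))" by (rule exE)
from bchoice[OF this] obtain nu where mn: "ALL y:F. finite_measure (mu y) & finite_measure (nu y) & sets (mu y) = sets borel & sets (nu y) = sets borel \<and>
 (ALL phi. test_fun (U \<inter> ball y (rho y)) phi --> T phi = (LINT x|(mu y). phi x) - (LINT x|(nu y). phi x))" by (rule exE)
\<comment> \<open>The boolean index selects the positive or the negative local measure, and its sign
  is carried by the density together with the partition function.\<close>
show ?thesis
proof (rule signed_rep_sum[where I="F \<times> (UNIV :: bool set)" and M="%i. if snd i then mu (fst i) else nu (fst i)"
  and theta="%_ x. x" and C="%i x. (if snd i then 1 else -1) * eta (fst i) x" and B="%_. 1"])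
 show "finite (F \<times> (UNIV :: bool set))" using F(1) by simp
 fix i assume i: "i : F \<times> (UNIV :: bool set)"
 then have fi: "fst i : F" by auto
 show "finite_measure (if snd i then mu (fst i) else nu (fst i))" using mn fi by simp
 have s: "sets (if snd i then mu (fst i) else nu (fst i)) = sets borel" using mn fi by simp
 show "(%x. x) : (if snd i then mu (fst i) else nu (fst i)) \<rightarrow>\<^sub>M borel"
 by (rule measurable_ident_sets[OF s])
 have "(%x. (if snd i then 1 else -1) * eta (fst i) x) : borel_measurable borel" using etam[OF fi] by simp
 then show "(%x. (if snd i then 1 else -1) * eta (fst i) x) : borel_measurable (if snd i then mu (fst i) else nu (fst i))"
 using measurable_cong_sets[OF s refl] by blast
 show "abs ((if snd i then 1 else -1) * eta (fst i) x) <= 1" for x using etab[OF fi, of x] by (simp add: abs_mult)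
next
 fix phi assume phi: "test_fun V phi"
 then obtain L where L: "compact L" "L <= V" "!!x. x ~: L ==> phi x = 0" unfolding test_fun_def by blast
 have LK: "L <= closure V" by (rule order_trans[OF L(2) closure_subset])
 have t: "test_fun (U \<inter> ball y (rho y)) (%x. eta y x * phi x)" if "y : F" for y
 by (rule test_fun_mono[OF eta(1)[OF test_fun_smooth[OF phi] L(1) LK L(3) that]]) (use LK K(2) in auto)
 have t': "test_fun U (%x. eta y x * phi x)" if "y : F" for y
 by (rule test_fun_mono[OF t[OF that]]) simp
 have "phi = (%x. \<Sum>y\<in>F. eta y x * phi x)" by (rule ext) (rule eta(2)[OF LK L(3)])
 then have "T phi = T (%x. \<Sum>y\<in>F. eta y x * phi x)" by (rule arg_cong)
 also have "... = (\<Sum>y\<in>F. T (%x. eta y x * phi x))"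
 using additive_distr_sum(1)[OF T F(1), where g="%y x. eta y x * phi x"] by (simp add: t')
 also have "... = (\<Sum>y\<in>F. (LINT x|(mu y). eta y x * phi x) - (LINT x|(nu y). eta y x * phi x))"
 using mn t by (intro sum.cong refl) blast
 also have "... = (\<Sum>y\<in>F. \<Sum>b\<in>(UNIV :: bool set). \<integral>x. phi x * ((if b then 1 else -1) * eta y x) \<partial>(if b then mu y else nu y))"
 by (intro sum.cong refl) (simp add: UNIV_bool mult.commute)
 also have "... = (\<Sum>i\<in>F \<times> (UNIV :: bool set). \<integral>x. phi x * ((if snd i then 1 else -1) * eta (fst i) x) \<partial>(if snd i then mu (fst i) else nu (fst i)))"
 by (simp add: sum.cartesian_product split_def)
 finally show "T phi = (\<Sum>i\<in>F \<times> (UNIV :: bool set). \<integral>x. phi x * ((if snd i then 1 else -1) * eta (fst i) x) \<partial>(if snd i then mu (fst i) else nu (fst i)))" .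
qed
qed

section \<open>Second derivatives of the graph as measures\<close>

context smooth_graph
begin

text \<open>The exact two-forms are the differentials of \<open>phi (Psi x) * p\<close> times
  \<open>dy1\<close> or \<open>dy2\<close>; they vanish under the integral and move the derivative
  from \<open>phi\<close> to the slope.\<close>

lemma weak_slope:
assumes p: "smooth_on W p"
shows "(LINT x:W|lborel. p x * pd 1 phi (Psi x) * J x) = - (LINT x:W|lborel. phi (Psi x) * jac p y2 x)"
 "(LINT x:W|lborel. p x * pd 2 phi (Psi x) * J x) = (LINT x:W|lborel. phi (Psi x) * jac p y1 x)"
proof -
note sm = smooth_on_mult W sphiPsi p sy1 sy2 test_funs
let ?a = "%x. phi (Psi x) * p x"
have sa: "smooth_on W ?a" by (intro sm)
have i1: "(LINT x:W|lborel. jac ?a y1 x) = 0" "set_integrable lborel W (jac ?a y1)"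
 by (rule integral_jac_zero[OF W sa sy1 K]; simp add: phi0)+
have i2: "(LINT x:W|lborel. jac ?a y2 x) = 0" "set_integrable lborel W (jac ?a y2)"
 by (rule integral_jac_zero[OF W sa sy2 K]; simp add: phi0)+
have ci: "set_integrable lborel W f" if "smooth_on W f" "!!x. x : W ==> x ~: K ==> f x = 0" for f :: "fun2"
 by (rule vanishing_set_integrable[OF smooth_on_cont[OF that(1)] K that(2)])
have i: "set_integrable lborel W (%x. phi (Psi x) * jac p y x)" if "smooth_on W y" for y
proof (rule ci)
 show "smooth_on W (%x. phi (Psi x) * jac p y x)" by (rule smooth_on_mult[OF W sphiPsi[OF phi] smooth_on_jac[OF W p that]])
qed (simp add: phi0)
have a: "pd i ?a x = (pd 1 phi (Psi x) * pd i y1 x + pd 2 phi (Psi x) * pd i y2 x) * p x + phi (Psi x) * pd i p x" if x: "x : W" for x i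
 using dd[OF x sphiPsi[OF phi]] dd[OF x p] by (simp add: pd_mult pd_phiPsi[OF x phi])
have e1: "(LINT x:W|lborel. p x * pd 1 phi (Psi x) * J x) = (LINT x:W|lborel. jac ?a y2 x - phi (Psi x) * jac p y2 x)"
proof (rule set_lebesgue_integral_cong)
 show "ALL x. x : W --> p x * pd 1 phi (Psi x) * J x = jac ?a y2 x - phi (Psi x) * jac p y2 x"
 by (intro allI impI) (simp only: jac_def a J, simp add: algebra_simps)
qed (use W in simp)
show "(LINT x:W|lborel. p x * pd 1 phi (Psi x) * J x) = - (LINT x:W|lborel. phi (Psi x) * jac p y2 x)"
 unfolding e1 using i1 i2 i[OF sy2] by (simp add: set_integral_diff)
have e2: "(LINT x:W|lborel. p x * pd 2 phi (Psi x) * J x) = (LINT x:W|lborel. phi (Psi x) * jac p y1 x - jac ?a y1 x)"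
proof (rule set_lebesgue_integral_cong)
 show "ALL x. x : W --> p x * pd 2 phi (Psi x) * J x = phi (Psi x) * jac p y1 x - jac ?a y1 x"
 by (intro allI impI) (simp only: jac_def a J, simp add: algebra_simps)
qed (use W in simp)
show "(LINT x:W|lborel. p x * pd 2 phi (Psi x) * J x) = (LINT x:W|lborel. phi (Psi x) * jac p y1 x)"
 unfolding e2 using i1 i2 i[OF sy1] by (simp add: set_integral_diff)
qed

text \<open>\<open>Q\<close> pairs the second derivatives of the map with
  \<open>(-p1, -p2, 1)\<close>. Cramer's rule shows that the derivatives of the slopes are linear in
  the second derivatives of the map, with coefficients depending on its gradient alone.\<close>

lemma pd_slopes:
assumes x: "x : W"
defines "Q \<equiv> %j i. pd j (pd i v) x - p1 x * pd j (pd i y1) x - p2 x * pd j (pd i y2) x"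
shows "pd j p1 x = (Q j 1 * pd 2 y2 x - Q j 2 * pd 1 y2 x) / J x"
 "pd j p2 x = (pd 1 y1 x * Q j 2 - pd 2 y1 x * Q j 1) / J x"
proof -
have Q: "Q j i = pd j p1 x * pd i y1 x + pd j p2 x * pd i y2 x" for i
 unfolding Q_def slope2[OF x] by simp
show "pd j p1 x = (Q j 1 * pd 2 y2 x - Q j 2 * pd 1 y2 x) / J x"
 "pd j p2 x = (pd 1 y1 x * Q j 2 - pd 2 y1 x * Q j 1) / J x"
 unfolding nonzero_eq_divide_eq[OF J0[OF x]] unfolding Q J by (simp_all add: algebra_simps)
qed

end

context graph_limit
begin

lemma ul_uminus: "ul h hl ==> ul (%e x. - h e x) (%x. - hl x)"
using ul_diff[OF ul_const[of "%_. 0"], of h hl] by simp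

text \<open>\<open>Re\<close>, \<open>Ze\<close> and \<open>Ne\<close> factor the coefficient of
  each second derivative of the map. \<open>Re\<close> writes the Jacobian with the complementary
  coordinate as a sum over \<open>j\<close>, \<open>Ze\<close> holds the entries of the inverse
  Jacobian matrix, and \<open>Ne\<close> is the normal \<open>(-p1, -p2, 1)\<close>.\<close>

definition Re :: "2 => 2 => real => fun2" where
"Re a j e x = (let c = (if a = 1 then 2 else 1) in if j = 1 then pd 2 (ue e c) x else - pd 1 (ue e c) x)"
definition Ze :: "2 => 2 => real => fun2" where
"Ze b i e x = (if b = 1 then (if i = 1 then pd 2 (ue e 2) x else - pd 1 (ue e 2) x)
 else (if i = 1 then - pd 2 (ue e 1) x else pd 1 (ue e 1) x)) / Je e x"
definition Ne :: "3 => real => fun2" where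
"Ne k e x = (if k = 1 then - p1e e x else if k = 2 then - p2e e x else 1)"
definition R\<^sub>0 :: "2 => 2 => fun2" where
"R\<^sub>0 a j x = (let c = (if a = 1 then 2 else 1) in if j = 1 then pd 2 (u c) x else - pd 1 (u c) x)"
definition Z\<^sub>0 :: "2 => 2 => fun2" where
"Z\<^sub>0 b i x = (if b = 1 then (if i = 1 then pd 2 (u 2) x else - pd 1 (u 2) x)
 else (if i = 1 then - pd 2 (u 1) x else pd 1 (u 1) x)) / J x"
definition N\<^sub>0 :: "3 => fun2" where
"N\<^sub>0 k x = (if k = 1 then - p1 x else if k = 2 then - p2 x else 1)"
definition coef :: "2 => 2 => 3 => 2 => 2 => fun2" where
"coef a b k j i x = R\<^sub>0 a j x * Z\<^sub>0 b i x * N\<^sub>0 k x"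

lemma ul_coef: "ul (%e x. Re a j e x * Ze b i e x * Ne k e x) (coef a b k j i)"
proof -
have R: "ul (Re a j) (R\<^sub>0 a j)" unfolding Re_def[abs_def] R\<^sub>0_def[abs_def] Let_def
 by (cases "a = 1"; cases "j = 1") (simp_all add: pd_ue_ul ul_uminus)
have N: "ul (Ne k) (N\<^sub>0 k)" unfolding Ne_def[abs_def] N\<^sub>0_def[abs_def]
 using ul_p[THEN ul_uminus] ul_const[of "%_. 1"] by (cases "k = 1"; cases "k = 2") simp_all
have Z: "ul (Ze b i) (Z\<^sub>0 b i)" unfolding Ze_def[abs_def] Z\<^sub>0_def[abs_def]
proof (rule ul_divide[OF _ good_ul[OF good_Je] J0])
 show "ul (%e x. if b = 1 then (if i = 1 then pd 2 (ue e 2) x else - pd 1 (ue e 2) x) else (if i = 1 then - pd 2 (ue e 1) x else pd 1 (ue e 1) x))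
 (%x. if b = 1 then (if i = 1 then pd 2 (u 2) x else - pd 1 (u 2) x) else (if i = 1 then - pd 2 (u 1) x else pd 1 (u 1) x))"
 by (cases "b = 1"; cases "i = 1") (simp_all add: pd_ue_ul ul_uminus)
qed
show ?thesis unfolding coef_def[abs_def] by (intro ul_mult R Z N)
qed

definition pb :: "2 => fun2" where "pb b x = (if b = 1 then p1 x else p2 x)"
definition sgna :: "2 => real" where "sgna a = (if a = 1 then -1 else 1)"

text \<open>The identity for smooth graphs, with the second derivatives of the mollified map
  isolated as linear factors so that their weak convergence can be used. The continuity statements
  are what the two limit lemmas require.\<close>

lemma approx_slope:
"EV e. (LINT x:W|lborel. (if b = 1 then p1e e x else p2e e x) * pd a phi (Psie e x) * Je e x)
 = sgna a * (SU k. SU j. SU i. LINT x:W|lborel. phi (Psie e x) * (Re a j e x * Ze b i e x * Ne k e x) * pd j (pd i (ue e k)) x)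
 & (ALL k j i. continuous_on W (%x. phi (Psie e x) * (Re a j e x * Ze b i e x * Ne k e x)))
 & continuous_on W (%x. (if b = 1 then p1e e x else p2e e x) * pd a phi (Psie e x) * Je e x)"
using small Je_nonzero Psie_avoids
proof eventually_elim
case (elim e)
have e: "e > 0" using elim by simp
have Jn: "Je e x ~= 0" if "x : W" for x using elim(2) that W_bounded(3) by blast
interpret s: smooth_graph W "cball x0 (r / 2)" "ue e 1" "ue e 2" "ue e 3" phi "p1e e" "p2e e" "Je e" S "Psie e"
proof
 show "cball x0 (r / 2) <= W" using r by auto
 show "smooth_on W (ue e k)" for k by (rule smooth_ue[OF e])
 show "!!x. x : W ==> x ~: cball x0 (r / 2) ==> Psie e x ~: S"
 using elim(3) W_bounded(3) ball_subset_cball[of x0 "r / 2"] by blast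
qed (use phi S Jn smooth_ue[OF e] in \<open>simp_all add: Je_def p1e_def p2e_def Psie_def\<close>)
let ?p = "%x. if b = 1 then p1e e x else p2e e x"
have sp: "smooth_on W ?p" using s.sp1 s.sp2 by (cases "b = 1") simp_all
have su: "smooth_on W (ue e k)" for k by (rule smooth_ue[OF e])
have sR: "smooth_on W (Re a j e)" for j unfolding Re_def[abs_def] Let_def
 by (cases "j = 1") (simp_all add: smooth_on_pd[OF su] smooth_on_uminus[OF open_ball smooth_on_pd[OF su]])
have sZ: "smooth_on W (Ze b i e)" for i unfolding Ze_def[abs_def]
 by (rule smooth_on_divide[OF open_ball _ s.sJ Jn])
 (cases "b = 1"; cases "i = 1"; simp_all add: smooth_on_pd[OF su] smooth_on_uminus[OF open_ball smooth_on_pd[OF su]])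
have sN: "smooth_on W (Ne k e)" for k unfolding Ne_def[abs_def]
 by (cases "k = 1"; cases "k = 2") (simp_all add: smooth_on_uminus[OF open_ball s.sp1] smooth_on_uminus[OF open_ball s.sp2])
have sc: "smooth_on W (%x. phi (Psie e x) * (Re a j e x * Ze b i e x * Ne k e x))" for k j i
 by (intro smooth_on_mult open_ball s.sphiPsi[OF phi] sR sZ sN)
let ?c = "if a = 1 then 2 else (1::3)"
have jacp: "jac ?p (ue e ?c) x = (SU k. SU j. SU i. Re a j e x * Ze b i e x * Ne k e x * pd j (pd i (ue e k)) x)" if x: "x : W" for x
proof -
 define q where "q j = (if b = 1 then pd j (p1e e) x else pd j (p2e e) x)" for j
 have qp: "pd j ?p x = q j" for j by (cases "b = 1") (simp_all add: q_def)
 define Q where "Q j i = pd j (pd i (ue e 3)) x - p1e e x * pd j (pd i (ue e 1)) x - p2e e x * pd j (pd i (ue e 2)) x" for j i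
 have q: "q j = (SU i. Ze b i e x * Q j i)" for j
 using Jn[OF x] unfolding q_def s.pd_slopes[OF x] Q_def Ze_def UNIV_2_sum by (simp add: field_simps)
 have Q: "Q j i = (SU k. Ne k e x * pd j (pd i (ue e k)) x)" for j i
 by (simp add: Q_def Ne_def sum_3)
 have "jac ?p (ue e ?c) x = (SU j. Re a j e x * q j)"
 unfolding jac_def qp Re_def Let_def UNIV_2_sum by (simp add: algebra_simps)
 then show ?thesis unfolding q Q UNIV_2_sum sum_3 by (simp add: algebra_simps)
qed
have "(LINT x:W|lborel. ?p x * pd a phi (Psie e x) * Je e x) = sgna a * (LINT x:W|lborel. phi (Psie e x) * jac ?p (ue e ?c) x)"
 using s.weak_slope[OF sp] exhaust_2[of a] by (auto simp: sgna_def)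
also have "(LINT x:W|lborel. phi (Psie e x) * jac ?p (ue e ?c) x) = (LINT x:W|lborel. (SU k. SU j. SU i. phi (Psie e x) * (Re a j e x * Ze b i e x * Ne k e x) * pd j (pd i (ue e k)) x))"
 by (rule set_lebesgue_integral_cong) (auto simp: jacp sum_distrib_left mult.assoc simp del: mem_ball)
also have "... = (SU k. SU j. SU i. LINT x:W|lborel. phi (Psie e x) * (Re a j e x * Ze b i e x * Ne k e x) * pd j (pd i (ue e k)) x)"
proof -
 have int: "set_integrable lborel W (%x. phi (Psie e x) * (Re a j e x * Ze b i e x * Ne k e x) * pd j (pd i (ue e k)) x)" for k j i
 proof (rule vanishing_set_integrable[OF _ s.K])
 show "continuous_on W (%x. phi (Psie e x) * (Re a j e x * Ze b i e x * Ne k e x) * pd j (pd i (ue e k)) x)"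
  by (rule smooth_on_cont[OF smooth_on_mult[OF open_ball sc smooth_on_pd[OF smooth_on_pd[OF su]]]])
 qed (simp add: s.phi0)
 then show ?thesis
 unfolding set_integral_def set_integrable_def scaleR_sum_right
 by (simp only: bochner_sum bochner_integrable_sum)
qed
finally have "(LINT x:W|lborel. ?p x * pd a phi (Psie e x) * Je e x)
 = sgna a * (SU k. SU j. SU i. LINT x:W|lborel. phi (Psie e x) * (Re a j e x * Ze b i e x * Ne k e x) * pd j (pd i (ue e k)) x)" .
moreover have "continuous_on W (%x. ?p x * pd a phi (Psie e x) * Je e x)"
 by (intro continuous_on_mult smooth_on_cont[OF sp] smooth_on_cont[OF s.sphiPsi[OF test_fun_pd[OF phi]]] smooth_on_cont[OF s.sJ])
ultimately show ?case using smooth_on_cont[OF sc] by blast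
qed

text \<open>The coefficients converge uniformly while the second derivatives converge weakly to
  \<open>M - N\<close>. Multiplied by the indicator of \<open>W\<close>, the limiting coefficient is
  still continuous on the plane, because \<open>phi (Psi x)\<close> vanishes on \<open>W\<close>
  outside the half ball.\<close>

lemma slope_measure:
assumes MN: "!!k i j. measure_rep k i j (M k i j) (N k i j)"
shows "(LINT x:W|lborel. pb b x * pd a phi (Psi x) * J x) = sgna a * (SU k. SU j. \<Sum>i\<in>UNIV.
 (LINT x|(M k j i). phi (Psi x) * (indicator W x * coef a b k j i x)) - (LINT x|(N k j i). phi (Psi x) * (indicator W x * coef a b k j i x)))"
proof -
let ?c = "%k j i x. phi (Psi x) * (indicator W x * coef a b k j i x)"
let ?ce = "%k j i e x. phi (Psie e x) * (Re a j e x * Ze b i e x * Ne k e x)"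
let ?K = "cball x0 (r / 2)"
have K: "compact ?K" "?K <= W" using r by auto
have ulc: "ul (?ce k j i) (%x. phi (Psi x) * coef a b k j i x)" for k j i
 by (intro ul_mult ul_Psi[OF phi] ul_coef)
have z: "?c k j i x = 0" if "x ~: ?K" for k j i x
proof (cases "x : W")
 case True
 then have "x : Kr" "x ~: ball x0 (r / 2)" using that by auto
 then have "Psi x ~: S" using S_half by blast
 then show ?thesis using S(2) by simp
qed simp
have cont: "continuous_on UNIV (?c k j i)" for k j i
proof -
 have "continuous_on W (%x. phi (Psi x) * coef a b k j i x)"
 using ulc[where k=k and j=j and i=i] continuous_on_subset[OF _ W_bounded(3)] unfolding ul_def by blast
 then have 1: "continuous_on W (?c k j i)"
 by (rule continuous_on_cong[THEN iffD1, rotated -1, OF _ refl]) simp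
 have 2: "continuous_on (- ?K) (?c k j i)"
 by (rule continuous_on_cong[THEN iffD1, rotated -1, OF continuous_on_const refl, of _ 0]) (use z in simp)
 have "W \<union> - ?K = UNIV" using K(2) by blast
 with continuous_on_open_Un[OF open_ball open_Compl[OF closed_cball] 1 2] show ?thesis by simp
qed
have lim: "((%e. LINT x:W|lborel. ?ce k j i e x * pd j (pd i (ue e k)) x) \<longlongrightarrow> (LINT x|(M k j i). ?c k j i x) - (LINT x|(N k j i). ?c k j i x)) (at_right 0)" for k j i
proof (rule pd2_ue_weak_limit[OF MN cont K z])
 fix eta :: real assume "eta > 0"
 from ulD[OF ulc[where k=k and j=j and i=i] this] show "EV e. ALL x:W. abs (?ce k j i e x - ?c k j i x) <= eta"
 proof eventually_elim
 case (elim e)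
 show ?case
 proof
  fix x assume x: "x : W"
  then have "indicator W x = (1::real)" by (rule indicator_simps)
  with bspec[OF elim subsetD[OF W_bounded(3) x]] show "abs (?ce k j i e x - ?c k j i x) <= eta" by (simp add: dist_real_def)
 qed
 qed
next
 show "EV e. continuous_on W (?ce k j i e)"
 using approx_slope[where a=a and b=b] by eventually_elim blast
qed
have R: "((%e. sgna a * (SU k. SU j. SU i. LINT x:W|lborel. ?ce k j i e x * pd j (pd i (ue e k)) x)) \<longlongrightarrow>
 sgna a * (SU k. SU j. SU i. (LINT x|(M k j i). ?c k j i x) - (LINT x|(N k j i). ?c k j i x))) (at_right 0)"
 by (intro tendsto_mult tendsto_const tendsto_sum lim)
have L: "((%e. LINT x:W|lborel. (if b = 1 then p1e e x else p2e e x) * pd a phi (Psie e x) * Je e x) \<longlongrightarrow> (LINT x:W|lborel. pb b x * pd a phi (Psi x) * J x)) (at_right 0)"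
proof (rule ul_integral)
 have "ul (%e x. if b = 1 then p1e e x else p2e e x) (pb b)"
 unfolding pb_def[abs_def] using ul_p by (cases "b = 1") simp_all
 then show "ul (%e x. (if b = 1 then p1e e x else p2e e x) * pd a phi (Psie e x) * Je e x) (%x. pb b x * pd a phi (Psi x) * J x)"
 by (intro ul_mult ul_Psi[OF test_fun_pd[OF phi]] good_ul[OF good_Je])
 show "EV e. continuous_on W (%x. (if b = 1 then p1e e x else p2e e x) * pd a phi (Psie e x) * Je e x)"
 using approx_slope[where a=a and b=b] by eventually_elim blast
qed
have "EV e. (LINT x:W|lborel. (if b = 1 then p1e e x else p2e e x) * pd a phi (Psie e x) * Je e x)
 = sgna a * (SU k. SU j. SU i. LINT x:W|lborel. ?ce k j i e x * pd j (pd i (ue e k)) x)"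
 using approx_slope[where a=a and b=b] by eventually_elim blast
from tendsto_cong[THEN iffD1, OF this L] show ?thesis
 using R by (rule tendsto_unique[OF trivial_limit_at_right_real])
qed

lemma coef_bounded:
"EX B. ALL x. abs (indicator W x * coef a b k j i x) <= B" "(%x. indicator W x * coef a b k j i x) : borel_measurable borel"
proof -
have c: "continuous_on Kr (coef a b k j i)" using ul_coef[where a=a and b=b and k=k and j=j and i=i] by (simp add: ul_def)
obtain B where B: "B > 0" "!!x. x : Kr ==> abs (coef a b k j i x) <= B"
 by (rule compact_bound[OF compact_cball c]) blast
have "abs (indicator W x * coef a b k j i x) <= B" for x
 using B(2)[OF subsetD[OF W_bounded(3)], of x] B(1) by (cases "x : W") (simp_all del: mem_ball mem_cball)
then show "EX B. ALL x. abs (indicator W x * coef a b k j i x) <= B" by blast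
show "(%x. indicator W x * coef a b k j i x) : borel_measurable borel"
 using borel_measurable_continuous_on_indicator[OF _ continuous_on_subset[OF c W_bounded(3)]] by simp
qed

end

section \<open>Integrability of continuous and \<open>C^1\<close> functions on precompact
  sets\<close>

lemma Lp_continuous:
fixes h :: "real^'n::finite => real"
assumes h: "continuous_on U h" and V: "open V" "bounded V" "closure V <= U" and p: "p >= 0"
shows "Lp p V h"
proof -
have K: "compact (closure V)" using V(2) by (simp add: compact_closure)
have VK: "V <= closure V" by (rule closure_subset)
obtain M where M: "M > 0" "!!x. x : closure V ==> abs (h x) <= M"
 by (rule compact_bound[OF K continuous_on_subset[OF h V(3)]]) blast
have Vm: "V : sets lborel" using V(1) by simp
define k where "k x = indicator V x *R h x" for x
have km[measurable]: "k : borel_measurable borel"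
 unfolding k_def[abs_def] using V(1) continuous_on_subset[OF h order_trans[OF VK V(3)]]
 by (intro borel_measurable_continuous_on_indicator) auto
have "set_borel_measurable lebesgue V h"
 unfolding set_borel_measurable_def k_def[symmetric] by (rule measurable_completion) (use km in simp)
moreover have "set_integrable lebesgue V (%x. abs (h x) powr p)"
proof -
 have km2: "(%x. abs (k x) powr p) : borel_measurable lborel" by measurable
 have "integrable lborel (%x. indicator V x *R (abs (k x) powr p))"
 proof (rule integrableI_bounded_set_indicator[OF Vm km2])
 show "emeasure lborel V < \<infinity>" using emeasure_bounded_finite[OF V(2)] by simp
 have "norm (abs (k x) powr p) <= M powr p" if "x : V" for x
  using M(2)[OF subsetD[OF VK that]] that p by (simp add: k_def powr_mono2)
 then show "AE x in lborel. x : V --> norm (abs (k x) powr p) <= M powr p" by simp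
 qed
 moreover have "(%x. indicator V x *R (abs (k x) powr p)) = (%x. indicator V x *R (abs (h x) powr p))"
 by (auto simp: k_def indicator_def)
 ultimately show ?thesis
 unfolding set_integrable_def by (subst integrable_completion) (auto dest: borel_measurable_integrable)
qed
ultimately show ?thesis unfolding Lp_def by simp
qed

lemma W1p_C1:
fixes f :: "real^'n::finite => real"
assumes f: "Ck_on 1 U f" and V: "open V" "bounded V" "closure V <= U" and p: "p >= 0"
shows "W1p p V f"
proof -
have fV: "Ck_on 1 V f" by (rule Ck_on_subset[OF f order_trans[OF closure_subset V(3)]])
have "continuous_on U (pd i f)" for i using f by simp
then show ?thesis unfolding W1p_def
 using Lp_continuous[OF Ck_on_imp_continuous_on[OF f] V p] Lp_continuous[OF _ V p] has_weak_pd_C1[OF V(1) fV] by blast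
qed

lemma signed_rep_cong: "signed_rep V T ==> (!!phi. test_fun V phi ==> T' phi = T phi) ==> signed_rep V T'"
unfolding signed_rep_def by simp

context C1_graph_metric
begin

definition represented :: "real^2 => real => bool" where
"represented x0 r \<longleftrightarrow> (ALL k i j. EX M N. C1_map.measure_rep x0 r u k i j M N)"

text \<open>Locally, a second derivative of the graph is a finite sum of push-forwards under
  \<open>Psi0\<close> of the measures representing second derivatives of the map, weighted by the
  bounded coefficients \<open>coef\<close>.\<close>

lemma hessian_signed_rep:
assumes rep: "!!x0 r. r > 0 ==> cball x0 (2 * r) <= U ==> represented x0 r" and y: "y : U'"
shows "EX rho>0. signed_rep (U' \<inter> ball y rho) (distr_pd a (distr_of_fun U' (pd b f)))"
proof -
obtain R where R: "R > 0" "cball (Phi y) R <= U" using Phi_in[OF y] U open_contains_cball by blast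
define x0 r where "x0 = Phi y" and "r = R / 2"
have r: "r > 0" "cball x0 (2 * r) <= U" using R by (simp_all add: x0_def r_def)
have "r / 2 > 0" using r by simp
then obtain rho where rho: "rho > 0" "cball y rho <= Psi ` (U \<inter> ball x0 (r / 2))" "cball y rho <= U'"
 unfolding x0_def by (rule graph_ball[OF y]) blast
then have rho': "cball y rho <= Psi ` ball x0 (r / 2)" by blast
let ?g = "%i j x. g x $ i $ j" and ?W = "ball x0 r"
note gl = graph_limit_ball[OF r rho']
\<comment> \<open>The measures and coefficients must be fixed before any test function; they do not
  depend on it, so an instance with the zero function gives access to them.\<close>
interpret L0: graph_limit U x0 r u ?g "%_. 0" "cball y rho" J p1 p2 by (rule gl[OF test_fun_zero])
have KrU: "cball x0 r <= U" "?W <= U" by (rule L0.WU)+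
obtain sgm where sgm: "sgm = 1 \<or> sgm = -1" "!!y. y : cball x0 r ==> abs (J y) = sgm * J y" by (rule J_sign[OF KrU(1)]) blast
have "ALL t. EX p. L0.measure_rep (fst t) (fst (snd t)) (snd (snd t)) (fst p) (snd p)"
 using rep[OF r] unfolding represented_def by simp
from choice[OF this] obtain P where P: "!!k i j. L0.measure_rep k i j (fst (P (k, i, j))) (snd (P (k, i, j)))" by force
define MN where "MN = (%i :: (3 \<times> 2 \<times> 2) \<times> bool. if snd i then fst (P (fst i)) else snd (P (fst i)))"
have MN: "finite_measure (MN i)" "sets (MN i) = sets (restrict_space borel (ball x0 (2 * r)))" for i
 using P[of "fst (fst i)" "fst (snd (fst i))" "snd (snd (fst i))"] by (simp_all add: L0.measure_rep_def MN_def)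
have meas: "h : MN i \<rightarrow>\<^sub>M N" if "h : borel \<rightarrow>\<^sub>M N" for h N i
 unfolding measurable_cong_sets[OF MN(2) refl] by (rule measurable_restrict_space1[OF that])
define c where "c = (%i :: (3 \<times> 2 \<times> 2) \<times> bool. %x. indicator ?W x * L0.coef a b (fst (fst i)) (fst (snd (fst i))) (snd (snd (fst i))) x)"
have "ALL i. EX B. ALL x. abs (c i x) <= B" unfolding c_def using L0.coef_bounded(1) by blast
from choice[OF this] obtain B where B: "!!i x. abs (c i x) <= B i" by blast
have cm: "c i : borel_measurable borel" for i unfolding c_def by (rule L0.coef_bounded(2))
\<comment> \<open>Collects three signs: the minus of the distributional derivative, the sign of the
  Jacobian, and the sign in \<open>weak_slope\<close>.\<close>
define \<tau> where "\<tau> = - sgm * L0.sgna a"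
have \<tau>: "abs (\<tau>) = 1" using sgm(1) by (auto simp: \<tau>_def L0.sgna_def)
have "signed_rep (U' \<inter> ball y rho) (distr_pd a (distr_of_fun U' (pd b f)))"
proof (rule signed_rep_sum[where I=UNIV and M=MN and theta="%_. Psi0" and C="%i x. (if snd i then 1 else -1) * \<tau> * c i x" and B=B])
 show "finite (UNIV :: ((3 \<times> 2 \<times> 2) \<times> bool) set)" by simp
 show "finite_measure (MN i)" for i by (rule MN(1))
 show "Psi0 : MN i \<rightarrow>\<^sub>M borel" for i by (rule meas[OF Psi0_measurable])
 show "(%x. (if snd i then 1 else -1) * \<tau> * c i x) : borel_measurable (MN i)" for i
 by (rule meas) (use cm in simp)
 show "abs ((if snd i then 1 else -1) * \<tau> * c i x) <= B i" for i x using B[of i x] \<tau> by (simp add: abs_mult)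
next
 fix phi assume phi': "test_fun (U' \<inter> ball y rho) phi"
 have phi: "test_fun (ball y rho) phi" and phiU: "test_fun U' phi" by (rule test_fun_mono[OF phi']; simp)+
 interpret L: graph_limit U x0 r u ?g phi "cball y rho" J p1 p2 by (rule gl[OF phi])
 have MPsi: "L0.Psi = Psi" by (rule ext) (simp add: L0.Psi_def Psi)
 have pf: "continuous_on U' (pd b f)" using f_C1 by simp
 have z: "pd a phi z = 0" if "z ~: Psi ` ?W" for z
 proof (rule pd_zero_outside[where f=phi and K="cball y rho", OF closed_cball])
 show "phi z = 0" if "z ~: cball y rho" for z by (rule L.S(2)[OF that])
 have "cball y rho <= Psi ` ?W" by (rule order_trans[OF rho' image_mono]) (use r in auto)
 then show "z ~: cball y rho" using that by blast
 qed
 have "distr_pd a (distr_of_fun U' (pd b f)) phi = - (LINT y:U'|lborel. pd b f y * pd a phi y)"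
 unfolding distr_pd_def continuous_mult_test_fun(1)[OF U' pf test_fun_pd[OF phiU]] by (rule refl)
 also have "(LINT y:U'|lborel. pd b f y * pd a phi y) = sgm * (LINT x:?W|lborel. (pd b f (Psi x) * pd a phi (Psi x)) * J x)"
 by (rule integral_transfer[OF KrU(1) sgm(2)])
  (auto intro!: continuous_on_mult pf test_fun_continuous[OF test_fun_pd[OF phi]] simp: z)
 also have "(LINT x:?W|lborel. (pd b f (Psi x) * pd a phi (Psi x)) * J x) = (LINT x:?W|lborel. L.pb b x * pd a phi (L0.Psi x) * J x)"
 proof (rule set_lebesgue_integral_cong)
 have "pd b f (Psi x) = L.pb b x" if "x : ?W" for x
  using pd_f[OF Psi_in[OF subsetD[OF KrU(2) that]]] PhiPsi[OF subsetD[OF KrU(2) that]] exhaust_2[of b] by (auto simp: L.pb_def)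
 then show "ALL x. x : ?W --> pd b f (Psi x) * pd a phi (Psi x) * J x = L.pb b x * pd a phi (L0.Psi x) * J x" unfolding MPsi by simp
 qed simp
 also have "... = L.sgna a * (SU k. SU j. \<Sum>i\<in>UNIV.
 (LINT x|(fst (P (k, j, i))). phi (L0.Psi x) * (indicator ?W x * L.coef a b k j i x)) - (LINT x|(snd (P (k, j, i))). phi (L0.Psi x) * (indicator ?W x * L.coef a b k j i x)))"
 by (rule L.slope_measure[where M="%k i j. fst (P (k, i, j))" and N="%k i j. snd (P (k, i, j))", OF P])
 also have "(SU k. SU j. \<Sum>i\<in>UNIV.
 (LINT x|(fst (P (k, j, i))). phi (L0.Psi x) * (indicator ?W x * L.coef a b k j i x)) - (LINT x|(snd (P (k, j, i))). phi (L0.Psi x) * (indicator ?W x * L.coef a b k j i x)))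
 = (SU t. SU s. (if s then 1 else -1) * (LINT x|(MN (t, s)). phi (Psi0 x) * c (t, s) x))"
 proof -
 have Psi0: "phi (L0.Psi x) * (indicator ?W x * d) = phi (Psi0 x) * (indicator ?W x * d)" for x d
  by (cases "x : ?W") (simp_all add: MPsi Psi0_def subsetD[OF KrU(2)] del: mem_ball)
 show ?thesis
  unfolding Psi0 UNIV_Times_UNIV[symmetric] sum.cartesian_product' by (simp add: UNIV_bool c_def MN_def)
 qed
 also have "... = (SU i. (if snd i then 1 else -1) * (LINT x|(MN i). phi (Psi0 x) * c i x))"
 by (subst UNIV_Times_UNIV[symmetric], subst sum.cartesian_product') simp
 also have "- (sgm * (L.sgna a * ...)) = (SU i. \<integral>x. phi (Psi0 x) * ((if snd i then 1 else -1) * \<tau> * c i x) \<partial>MN i)"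
 proof -
 have "(LINT x|(MN i). phi (Psi0 x) * ((if snd i then 1 else -1) * \<tau> * c i x)) = \<tau> * ((if snd i then 1 else -1) * (LINT x|(MN i). phi (Psi0 x) * c i x))" for i
 proof -
  have "(%x. phi (Psi0 x) * ((if snd i then 1 else -1) * \<tau> * c i x)) = (%x. (\<tau> * (if snd i then 1 else -1)) * (phi (Psi0 x) * c i x))"
  by (rule ext) (simp add: mult_ac)
  then show ?thesis by (simp only: integral_mult_right_zero mult.assoc)
 qed
 then show ?thesis by (simp only: sum_distrib_left[symmetric] \<tau>_def mult.assoc minus_mult_left)
 qed
 finally show "distr_pd a (distr_of_fun U' (pd b f)) phi = (SU i. \<integral>x. phi (Psi0 x) * ((if snd i then 1 else -1) * \<tau> * c i x) \<partial>MN i)" .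
qed
then show ?thesis using rho(1) by blast
qed

text \<open>The local representations belong to the distributional derivative of the classical slope
  \<open>pd b f\<close> on \<open>U'\<close>. They are glued over the compact closure of
  \<open>V\<close>, and integration by parts for the \<open>C^1\<close> function identifies the
  result with a second derivative of \<open>f\<close>.\<close>

lemma BV2_graph:
assumes rep: "!!x0 r. r > 0 ==> cball x0 (2 * r) <= U ==> represented x0 r"
 and V: "open V" "bounded V" "closure V <= U'"
shows "BV2 V f"
unfolding BV2_def
proof (intro conjI allI)
show "W1p 1 V f" by (rule W1p_C1[OF f_C1 V]) simp
fix a b
have VU: "V <= U'" by (rule order_trans[OF closure_subset V(3)])
have pf: "continuous_on U' (pd b f)" using f_C1 by simp
have K: "compact (closure V)" using V(2) by (simp add: compact_closure)
have "signed_rep V (distr_pd a (distr_of_fun U' (pd b f)))"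
 by (rule signed_rep_localise[OF U' additive_distr_pd[OF additive_distr_of_fun[OF continuous_locally_integrable[OF pf]]] K V(3) hessian_signed_rep[OF rep]])
then have "signed_rep V (distr_pd a (distr_pd b (distr_of_fun V f)))"
proof (rule signed_rep_cong)
 fix phi assume phi: "test_fun V phi"
 have t: "test_fun V (pd b (pd a phi))" by (intro test_fun_pd phi)
 have z: "pd b (pd a phi) x = 0" if "x ~: V" for x using t that unfolding test_fun_def by blast
 have e: "distr_of_fun V f (pd b (pd a phi)) = distr_of_fun U' f (pd b (pd a phi))"
 unfolding distr_of_fun_def by (rule set_integral_vanishing[OF VU, symmetric]) (simp add: z)
 have "test_fun U' (pd a phi)" by (rule test_fun_mono[OF test_fun_pd[OF phi] VU])
 then have "distr_pd b (distr_of_fun U' f) (pd a phi) = distr_of_fun U' (pd b f) (pd a phi)"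
 using has_weak_pd_C1[OF U' f_C1, of b] unfolding has_weak_pd_def eq_distr_def by blast
 then show "distr_pd a (distr_pd b (distr_of_fun V f)) phi = distr_pd a (distr_of_fun U' (pd b f)) phi"
 unfolding distr_pd_def e by simp
qed
then show "is_finite_signed_measure V (distr_pd a (distr_pd b (distr_of_fun V f)))" by (rule signed_rep_imp[OF V(1)])
qed

text \<open>Compactness of the ball makes the local oscillation bound uniform, and the representing
  measures bound the second derivatives of the mollified map in L^1.\<close>

lemma errors_vanish_little_holder:
assumes osc: "!!k i. osc_half U (pd i (u k))" and rep: "represented x0 r"
 and r: "r > 0" "cball x0 (2 * r) <= U"
shows "errors_vanish x0 r"
proof -
interpret M: C1_metric_map U x0 r u "%i j x. g x $ i $ j" by (rule C1_metric_map[OF r])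
have KrU: "cball x0 r <= U" by (rule M.WU)
obtain A where A: "EV e. (LINT x:ball x0 r|lborel. M.T e x) <= A"
 using M.T_L1_bounded rep unfolding represented_def by blast
have hol: "EV e. ALL x:cball x0 r. ALL y:cball x e. abs (pd i (u k) y - pd i (u k) x) <= eta * sqrt e" if eta: "eta > 0" for k i eta
proof -
 have loc: "EX t>0. ALL a:ball y t. ALL b:ball y t. abs (pd i (u k) a - pd i (u k) b) <= eta * sqrt (dist a b)" if "y : cball x0 r" for y
 using osc[of i k] subsetD[OF KrU that] eta unfolding osc_half_def by blast
 obtain delta where delta: "delta > 0" "!!x x'. x : cball x0 r ==> dist x x' < delta ==> abs (pd i (u k) x - pd i (u k) x') <= eta * sqrt (dist x x')"
 using compact_uniformly_local[where P="%a b. abs (pd i (u k) a - pd i (u k) b) <= eta * sqrt (dist a b)", OF compact_cball loc] by blast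
 show ?thesis
 proof (rule eventually_at_right_0I[OF _ delta(1)], intro ballI)
 fix e x y assume e: "0 < e" "e < delta" and x: "x : cball x0 r" and y: "y : cball x e"
 have d: "dist x y <= e" using y by simp
 then have "dist x y < delta" using e by simp
 from delta(2)[OF x this] have "abs (pd i (u k) y - pd i (u k) x) <= eta * sqrt (dist x y)" by (simp add: abs_minus_commute)
 also have "... <= eta * sqrt e" using d eta by (intro mult_left_mono real_sqrt_le_mono) auto
 finally show "abs (pd i (u k) y - pd i (u k) x) <= eta * sqrt e" .
 qed
qed
show ?thesis unfolding errors_vanish_def using M.errors_vanish_BV[OF hol A] by blast
qed

lemma errors_vanish_gagliardo:
assumes gag: "!!k i. gagliardo (2/3) 3 (ball x0 (2 * r)) (pd i (u k)) < \<infinity>"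
 and r: "r > 0" "cball x0 (2 * r) <= U"
shows "errors_vanish x0 r"
proof -
interpret M: C1_metric_map U x0 r u "%i j x. g x $ i $ j" by (rule C1_metric_map[OF r])
show ?thesis unfolding errors_vanish_def using M.errors_vanish_I3[OF M.I3_vanishes[OF gag]] by blast
qed

lemma little_holder_BV2_case:
assumes u: "!!k. loc (little_holder 1 (1/2)) U (u k)" "!!k. loc BV2 U (u k)"
shows "loc (little_holder 1 (1/2)) U' f" "loc BV2 U' f" "eq_distr U' (Det_D2 U' f) (distr_of_fun U' gauss_rhs)"
proof -
have osc: "osc_half U (pd i (u k))" for k i
 unfolding osc_half_def
proof (intro ballI allI impI)
 fix x eta :: real and z assume z: "z : U" and eta: "eta > 0"
 obtain R where R: "R > 0" "cball z R <= U" using z U open_contains_cball by blast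
 show "EX t>0. ALL a:ball z t. ALL b:ball z t. abs (pd i (u k) a - pd i (u k) b) <= eta * sqrt (dist a b)"
 by (rule little_holder_osc[OF loc_ball[OF u(1) R] R(1) eta])
qed
have rep: "represented x0 r" if r: "r > 0" "cball x0 (2 * r) <= U" for x0 r
 unfolding represented_def
proof (intro allI)
 interpret M: C1_metric_map U x0 r u "%i j x. g x $ i $ j" by (rule C1_metric_map[OF r])
 fix k i j
 have "2 * r > 0" using r by simp
 from loc_ball[OF u(2) this r(2), of k] have "is_finite_signed_measure (ball x0 (2 * r)) (distr_pd i (distr_pd j (distr_of_fun (ball x0 (2 * r)) (u k))))"
 unfolding BV2_def by blast
 then show "EX M N. M.measure_rep k i j M N"
 unfolding is_finite_signed_measure_def M.measure_rep_def by blast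
qed
show "loc (little_holder 1 (1/2)) U' f" unfolding loc_def bounded_lipschitz_domain_def
 using little_holder_C1[OF U' f_C1 osc_half_graph[OF osc]] by blast
show "loc BV2 U' f" unfolding loc_def bounded_lipschitz_domain_def
 using BV2_graph[OF rep] by blast
show "eq_distr U' (Det_D2 U' f) (distr_of_fun U' gauss_rhs)"
 by (rule gauss_equation[OF errors_vanish_little_holder[OF osc rep]])
qed

lemma W1sp_case:
assumes u: "!!k. loc (W1sp (2/3) 3) U (u k)"
shows "loc (W1sp (2/3) 3) U' f" "eq_distr U' (Det_D2 U' f) (distr_of_fun U' gauss_rhs)"
proof -
have gag: "gagliardo (2/3) 3 (ball x R) (pd i (u k)) < \<infinity>" if R: "R > 0" "cball x R <= U" for k i x R
proof -
 obtain w where w: "has_weak_pd (ball x R) i (u k) w" "Wsp (2/3) 3 (ball x R) w"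
 using loc_ball[OF u R, of k] unfolding W1sp_def by blast
 have "has_weak_pd (ball x R) i (u k) (pd i (u k))"
 by (rule has_weak_pd_C1[OF open_ball Ck_on_subset[OF C1_graph.u[OF C1_graph_axioms] order_trans[OF ball_subset_cball R(2)]]])
 from gagliardo_cong_AE[OF weak_pd_unique[OF open_ball this w(1)], of "2/3" 3] w(2)
 show ?thesis unfolding Wsp_def by simp
qed
show "loc (W1sp (2/3) 3) U' f" unfolding loc_def
proof (intro allI impI)
 fix V assume "bounded_lipschitz_domain V & closure V <= U'"
 then have V: "open V" "bounded V" "closure V <= U'" unfolding bounded_lipschitz_domain_def by blast+
 have pf: "continuous_on U' (pd i f)" for i using f_C1 by simp
 have "Wsp (2/3) 3 V (pd i f)" for i
 unfolding Wsp_def using Lp_continuous[OF pf V, of 3] gagliardo_finite_local[OF U' pf V gagliardo_graph[OF gag]] by simp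
 moreover have "has_weak_pd V i f (pd i f)" for i
 by (rule has_weak_pd_C1[OF V(1) Ck_on_subset[OF f_C1 order_trans[OF closure_subset V(3)]]])
 ultimately show "W1sp (2/3) 3 V f" unfolding W1sp_def using W1p_C1[OF f_C1 V, of 3] by (auto simp del: One_nat_def)
qed
show "eq_distr U' (Det_D2 U' f) (distr_of_fun U' gauss_rhs)"
 by (rule gauss_equation[OF errors_vanish_gagliardo[OF gag]]) simp_all
qed

end

theorem theorem1p3:
  fixes U U' :: "(real^2) set"
    and g :: "real^2 \<Rightarrow> real^2^2"
    and u :: "real^2 \<Rightarrow> real^3"
    and \<Psi> \<Phi> :: "real^2 \<Rightarrow> real^2"
    and v f :: "real^2 \<Rightarrow> real"
  assumes "open U" and "connected U" and "open U'"
    and "smooth_metric_on U g"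
    and "C1_isometric_embedding U g u"
    and "\<forall>x\<in>U. u x = vector [\<Psi> x $ 1, \<Psi> x $ 2, v x]"
    and "C1_diffeomorphism U U' \<Psi> \<Phi>"
    and "\<forall>y\<in>U'. f y = v (\<Phi> y)"
  shows
    "((\<forall>k. loc (little_holder 1 (1/2)) U (\<lambda>x. u x $ k) \<and> loc BV2 U (\<lambda>x. u x $ k)) \<longrightarrow>
        loc (little_holder 1 (1/2)) U' f \<and> loc BV2 U' f \<and>
        eq_distr U' (Det_D2 U' f)
          (distr_of_fun U' (\<lambda>y. gauss_curvature g (\<Phi> y) * (1 + (\<Sum>i\<in>UNIV. (pd i f y)\<^sup>2))\<^sup>2)))
     \<and>
     ((\<forall>k. loc (W1sp (2/3) 3) U (\<lambda>x. u x $ k)) \<longrightarrow>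
        Ck_on 1 U' f \<and> loc (W1sp (2/3) 3) U' f \<and>
        eq_distr U' (Det_D2 U' f)
          (distr_of_fun U' (\<lambda>y. gauss_curvature g (\<Phi> y) * (1 + (\<Sum>i\<in>UNIV. (pd i f y)\<^sup>2))\<^sup>2)))"
proof -
\<comment> \<open>The locale requires the projection to equal the vector of the first two components
  everywhere, whereas the hypothesis relates them on \<open>U\<close> only; hence it is rebuilt from
  \<open>u\<close>, and agrees with \<open>\<Psi>\<close> on \<open>U\<close>.\<close>
let ?u = "\<lambda>k x. u x $ k" and ?\<Psi> = "\<lambda>x. vector [u x $ 1, u x $ 2] :: real^2"
have uC: "Ck_on 1 U u" and iso: "\<And>x i j. x \<in> U \<Longrightarrow> pd i u x \<bullet> pd j u x = g x $ i $ j"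
 using assms(5) unfolding C1_isometric_embedding_def by blast+
have hom: "homeomorphism U U' \<Psi> \<Phi>" and \<Phi>: "Ck_on 1 U' \<Phi>"
 using assms(7) unfolding C1_diffeomorphism_def by blast+
have comp: "u x $ 1 = \<Psi> x $ 1" "u x $ 2 = \<Psi> x $ 2" "u x $ 3 = v x" if "x \<in> U" for x
 using bspec[OF assms(6) that] by simp_all
have \<Psi>: "?\<Psi> x = \<Psi> x" if "x \<in> U" for x
 using comp[OF that] by (simp add: vec_eq_iff forall_2)
interpret C1_graph_metric U U' ?u ?\<Psi> \<Phi> f g
proof unfold_locales
 show "Ck_on 1 U (\<lambda>x. u x $ k)" for k by (rule Ck_on_vec_nth[OF assms(1) uC])
 show "homeomorphism U U' ?\<Psi> \<Phi>"
 by (rule homeomorphism_cong[OF hom]) (simp_all add: \<Psi>)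
 show "f y = u (\<Phi> y) $ 3" if "y \<in> U'" for y
 proof -
 have "\<Phi> y \<in> U" using hom that unfolding homeomorphism_def by blast
 then show ?thesis using assms(8) that comp(3) by simp
 qed
 show "g x $ i $ j = (\<Sum>k\<in>UNIV. pd i (\<lambda>x. u x $ k) x * pd j (\<lambda>x. u x $ k) x)" if "x \<in> U" for x i j
 proof -
 have "u differentiable (at x)" using uC that by simp
 then show ?thesis unfolding iso[OF that, symmetric] by (simp add: inner_vec_def pd_vec_nth)
 qed
qed (use assms \<Phi> in simp_all)
have rhs: "gauss_rhs = (\<lambda>y. gauss_curvature g (\<Phi> y) * (1 + (\<Sum>i\<in>UNIV. (pd i f y)\<^sup>2))\<^sup>2)"
 by (rule ext) (rule gauss_rhs_def)
show ?thesis
 unfolding rhs[symmetric] using little_holder_BV2_case W1sp_case f_C1 by blast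
qed

end
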